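(* Let $G=(V,E)$ be a connected, locally finite, quasi-transitive graph such that $p_c(G)<p_{2\to 2}(G)$, and write $p_c=p_c(G)$. Then there exist positive constants $\delta, c_1, c_2, C_1, C_2$ depending only on $G$ such that both $$\frac{c_1}{r}\exp\left[-C_1|p-p_c| r\right] \leq \mathbf{P}_p\bigl(r\leq \operatorname{Rad}_{\mathrm{int}}(K_v)<\infty\bigr)\leq \frac{C_2}{r}\exp\left[-c_2|p-p_c| r\right]$$ and $$\frac{c_1}{r}\exp\left[-C_1|p-p_c| r\right] \leq \mathbf{P}_p\bigl(r\leq \operatorname{Rad}_{\mathrm{ext}}(K_v)<\infty\bigr)\leq \frac{C_2}{r}\exp\left[-c_2|p-p_c| r\right]$$ hold for every $r\geq 1$, every $v\in V$, and every $p\in(p_c-\delta,p_c+\delta)$.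
   Context: A graph is quasi-transitive if the action of its automorphism group on its vertex set has at most finitely many orbits. In Bernoulli-$p$ bond percolation on $G$, with law $\mathbf{P}_p$, each edge is independently open with probability $p$ and closed otherwise; clusters are the connected components of the random subgraph of open edges. $K_v$ is the cluster of $v$. $\operatorname{Rad}_{\mathrm{int}}(K_v)$ (resp. $\operatorname{Rad}_{\mathrm{ext}}(K_v)$) is the maximum (supremum, possibly $\infty$) distance from $v$ to another point of $K_v$ in the graph metric of $K_v$, i.e. of the open subgraph (resp. in the graph metric of $G$). The critical probability is $p_c(G)=\sup\{p\in[0,1]:\text{every cluster is finite } \mathbf{P}_p\text{-a.s.}\}$. The two-point matrix is $T_p(u,v)=\mathbf{P}_p(u\leftrightarrow v)$ (the probability that $u,v$ lie in the same cluster), $\|T_p\|_{2\to2}\in[0,\infty]$ is its $L^2(V)\to L^2(V)$ operator norm, and $p_{2\to2}(G)=\sup\{p\in[0,1]:\|T_p\|_{2\to2}<\infty\}$. *)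

theory Defs
  imports "HOL-Probability.Probability"
begin

definition simple_graph :: "'v set \<Rightarrow> 'v set set \<Rightarrow> bool" where
  "simple_graph V E \<longleftrightarrow> (\<forall>e\<in>E. e \<subseteq> V \<and> card e = 2)"

definition adj :: "'v set set \<Rightarrow> ('v \<times> 'v) set" where
  "adj F = {(x, y). {x, y} \<in> F}"

definition connected_graph :: "'v set \<Rightarrow> 'v set set \<Rightarrow> bool" where
  "connected_graph V E \<longleftrightarrow> (\<forall>u\<in>V. \<forall>v\<in>V. (u, v) \<in> (adj E)\<^sup>*)"

definition locally_finite_graph :: "'v set \<Rightarrow> 'v set set \<Rightarrow> bool" where
  "locally_finite_graph V E \<longleftrightarrow> (\<forall>v\<in>V. finite {e \<in> E. v \<in> e})"

definition graph_automorphisms :: "'v set \<Rightarrow> 'v set set \<Rightarrow> ('v \<Rightarrow> 'v) set" where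
  "graph_automorphisms V E =
     {\<phi>. bij_betw \<phi> V V \<and> (\<forall>x\<in>V. \<forall>y\<in>V. {\<phi> x, \<phi> y} \<in> E \<longleftrightarrow> {x, y} \<in> E)}"

definition vertex_orbit :: "'v set \<Rightarrow> 'v set set \<Rightarrow> 'v \<Rightarrow> 'v set" where
  "vertex_orbit V E v = {\<phi> v |\<phi>. \<phi> \<in> graph_automorphisms V E}"

definition quasi_transitive :: "'v set \<Rightarrow> 'v set set \<Rightarrow> bool" where
  "quasi_transitive V E \<longleftrightarrow> finite (vertex_orbit V E ` V)"

text \<open>The infimum of the empty set in \<^typ>\<open>enat\<close> is \<open>\<infinity>\<close>, the distance of unconnected points.\<close>

definition graph_dist :: "'v set set \<Rightarrow> 'v \<Rightarrow> 'v \<Rightarrow> enat" where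
  "graph_dist F u v = (INF n\<in>{n. (u, v) \<in> adj F ^^ n}. enat n)"

definition percolation :: "'v set set \<Rightarrow> real \<Rightarrow> ('v set \<Rightarrow> bool) measure" where
  "percolation E p = (\<Pi>\<^sub>M e\<in>E. measure_pmf (bernoulli_pmf p))"

definition open_edges :: "'v set set \<Rightarrow> ('v set \<Rightarrow> bool) \<Rightarrow> 'v set set" where
  "open_edges E \<omega> = {e \<in> E. \<omega> e}"

definition cluster :: "'v set set \<Rightarrow> ('v set \<Rightarrow> bool) \<Rightarrow> 'v \<Rightarrow> 'v set" where
  "cluster E \<omega> v = {u. (v, u) \<in> (adj (open_edges E \<omega>))\<^sup>*}"

definition Rad_int :: "'v set set \<Rightarrow> ('v set \<Rightarrow> bool) \<Rightarrow> 'v \<Rightarrow> enat" where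
  "Rad_int E \<omega> v = (SUP u\<in>cluster E \<omega> v. graph_dist (open_edges E \<omega>) v u)"

definition Rad_ext :: "'v set set \<Rightarrow> ('v set \<Rightarrow> bool) \<Rightarrow> 'v \<Rightarrow> enat" where
  "Rad_ext E \<omega> v = (SUP u\<in>cluster E \<omega> v. graph_dist E v u)"

definition p_crit :: "'v set \<Rightarrow> 'v set set \<Rightarrow> real" where
  "p_crit V E = Sup {p \<in> {0..1}. AE \<omega> in percolation E p. \<forall>v\<in>V. finite (cluster E \<omega> v)}"

definition two_point :: "'v set set \<Rightarrow> real \<Rightarrow> 'v \<Rightarrow> 'v \<Rightarrow> real" where
  "two_point E p u v =
     measure (percolation E p) {\<omega> \<in> space (percolation E p). v \<in> cluster E \<omega> u}"

definition in_L2 :: "'v set \<Rightarrow> ('v \<Rightarrow> real) \<Rightarrow> bool" where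
  "in_L2 V f \<longleftrightarrow> (\<lambda>v. (f v)\<^sup>2) summable_on V"

definition L2_norm_on :: "'v set \<Rightarrow> ('v \<Rightarrow> real) \<Rightarrow> real" where
  "L2_norm_on V f = sqrt (\<Sum>\<^sub>\<infinity>v\<in>V. (f v)\<^sup>2)"

definition mat_apply :: "'v set \<Rightarrow> ('v \<Rightarrow> 'v \<Rightarrow> real) \<Rightarrow> ('v \<Rightarrow> real) \<Rightarrow> 'v \<Rightarrow> real" where
  "mat_apply V M f u = (\<Sum>\<^sub>\<infinity>v\<in>V. M u v * f v)"

text \<open>
  The \<open>L\<^sup>2(V) \<rightarrow> L\<^sup>2(V)\<close> operator norm, i.e. the supremum of \<open>\<parallel>M f\<parallel> / \<parallel>f\<parallel>\<close> over nonzero \<open>f\<close> in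
  \<open>L\<^sup>2(V)\<close>; it is \<open>\<infinity>\<close> as soon as \<open>M f\<close> is undefined or outside \<open>L\<^sup>2(V)\<close> for some such \<open>f\<close>.
  The explicit conditions are needed because \<^const>\<open>infsum\<close> is \<open>0\<close> on non-summable families.
\<close>

definition L2_op_norm :: "'v set \<Rightarrow> ('v \<Rightarrow> 'v \<Rightarrow> real) \<Rightarrow> ennreal" where
  "L2_op_norm V M =
     (SUP f\<in>{f. in_L2 V f \<and> (\<exists>v\<in>V. f v \<noteq> 0)}.
        if (\<forall>u\<in>V. (\<lambda>v. M u v * f v) summable_on V) \<and> in_L2 V (mat_apply V M f)
        then ennreal (L2_norm_on V (mat_apply V M f) / L2_norm_on V f)
        else \<infinity>)"

definition p_2to2 :: "'v set \<Rightarrow> 'v set set \<Rightarrow> real" where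
  "p_2to2 V E = Sup {p \<in> {0..1}. L2_op_norm V (two_point E p) < \<infinity>}"

end

theory Submission
  imports Defs
begin

text \<open>
  Everything except the final passage to the limit happens on finite edge sets, where expectations are finite
  sums, with bounds uniform in the edge set. Write \<open>\<epsilon>\<close> for \<open>\<bar>p - p_crit\<bar>\<close> and \<open>K\<close> for the cluster of \<open>v\<close>. Two inputs about the graph are
  used: the \<open>L\<^sup>2\<close> bound on the two-point matrix at some \<open>p1 > p_crit\<close>, and the Duminil-Copin--Tassion dichotomy, which gives
  \<open>E\<bar>K\<bar> < \<infinity>\<close> below \<open>p_crit\<close> and \<open>P(v \<leftrightarrow> \<infinity>) \<ge> \<theta> \<epsilon>\<close> above.

  Exploring clusters replaces the BK inequality throughout. Together with the \<open>L\<^sup>2\<close> bound it shows that the cluster boundary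
  is seen efficiently, which turns Russo's formula into \<open>E\<bar>K\<bar> = O(1 / \<epsilon>)\<close> below \<open>p_crit\<close>. A variance bound for
  decision trees then gives \<open>P(\<bar>K\<bar> \<ge> n) = O(n powr (-1/2))\<close> at \<open>p_crit\<close>, and the Kozma--Nachmias argument (a long cluster
  is either large or has a thin level) gives \<open>P(Rad \<ge> n) = O(1 / n)\<close>. Below \<open>p_crit\<close> some level
  before \<open>O(1 / \<epsilon>)\<close> has small mean size, so the radius tail decays exponentially on that scale.

  Above \<open>p_crit\<close> a path of length \<open>n\<close> survives thinning from \<open>p\<close> to \<open>p' = p - \<kappa> \<epsilon>\<close> with
  probability \<open>(p' / p) ^ n\<close>, after which sprinkling back to \<open>p\<close> must not connect the cluster to infinity; the \<open>L\<^sup>2\<close> bound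
  makes this as unlikely as \<open>exp (- c \<kappa> \<epsilon>\<^sup>2 \<bar>K\<bar>)\<close>. Finally, a cluster with small volume on
  all scales \<open>1 / \<epsilon>\<close> dies out at each scale with probability bounded below, and \<open>\<kappa>\<close> is chosen so that the gain wins over
  the thinning loss. The lower bound thins the estimate \<open>P(v \<leftrightarrow> \<infinity>) \<ge> \<theta> / n\<close> at \<open>p_crit + 1 / n\<close>; the \<open>L\<^sup>2\<close> bound makes
  intrinsic distances comparable to extrinsic ones, and Harris' inequality isolates the open path.
\<close>

section \<open>Expectations over finite edge sets\<close>

text \<open>The events \<open>lv w A n \<noteq> {}\<close> are not monotone in \<open>w\<close>: one
  more open edge may shorten distances and empty a level. Being long and finite is not monotone
  either. So for these events neither two values of \<open>p\<close> nor two edge sets can be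
  compared for free. What survives is thinning: deleting edges cannot shorten a distance, so a level
  stays occupied as long as one geodesic to it is kept. This compares \<open>p' < p\<close> in one
  direction only and costs \<open>(p' / p) ^ n\<close>. The factor is bounded for
  \<open>n = O(1 / \<epsilon>)\<close>, which settles the critical window, but beyond that scale it
  decays exponentially at a rate proportional to \<open>p - p'\<close>. There the sprinkling must
  produce a gain whose rate is also proportional to \<open>p - p'\<close>, with a better constant.
  This competition is decided by a free threshold between thin and thick levels: the gain from thick
  levels grows with the threshold, while the chance that a thin level dies out does not depend on
  \<open>\<kappa>\<close>, so \<open>\<kappa>\<close> can be taken small at the very end.\<close>

definition bexp :: "'i set => real => ('i set => real) => real" where
 "bexp F p f = (\<Sum>w\<in>Pow F. p ^ card w * (1 - p) ^ card (F - w) * f w)"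

abbreviation bprob :: "'i set => real => ('i set => bool) => real" where
 "bprob F p Q \<equiv> bexp F p (%w. of_bool (Q w))"

lemma bexp_empty [simp]: "bexp {} p f = f {}"
 by (simp add: bexp_def)

lemma bexp_insert:
 assumes "finite F" "e \<notin> F"
 shows "bexp (insert e F) p f = p * bexp F p (%w. f (insert e w)) + (1 - p) * bexp F p f"
proof -
 have disj: "Pow F \<inter> insert e ` Pow F = {}" using assms(2) by auto
 have inj: "inj_on (insert e) (Pow F)" using assms(2) by (auto simp: inj_on_def)
 have 1: "(\<Sum>w\<in>Pow F. p ^ card w * (1 - p) ^ card (insert e F - w) * f w) = (1 - p) * bexp F p f"
  unfolding bexp_def sum_distrib_left
 proof (rule sum.cong[OF refl])
  fix w assume u: "w \<in> Pow F"
  have "insert e F - w = insert e (F - w)" using u assms by auto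
  then have "card (insert e F - w) = Suc (card (F - w))" using assms by simp
  then show "p ^ card w * (1 - p) ^ card (insert e F - w) * f w =
    (1 - p) * (p ^ card w * (1 - p) ^ card (F - w) * f w)" by simp
 qed
 have 2: "(\<Sum>w\<in>Pow F. p ^ card (insert e w) * (1 - p) ^ card (insert e F - insert e w) * f (insert e w))
  = p * bexp F p (%w. f (insert e w))"
  unfolding bexp_def sum_distrib_left
 proof (rule sum.cong[OF refl])
  fix w assume u: "w \<in> Pow F"
  have "insert e F - insert e w = F - w" using u assms by auto
  moreover have "card (insert e w) = Suc (card w)" using u assms by (meson PowD card_insert_disjoint finite_subset subsetD)
  ultimately show "p ^ card (insert e w) * (1 - p) ^ card (insert e F - insert e w) * f (insert e w) =
    p * (p ^ card w * (1 - p) ^ card (F - w) * f (insert e w))" by simp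
 qed
 show ?thesis
  unfolding bexp_def Pow_insert
  by (subst sum.union_disjoint) (use assms disj inj 1 2 in \<open>auto simp: sum.reindex bexp_def\<close>)
qed

lemma bexp_cong: "(\<And>w. w \<subseteq> F ==> f w = g w) ==> bexp F p f = bexp F p g"
 unfolding bexp_def by (intro sum.cong) auto

lemma bexp_mono:
 assumes "0 <= p" "p <= 1" "\<And>w. w \<subseteq> F ==> f w <= g w"
 shows "bexp F p f <= bexp F p g"
 unfolding bexp_def using assms by (intro sum_mono mult_left_mono) auto

lemma bexp_nonneg:
 assumes "0 <= p" "p <= 1" "\<And>w. w \<subseteq> F ==> 0 <= f w"
 shows "0 <= bexp F p f"
 unfolding bexp_def using assms by (intro sum_nonneg mult_nonneg_nonneg) auto

lemma bexp_add: "bexp F p (%w. f w + g w) = bexp F p f + bexp F p g"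
 by (simp add: bexp_def sum.distrib algebra_simps)

lemma bexp_diff: "bexp F p (%w. f w - g w) = bexp F p f - bexp F p g"
 by (simp add: bexp_def sum_subtractf algebra_simps)

lemma bexp_cmult: "bexp F p (%w. c * f w) = c * bexp F p f"
 unfolding bexp_def sum_distrib_left by (intro sum.cong) auto

lemma bexp_multc: "bexp F p (%w. f w * c) = bexp F p f * c"
 unfolding bexp_def sum_distrib_right by (intro sum.cong) auto

lemma bexp_sum: "bexp F p (%w. \<Sum>i\<in>I. f i w) = (\<Sum>i\<in>I. bexp F p (f i))"
 unfolding bexp_def by (subst sum.swap) (simp add: sum_distrib_left)

lemma bexp_const:
 assumes "finite F" shows "bexp F p (%w. c) = c"
 using assms by (induction F) (auto simp: bexp_insert algebra_simps)

lemma bprob_le_1: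
 assumes "finite F" "0 <= p" "p <= 1" shows "bprob F p Q <= 1"
 using bexp_mono[of p F "%w. of_bool (Q w)" "%_. 1"] assms by (auto simp: bexp_const)

lemma bprob_nonneg: "0 <= p ==> p <= 1 ==> 0 <= bprob F p Q"
 by (rule bexp_nonneg) auto

lemma bprob_mono:
 assumes "0 <= p" "p <= 1" "\<And>w. w \<subseteq> F ==> Q w ==> R w"
 shows "bprob F p Q <= bprob F p R"
 using assms by (intro bexp_mono) auto

lemma bprob_not:
 assumes "finite F" shows "bprob F p (%w. \<not> Q w) = 1 - bprob F p Q"
 using bexp_diff[of F p "%_. 1" "%w. of_bool (Q w)"] assms
 by (simp add: bexp_const of_bool_not_iff)

lemma bexp_union:
 assumes "finite A" "finite B" "A \<inter> B = {}"
 shows "bexp (A \<union> B) p f = bexp A p (%w. bexp B p (%w'. f (w \<union> w')))"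
 using assms
proof (induction A arbitrary: f)
 case empty
 then show ?case by simp
next
 case (insert e A)
 have "bexp (insert e A \<union> B) p f = bexp (insert e (A \<union> B)) p f" by simp
 also have "... = p * bexp (A \<union> B) p (%w. f (insert e w)) + (1 - p) * bexp (A \<union> B) p f"
  using insert by (intro bexp_insert) auto
 also have "... = bexp (insert e A) p (%w. bexp B p (%w'. f (w \<union> w')))"
  using insert by (simp add: bexp_insert)
 finally show ?case .
qed

lemma bexp_swap:
 "bexp A p (%x. bexp B q (%y. f x y)) = bexp B q (%y. bexp A p (%x. f x y))"
 unfolding bexp_def
 by (simp add: sum_distrib_left mult_ac) (rule sum.swap)

lemma bexp_restrict:
 assumes "finite F" "A \<subseteq> F"
 shows "bexp F p (%w. f (w \<inter> A)) = bexp A p f"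
proof -
 have "bexp F p (%w. f (w \<inter> A)) = bexp (A \<union> (F - A)) p (%w. f (w \<inter> A))"
  using assms by (simp add: Un_absorb1)
 also have "... = bexp A p (%w. bexp (F - A) p (%w'. f ((w \<union> w') \<inter> A)))"
  using assms by (intro bexp_union) (auto dest: finite_subset)
 also have "... = bexp A p (%w. bexp (F - A) p (%w'. f w))"
  by (intro bexp_cong arg_cong[where f = f]) auto
 also have "... = bexp A p f" using assms by (simp add: bexp_const)
 finally show ?thesis .
qed

lemma bexp_ignore:
 assumes "finite F" "A \<subseteq> F" "\<And>w. w \<subseteq> F ==> f w = f (w \<inter> A)"
 shows "bexp F p f = bexp A p f"
 using bexp_restrict[OF assms(1,2), of p f] assms(3) by (metis (no_types, lifting) bexp_cong)

section \<open>Monotone functions, Harris' inequality, thinning and Russo's formula\<close>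

definition incr_on :: "'i set => ('i set => real) => bool" where
 "incr_on F f \<longleftrightarrow> (\<forall>A B. A \<subseteq> B --> B \<subseteq> F --> f A <= f B)"

lemma incr_onI: "(\<And>A B. A \<subseteq> B ==> B \<subseteq> F ==> f A <= f B) ==> incr_on F f"
 by (auto simp: incr_on_def)

lemma incr_onD: "incr_on F f ==> A \<subseteq> B ==> B \<subseteq> F ==> f A <= f B"
 by (auto simp: incr_on_def)

lemma harris:
 assumes "finite F" "0 <= p" "p <= 1" "incr_on F f" "incr_on F g"
 shows "bexp F p f * bexp F p g <= bexp F p (%w. f w * g w)"
 using assms
proof (induction F arbitrary: f g)
 case empty
 then show ?case by simp
next
 case (insert e F)
 let ?f1 = "bexp F p (%w. f (insert e w))" and ?f0 = "bexp F p f"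
 let ?g1 = "bexp F p (%w. g (insert e w))" and ?g0 = "bexp F p g"
 have i: "incr_on F f" "incr_on F g" "incr_on F (%w. f (insert e w))" "incr_on F (%w. g (insert e w))"
  using insert.prems(3,4) unfolding incr_on_def
  by (auto simp: insert_mono subset_insertI2)
 have f: "?f0 <= ?f1" 
  using insert.prems(3) by (intro bexp_mono insert.prems(1,2) incr_onD[where F = "insert e F"]) auto
 have g: "?g0 <= ?g1" 
  using insert.prems(4) by (intro bexp_mono insert.prems(1,2) incr_onD[where F = "insert e F"]) auto
 \<comment> \<open>This is the covariance of the two conditional expectations given the state of
   \<open>e\<close>; it is nonnegative because both increase when \<open>e\<close> opens.\<close>
 have "0 <= p * (1 - p) * ((?f1 - ?f0) * (?g1 - ?g0))"
  using f g insert.prems by (intro mult_nonneg_nonneg) auto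
 then have "(p * ?f1 + (1 - p) * ?f0) * (p * ?g1 + (1 - p) * ?g0) <= p * (?f1 * ?g1) + (1 - p) * (?f0 * ?g0)"
  by (simp add: algebra_simps)
 also have "... <= p * bexp F p (%w. f (insert e w) * g (insert e w)) + (1 - p) * bexp F p (%w. f w * g w)"
  using insert.IH i insert.prems(1,2) by (intro add_mono mult_left_mono) auto
 finally show ?case using insert by (simp add: bexp_insert)
qed

lemma harris_neg:
 assumes "finite F" "0 <= p" "p <= 1" "incr_on F f" "incr_on F (%w. - g w)"
 shows "bexp F p (%w. f w * g w) <= bexp F p f * bexp F p g"
proof -
 have "bexp F p f * bexp F p (%w. - 1 * g w) <= bexp F p (%w. f w * (- 1 * g w))"
  using assms by (intro harris) auto
 also have "(%w. f w * (- 1 * g w)) = (%w. - 1 * (f w * g w))" by auto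
 finally show ?thesis by (simp only: bexp_cmult)
qed

lemma harris_decr:
 assumes "finite F" "0 <= p" "p <= 1" "incr_on F (%w. - f w)" "incr_on F (%w. - g w)"
 shows "bexp F p f * bexp F p g <= bexp F p (%w. f w * g w)"
 using harris[OF assms(1-5)] bexp_cmult[of F p "-1" f] bexp_cmult[of F p "-1" g] by simp

text \<open>
 Thinning \<open>p\<close> by \<open>s\<close> and then sprinkling with density \<open>t\<close> recovers \<open>p\<close>: both sides describe the pair
 (thinned configuration, original configuration).
\<close>

lemma bexp_coupling:
 assumes "finite F" "(1 - p * s) * t = p * (1 - s)"
 shows "bexp F p (%w. bexp F s (%\<sigma>. g (w \<inter> \<sigma>) w)) =
    bexp F (p * s) (%w. bexp F t (%\<sigma>. g w (w \<union> \<sigma>)))"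
 using assms(1)
proof (induction F arbitrary: g)
 case empty
 then show ?case by simp
next
 case (insert e F)
 have e: "e \<notin> F" by fact
 define a where "a = (%g. bexp F p (%w. bexp F s (%\<sigma>. g (w \<inter> \<sigma>) w)))"
 define g11 where "g11 = (%x y. g (insert e x) (insert e y))"
 define g01 where "g01 = (%x y. g x (insert e y))"
 have c: "bexp F p (%w. bexp F s (%\<sigma>. g (insert e w \<inter> \<sigma>) (insert e w))) = a g01"
  unfolding a_def g01_def
  by (intro bexp_cong) (metis Int_insert_left e subsetD)
 have d: "bexp F p (%w. bexp F s (%\<sigma>. g (w \<inter> insert e \<sigma>) w)) = a g"
  unfolding a_def
  by (intro bexp_cong) (metis Int_insert_right e subsetD)
 have f: "bexp F p (%w. bexp F s (%\<sigma>. g (insert e w \<inter> insert e \<sigma>) (insert e w))) = a g11"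
  unfolding a_def g11_def by (intro bexp_cong) (metis Int_insert_left_if1 Int_insert_right insertI1 insert_absorb2)
 have "bexp (insert e F) p (%w. bexp (insert e F) s (%\<sigma>. g (w \<inter> \<sigma>) w))
  = p * (s * a g11 + (1 - s) * a g01) + (1 - p) * (s * a g + (1 - s) * a g)"
  by (simp only: bexp_insert[OF insert.hyps] bexp_add bexp_cmult c d f) (simp add: a_def algebra_simps)
 then have "bexp (insert e F) p (%w. bexp (insert e F) s (%\<sigma>. g (w \<inter> \<sigma>) w))
  = p * s * a g11 + p * (1 - s) * a g01 + (1 - p) * a g"
  by (simp add: algebra_simps)
 moreover have "bexp (insert e F) (p * s) (%w. bexp (insert e F) t (%\<sigma>. g w (w \<union> \<sigma>)))
  = p * s * (t * a g11 + (1 - t) * a g11) + (1 - p * s) * (t * a g01 + (1 - t) * a g)"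
  by (simp only: bexp_insert[OF insert.hyps] bexp_add bexp_cmult a_def insert.IH)
   (simp add: g11_def g01_def algebra_simps)
 then have "bexp (insert e F) (p * s) (%w. bexp (insert e F) t (%\<sigma>. g w (w \<union> \<sigma>)))
  = p * s * a g11 + (1 - p * s) * t * a g01 + (1 - p * s) * (1 - t) * a g"
  by (simp add: algebra_simps)
 moreover have "(1 - p * s) * (1 - t) = 1 - p" using assms(2) by (simp add: algebra_simps)
 ultimately show ?case using assms(2) by metis
qed

text \<open>The marginal of the coupling. Here \<open>p\<close> and \<open>s\<close> are arbitrary
  reals, so \<open>p * s = 1\<close> does not force \<open>s = 1\<close>; a sprinkling density
  \<open>t\<close> need not exist then, and a direct induction takes over.\<close>

lemma bexp_thin:
 assumes "finite F"
 shows "bexp F (p * s) g = bexp F p (%w. bexp F s (%\<sigma>. g (w \<inter> \<sigma>)))"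
proof (cases "p * s = 1")
 case False
 have "bexp F p (%w. bexp F s (%\<sigma>. g (w \<inter> \<sigma>))) =
    bexp F (p * s) (%w. bexp F (p * (1 - s) / (1 - p * s)) (%\<sigma>. g w))"
  using False assms by (intro bexp_coupling[where g = "%x y. g x"]) (auto simp: field_simps)
 then show ?thesis using assms by (simp add: bexp_const)
next
 case True
 show ?thesis using assms
 proof (induction F arbitrary: g)
  case (insert e F)
  have e: "e \<notin> F" by fact
  have c: "bexp F p (%w. bexp F s (%\<sigma>. g (insert e w \<inter> \<sigma>))) = bexp F p (%w. bexp F s (%\<sigma>. g (w \<inter> \<sigma>)))"
   by (intro bexp_cong) (metis Int_insert_left e subsetD)
  have d: "bexp F p (%w. bexp F s (%\<sigma>. g (w \<inter> insert e \<sigma>))) = bexp F p (%w. bexp F s (%\<sigma>. g (w \<inter> \<sigma>)))"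
   by (intro bexp_cong) (metis Int_insert_right e subsetD)
  have f: "bexp F p (%w. bexp F s (%\<sigma>. g (insert e w \<inter> insert e \<sigma>))) = bexp F p (%w. bexp F s (%\<sigma>. g (insert e (w \<inter> \<sigma>))))"
   by (intro bexp_cong) (metis Int_insert_left_if1 Int_insert_right insertI1 insert_absorb2)
  have r: "bexp (insert e F) (p * s) g = (p * s) * bexp F (p * s) (%w. g (insert e w)) + (1 - p * s) * bexp F (p * s) g"
   using insert.hyps by (rule bexp_insert)
  have "bexp (insert e F) p (%w. bexp (insert e F) s (%\<sigma>. g (w \<inter> \<sigma>)))
   = p * (s * bexp F (p * s) (%w. g (insert e w)) + (1 - s) * bexp F (p * s) g) + (1 - p) * (s * bexp F (p * s) g + (1 - s) * bexp F (p * s) g)"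
   by (simp only: bexp_insert[OF insert.hyps] bexp_add bexp_cmult c d f insert.IH) (simp add: algebra_simps)
  then show ?case unfolding r by (simp add: algebra_simps)
 qed simp
qed

lemma bexp_mono_p:
 assumes "finite F" "0 <= p" "p <= q" "q <= 1" "incr_on F f"
 shows "bexp F p f <= bexp F q f"
proof (cases "q = 0")
 case False
 have "bexp F p f = bexp F (q * (p / q)) f" using False by simp
 also have "... = bexp F q (%w. bexp F (p / q) (%\<sigma>. f (w \<inter> \<sigma>)))" by (rule bexp_thin) fact
 also have "... <= bexp F q (%w. bexp F (p / q) (%\<sigma>. f w))"
  using assms False by (intro bexp_mono incr_onD[OF assms(5)]) (auto simp: field_simps)
 finally show ?thesis using assms by (simp add: bexp_const)
qed (use assms in auto)

lemma bexp_mono_F: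
 assumes "finite F" "A \<subseteq> F" "0 <= p" "p <= 1" "incr_on F f"
 shows "bexp A p f <= bexp F p f"
proof -
 have "bexp A p f = bexp F p (%w. f (w \<inter> A))" using assms by (intro bexp_restrict[symmetric]) auto
 also have "... <= bexp F p f" using assms by (intro bexp_mono incr_onD[OF assms(5)]) auto
 finally show ?thesis .
qed

lemma bexp_open:
 assumes "finite F" "S \<subseteq> F"
 shows "bexp F p (%w. of_bool (S \<subseteq> w) * f w) = p ^ card S * bexp (F - S) p (%w. f (S \<union> w))"
proof -
 have fin: "finite S" using assms by (auto dest: finite_subset)
 then have "S \<subseteq> F ==> ?thesis"
 proof (induction S arbitrary: f)
  case (insert e S)
  have eq: "F - S = insert e (F - insert e S)" using insert by auto
  have "bexp F p (%w. of_bool (insert e S \<subseteq> w) * f w)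
    = bexp F p (%w. of_bool (S \<subseteq> w) * (of_bool (e \<in> w) * f w))"
   by (intro bexp_cong) auto
  also have "... = p ^ card S * bexp (insert e (F - insert e S)) p (%w. of_bool (e \<in> S \<union> w) * f (S \<union> w))"
   using insert eq by simp
  also have "bexp (insert e (F - insert e S)) p (%w. of_bool (e \<in> S \<union> w) * f (S \<union> w))
   = p * bexp (F - insert e S) p (%w. f (insert e (S \<union> w)))
    + (1 - p) * bexp (F - insert e S) p (%w. of_bool (e \<in> S \<union> w) * f (S \<union> w))"
   using assms by (subst bexp_insert) auto
  also have "bexp (F - insert e S) p (%w. of_bool (e \<in> S \<union> w) * f (S \<union> w)) = bexp (F - insert e S) p (%w. 0)"
   using insert by (intro bexp_cong) auto
  finally show ?case using insert assms by (simp add: bexp_const)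
 qed simp
 then show ?thesis using assms by simp
qed

lemma bprob_open:
 assumes "finite F" "S \<subseteq> F"
 shows "bprob F p (%w. S \<subseteq> w) = p ^ card S"
 using bexp_open[OF assms, of p "%_. 1"] assms by (simp add: bexp_const)

text \<open>Insertion tolerance: \<open>f (S \<union> w)\<close> does not see the edges of
  \<open>S\<close>, hence is independent of the event that they are all open, and on that event it
  equals \<open>f w\<close>.\<close>

lemma bexp_force_open:
 assumes "finite F" "S \<subseteq> F" "0 <= p" "p <= 1" "\<And>w. w \<subseteq> F ==> 0 <= f w"
 shows "p ^ card S * bexp F p (%w. f (S \<union> w)) <= bexp F p f"
proof -
 have "bexp F p (%w. f (S \<union> w)) = bexp (F - S) p (%w. f (S \<union> w))"
  using assms by (intro bexp_ignore arg_cong[where f = f]) auto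
 then have "p ^ card S * bexp F p (%w. f (S \<union> w)) = bexp F p (%w. of_bool (S \<subseteq> w) * f w)"
  using bexp_open[OF assms(1,2), of p f] by simp
 also have "... <= bexp F p f" using assms by (intro bexp_mono) auto
 finally show ?thesis .
qed

text \<open>Russo's formula for an arbitrary real function: in each single edge the expectation is
  affine in its density, with slope the mean difference between the edge forced open and the edge
  forced closed.\<close>

lemma russo:
 assumes "finite F"
 shows "((%p. bexp F p f) has_real_derivative (\<Sum>e\<in>F. bexp F p (%w. f (insert e w) - f (w - {e})))) (at p)"
 using assms
proof (induction F arbitrary: f)
 case empty
 then show ?case by simp
next
 case (insert e F)
 let ?D = "%f. (\<Sum>e\<in>F. bexp F p (%w. f (insert e w) - f (w - {e})))"
 have e: "e \<notin> F" by fact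
 have eq: "(%p. bexp (insert e F) p f) = (%p. p * bexp F p (%w. f (insert e w)) + (1 - p) * bexp F p f)"
  using insert by (auto simp: bexp_insert)
 have "((%p. p * bexp F p (%w. f (insert e w)) + (1 - p) * bexp F p f) has_real_derivative
   (bexp F p (%w. f (insert e w)) - bexp F p f + p * ?D (%w. f (insert e w)) + (1 - p) * ?D f)) (at p)"
  by (rule derivative_eq_intros insert.IH refl | simp)+
 also have "bexp F p (%w. f (insert e w)) - bexp F p f + p * ?D (%w. f (insert e w)) + (1 - p) * ?D f
  = (\<Sum>e'\<in>insert e F. bexp (insert e F) p (%w. f (insert e' w) - f (w - {e'})))"
 proof -
  have 1: "bexp (insert e F) p (%w. f (insert e w) - f (w - {e})) = bexp F p (%w. f (insert e w)) - bexp F p f"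
  proof -
   have "bexp (insert e F) p (%w. f (insert e w) - f (w - {e})) = bexp F p (%w. f (insert e w) - f (w - {e}))"
    using insert by (simp add: bexp_insert algebra_simps)
   also have "... = bexp F p (%w. f (insert e w) - f w)" using e by (intro bexp_cong) (metis Diff_empty Diff_insert0 subsetD)
   finally show ?thesis by (simp add: bexp_diff)
  qed
  have 2: "bexp (insert e F) p (%w. f (insert e' w) - f (w - {e'})) =
   p * bexp F p (%w. f (insert e (insert e' w)) - f (insert e (w - {e'}))) + (1 - p) * bexp F p (%w. f (insert e' w) - f (w - {e'}))"
   if "e' \<in> F" for e'
  proof -
   have "insert e w - {e'} = insert e (w - {e'})" for w using that e by auto
   then show ?thesis using insert by (simp add: bexp_insert insert_commute)
  qed
  show ?thesis using insert 1 2 by (simp add: sum.distrib sum_distrib_left)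
 qed
 finally show ?case unfolding eq .
qed

section \<open>Clusters and their exploration\<close>

text \<open>
 \<open>tch F S\<close> and \<open>nt F S\<close> are the edges of \<open>F\<close> that touch, respectively avoid, \<open>S\<close>; \<open>lv w A n\<close> is the \<open>n\<close>-th breadth-first
 level from \<open>A\<close> in the configuration \<open>w\<close>, and \<open>rs w A n\<close> the edges not yet inspected once level \<open>n\<close> is known.
\<close>

definition CL :: "'v set set => 'v set => 'v set" where
 "CL w A = (adj w)\<^sup>* `` A"

definition tch :: "'v set set => 'v set => 'v set set" where
 "tch F S = {e \<in> F. e \<inter> S \<noteq> {}}"

definition nt :: "'v set set => 'v set => 'v set set" where
 "nt F S = {e \<in> F. e \<inter> S = {}}"

lemma adj_iff: "(x, y) \<in> adj F \<longleftrightarrow> {x, y} \<in> F"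
 by (simp add: adj_def)

lemma adj_mono: "F \<subseteq> G ==> adj F \<subseteq> adj G"
 by (auto simp: adj_def)

lemma tch_subset: "tch F S \<subseteq> F" and nt_subset: "nt F S \<subseteq> F"
 by (auto simp: tch_def nt_def)

lemma tch_nt: "tch F S \<union> nt F S = F" "tch F S \<inter> nt F S = {}"
 by (auto simp: tch_def nt_def)

lemma nt_empty [simp]: "nt F {} = F"
 by (auto simp: nt_def)

lemma nt_split: "w1 \<subseteq> tch F S ==> w2 \<subseteq> nt F S ==> nt (w1 \<union> w2) S = w2"
 and tch_split: "w1 \<subseteq> tch F S ==> w2 \<subseteq> nt F S ==> tch (w1 \<union> w2) S = w1"
 by (auto simp: tch_def nt_def)

lemma finite_tch: "finite F ==> finite (tch F S)" and finite_nt: "finite F ==> finite (nt F S)"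
 by (auto simp: tch_def nt_def)

lemma CL_mono: "w \<subseteq> w' ==> A \<subseteq> A' ==> CL w A \<subseteq> CL w' A'"
 unfolding CL_def by (intro Image_mono rtrancl_mono adj_mono)

lemma CL_self: "A \<subseteq> CL w A"
 by (auto simp: CL_def)

lemma CL_closed:
 assumes "x \<in> CL w A" "{x, y} \<in> w" shows "y \<in> CL w A"
proof -
 obtain a where a: "a \<in> A" "(a, x) \<in> (adj w)\<^sup>*" using assms(1) unfolding CL_def by (elim ImageE)
 have "(x, y) \<in> adj w" using assms(2) by (simp add: adj_def)
 with a(2) have "(a, y) \<in> (adj w)\<^sup>*" by (rule rtrancl_into_rtrancl)
 with a(1) show ?thesis unfolding CL_def by (rule ImageI[rotated])
qed

lemma CL_closed': "x \<in> CL w A ==> {y, x} \<in> w ==> y \<in> CL w A"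
 using CL_closed[of x w A y] by (simp add: insert_commute)

lemma CL_least:
 assumes "A \<subseteq> S" "\<And>x y. x \<in> S ==> {x, y} \<in> w ==> y \<in> S"
 shows "CL w A \<subseteq> S"
proof
 fix y assume "y \<in> CL w A"
 then obtain a where "a \<in> A" "(a, y) \<in> (adj w)\<^sup>*" by (auto simp: CL_def)
 from this(2,1) show "y \<in> S"
  by (induction rule: rtrancl_induct) (use assms in \<open>auto simp: adj_iff\<close>)
qed

lemma CL_empty [simp]: "CL w {} = {}"
 by (auto simp: CL_def)

lemma CL_no_edges [simp]: "CL {} A = A"
 by (intro equalityI CL_least CL_self) auto

lemma CL_Un: "CL w (A \<union> B) = CL w A \<union> CL w B"
 by (auto simp: CL_def)

lemma CL_iff: "x \<in> CL w A \<longleftrightarrow> (\<exists>a\<in>A. x \<in> CL w {a})"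
 by (auto simp: CL_def)

lemma CL_idem: "CL w (CL w A) = CL w A"
 by (auto simp: CL_def intro: rtrancl_trans)

lemma CL_sym: "y \<in> CL w {x} \<longleftrightarrow> x \<in> CL w {y}"
proof -
 have "sym ((adj w)\<^sup>*)" by (intro sym_rtrancl symI) (simp add: adj_def insert_commute)
 then have "(x, y) \<in> (adj w)\<^sup>* \<longleftrightarrow> (y, x) \<in> (adj w)\<^sup>*" by (meson symE)
 then show ?thesis by (simp add: CL_def)
qed

lemma CL_trans: "B \<subseteq> CL w A ==> CL w B \<subseteq> CL w A"
 using CL_mono[of w w B "CL w A"] by (simp add: CL_idem)

lemma CL_eq: "y \<in> CL w {x} ==> CL w {y} = CL w {x}"
 using CL_trans[of "{y}" w "{x}"] CL_trans[of "{x}" w "{y}"] CL_sym[of y w x] by auto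

lemma CL_bound: "CL w A \<subseteq> A \<union> \<Union>w"
 by (rule CL_least) auto

text \<open>A path from \<open>A\<close> only uses edges that touch the cluster, so these edges
  determine it. Hence the event that the cluster equals \<open>S\<close> is independent of all edges
  in \<open>nt F S\<close>.\<close>

lemma CL_tch: "CL (tch w (CL w A)) A = CL w A"
proof (rule antisym)
 show "CL (tch w (CL w A)) A \<subseteq> CL w A" by (intro CL_mono tch_subset order_refl)
 have "CL w A \<subseteq> CL (tch w (CL w A)) A \<inter> CL w A"
 proof (rule CL_least)
  show "A \<subseteq> CL (tch w (CL w A)) A \<inter> CL w A" by (simp add: CL_self)
  fix x y assume x: "x \<in> CL (tch w (CL w A)) A \<inter> CL w A" and e: "{x, y} \<in> w"
  then have "{x, y} \<in> tch w (CL w A)" by (simp add: tch_def)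
  then show "y \<in> CL (tch w (CL w A)) A \<inter> CL w A"
   using x e CL_closed[of x _ A y] by simp
 qed
 then show "CL w A \<subseteq> CL (tch w (CL w A)) A" by simp
qed

lemma CL_tchD:
 assumes "CL (tch w S) A = S" shows "CL w A = S"
proof (rule antisym)
 show "CL w A \<subseteq> S"
 proof (rule CL_least)
  show "A \<subseteq> S" using CL_self[of A "tch w S"] assms by simp
  fix x y assume "x \<in> S" "{x, y} \<in> w"
  then show "y \<in> S" using CL_closed[of x "tch w S" A y] assms by (auto simp: tch_def)
 qed
 show "S \<subseteq> CL w A" using CL_mono[OF tch_subset order_refl, of w S A] assms by simp
qed

lemma CL_eq_tch_iff: "CL w A = S \<longleftrightarrow> CL (tch w S) A = S"
 using CL_tch[of w A] CL_tchD[of w S A] by auto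

lemma CL_nt_avoid:
 assumes "A \<inter> S = {}" shows "CL (nt w S) A \<inter> S = {}"
proof -
 have "CL (nt w S) A \<subseteq> - S"
  by (rule CL_least) (use assms in \<open>auto simp: nt_def\<close>)
 then show ?thesis by auto
qed

lemma CL_off:
 assumes "B \<inter> CL w A = {}"
 shows "CL w B = CL (nt w (CL w A)) B"
proof (rule antisym)
 show "CL (nt w (CL w A)) B \<subseteq> CL w B" by (intro CL_mono nt_subset order_refl)
 have "CL w B \<subseteq> CL (nt w (CL w A)) B \<inter> - CL w A"
 proof (rule CL_least)
  show "B \<subseteq> CL (nt w (CL w A)) B \<inter> - CL w A" using assms by (auto simp: subsetD[OF CL_self])
  fix x y assume x: "x \<in> CL (nt w (CL w A)) B \<inter> - CL w A" and e: "{x, y} \<in> w"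
  then have y: "y \<notin> CL w A" using CL_closed'[of y w A x] by auto
  then have "{x, y} \<in> nt w (CL w A)" using x e by (auto simp: nt_def)
  then show "y \<in> CL (nt w (CL w A)) B \<inter> - CL w A" using x y CL_closed[of x _ B y] by simp
 qed
 then show "CL w B \<subseteq> CL (nt w (CL w A)) B" by simp
qed

text \<open>Explore \<open>A\<close> first, then the part of \<open>B\<close> that was not
  swallowed; the second exploration uses only edges that the first has not touched.\<close>

lemma CL_decomp: "CL w (A \<union> B) = CL w A \<union> CL (nt w (CL w A)) (B - CL w A)"
proof -
 have "CL w B \<subseteq> CL w (CL w A \<union> (B - CL w A))" by (rule CL_mono) auto
 then have 1: "CL w B \<subseteq> CL w A \<union> CL w (B - CL w A)" unfolding CL_Un CL_idem .
 have 2: "CL w (B - CL w A) \<subseteq> CL w B" by (rule CL_mono) auto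
 have "CL w (B - CL w A) = CL (nt w (CL w A)) (B - CL w A)" by (rule CL_off) auto
 with 1 2 show ?thesis unfolding CL_Un by auto
qed

lemma bexp_split:
 assumes "finite F"
 shows "bexp F p f = bexp (tch F S) p (%w1. bexp (nt F S) p (%w2. f (w1 \<union> w2)))"
 using bexp_union[of "tch F S" "nt F S" p f] assms by (simp add: tch_nt finite_tch finite_nt)

text \<open>The edges avoiding an explored cluster are still independent and fresh; this substitutes for the BK inequality.\<close>

lemma bexp_explore:
 fixes p :: real and A :: "'v set"
 assumes F: "finite F"
 shows "bexp F p (%w. h (tch w (CL w A)) (nt w (CL w A))) =
    bexp F p (%w. bexp (nt F (CL w A)) p (h (tch w (CL w A))))"
proof -
 let ?T = "(%w. CL w A) ` Pow F"
 have fin: "finite ?T" using F by simp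
 have exp: "g (CL w A) = (\<Sum>S\<in>?T. of_bool (CL w A = S) * g S)" if "w \<subseteq> F" for w and g :: "'v set => real"
 proof -
  have "(\<Sum>S\<in>?T. of_bool (CL w A = S) * g S) = (\<Sum>S\<in>{CL w A}. of_bool (CL w A = S) * g S)"
   using fin that by (intro sum.mono_neutral_right) auto
  then show ?thesis by simp
 qed
 have *: "bexp F p (%w. of_bool (CL w A = S) * h (tch w S) (nt w S)) =
    bexp F p (%w. of_bool (CL w A = S) * bexp (nt F S) p (h (tch w S)))" for S
 proof -
  have t: "CL (w1 \<union> w2) A = S \<longleftrightarrow> CL w1 A = S" "tch (w1 \<union> w2) S = w1" "nt (w1 \<union> w2) S = w2"
   if "w1 \<subseteq> tch F S" "w2 \<subseteq> nt F S" for w1 w2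
  proof -
   have "tch w1 S = w1" using that by (auto simp: tch_def)
   then show "CL (w1 \<union> w2) A = S \<longleftrightarrow> CL w1 A = S"
    using tch_split[OF that] by (metis CL_eq_tch_iff)
  qed (use tch_split[OF that] nt_split[OF that] in auto)
  have "bexp F p (%w. of_bool (CL w A = S) * h (tch w S) (nt w S)) =
   bexp (tch F S) p (%w1. bexp (nt F S) p (%w2. of_bool (CL w1 A = S) * h w1 w2))"
   unfolding bexp_split[OF F, of p _ S] by (intro bexp_cong) (simp add: t)
  also have "... = bexp (tch F S) p (%w1. bexp (nt F S) p (%w2. of_bool (CL w1 A = S) * bexp (nt F S) p (h w1)))"
   using F by (simp add: bexp_cmult bexp_const finite_nt)
  also have "... = bexp F p (%w. of_bool (CL w A = S) * bexp (nt F S) p (h (tch w S)))"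
   unfolding bexp_split[OF F, of p _ S] by (intro bexp_cong) (simp add: t)
  finally show ?thesis .
 qed
 have "bexp F p (%w. h (tch w (CL w A)) (nt w (CL w A))) =
  bexp F p (%w. \<Sum>S\<in>?T. of_bool (CL w A = S) * h (tch w S) (nt w S))"
  by (intro bexp_cong exp[where g = "%S. h (tch _ S) (nt _ S)"])
 also have "... = bexp F p (%w. \<Sum>S\<in>?T. of_bool (CL w A = S) * bexp (nt F S) p (h (tch w S)))"
  by (simp add: bexp_sum *)
 also have "... = bexp F p (%w. bexp (nt F (CL w A)) p (h (tch w (CL w A))))"
  by (intro bexp_cong exp[where g = "%S. bexp (nt F S) p (h (tch _ S))", symmetric])
 finally show ?thesis .
qed

section \<open>Breadth-first levels and their Markov property\<close>

definition reach :: "'v set set => 'v set => nat => 'v set" where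
 "reach w A n = (adj w ^^ n) `` A"

definition lv :: "'v set set => 'v set => nat => 'v set" where
 "lv w A n = reach w A n - (\<Union>m<n. reach w A m)"

definition nb :: "'v set set => 'v set => 'v set" where
 "nb w A = {y. y \<notin> A \<and> (\<exists>x\<in>A. {x, y} \<in> w)}"

lemma reach_0 [simp]: "reach w A 0 = A"
 by (auto simp: reach_def)

lemma reach_Suc: "y \<in> reach w A (Suc n) \<longleftrightarrow> (\<exists>x\<in>reach w A n. {x, y} \<in> w)"
 unfolding reach_def relpow.simps relcomp_Image by (auto simp: Image_iff adj_def)

lemma reach_mono:
 assumes "w \<subseteq> w'" "A \<subseteq> A'" shows "reach w A n \<subseteq> reach w' A' n"
proof (induction n)
 case (Suc n)
 show ?case
 proof
  fix y assume "y \<in> reach w A (Suc n)"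
  then obtain x where "x \<in> reach w A n" "{x, y} \<in> w" unfolding reach_Suc by (elim bexE)
  then have "x \<in> reach w' A' n" "{x, y} \<in> w'" using Suc assms(1) by (simp_all add: subsetD)
  then show "y \<in> reach w' A' (Suc n)" unfolding reach_Suc by (rule bexI[rotated])
 qed
qed (simp add: assms(2))

lemma reach_iff: "y \<in> reach w A n \<longleftrightarrow> (\<exists>a\<in>A. y \<in> reach w {a} n)"
 by (auto simp: reach_def)

lemma CL_reach: "CL w A = (\<Union>n. reach w A n)"
 unfolding CL_def reach_def rtrancl_is_UN_relpow by blast

lemma reach_empty [simp]: "reach w {} n = {}"
 by (auto simp: reach_def)

lemma lv_empty [simp]: "lv w {} n = {}"
 by (auto simp: lv_def)

lemma lv_0 [simp]: "lv w A 0 = A"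
 by (auto simp: lv_def)

lemma lv_subset_CL: "lv w A n \<subseteq> CL w A"
 by (auto simp: lv_def CL_reach)

lemma lv_subset_reach: "lv w A n \<subseteq> reach w A n"
 by (auto simp: lv_def)

lemma reach_lv: "(\<Union>m<n. reach w A m) = (\<Union>m<n. lv w A m)"
proof (induction n)
 case (Suc n)
 have "(\<Union>m<Suc n. reach w A m) = (\<Union>m<n. reach w A m) \<union> lv w A n"
  by (auto simp: lv_def lessThan_Suc)
 then show ?case using Suc by (auto simp: lessThan_Suc)
qed simp

lemma CL_lv: "CL w A = (\<Union>n. lv w A n)"
proof
 show "CL w A \<subseteq> (\<Union>n. lv w A n)"
 proof
  fix x assume "x \<in> CL w A"
  then obtain n where "x \<in> (\<Union>m<Suc n. reach w A m)" by (auto simp: CL_reach)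
  then show "x \<in> (\<Union>n. lv w A n)" unfolding reach_lv by blast
 qed
 show "(\<Union>n. lv w A n) \<subseteq> CL w A" by (intro UN_least lv_subset_CL)
qed

lemma lv_disjoint: "m \<noteq> n ==> lv w A m \<inter> lv w A n = {}"
 using linorder_neq_iff[of m n] by (auto simp: lv_def)

text \<open>Cut a walk at its last visit to \<open>A\<close>: the rest starts in
  \<open>nb w A\<close> and uses no edge touching \<open>A\<close>. Unions over all lengths are
  compared because \<open>reach\<close> counts walks of exactly \<open>m\<close> steps, backtracking
  included.\<close>

lemma reach_decomp: "(\<Union>m<Suc (Suc n). reach w A m) = A \<union> (\<Union>m<Suc n. reach (nt w A) (nb w A) m)"
proof -
 have sub: "reach w A m \<subseteq> A \<union> (\<Union>k<m. reach (nt w A) (nb w A) k)" for m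
 proof (induction m)
  case (Suc m)
  show ?case
  proof
   fix y assume "y \<in> reach w A (Suc m)"
   then obtain x where x: "x \<in> reach w A m" "{x, y} \<in> w" by (auto simp: reach_Suc)
   show "y \<in> A \<union> (\<Union>k<Suc m. reach (nt w A) (nb w A) k)"
   proof (cases "y \<in> A \<or> x \<in> A")
    case True
    then have "y \<in> A \<or> y \<in> nb w A" using x by (auto simp: nb_def)
    then show ?thesis by (auto intro!: bexI[of _ 0])
   next
    case False
    then obtain k where k: "k < m" "x \<in> reach (nt w A) (nb w A) k" using Suc x by blast
    have "{x, y} \<in> nt w A" using False x by (auto simp: nt_def)
    then have "y \<in> reach (nt w A) (nb w A) (Suc k)" using k by (auto simp: reach_Suc)
    then show ?thesis using k by (auto intro!: bexI[of _ "Suc k"])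
   qed
  qed
 qed simp
 have sup: "reach (nt w A) (nb w A) m \<subseteq> reach w A (Suc m)" for m
 proof (induction m)
  case 0
  then show ?case by (auto simp: nb_def reach_Suc)
 next
  case (Suc m)
  show ?case
  proof
   fix y assume "y \<in> reach (nt w A) (nb w A) (Suc m)"
   then obtain x where "x \<in> reach (nt w A) (nb w A) m" "{x, y} \<in> w"
    by (auto simp: reach_Suc nt_def)
   then show "y \<in> reach w A (Suc (Suc m))" using Suc reach_Suc[of y w A "Suc m"] by auto
  qed
 qed
 show ?thesis
 proof (intro equalityI subsetI)
  fix x assume "x \<in> (\<Union>m<Suc (Suc n). reach w A m)"
  then obtain m where m: "m < Suc (Suc n)" "x \<in> reach w A m" by blast
  then have "x \<in> A \<union> (\<Union>k<m. reach (nt w A) (nb w A) k)" using sub by blast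
  then show "x \<in> A \<union> (\<Union>m<Suc n. reach (nt w A) (nb w A) m)"
   using m(1) by (auto intro: less_le_trans)
 next
  fix x assume "x \<in> A \<union> (\<Union>m<Suc n. reach (nt w A) (nb w A) m)"
  then consider "x \<in> reach w A 0" | m where "m < Suc n" "x \<in> reach w A (Suc m)" using sup by force
  then show "x \<in> (\<Union>m<Suc (Suc n). reach w A m)" by cases blast+
 qed
qed

lemma reach_nt_avoid: "reach (nt w A) (nb w A) m \<inter> A = {}"
 using CL_nt_avoid[of "nb w A" A w] by (auto simp: CL_reach nb_def)

lemma lv_alt: "lv w A n = (\<Union>m<Suc n. reach w A m) - (\<Union>m<n. reach w A m)"
 by (auto simp: lv_def lessThan_Suc)

lemma lv_Suc: "lv w A (Suc n) = lv (nt w A) (nb w A) n"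
proof (cases n)
 case 0
 have "lv w A (Suc 0) = (A \<union> nb w A) - A"
  unfolding lv_alt[of w A "Suc 0"] reach_decomp[of w A 0] by (simp add: lessThan_Suc)
 then show ?thesis using 0 by (auto simp: nb_def)
next
 case (Suc k)
 have a: "(\<Union>m<Suc (Suc n). reach w A m) = A \<union> (\<Union>m<Suc n. reach (nt w A) (nb w A) m)"
  by (rule reach_decomp)
 have b: "(\<Union>m<Suc n. reach w A m) = A \<union> (\<Union>m<n. reach (nt w A) (nb w A) m)"
  unfolding Suc by (rule reach_decomp)
 show ?thesis
  unfolding lv_alt[of w A "Suc n"] a b lv_alt[of "nt w A" "nb w A" n]
  using reach_nt_avoid[of w A] by blast
qed

fun rs :: "'v set set => 'v set => nat => 'v set set" where
 "rs w A 0 = w"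
| "rs w A (Suc n) = rs (nt w A) (nb w A) n"

lemma lv_add: "lv w A (r + k) = lv (rs w A r) (lv w A r) k"
 by (induction w A r rule: rs.induct) (auto simp: lv_Suc)

lemma lv_empty_mono: "lv w A n = {} ==> n <= m ==> lv w A m = {}"
 using lv_add[of w A n "m - n"] by simp

lemma CL_lv_bounded: "lv w A n = {} ==> CL w A = (\<Union>m<n. reach w A m)"
proof -
 assume *: "lv w A n = {}"
 have "lv w A m \<subseteq> (\<Union>m<n. lv w A m)" for m
  using lv_empty_mono[OF *, of m] by (cases "m < n") auto
 then have "CL w A = (\<Union>m<n. lv w A m)" by (auto simp: CL_lv)
 then show ?thesis by (simp add: reach_lv)
qed

text \<open>The Markov property of breadth-first search. Once the first levels are known, the edges
  in \<open>rs w A r\<close> carry fresh percolation on a random subset of \<open>F\<close>, so the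
  bound on \<open>\<Psi>\<close> is assumed for every \<open>F' \<subseteq> F\<close>. The
  nonnegative weights \<open>u\<close> remember the sizes of the levels already passed.\<close>

lemma bexp_level_weighted:
 fixes u :: "'v set => real"
 assumes "finite F" "0 <= p" "p <= 1" "\<Union>F \<subseteq> W" "A \<subseteq> W" and u: "\<And>B. 0 <= u B"
  and "\<And>F' B. F' \<subseteq> F ==> B \<subseteq> W ==> bexp F' p (\<Psi> B) <= k B"
 shows "bexp F p (%w. (\<Prod>j<r. u (lv w A j)) * \<Psi> (lv w A r) (rs w A r))
  <= bexp F p (%w. (\<Prod>j<r. u (lv w A j)) * k (lv w A r))"
 using assms
proof (induction r arbitrary: F A)
 case 0
 then show ?case by (simp add: bexp_const)
next
 case (Suc r)
 have s: "nb (w1 \<union> w2) A = nb w1 A" "nt (w1 \<union> w2) A = w2"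
  if "w1 \<subseteq> tch F A" "w2 \<subseteq> nt F A" for w1 w2
  using that by (auto simp: nb_def nt_def tch_def)
 have "bexp F p (%w. (\<Prod>j<Suc r. u (lv w A j)) * \<Psi> (lv w A (Suc r)) (rs w A (Suc r))) =
  bexp (tch F A) p (%w1. u A * bexp (nt F A) p (%w2. (\<Prod>j<r. u (lv w2 (nb w1 A) j)) *
   \<Psi> (lv w2 (nb w1 A) r) (rs w2 (nb w1 A) r)))"
  unfolding bexp_split[OF Suc.prems(1), of p _ A] bexp_cmult[symmetric]
  by (intro bexp_cong) (simp add: s lv_Suc prod.lessThan_Suc_shift mult.assoc del: prod.lessThan_Suc)
 also have "... <= bexp (tch F A) p (%w1. u A * bexp (nt F A) p (%w2. (\<Prod>j<r. u (lv w2 (nb w1 A) j)) *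
   k (lv w2 (nb w1 A) r)))"
 proof (rule bexp_mono[OF Suc.prems(2,3)], rule mult_left_mono[OF _ u])
  fix w1 assume "w1 \<subseteq> tch F A"
  then have 1: "nb w1 A \<subseteq> W" using Suc.prems(4) by (auto simp: nb_def tch_def)
  have 2: "\<Union>(nt F A) \<subseteq> W" using Suc.prems(4) by (auto simp: nt_def)
  have 3: "bexp F' p (\<Psi> B) <= k B" if "F' \<subseteq> nt F A" "B \<subseteq> W" for F' B
   using Suc.prems(7)[of F' B] that order_trans[OF that(1) nt_subset] by simp
  show "bexp (nt F A) p (%w2. (\<Prod>j<r. u (lv w2 (nb w1 A) j)) * \<Psi> (lv w2 (nb w1 A) r) (rs w2 (nb w1 A) r))
    <= bexp (nt F A) p (%w2. (\<Prod>j<r. u (lv w2 (nb w1 A) j)) * k (lv w2 (nb w1 A) r))"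
   by (rule Suc.IH[OF finite_nt[OF Suc.prems(1)] Suc.prems(2,3) 2 1 u 3])
 qed
 also have "... = bexp F p (%w. (\<Prod>j<Suc r. u (lv w A j)) * k (lv w A (Suc r)))"
  unfolding bexp_split[OF Suc.prems(1), of p _ A] bexp_cmult[symmetric]
  by (intro bexp_cong) (simp add: s lv_Suc prod.lessThan_Suc_shift mult.assoc del: prod.lessThan_Suc)
 finally show ?case .
qed

lemma bexp_level:
 assumes "finite F" "0 <= p" "p <= 1" "\<Union>F \<subseteq> W" "A \<subseteq> W"
  and "\<And>F' B. F' \<subseteq> F ==> B \<subseteq> W ==> bexp F' p (\<Psi> B) <= k B"
 shows "bexp F p (%w. \<Psi> (lv w A r) (rs w A r)) <= bexp F p (%w. k (lv w A r))"
 using bexp_level_weighted[where u = "%_. 1", OF assms(1-5) _ assms(6)] by simp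

lemma reach_witness:
 assumes "y \<in> reach w A n"
 shows "\<exists>S\<subseteq>w. finite S \<and> card S <= n \<and> y \<in> reach S A n"
 using assms
proof (induction n arbitrary: y)
 case 0
 then show ?case by (auto intro!: exI[of _ "{}"])
next
 case (Suc n)
 then obtain x where x: "x \<in> reach w A n" "{x, y} \<in> w" by (auto simp: reach_Suc)
 then obtain S where S: "S \<subseteq> w" "finite S" "card S <= n" "x \<in> reach S A n" using Suc.IH by blast
 have "x \<in> reach (insert {x, y} S) A n" using S reach_mono[of S "insert {x, y} S" A A n] by auto
 then have "y \<in> reach (insert {x, y} S) A (Suc n)" by (auto simp: reach_Suc)
 moreover have "card (insert {x, y} S) <= Suc n" using S by (simp add: card_insert_if)
 ultimately show ?case using S x by (intro exI[of _ "insert {x, y} S"]) auto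
qed

text \<open>In the smaller configuration \<open>\<sigma>\<close> distances can only grow, and the
  surviving walk in \<open>S\<close> keeps the distance of \<open>y\<close> from growing.\<close>

lemma lv_thin:
 assumes "y \<in> lv w A n" "y \<in> reach S A n" "S \<subseteq> \<sigma>" "\<sigma> \<subseteq> w"
 shows "y \<in> lv \<sigma> A n"
proof -
 have "y \<in> reach \<sigma> A n" using assms(2,3) reach_mono by blast
 moreover have "y \<notin> reach \<sigma> A m" if "m < n" for m
  using assms(1,4) that reach_mono[of \<sigma> w A A m] by (auto simp: lv_def)
 ultimately show ?thesis by (auto simp: lv_def)
qed

lemma finite_CL:
 assumes "finite A" "finite w" "\<And>e. e \<in> w ==> finite e"
 shows "finite (CL w A)"
 using CL_bound[of w A] by (rule finite_subset) (use assms in auto)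

lemma card_CL_le:
 assumes "finite w" "\<And>e. e \<in> w ==> card e = 2"
 shows "card (CL w {x}) <= 2 * card w + 1"
proof -
 have fe: "finite e" if "e \<in> w" for e by (rule card_ge_0_finite) (simp add: assms(2)[OF that])
 have "card (CL w {x}) <= card ({x} \<union> \<Union>w)"
  using assms fe by (intro card_mono CL_bound) auto
 also have "... <= card {x} + card (\<Union>w)" by (rule card_Un_le)
 also have "card (\<Union>w) <= sum card w" by (rule card_Union_le_sum_card)
 also have "sum card w = 2 * card w" using assms(2) by simp
 finally show ?thesis by simp
qed

lemma lv_finite:
 assumes "finite A" "finite w" "\<And>e. e \<in> w ==> finite e"
 shows "finite (lv w A n)"
 by (rule finite_subset[OF lv_subset_CL finite_CL[OF assms]])

lemma lv_parent:
 assumes "y \<in> lv w A n" "j <= n"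
 shows "\<exists>u\<in>lv w A j. y \<in> CL (rs w A j) {u}"
proof -
 have "y \<in> lv (rs w A j) (lv w A j) (n - j)" using lv_add[of w A j "n - j"] assms by simp
 then have "y \<in> CL (rs w A j) (lv w A j)" by (rule subsetD[OF lv_subset_CL])
 then show ?thesis unfolding CL_iff[of y _ "lv w A j"] .
qed

section \<open>Entering a set through its boundary\<close>

definition bd :: "'v set set => 'v set => ('v \<times> 'v) set" where
 "bd F S = {(z, z'). z \<in> S \<and> z' \<notin> S \<and> {z, z'} \<in> F}"

lemma finite_bd:
 assumes "finite F" "\<And>e. e \<in> F ==> finite e"
 shows "finite (bd F S)"
proof -
 have "bd F S \<subseteq> \<Union>F \<times> \<Union>F" by (auto simp: bd_def)
 then show ?thesis by (rule finite_subset) (use assms in auto)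
qed

lemma incr_CL: "incr_on F (%w. of_bool (x \<in> CL w D))"
 by (intro incr_onI) (use CL_mono[OF _ order_refl, THEN subsetD] in auto)

lemma incr_card_CL:
 assumes "finite F" "\<And>e. e \<in> F ==> finite e" "finite D"
 shows "incr_on F (%w. real (card (CL w D \<inter> B)))"
proof (rule incr_onI)
 fix X Y :: "'a set set" assume "X \<subseteq> Y" "Y \<subseteq> F"
 then have "finite (CL Y D)" by (intro finite_CL) (use assms finite_subset in \<open>auto\<close>)
 moreover have "CL X D \<subseteq> CL Y D" using \<open>X \<subseteq> Y\<close> by (rule CL_mono) simp
 ultimately show "real (card (CL X D \<inter> B)) <= real (card (CL Y D \<inter> B))"
  by (intro of_nat_mono card_mono) auto
qed

text \<open>The first time a path from \<open>x\<close> meets the cluster \<open>W\<close> of \<open>D\<close> off \<open>S\<close>, it does so through a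
 boundary edge of \<open>S\<close>.\<close>

lemma boundary_entry:
 assumes "x \<in> S" "D \<inter> S = {}" "x \<in> CL w D"
 defines "W \<equiv> CL (nt w S) D"
 shows "\<exists>z z'. z \<in> S \<and> z' \<notin> S \<and> {z, z'} \<in> w \<and> z' \<in> W \<and> z \<in> CL (nt w W) {x}"
proof -
 let ?X = "CL (nt w W) {x}"
 have WS: "W \<inter> S = {}" unfolding W_def using assms(2) by (rule CL_nt_avoid)
 have XW: "?X \<inter> W = {}" using WS assms(1) by (intro CL_nt_avoid) auto
 obtain d where d: "d \<in> D" "x \<in> CL w {d}" using assms(3) unfolding CL_iff[of x w D] by (elim bexE)
 then have "d \<in> CL w {x}" by (simp add: CL_sym)
 \<comment> \<open>The part of the cluster of \<open>x\<close> that is found off \<open>W\<close>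
   misses \<open>d\<close>, so an open edge must leave it, and only \<open>W\<close> can have
   blocked that edge.\<close>
 moreover have "d \<notin> ?X" using XW CL_self[of D "nt w S"] d unfolding W_def by auto
 ultimately have "\<not> CL w {x} \<subseteq> ?X" by auto
 then obtain z z' where z: "z \<in> ?X" "{z, z'} \<in> w" "z' \<notin> ?X"
  using CL_least[of "{x}" ?X w] CL_self[of "{x}" "nt w W"] by auto
 have "{z, z'} \<notin> nt w W" using CL_closed[OF z(1)] z(3) by auto
 then have z': "z' \<in> W" using z XW by (auto simp: nt_def)
 have "z \<in> S"
 proof (rule ccontr)
  assume "z \<notin> S"
  then have "{z, z'} \<in> nt w S" using z z' WS by (auto simp: nt_def)
  then have "z \<in> W" by (rule CL_closed'[OF z'[unfolded W_def], folded W_def])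
  then show False using z XW by auto
 qed
 then show ?thesis using z z' WS by blast
qed

text \<open>A union bound over the entry edge. The cluster \<open>?W\<close> of \<open>D\<close> off
  \<open>S\<close> is explored first. Given \<open>?W\<close>, the edges touching \<open>S\<close>
  and the edges of \<open>nt F S\<close> avoiding \<open>?W\<close> are fresh, so a connection from
  \<open>x\<close> to \<open>z\<close> that avoids \<open>?W\<close> costs at most its unconditional
  probability.\<close>

lemma boundary_decomposition:
 fixes p :: real
 assumes F: "finite F" "\<And>e. e \<in> F ==> finite e" and p: "0 <= p" "p <= 1"
  and S: "x \<in> S" "D \<inter> S = {}"
 shows "bprob F p (%w. x \<in> CL w D)
  <= (\<Sum>(z, z')\<in>bd F S. bprob F p (%w. z \<in> CL w {x}) * bprob (nt F S) p (%w. z' \<in> CL w D))"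
proof -
 let ?W = "%w. CL (nt w S) D"
 have fin: "finite (bd F S)" using F by (rule finite_bd)
 have "bprob F p (%w. x \<in> CL w D)
  <= bexp F p (%w. \<Sum>e\<in>bd F S. of_bool (snd e \<in> ?W w) * of_bool (fst e \<in> CL (nt w (?W w)) {x}))"
 proof (rule bexp_mono[OF p])
  fix w assume u: "w \<subseteq> F"
  show "of_bool (x \<in> CL w D) <= (\<Sum>e\<in>bd F S. of_bool (snd e \<in> ?W w) * of_bool (fst e \<in> CL (nt w (?W w)) {x}) :: real)"
  proof (cases "x \<in> CL w D")
   case True
   obtain z z' where z: "z \<in> S" "z' \<notin> S" "{z, z'} \<in> w" "z' \<in> ?W w" "z \<in> CL (nt w (?W w)) {x}"
    using boundary_entry[OF S True] by blast
   then have "(z, z') \<in> bd F S" using u by (auto simp: bd_def)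
   then have "(\<Sum>e\<in>{(z, z')}. of_bool (snd e \<in> ?W w) * of_bool (fst e \<in> CL (nt w (?W w)) {x}) :: real)
    <= (\<Sum>e\<in>bd F S. of_bool (snd e \<in> ?W w) * of_bool (fst e \<in> CL (nt w (?W w)) {x}))"
    using fin by (intro sum_mono2) auto
   then show ?thesis using z True by simp
  qed (simp add: sum_nonneg)
 qed
 also have "... = (\<Sum>e\<in>bd F S. bexp F p (%w. of_bool (snd e \<in> ?W w) * of_bool (fst e \<in> CL (nt w (?W w)) {x})))"
  by (rule bexp_sum)
 also have "... <= (\<Sum>e\<in>bd F S. bprob F p (%w. fst e \<in> CL w {x}) * bprob (nt F S) p (%w. snd e \<in> CL w D))"
 proof (rule sum_mono)
  fix e assume "e \<in> bd F S"
  let ?T = "tch F S" and ?F = "nt F S"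
  \<comment> \<open>\<open>a\<close> is the part of \<open>nt F S\<close> that determines the
    cluster of \<open>D\<close>, \<open>b\<close> is the rest of \<open>nt F S\<close>, and
    \<open>w1\<close> runs over the fresh edges touching \<open>S\<close>.\<close>
  define h where "h = (%a b. of_bool (snd e \<in> CL a D) *
   bexp ?T p (%w1. of_bool (fst e \<in> CL (nt w1 (CL a D) \<union> b) {x}) :: real))"
  have "bexp F p (%w. of_bool (snd e \<in> ?W w) * of_bool (fst e \<in> CL (nt w (?W w)) {x}))
   = bexp ?F p (%w2. bexp ?T p (%w1. of_bool (snd e \<in> CL w2 D) *
     of_bool (fst e \<in> CL (nt w1 (CL w2 D) \<union> nt w2 (CL w2 D)) {x})))"
   unfolding bexp_split[OF F(1), of p _ S] bexp_swap[of ?F]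
  proof (intro bexp_cong)
   fix w1 w2 assume "w1 \<subseteq> ?T" "w2 \<subseteq> ?F"
   then have "nt (w1 \<union> w2) S = w2" by (rule nt_split)
   moreover have "nt (w1 \<union> w2) X = nt w1 X \<union> nt w2 X" for X by (auto simp: nt_def)
   ultimately show "of_bool (snd e \<in> ?W (w1 \<union> w2)) * of_bool (fst e \<in> CL (nt (w1 \<union> w2) (?W (w1 \<union> w2))) {x}) =
    (of_bool (snd e \<in> CL w2 D) * of_bool (fst e \<in> CL (nt w1 (CL w2 D) \<union> nt w2 (CL w2 D)) {x}) :: real)"
    by simp
  qed
  also have "... = bexp ?F p (%w2. h (tch w2 (CL w2 D)) (nt w2 (CL w2 D)))"
   unfolding h_def by (simp add: bexp_cmult CL_tch)
  also have "... = bexp ?F p (%w2. bexp (nt ?F (CL w2 D)) p (h (tch w2 (CL w2 D))))"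
   by (rule bexp_explore) (use F in \<open>simp add: finite_nt\<close>)
  also have "... <= bexp ?F p (%w2. of_bool (snd e \<in> CL w2 D) * bprob F p (%w. fst e \<in> CL w {x}))"
  proof (rule bexp_mono[OF p])
   fix w2 assume "w2 \<subseteq> ?F"
   let ?W2 = "CL w2 D"
   have "bexp (nt ?F ?W2) p (%b. bexp ?T p (%w1. of_bool (fst e \<in> CL (nt w1 ?W2 \<union> b) {x}) :: real))
    <= bexp (nt ?F ?W2) p (%b. bexp ?T p (%w1. of_bool (fst e \<in> CL (b \<union> w1) {x})))"
   proof (intro bexp_mono p)
    fix b w1
    have "CL (nt w1 ?W2 \<union> b) {x} \<subseteq> CL (b \<union> w1) {x}" by (intro CL_mono) (auto simp: nt_def)
    then show "of_bool (fst e \<in> CL (nt w1 ?W2 \<union> b) {x}) <= (of_bool (fst e \<in> CL (b \<union> w1) {x}) :: real)" by auto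
   qed
   also have "... = bprob (nt ?F ?W2 \<union> ?T) p (%w. fst e \<in> CL w {x})"
    using F(1) by (intro bexp_union[symmetric] finite_nt finite_tch) (auto simp: nt_def tch_def)
   also have "... <= bprob F p (%w. fst e \<in> CL w {x})"
    using F(1) p by (intro bexp_mono_F incr_CL) (auto simp: nt_def tch_def)
   finally have *: "bexp (nt ?F ?W2) p (%b. bexp ?T p (%w1. of_bool (fst e \<in> CL (nt w1 ?W2 \<union> b) {x}) :: real))
    <= bprob F p (%w. fst e \<in> CL w {x})" .
   show "bexp (nt ?F ?W2) p (h (tch w2 ?W2)) <= of_bool (snd e \<in> ?W2) * bprob F p (%w. fst e \<in> CL w {x})"
    unfolding h_def CL_tch bexp_cmult using * by (intro mult_left_mono) auto
  qed
  also have "... = bprob F p (%w. fst e \<in> CL w {x}) * bprob ?F p (%w. snd e \<in> CL w D)"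
   by (simp add: bexp_multc)
  finally show "bexp F p (%w. of_bool (snd e \<in> ?W w) * of_bool (fst e \<in> CL (nt w (?W w)) {x}))
   <= bprob F p (%w. fst e \<in> CL w {x}) * bprob ?F p (%w. snd e \<in> CL w D)" .
 qed
 finally show ?thesis by (simp add: case_prod_beta)
qed

lemma bexp_card_CL:
 assumes "finite F" "\<And>e. e \<in> F ==> finite e" "finite D" "finite U" "\<Union>F \<union> D \<subseteq> U"
 shows "bexp F p (%w. real (card (CL w D \<inter> B))) = (\<Sum>u\<in>U \<inter> B. bprob F p (%w. u \<in> CL w D))"
proof -
 have "bexp F p (%w. real (card (CL w D \<inter> B))) = bexp F p (%w. \<Sum>u\<in>U \<inter> B. of_bool (u \<in> CL w D))"
 proof (rule bexp_cong)
  fix w assume "w \<subseteq> F"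
  then have "CL w D \<subseteq> U" using CL_bound[of w D] assms(5) by blast
  then have "CL w D \<inter> B = (U \<inter> B) \<inter> {u. u \<in> CL w D}" by auto
  then show "real (card (CL w D \<inter> B)) = (\<Sum>u\<in>U \<inter> B. of_bool (u \<in> CL w D))"
   using assms(4) by (simp add: sum_of_bool_eq)
 qed
 then show ?thesis by (simp add: bexp_sum)
qed

text \<open>Sum \<open>boundary_decomposition\<close> with \<open>D = {u}\<close> over all
  \<open>u\<close> outside \<open>S\<close>. Since connection is symmetric, the second factors add
  up to the mean cluster size of \<open>z'\<close> off \<open>S\<close>.\<close>

lemma boundary_decomposition_card:
 fixes p :: real
 assumes F: "finite F" "\<And>e. e \<in> F ==> finite e" and p: "0 <= p" "p <= 1" and S: "x \<in> S"
 shows "bexp F p (%w. real (card (CL w {x} - S)))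
  <= (\<Sum>(z, z')\<in>bd F S. bprob F p (%w. z \<in> CL w {x}) * bexp (nt F S) p (%w. real (card (CL w {z'}))))"
proof -
 define U where "U = \<Union>F \<union> {x}"
 have U: "finite U" using F by (simp add: U_def)
 have fin: "finite (bd F S)" using F by (rule finite_bd)
 have "bexp F p (%w. real (card (CL w {x} - S))) = (\<Sum>u\<in>U \<inter> - S. bprob F p (%w. u \<in> CL w {x}))"
  unfolding Diff_eq using F U by (intro bexp_card_CL) (auto simp: U_def)
 also have "... = (\<Sum>u\<in>U \<inter> - S. bprob F p (%w. x \<in> CL w {u}))" by (simp add: CL_sym)
 also have "... <= (\<Sum>u\<in>U \<inter> - S. \<Sum>e\<in>bd F S. bprob F p (%w. fst e \<in> CL w {x}) * bprob (nt F S) p (%w. snd e \<in> CL w {u}))"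
  using boundary_decomposition[OF F p S, of "{u}" for u] by (intro sum_mono) (auto simp: case_prod_beta)
 also have "... = (\<Sum>e\<in>bd F S. bprob F p (%w. fst e \<in> CL w {x}) * (\<Sum>u\<in>U \<inter> - S. bprob (nt F S) p (%w. snd e \<in> CL w {u})))"
  by (subst sum.swap) (simp add: sum_distrib_left)
 also have "... <= (\<Sum>e\<in>bd F S. bprob F p (%w. fst e \<in> CL w {x}) * bexp (nt F S) p (%w. real (card (CL w {snd e}))))"
 proof (intro sum_mono mult_left_mono bprob_nonneg p)
  fix e assume e: "e \<in> bd F S"
  have "(\<Sum>u\<in>U \<inter> - S. bprob (nt F S) p (%w. snd e \<in> CL w {u})) = (\<Sum>u\<in>U \<inter> - S. bprob (nt F S) p (%w. u \<in> CL w {snd e}))"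
   by (simp add: CL_sym)
  also have "... <= (\<Sum>u\<in>U \<inter> UNIV. bprob (nt F S) p (%w. u \<in> CL w {snd e}))"
   using U p by (intro sum_mono2 bprob_nonneg) auto
  also have "... = bexp (nt F S) p (%w. real (card (CL w {snd e} \<inter> UNIV)))"
   using F U e by (intro bexp_card_CL[symmetric]) (auto simp: U_def nt_def bd_def)
  finally show "(\<Sum>u\<in>U \<inter> - S. bprob (nt F S) p (%w. snd e \<in> CL w {u})) <= bexp (nt F S) p (%w. real (card (CL w {snd e})))"
   by simp
 qed
 finally show ?thesis by (simp add: case_prod_beta)
qed

text \<open>Conditioning on the first open set of a list leaves, outside this set, a percolation
 conditioned on a decreasing event; Harris' inequality then applies.\<close>

definition first_open :: "'i set list => nat => 'i set => bool" where
 "first_open xs i w \<longleftrightarrow> xs ! i \<subseteq> w \<and> (\<forall>j<i. \<not> xs ! j \<subseteq> w)"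

lemma first_open_ex: "\<gamma> \<in> set xs ==> \<gamma> \<subseteq> w ==> \<exists>i<length xs. first_open xs i w"
proof -
 assume "\<gamma> \<in> set xs" "\<gamma> \<subseteq> w"
 then obtain k where k: "k < length xs" "xs ! k \<subseteq> w" by (auto simp: in_set_conv_nth)
 define i where "i = (LEAST i. xs ! i \<subseteq> w)"
 have "xs ! i \<subseteq> w" unfolding i_def by (rule LeastI) (rule k(2))
 moreover have "i <= k" unfolding i_def by (rule Least_le) (rule k(2))
 moreover have "\<not> xs ! j \<subseteq> w" if "j < i" for j using not_less_Least that unfolding i_def by blast
 ultimately show ?thesis using k unfolding first_open_def by (intro exI[of _ i]) auto
qed

lemma first_open_unique: "first_open xs i w ==> first_open xs j w ==> i = j"
 unfolding first_open_def by (metis linorder_neqE_nat)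

lemma sum_first_open_mult:
 fixes k :: "nat => real"
 assumes "l < length xs" "first_open xs l w"
 shows "(\<Sum>j<length xs. of_bool (first_open xs j w) * k j) = k l"
proof -
 have "first_open xs j w \<longleftrightarrow> j = l" for j
  using assms(2) first_open_unique[of xs j w l] by auto
 then have "(\<Sum>j<length xs. of_bool (first_open xs j w) * k j) = (\<Sum>j<length xs. if j = l then k j else 0)"
  by (intro sum.cong) auto
 then show ?thesis using assms(1) by simp
qed

lemma sum_first_open:
 "(\<Sum>i<length xs. of_bool (first_open xs i w)) = (of_bool (\<exists>\<gamma>\<in>set xs. \<gamma> \<subseteq> w) :: real)"
proof (cases "\<exists>\<gamma>\<in>set xs. \<gamma> \<subseteq> w")
 case True
 then obtain \<gamma> where "\<gamma> \<in> set xs" "\<gamma> \<subseteq> w" by auto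
 then obtain i where i: "i < length xs" "first_open xs i w" using first_open_ex[of \<gamma> xs w] by auto
 show ?thesis using sum_first_open_mult[OF i, of "%_. 1"] True by simp
next
 case False
 then have "\<not> first_open xs i w" if "i < length xs" for i using that by (auto simp: first_open_def)
 then show ?thesis using False by simp
qed

lemma first_open_bexp:
 assumes "finite F" "xs ! i \<subseteq> F"
 shows "bexp F p (%w. of_bool (first_open xs i w) * g (w - xs ! i)) =
  p ^ card (xs ! i) * bexp (F - xs ! i) p (%w. of_bool (\<forall>j<i. \<not> xs ! j \<subseteq> xs ! i \<union> w) * g w)"
proof -
 have "bexp F p (%w. of_bool (first_open xs i w) * g (w - xs ! i)) =
  bexp F p (%w. of_bool (xs ! i \<subseteq> w) * (of_bool (\<forall>j<i. \<not> xs ! j \<subseteq> w) * g (w - xs ! i)))"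
  by (intro bexp_cong) (auto simp: first_open_def)
 also have "... = p ^ card (xs ! i) * bexp (F - xs ! i) p
   (%w. of_bool (\<forall>j<i. \<not> xs ! j \<subseteq> xs ! i \<union> w) * g (xs ! i \<union> w - xs ! i))"
  by (rule bexp_open[OF assms])
 also have "bexp (F - xs ! i) p (%w. of_bool (\<forall>j<i. \<not> xs ! j \<subseteq> xs ! i \<union> w) * g (xs ! i \<union> w - xs ! i)) =
  bexp (F - xs ! i) p (%w. of_bool (\<forall>j<i. \<not> xs ! j \<subseteq> xs ! i \<union> w) * g w)"
  by (intro bexp_cong arg_cong2[where f = "(*)"] refl arg_cong[where f = g]) auto
 finally show ?thesis .
qed

lemma decr_first_open:
 fixes xs :: "'i set list"
 shows "incr_on F (%w. - of_bool (\<forall>j<i. \<not> xs ! j \<subseteq> xs ! i \<union> w) :: real)"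
proof (rule incr_onI)
 fix A B :: "'i set" assume "A \<subseteq> B"
 then have "\<And>j. xs ! j \<subseteq> xs ! i \<union> A ==> xs ! j \<subseteq> xs ! i \<union> B" by blast
 then have "(\<forall>j<i. \<not> xs ! j \<subseteq> xs ! i \<union> B) --> (\<forall>j<i. \<not> xs ! j \<subseteq> xs ! i \<union> A)" by meson
 then show "- of_bool (\<forall>j<i. \<not> xs ! j \<subseteq> xs ! i \<union> A) <= (- of_bool (\<forall>j<i. \<not> xs ! j \<subseteq> xs ! i \<union> B) :: real)"
  unfolding of_bool_def by (simp only: neg_le_iff_le split: if_split) simp
qed

text \<open>Given that \<open>xs ! i\<close> is open, being the first open set is a decreasing event
  of the other edges: positively correlated with the decreasing \<open>g\<close> here, negatively
  with the increasing one in \<open>first_open_le\<close>.\<close>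

lemma first_open_ge:
 assumes "finite F" "xs ! i \<subseteq> F" "0 <= p" "p <= 1" "incr_on (F - xs ! i) (%w. - g w)"
 shows "bprob F p (first_open xs i) * bexp (F - xs ! i) p g <= bexp F p (%w. of_bool (first_open xs i w) * g (w - xs ! i))"
proof -
 have "bprob F p (first_open xs i) = p ^ card (xs ! i) * bprob (F - xs ! i) p (%w. \<forall>j<i. \<not> xs ! j \<subseteq> xs ! i \<union> w)"
  using first_open_bexp[OF assms(1,2), of p "%_. 1"] by simp
 then show ?thesis
  unfolding first_open_bexp[OF assms(1,2)]
  using mult_left_mono[OF harris_decr[OF _ assms(3,4) decr_first_open assms(5)], of "p ^ card (xs ! i)"] assms
  by (simp add: mult.assoc)
qed

lemma first_open_le:
 assumes "finite F" "xs ! i \<subseteq> F" "0 <= p" "p <= 1" "incr_on (F - xs ! i) g"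
 shows "bexp F p (%w. of_bool (first_open xs i w) * g (w - xs ! i)) <= bprob F p (first_open xs i) * bexp (F - xs ! i) p g"
proof -
 have "bprob F p (first_open xs i) = p ^ card (xs ! i) * bprob (F - xs ! i) p (%w. \<forall>j<i. \<not> xs ! j \<subseteq> xs ! i \<union> w)"
  using first_open_bexp[OF assms(1,2), of p "%_. 1"] by simp
 moreover have "bexp (F - xs ! i) p (%w. of_bool (\<forall>j<i. \<not> xs ! j \<subseteq> xs ! i \<union> w) * g w)
  <= bprob (F - xs ! i) p (%w. \<forall>j<i. \<not> xs ! j \<subseteq> xs ! i \<union> w) * bexp (F - xs ! i) p g"
  using harris_neg[OF _ assms(3,4,5) decr_first_open[where xs = xs and i = i]] assms(1)
  by (simp add: mult.commute)
 ultimately show ?thesis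
  unfolding first_open_bexp[OF assms(1,2)] using assms by (simp add: mult.assoc mult_left_mono)
qed

text \<open>\<open>G\<close> is a family of candidate paths. Sum over which of them is the first
  open one: what this reveals about the remaining edges is decreasing and can only favour the
  decreasing requirement \<open>g \<gamma>\<close>.\<close>

lemma path_harris_ge:
 assumes "finite F" "0 <= p" "p <= 1" "0 <= \<beta>" and G: "\<And>\<gamma>. \<gamma> \<in> G ==> \<gamma> \<subseteq> F"
  and g: "\<And>\<gamma>. \<gamma> \<in> G ==> incr_on (F - \<gamma>) (%w. - g \<gamma> w)" "\<And>\<gamma>. \<gamma> \<in> G ==> \<beta> <= bexp (F - \<gamma>) p (g \<gamma>)"
  and Q: "\<And>w \<gamma>. w \<subseteq> F ==> \<gamma> \<in> G ==> \<gamma> \<subseteq> w ==> g \<gamma> (w - \<gamma>) <= of_bool (Q w)"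
 shows "\<beta> * bprob F p (%w. \<exists>\<gamma>\<in>G. \<gamma> \<subseteq> w) <= bprob F p (%w. (\<exists>\<gamma>\<in>G. \<gamma> \<subseteq> w) \<and> Q w)"
proof -
 have "finite G" using assms(1) G by (intro finite_subset[of G "Pow F"]) auto
 then obtain xs where xs: "set xs = G" using finite_list by blast
 have i: "xs ! i \<in> G" if "i < length xs" for i using that xs by auto
 have "\<beta> * bprob F p (%w. \<exists>\<gamma>\<in>G. \<gamma> \<subseteq> w) = (\<Sum>i<length xs. \<beta> * bprob F p (first_open xs i))"
  unfolding xs[symmetric] sum_first_open[symmetric] bexp_sum by (simp add: sum_distrib_left)
 also have "... <= (\<Sum>i<length xs. bexp F p (%w. of_bool (first_open xs i w) * g (xs ! i) (w - xs ! i)))"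
 proof (rule sum_mono)
  fix i assume "i \<in> {..<length xs}"
  then have *: "xs ! i \<in> G" using i by auto
  have "\<beta> * bprob F p (first_open xs i) <= bprob F p (first_open xs i) * bexp (F - xs ! i) p (g (xs ! i))"
   using g(2)[OF *] bprob_nonneg[OF assms(2,3)] by (subst mult.commute) (intro mult_left_mono)
  also have "... <= bexp F p (%w. of_bool (first_open xs i w) * g (xs ! i) (w - xs ! i))"
   by (intro first_open_ge assms G[OF *] g(1)[OF *])
  finally show "\<beta> * bprob F p (first_open xs i) <= ..." .
 qed
 also have "... <= (\<Sum>i<length xs. bexp F p (%w. of_bool (first_open xs i w) * of_bool (Q w)))"
 proof (intro sum_mono bexp_mono assms)
  fix i w assume "i \<in> {..<length xs}" "w \<subseteq> F"
  then show "of_bool (first_open xs i w) * g (xs ! i) (w - xs ! i) <= of_bool (first_open xs i w) * of_bool (Q w)"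
   using Q[of w "xs ! i"] i[of i] by (auto simp: first_open_def)
 qed
 also have "... = bprob F p (%w. (\<exists>\<gamma>\<in>G. \<gamma> \<subseteq> w) \<and> Q w)"
  unfolding bexp_sum[symmetric] sum_distrib_right[symmetric] sum_first_open xs by (simp add: of_bool_conj)
 finally show ?thesis .
qed

lemma path_harris_le:
 assumes "finite F" "0 <= p" "p <= 1" and G: "\<And>\<gamma>. \<gamma> \<in> G ==> \<gamma> \<subseteq> F"
  and g: "\<And>\<gamma>. \<gamma> \<in> G ==> incr_on (F - \<gamma>) (g \<gamma>)" "\<And>\<gamma>. \<gamma> \<in> G ==> bexp (F - \<gamma>) p (g \<gamma>) <= k (card \<gamma>)"
  and Q: "\<And>w. w \<subseteq> F ==> Q w ==> \<exists>\<gamma>\<in>G. \<gamma> \<subseteq> w"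
   "\<And>w \<gamma>. w \<subseteq> F ==> \<gamma> \<in> G ==> \<gamma> \<subseteq> w ==> of_bool (Q w) <= g \<gamma> (w - \<gamma>)"
  and K: "\<And>w \<gamma>. w \<subseteq> F ==> \<gamma> \<in> G ==> \<gamma> \<subseteq> w ==> (\<And>\<gamma>'. \<gamma>' \<in> G ==> \<gamma>' \<subseteq> w ==> card \<gamma> <= card \<gamma>') ==> k (card \<gamma>) <= \<kappa> w"
   "\<And>w. w \<subseteq> F ==> 0 <= \<kappa> w"
 shows "bprob F p Q <= bexp F p \<kappa>"
proof -
 have "finite G" using assms(1) G by (intro finite_subset[of G "Pow F"]) auto
 then obtain ys where ys: "set ys = G" using finite_list by blast
 \<comment> \<open>Sorted by size, so that the first open set is a smallest open one; this is what
   lets \<open>K\<close> bound \<open>k (card \<gamma>)\<close> by a function of the configuration,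
   such as one of the intrinsic distance.\<close>
 define xs where "xs = sort_key card ys"
 have xs: "set xs = G" "sorted (map card xs)" using ys by (simp_all add: xs_def)
 have i: "xs ! i \<in> G" if "i < length xs" for i using that xs by auto
 have "bprob F p Q <= bexp F p (%w. \<Sum>i<length xs. of_bool (first_open xs i w) * g (xs ! i) (w - xs ! i))"
 proof (rule bexp_mono[OF assms(2,3)])
  fix w assume u: "w \<subseteq> F"
  have nn: "0 <= of_bool (first_open xs i w) * g (xs ! i) (w - xs ! i)" if "i < length xs" for i
   using Q(2)[OF u i[OF that]] by (cases "Q w") (auto simp: first_open_def)
  show "of_bool (Q w) <= (\<Sum>i<length xs. of_bool (first_open xs i w) * g (xs ! i) (w - xs ! i))"
  proof (cases "Q w")
   case True
   then obtain \<gamma> where "\<gamma> \<in> set xs" "\<gamma> \<subseteq> w" using Q(1)[OF u] xs(1) by auto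
   then obtain k where k: "k < length xs" "first_open xs k w" using first_open_ex[of \<gamma> xs w] by auto
   have "of_bool (Q w) <= of_bool (first_open xs k w) * g (xs ! k) (w - xs ! k)"
    using Q(2)[OF u i[OF k(1)]] k(2) by (auto simp: first_open_def)
   also have "... <= (\<Sum>i<length xs. of_bool (first_open xs i w) * g (xs ! i) (w - xs ! i))"
    using nn k(1) by (intro member_le_sum) auto
   finally show ?thesis .
  next
   case False
   have "0 <= (\<Sum>i<length xs. of_bool (first_open xs i w) * g (xs ! i) (w - xs ! i))"
    by (rule sum_nonneg) (rule nn, simp)
   then show ?thesis using False by simp
  qed
 qed
 also have "... = (\<Sum>i<length xs. bexp F p (%w. of_bool (first_open xs i w) * g (xs ! i) (w - xs ! i)))"
  by (rule bexp_sum)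
 also have "... <= (\<Sum>i<length xs. bprob F p (first_open xs i) * k (card (xs ! i)))"
 proof (rule sum_mono)
  fix j assume "j \<in> {..<length xs}"
  then have *: "xs ! j \<in> G" using i by auto
  have "bexp F p (%w. of_bool (first_open xs j w) * g (xs ! j) (w - xs ! j)) <=
    bprob F p (first_open xs j) * bexp (F - xs ! j) p (g (xs ! j))"
   by (intro first_open_le assms G[OF *] g(1)[OF *])
  also have "... <= bprob F p (first_open xs j) * k (card (xs ! j))"
   by (intro mult_left_mono g(2)[OF *] bprob_nonneg assms)
  finally show "bexp F p (%w. of_bool (first_open xs j w) * g (xs ! j) (w - xs ! j)) <= ..." .
 qed
 also have "... = bexp F p (%w. \<Sum>i<length xs. of_bool (first_open xs i w) * k (card (xs ! i)))"
  by (simp only: bexp_sum bexp_multc)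
 also have "... <= bexp F p \<kappa>"
 proof (rule bexp_mono[OF assms(2,3)])
  fix w assume u: "w \<subseteq> F"
  show "(\<Sum>i<length xs. of_bool (first_open xs i w) * k (card (xs ! i))) <= \<kappa> w"
  proof (cases "\<exists>\<gamma>\<in>set xs. \<gamma> \<subseteq> w")
   case True
   then obtain \<gamma> where "\<gamma> \<in> set xs" "\<gamma> \<subseteq> w" by auto
   then obtain l where l: "l < length xs" "first_open xs l w" using first_open_ex[of \<gamma> xs w] by auto
   have "(\<Sum>j<length xs. of_bool (first_open xs j w) * k (card (xs ! j))) = k (card (xs ! l))"
    by (rule sum_first_open_mult[OF l])
   also have "... <= \<kappa> w"
   proof (rule K(1)[OF u i[OF l(1)]])
    show "xs ! l \<subseteq> w" using l by (simp add: first_open_def)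
    fix \<gamma>' assume "\<gamma>' \<in> G" "\<gamma>' \<subseteq> w"
    then obtain m where m: "m < length xs" "xs ! m = \<gamma>'" using xs by (metis in_set_conv_nth)
    then have "l <= m" using l(2) \<open>\<gamma>' \<subseteq> w\<close> unfolding first_open_def by (metis linorder_not_le)
    then show "card (xs ! l) <= card \<gamma>'" using sorted_nth_mono[OF xs(2), of l m] m l by simp
   qed
   finally show ?thesis .
  next
   case False
   then have "\<not> first_open xs i w" if "i < length xs" for i using that by (auto simp: first_open_def)
   then show ?thesis using K(2)[OF u] by simp
  qed
 qed
 finally show ?thesis .
qed

lemma harris_all_decr:
 assumes "finite F" "0 <= p" "p <= 1" "finite X" "0 <= \<beta>"
  and "\<And>x. x \<in> X ==> incr_on F (%w. - of_bool (Q x w) :: real)" "\<And>x. x \<in> X ==> \<beta> <= bprob F p (Q x)"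
 shows "\<beta> ^ card X <= bprob F p (%w. \<forall>x\<in>X. Q x w)"
 using assms(4,6,7)
proof (induction X)
 case empty
 then show ?case using assms(1) by (simp add: bexp_const)
next
 case (insert x X)
 have d: "incr_on F (%w. - of_bool (\<forall>x\<in>X. Q x w) :: real)"
 proof (rule incr_onI)
  fix A B :: "'a set" assume "A \<subseteq> B" "B \<subseteq> F"
  then have "Q y B ==> Q y A" if "y \<in> X" for y
   using incr_onD[OF insert.prems(1), of y A B] that by (auto split: if_splits simp: of_bool_def)
  then show "- of_bool (\<forall>x\<in>X. Q x A) <= (- of_bool (\<forall>x\<in>X. Q x B) :: real)" by auto
 qed
 have "\<beta> ^ card (insert x X) = \<beta> * \<beta> ^ card X" using insert by simp
 also have "... <= bprob F p (Q x) * bprob F p (%w. \<forall>x\<in>X. Q x w)"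
  using insert.IH insert.prems assms(2,3,5) by (intro mult_mono bprob_nonneg) auto
 also have "... <= bexp F p (%w. of_bool (Q x w) * of_bool (\<forall>x\<in>X. Q x w))"
  by (rule harris_decr[OF assms(1-3) insert.prems(1) d]) simp
 finally show ?case by (simp add: of_bool_conj)
qed

section \<open>Open paths and the connections leaving their vertices\<close>

lemma lv_nonempty_card:
 assumes "finite w" "lv w A n \<noteq> {}" shows "n <= card w"
 using assms
proof (induction n arbitrary: w A)
 case (Suc n)
 have ne: "lv (nt w A) (nb w A) n \<noteq> {}" using Suc.prems(2) by (simp add: lv_Suc)
 then have "nb w A \<noteq> {}" by (metis lv_empty)
 then have "tch w A \<noteq> {}" by (auto simp: nb_def tch_def)
 moreover have "card w = card (tch w A) + card (nt w A)"
  using Suc.prems(1) card_Un_disjoint[of "tch w A" "nt w A"] tch_nt[of w A] by (simp add: finite_tch finite_nt)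
 moreover have "n <= card (nt w A)" using Suc.prems(1) ne by (intro Suc.IH) (simp_all add: finite_nt)
 ultimately show ?case using Suc.prems(1) by (simp add: finite_tch Suc_le_eq card_gt_0_iff less_add_same_cancel2 le_less_trans)
qed simp

lemma lv_index_le: "finite w ==> y \<in> lv w A n ==> n <= card w"
 by (rule lv_nonempty_card[where A = A]) auto

lemma CL_lvE:
 assumes "y \<in> CL w A" obtains n where "y \<in> lv w A n"
 using assms unfolding CL_lv by auto

text \<open>Follow a connection between \<open>x\<close> and \<open>D\<close>, and cut it after the
  last edge of \<open>\<gamma>\<close> that it uses on the way from \<open>x\<close>.\<close>

lemma CL_remove:
 assumes "x \<in> CL w D" shows "\<exists>u\<in>insert x (\<Union>\<gamma>). u \<in> CL (w - \<gamma>) D"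
proof (rule ccontr)
 assume n: "\<not> (\<exists>u\<in>insert x (\<Union>\<gamma>). u \<in> CL (w - \<gamma>) D)"
 have "CL w D \<subseteq> CL (w - \<gamma>) D"
 proof (rule CL_least[OF CL_self])
  fix a b assume a: "a \<in> CL (w - \<gamma>) D" "{a, b} \<in> w"
  then have "{a, b} \<notin> \<gamma>" using n by auto
  then show "b \<in> CL (w - \<gamma>) D" using a CL_closed[of a "w - \<gamma>" D b] by simp
 qed
 then show False using assms n by auto
qed

lemma card_vertices_le:
 assumes "finite \<gamma>" "\<And>e. e \<in> \<gamma> ==> card e = 2"
 shows "finite (\<Union>\<gamma>)" "card (insert x (\<Union>\<gamma>)) <= 2 * card \<gamma> + 1"
proof -
 have fe: "finite e" if "e \<in> \<gamma>" for e by (rule card_ge_0_finite) (simp add: assms(2)[OF that])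
 then show "finite (\<Union>\<gamma>)" using assms(1) by auto
 have "card (\<Union>\<gamma>) <= sum card \<gamma>" by (rule card_Union_le_sum_card)
 also have "sum card \<gamma> = 2 * card \<gamma>" using assms(2) by simp
 finally have "Suc (card (\<Union>\<gamma>)) <= 2 * card \<gamma> + 1" by simp
 moreover have "card (insert x (\<Union>\<gamma>)) <= Suc (card (\<Union>\<gamma>))" by (rule card_insert_le_m1) simp_all
 ultimately show "card (insert x (\<Union>\<gamma>)) <= 2 * card \<gamma> + 1" by linarith
qed

text \<open>The witness is pruned to its component of \<open>x\<close>. All its vertices then lie
  within \<open>card \<gamma>\<close> steps of \<open>x\<close>, which is what allows local bounds
  to be applied to each of them.\<close>

lemma connected_witness:
 assumes "y \<in> reach w {x} n" "\<And>e. e \<in> w ==> card e = 2"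
 shows "\<exists>\<gamma>\<subseteq>w. finite \<gamma> \<and> card \<gamma> <= n \<and> y \<in> CL \<gamma> {x} \<and> \<Union>\<gamma> \<subseteq> CL \<gamma> {x}"
proof -
 obtain S where S: "S \<subseteq> w" "finite S" "card S <= n" "y \<in> reach S {x} n"
  using reach_witness[OF assms(1)] by auto
 let ?\<gamma> = "tch S (CL S {x})"
 have "\<Union>?\<gamma> \<subseteq> CL S {x}"
 proof
  fix b assume "b \<in> \<Union>?\<gamma>"
  then obtain e a where e: "e \<in> S" "b \<in> e" "a \<in> e" "a \<in> CL S {x}" by (auto simp: tch_def)
  then have "card e = 2" using assms(2) S(1) by auto
  then obtain u v where "e = {u, v}" by (auto simp: card_2_iff)
  then have "e = {a, b} \<or> b = a" using e by auto
  then show "b \<in> CL S {x}" using e CL_closed[of a S "{x}" b] by auto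
 qed
 moreover have "CL ?\<gamma> {x} = CL S {x}" by (rule CL_tch)
 moreover have "y \<in> CL S {x}" using S(4) by (auto simp: CL_reach)
 moreover have "?\<gamma> \<subseteq> S" by (rule tch_subset)
 moreover have "card ?\<gamma> <= n" using card_mono[OF S(2) tch_subset, of "CL S {x}"] S(3) by linarith
 ultimately show ?thesis using S by (intro exI[of _ ?\<gamma>]) (auto simp: finite_tch)
qed

text \<open>
 A path of \<open>m\<close> edges has at most \<open>2 m + 1\<close> vertices, each connected to a distant set with probability at most \<open>g\<close>
 as long as \<open>m \<le> M\<close>, and trivially at most \<open>1\<close> beyond.
\<close>

definition path_weight :: "real => nat => nat => real" where
 "path_weight g M m = (2 * real m + 1) * (g + (if m <= M then 0 else 1))"

lemma path_weight_mono: "0 <= g ==> m <= n ==> path_weight g M m <= path_weight g M n"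
 unfolding path_weight_def by (intro mult_mono) auto

lemma path_weight_nonneg: "0 <= g ==> 0 <= path_weight g M m"
 unfolding path_weight_def by (intro mult_nonneg_nonneg) auto

text \<open>\<open>4 * (n choose 2) + 5 * n + 1 = (2 * n + 1) * (n + 1)\<close>, and the indicator
  of \<open>n > M\<close> is at most \<open>(n + 1) / M\<close>. The binomial basis is used because
  binomial moments of the distance are what \<open>level_sum\<close> controls.\<close>

lemma path_weight_le:
 assumes "0 <= g" "1 <= M"
 shows "path_weight g M n <= (g + 1 / M) * (4 * real (n choose 2) + 5 * real (n choose 1) + real (n choose 0))"
proof -
 have c: "4 * real (n choose 2) + 5 * real (n choose 1) + real (n choose 0) = (2 * real n + 1) * (real n + 1)"
 proof -
  have "even (n * (n - 1))" by (cases n) auto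
  then have "2 * (n choose 2) = n * (n - 1)" by (simp add: choose_two)
  then have "2 * real (n choose 2) = real n * real (n - 1)" by (metis of_nat_mult of_nat_numeral)
  then show ?thesis by (cases n) (auto simp: algebra_simps)
 qed
 have "g + (if n <= M then 0 else 1) <= (g + 1 / M) * (real n + 1)"
 proof (cases "n <= M")
  case True
  then show ?thesis using assms by (simp add: algebra_simps add_nonneg_nonneg)
 next
  case False
  then have "1 <= (1 + real n) / real M" using assms by (simp add: field_simps)
  moreover have "0 <= g * real n" using assms by auto
  ultimately show ?thesis using False by (simp add: algebra_simps)
 qed
 then have "(2 * real n + 1) * (g + (if n <= M then 0 else 1)) <= (2 * real n + 1) * ((g + 1 / M) * (real n + 1))"
  by (intro mult_left_mono) auto
 then show ?thesis unfolding path_weight_def c by (simp add: mult_ac)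
qed

text \<open>Condition on a shortest open connection \<open>\<gamma>\<close> from \<open>x\<close> to
  \<open>y\<close>. The set \<open>D\<close> must then be reached off \<open>\<gamma>\<close> from
  one of its at most \<open>2 * card \<gamma> + 1\<close> vertices; by Harris the conditioning does
  not raise this probability, and a union bound gives \<open>path_weight\<close>. If
  \<open>y\<close> is on level \<open>n\<close>, then \<open>card \<gamma> <= n\<close>.\<close>

lemma connect_and_reach_le:
 fixes p :: real and F :: "'v set set"
 assumes F: "finite F" "\<And>e. e \<in> F ==> card e = 2" and p: "0 <= p" "p <= 1" and g: "0 <= g"
  and loc: "\<And>\<gamma> u m. \<gamma> \<subseteq> F ==> m <= M ==> u \<in> reach F {x} m ==> bprob (F - \<gamma>) p (%w. u \<in> CL w D) <= g"
 shows "bprob F p (%w. y \<in> CL w {x} \<and> x \<in> CL w D)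
  <= (\<Sum>n\<le>card F. path_weight g M n * bprob F p (%w. y \<in> lv w {x} n))"
proof -
 define G where "G = {\<gamma>. \<gamma> \<subseteq> F \<and> y \<in> CL \<gamma> {x} \<and> \<Union>\<gamma> \<subseteq> CL \<gamma> {x}}"
 define h where "h = (%\<gamma> w. of_bool (\<exists>u\<in>insert x (\<Union>\<gamma>). u \<in> CL w D) :: real)"
 define \<kappa> where "\<kappa> = (%w. \<Sum>n\<le>card F. path_weight g M n * of_bool (y \<in> lv w {x} n))"
 have short: "\<exists>\<gamma>\<in>G. \<gamma> \<subseteq> w \<and> card \<gamma> <= n" if u: "w \<subseteq> F" and l: "y \<in> lv w {x} n" for w n
 proof -
  have "y \<in> reach w {x} n" by (rule subsetD[OF lv_subset_reach l])
  then obtain \<gamma> where "\<gamma> \<subseteq> w" "card \<gamma> <= n" "y \<in> CL \<gamma> {x}" "\<Union>\<gamma> \<subseteq> CL \<gamma> {x}"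
   using connected_witness[of y w x n] F(2) u by auto
  then show ?thesis using u by (intro bexI[of _ \<gamma>]) (auto simp: G_def)
 qed
 have "bprob F p (%w. y \<in> CL w {x} \<and> x \<in> CL w D) <= bexp F p \<kappa>"
 proof (rule path_harris_le[OF F(1) p, where G = G and g = h and k = "path_weight g M"])
  show "\<gamma> \<subseteq> F" if "\<gamma> \<in> G" for \<gamma> using that by (simp add: G_def)
  show "incr_on (F - \<gamma>) (h \<gamma>)" if "\<gamma> \<in> G" for \<gamma>
  proof (rule incr_onI)
   fix A B :: "'v set set" assume "A \<subseteq> B"
   then have "CL A D \<subseteq> CL B D" by (rule CL_mono) simp
   then show "h \<gamma> A <= h \<gamma> B" unfolding h_def by auto
  qed
  show "bexp (F - \<gamma>) p (h \<gamma>) <= path_weight g M (card \<gamma>)" if "\<gamma> \<in> G" for \<gamma>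
  proof -
   have \<gamma>: "\<gamma> \<subseteq> F" "\<Union>\<gamma> \<subseteq> CL \<gamma> {x}" "finite \<gamma>" using that F(1) by (auto simp: G_def dest: finite_subset)
   have c: "finite (\<Union>\<gamma>)" "card (insert x (\<Union>\<gamma>)) <= 2 * card \<gamma> + 1"
    using card_vertices_le(1)[of \<gamma>] card_vertices_le(2)[of \<gamma> x] \<gamma> F(2) by auto
   have each: "bprob (F - \<gamma>) p (%w. u \<in> CL w D) <= g + (if card \<gamma> <= M then 0 else 1)" if u: "u \<in> insert x (\<Union>\<gamma>)" for u
   proof (cases "card \<gamma> <= M")
    case True
    have "u \<in> CL \<gamma> {x}" using u \<gamma>(2) CL_self[of "{x}" \<gamma>] by auto
    then obtain m where m: "u \<in> lv \<gamma> {x} m" by (rule CL_lvE)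
    then have "m <= card \<gamma>" by (rule lv_index_le[OF \<gamma>(3)])
    moreover have "u \<in> reach F {x} m"
     using subsetD[OF lv_subset_reach m] reach_mono[OF \<gamma>(1) order_refl, of "{x}" m] by (rule subsetD[rotated])
    ultimately show ?thesis using loc[OF \<gamma>(1), of m u] True by simp
   next
    case False
    have "bprob (F - \<gamma>) p (%w. u \<in> CL w D) <= 1" using F(1) p by (intro bprob_le_1) auto
    then show ?thesis using False g by simp
   qed
   have "bexp (F - \<gamma>) p (h \<gamma>) <= bexp (F - \<gamma>) p (%w. \<Sum>u\<in>insert x (\<Union>\<gamma>). of_bool (u \<in> CL w D))"
   proof (rule bexp_mono[OF p])
    fix w
    show "h \<gamma> w <= (\<Sum>u\<in>insert x (\<Union>\<gamma>). of_bool (u \<in> CL w D))"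
    proof (cases "\<exists>u\<in>insert x (\<Union>\<gamma>). u \<in> CL w D")
     case True
     then obtain u where u: "u \<in> insert x (\<Union>\<gamma>)" "u \<in> CL w D" by (elim bexE)
     have "(\<Sum>u\<in>{u}. of_bool (u \<in> CL w D)) <= (\<Sum>u\<in>insert x (\<Union>\<gamma>). of_bool (u \<in> CL w D) :: real)"
      using c(1) u(1) by (intro sum_mono2) auto
     then show ?thesis using u unfolding h_def by simp
    next
     case False
     then show ?thesis unfolding h_def by (simp add: sum_nonneg)
    qed
   qed
   also have "... = (\<Sum>u\<in>insert x (\<Union>\<gamma>). bprob (F - \<gamma>) p (%w. u \<in> CL w D))" by (rule bexp_sum)
   also have "... <= real (card (insert x (\<Union>\<gamma>))) * (g + (if card \<gamma> <= M then 0 else 1))"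
    by (rule sum_bounded_above) (rule each)
   also have "... <= (2 * real (card \<gamma>) + 1) * (g + (if card \<gamma> <= M then 0 else 1))"
   proof (rule mult_right_mono)
    have "real (card (insert x (\<Union>\<gamma>))) <= real (2 * card \<gamma> + 1)" using c(2) by (rule of_nat_mono)
    then show "real (card (insert x (\<Union>\<gamma>))) <= 2 * real (card \<gamma>) + 1" by simp
   qed (use g in auto)
   finally show ?thesis unfolding path_weight_def .
  qed
  show "\<exists>\<gamma>\<in>G. \<gamma> \<subseteq> w" if u: "w \<subseteq> F" and c: "y \<in> CL w {x} \<and> x \<in> CL w D" for w
  proof -
   from c have "y \<in> CL w {x}" ..
   then obtain n where "y \<in> lv w {x} n" by (rule CL_lvE)
   from short[OF u this] show ?thesis by auto
  qed
  show "of_bool (y \<in> CL w {x} \<and> x \<in> CL w D) <= h \<gamma> (w - \<gamma>)" for w \<gamma>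
   using CL_remove[of x w D \<gamma>] unfolding h_def by auto
  show "path_weight g M (card \<gamma>) <= \<kappa> w"
   if u: "w \<subseteq> F" and \<gamma>: "\<gamma> \<in> G" "\<gamma> \<subseteq> w" and min: "\<And>\<gamma>'. \<gamma>' \<in> G ==> \<gamma>' \<subseteq> w ==> card \<gamma> <= card \<gamma>'" for w \<gamma>
  proof -
   have "y \<in> CL w {x}" using \<gamma> CL_mono[OF \<gamma>(2) order_refl, of "{x}"] by (auto simp: G_def)
   then obtain n where n: "y \<in> lv w {x} n" by (rule CL_lvE)
   have fw: "finite w" using u F(1) by (rule finite_subset)
   have "n <= card w" using fw n by (rule lv_index_le)
   also have "... <= card F" using u F(1) by (intro card_mono)
   finally have nF: "n <= card F" .
   obtain \<gamma>' where "\<gamma>' \<in> G" "\<gamma>' \<subseteq> w" "card \<gamma>' <= n" using short[OF u n] by auto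
   then have "card \<gamma> <= n" using min[of \<gamma>'] by simp
   then have "path_weight g M (card \<gamma>) <= path_weight g M n * of_bool (y \<in> lv w {x} n)"
    using n path_weight_mono[OF g] by simp
   also have "... <= \<kappa> w" unfolding \<kappa>_def using nF g
    by (intro member_le_sum) (auto intro: path_weight_nonneg)
   finally show ?thesis .
  qed
  show "0 <= \<kappa> w" for w unfolding \<kappa>_def using g by (intro sum_nonneg) (auto intro: path_weight_nonneg)
 qed
 then show ?thesis unfolding \<kappa>_def by (simp only: bexp_sum bexp_cmult)
qed

text \<open>Given the first open path of at most \<open>n\<close> edges, each of its at most
  \<open>2 * n + 1\<close> vertices should fail to reach \<open>D\<close> off the path. These events
  are decreasing, so Harris multiplies their probabilities, and having found the path does not lower
  them.\<close>

lemma path_and_isolated_ge: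
 fixes p :: real and F :: "'v set set"
 assumes F: "finite F" "\<And>e. e \<in> F ==> card e = 2" and p: "0 <= p" "p <= 1" and g: "0 <= g" "g <= 1"
  and loc: "\<And>\<gamma> u m. \<gamma> \<subseteq> F ==> m <= n ==> u \<in> reach F {x} m ==> bprob (F - \<gamma>) p (%w. u \<in> CL w D) <= g"
 shows "(1 - g) ^ (2 * n + 1) * bprob F p (%w. \<exists>y\<in>U. \<exists>m\<le>n. y \<in> reach w {x} m)
  <= bprob F p (%w. (\<exists>y\<in>U. \<exists>m\<le>n. y \<in> reach w {x} m) \<and> x \<notin> CL w D)"
proof -
 define G where "G = {\<gamma>. \<gamma> \<subseteq> F \<and> (\<exists>y\<in>U. y \<in> CL \<gamma> {x}) \<and> \<Union>\<gamma> \<subseteq> CL \<gamma> {x} \<and> card \<gamma> <= n}"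
 define h where "h = (%\<gamma> w. of_bool (\<forall>u\<in>insert x (\<Union>\<gamma>). u \<notin> CL w D) :: real)"
 have eq: "(\<exists>y\<in>U. \<exists>m\<le>n. y \<in> reach w {x} m) \<longleftrightarrow> (\<exists>\<gamma>\<in>G. \<gamma> \<subseteq> w)" if u: "w \<subseteq> F" for w
 proof
  assume "\<exists>y\<in>U. \<exists>m\<le>n. y \<in> reach w {x} m"
  then obtain y m where y: "y \<in> U" "m <= n" "y \<in> reach w {x} m" by auto
  then obtain \<gamma> where "\<gamma> \<subseteq> w" "card \<gamma> <= m" "y \<in> CL \<gamma> {x}" "\<Union>\<gamma> \<subseteq> CL \<gamma> {x}"
   using connected_witness[of y w x m] F(2) u by auto
  then show "\<exists>\<gamma>\<in>G. \<gamma> \<subseteq> w" using u y by (intro bexI[of _ \<gamma>]) (auto simp: G_def)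
 next
  assume "\<exists>\<gamma>\<in>G. \<gamma> \<subseteq> w"
  then obtain \<gamma> y where \<gamma>: "\<gamma> \<subseteq> w" "\<gamma> \<subseteq> F" "y \<in> U" "y \<in> CL \<gamma> {x}" "card \<gamma> <= n" by (auto simp: G_def)
  obtain m where m: "y \<in> lv \<gamma> {x} m" using \<gamma>(4) by (rule CL_lvE)
  have "finite \<gamma>" using \<gamma>(2) F(1) by (rule finite_subset)
  then have "m <= n" using lv_index_le[of \<gamma> y "{x}" m] m \<gamma>(5) by auto
  moreover have "y \<in> reach w {x} m"
   using subsetD[OF lv_subset_reach m] reach_mono[OF \<gamma>(1) order_refl, of "{x}" m] by (rule subsetD[rotated])
  ultimately show "\<exists>y\<in>U. \<exists>m\<le>n. y \<in> reach w {x} m" using \<gamma>(3) by auto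
 qed
 have "(1 - g) ^ (2 * n + 1) * bprob F p (%w. \<exists>\<gamma>\<in>G. \<gamma> \<subseteq> w)
  <= bprob F p (%w. (\<exists>\<gamma>\<in>G. \<gamma> \<subseteq> w) \<and> x \<notin> CL w D)"
 proof (rule path_harris_ge[OF F(1) p, where g = h])
  show "\<gamma> \<subseteq> F" if "\<gamma> \<in> G" for \<gamma> using that by (simp add: G_def)
  show "0 <= (1 - g) ^ (2 * n + 1)" using g by simp
  have decr: "incr_on (F - \<gamma>) (%w. - of_bool (u \<notin> CL w D) :: real)" for \<gamma> u
  proof (rule incr_onI)
   fix A B :: "'v set set" assume "A \<subseteq> B"
   then have "CL A D \<subseteq> CL B D" by (rule CL_mono) simp
   then show "- of_bool (u \<notin> CL A D) <= (- of_bool (u \<notin> CL B D) :: real)" by auto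
  qed
  show "incr_on (F - \<gamma>) (%w. - h \<gamma> w)" if "\<gamma> \<in> G" for \<gamma>
  proof (rule incr_onI)
   fix A B :: "'v set set" assume "A \<subseteq> B"
   then have "CL A D \<subseteq> CL B D" by (rule CL_mono) simp
   then show "- h \<gamma> A <= - h \<gamma> B" unfolding h_def by auto
  qed
  show "(1 - g) ^ (2 * n + 1) <= bexp (F - \<gamma>) p (h \<gamma>)" if "\<gamma> \<in> G" for \<gamma>
  proof -
   have \<gamma>: "\<gamma> \<subseteq> F" "\<Union>\<gamma> \<subseteq> CL \<gamma> {x}" "finite \<gamma>" "card \<gamma> <= n" using that F(1) by (auto simp: G_def dest: finite_subset)
   have c: "finite (\<Union>\<gamma>)" "card (insert x (\<Union>\<gamma>)) <= 2 * card \<gamma> + 1"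
    using card_vertices_le(1)[of \<gamma>] card_vertices_le(2)[of \<gamma> x] \<gamma> F(2) by auto
   have "(1 - g) ^ (2 * n + 1) <= (1 - g) ^ card (insert x (\<Union>\<gamma>))"
    using c(2) \<gamma>(4) g by (intro power_decreasing) auto
   also have "... <= bexp (F - \<gamma>) p (h \<gamma>)"
    unfolding h_def
   proof (rule harris_all_decr[OF _ p])
    fix u assume u: "u \<in> insert x (\<Union>\<gamma>)"
    have "u \<in> CL \<gamma> {x}" using u \<gamma>(2) CL_self[of "{x}" \<gamma>] by auto
    then obtain m where m: "u \<in> lv \<gamma> {x} m" by (rule CL_lvE)
    then have "m <= card \<gamma>" by (rule lv_index_le[OF \<gamma>(3)])
    moreover have "u \<in> reach F {x} m"
     using subsetD[OF lv_subset_reach m] reach_mono[OF \<gamma>(1) order_refl, of "{x}" m] by (rule subsetD[rotated])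
    ultimately have "bprob (F - \<gamma>) p (%w. u \<in> CL w D) <= g" using loc[OF \<gamma>(1), of m u] \<gamma>(4) by simp
    then show "1 - g <= bprob (F - \<gamma>) p (%w. u \<notin> CL w D)" using F(1) by (simp add: bprob_not)
   qed (use F(1) c(1) g decr in auto)
   finally show ?thesis .
  qed
  show "h \<gamma> (w - \<gamma>) <= of_bool (x \<notin> CL w D)" for w \<gamma>
   using CL_remove[of x w D \<gamma>] unfolding h_def by auto
 qed
 moreover have "bprob F p (%w. \<exists>\<gamma>\<in>G. \<gamma> \<subseteq> w) = bprob F p (%w. \<exists>y\<in>U. \<exists>m\<le>n. y \<in> reach w {x} m)"
  by (rule bexp_cong) (simp add: eq)
 moreover have "bprob F p (%w. (\<exists>\<gamma>\<in>G. \<gamma> \<subseteq> w) \<and> x \<notin> CL w D) =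
   bprob F p (%w. (\<exists>y\<in>U. \<exists>m\<le>n. y \<in> reach w {x} m) \<and> x \<notin> CL w D)"
  by (rule bexp_cong) (simp add: eq)
 ultimately show ?thesis by simp
qed

section \<open>Binomial moments of the intrinsic distance\<close>

lemma sum_of_bool_le_1:
 assumes "finite I" "\<And>i j. i \<in> I ==> j \<in> I ==> P i ==> P j ==> i = j"
 shows "(\<Sum>i\<in>I. of_bool (P i)) <= (of_bool (\<exists>i\<in>I. P i) :: real)"
proof (cases "\<exists>i\<in>I. P i")
 case True
 then obtain i where i: "i \<in> I" "P i" by auto
 have "P j \<longleftrightarrow> j = i" if "j \<in> I" for j using assms(2)[OF that i(1)] i(2) by metis
 then have "(\<Sum>j\<in>I. of_bool (P j)) = (\<Sum>j\<in>I. if j = i then 1 else (0::real))"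
  by (intro sum.cong) auto
 then show ?thesis using assms(1) i True by simp
qed simp

text \<open>The mean of \<open>dist choose k\<close> on the event that \<open>x\<close> and
  \<open>y\<close> are connected by an open path, where \<open>dist\<close> is their intrinsic
  distance, truncated at \<open>N\<close>.\<close>

definition level_sum :: "'v set set => real => nat => nat => 'v => 'v => real" where
 "level_sum F p N k x y = (\<Sum>n\<le>N. real (n choose k) * bprob F p (%w. y \<in> lv w {x} n))"

lemma level_sum_nonneg: "0 <= p ==> p <= 1 ==> 0 <= level_sum F p N k x y"
 unfolding level_sum_def by (intro sum_nonneg mult_nonneg_nonneg bprob_nonneg) auto

lemma lv_unique: "y \<in> lv w A m ==> y \<in> lv w A n ==> m = n"
 using lv_disjoint[of m n w A] by auto

lemma level_sum_0:
 assumes "finite F" "0 <= p" "p <= 1"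
 shows "level_sum F p N 0 x y <= bprob F p (%w. y \<in> CL w {x})"
proof -
 have "level_sum F p N 0 x y = bexp F p (%w. \<Sum>n\<le>N. of_bool (y \<in> lv w {x} n))"
  unfolding level_sum_def by (simp only: bexp_sum) simp
 also have "... <= bprob F p (%w. y \<in> CL w {x})"
 proof (rule bexp_mono[OF assms(2,3)])
  fix w
  have "(\<Sum>n\<le>N. of_bool (y \<in> lv w {x} n)) <= (of_bool (\<exists>n\<in>{..N}. y \<in> lv w {x} n) :: real)"
   by (rule sum_of_bool_le_1, simp, erule (1) lv_unique)
  also have "... <= of_bool (y \<in> CL w {x})" by (auto simp: CL_lv)
  finally show "(\<Sum>n\<le>N. of_bool (y \<in> lv w {x} n)) <= (of_bool (y \<in> CL w {x}) :: real)" .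
 qed
 finally show ?thesis .
qed

text \<open>\<open>n choose Suc k\<close> counts sets of \<open>k + 1\<close> levels before
  \<open>y\<close>. Fix the last of these levels, \<open>j\<close>, and a vertex \<open>u\<close> on
  it from which \<open>y\<close> is reached; beyond level \<open>j\<close> only fresh edges are
  used, which gives the factor \<open>P(u \<leftrightarrow> y)\<close>. By iteration the binomial
  moments are dominated by powers of the two-point matrix.\<close>

lemma level_sum_Suc:
 fixes p :: real
 assumes F: "finite F" "finite X" "\<Union>F \<subseteq> X" "x \<in> X" and p: "0 <= p" "p <= 1"
 shows "level_sum F p N (Suc k) x y <= (\<Sum>u\<in>X. level_sum F p N k x u * bprob F p (%w. y \<in> CL w {u}))"
proof -
 let ?T = "%u. bprob F p (%w. y \<in> CL w {u})"
 have hockey: "real (n choose Suc k) = (\<Sum>j<n. real (j choose k))" for n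
  by (induction n) auto
 have step: "bprob F p (%w. \<exists>n\<in>{j<..N}. y \<in> lv w {x} n) <= (\<Sum>u\<in>X. bprob F p (%w. u \<in> lv w {x} j) * ?T u)" for j
 proof -
  have "bprob F p (%w. \<exists>n\<in>{j<..N}. y \<in> lv w {x} n)
   <= bexp F p (%w. \<Sum>u\<in>X. of_bool (u \<in> lv w {x} j) * of_bool (y \<in> CL (rs w {x} j) {u}))"
  proof (rule bexp_mono[OF p])
   fix w assume u: "w \<subseteq> F"
   show "of_bool (\<exists>n\<in>{j<..N}. y \<in> lv w {x} n) <= (\<Sum>u\<in>X. of_bool (u \<in> lv w {x} j) * of_bool (y \<in> CL (rs w {x} j) {u}) :: real)"
   proof (cases "\<exists>n\<in>{j<..N}. y \<in> lv w {x} n")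
    case True
    then obtain n where "n \<in> {j<..N}" "y \<in> lv w {x} n" by (elim bexE)
    then have n: "j <= n" "y \<in> lv w {x} n" by auto
    then obtain w' where w': "w' \<in> lv w {x} j" "y \<in> CL (rs w {x} j) {w'}" using lv_parent[OF n(2,1)] by auto
    have "w' \<in> {x} \<union> \<Union>w" using w'(1) lv_subset_CL[of w "{x}" j] CL_bound[of w "{x}"] by auto
    then have "w' \<in> X" using F u by auto
    then have "(\<Sum>u\<in>{w'}. of_bool (u \<in> lv w {x} j) * of_bool (y \<in> CL (rs w {x} j) {u}) :: real)
     <= (\<Sum>u\<in>X. of_bool (u \<in> lv w {x} j) * of_bool (y \<in> CL (rs w {x} j) {u}))"
     using F(2) by (intro sum_mono2) auto
    then show ?thesis using True w' by simp
   next
    case False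
    then show ?thesis by (simp add: sum_nonneg)
   qed
  qed
  also have "... <= bexp F p (%w. \<Sum>u\<in>X. of_bool (u \<in> lv w {x} j) * ?T u)"
  proof (rule bexp_level[where \<Psi> = "%B w. \<Sum>u\<in>X. of_bool (u \<in> B) * of_bool (y \<in> CL w {u})" and
     k = "%B. \<Sum>u\<in>X. of_bool (u \<in> B) * ?T u", OF F(1) p F(3)])
   show "{x} \<subseteq> X" using F(4) by simp
   fix F' B assume "F' \<subseteq> F"
   then have "bprob F' p (%w. y \<in> CL w {u}) <= ?T u" for u using F(1) p by (intro bexp_mono_F incr_CL)
   then show "bexp F' p (%w. \<Sum>u\<in>X. of_bool (u \<in> B) * of_bool (y \<in> CL w {u})) <= (\<Sum>u\<in>X. of_bool (u \<in> B) * ?T u)"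
    unfolding bexp_sum bexp_cmult by (intro sum_mono mult_left_mono) auto
  qed
  also have "... = (\<Sum>u\<in>X. bprob F p (%w. u \<in> lv w {x} j) * ?T u)" by (simp only: bexp_sum bexp_multc)
  finally show ?thesis .
 qed
 have "level_sum F p N (Suc k) x y = (\<Sum>n\<le>N. \<Sum>j<n. real (j choose k) * bprob F p (%w. y \<in> lv w {x} n))"
  unfolding level_sum_def hockey by (simp add: sum_distrib_right)
 also have "... = (\<Sum>(n, j)\<in>(SIGMA n:{..N}. {..<n}). real (j choose k) * bprob F p (%w. y \<in> lv w {x} n))"
  by (subst sum.Sigma) auto
 also have "... = (\<Sum>(j, n)\<in>(SIGMA j:{..N}. {j<..N}). real (j choose k) * bprob F p (%w. y \<in> lv w {x} n))"
  by (rule sum.reindex_bij_witness[where i = "%(a, b). (b, a)" and j = "%(a, b). (b, a)"]) auto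
 also have "... = (\<Sum>j\<le>N. \<Sum>n\<in>{j<..N}. real (j choose k) * bprob F p (%w. y \<in> lv w {x} n))"
  by (subst sum.Sigma) auto
 also have "... = (\<Sum>j\<le>N. real (j choose k) * bexp F p (%w. \<Sum>n\<in>{j<..N}. of_bool (y \<in> lv w {x} n)))"
  by (simp only: bexp_sum sum_distrib_left)
 also have "... <= (\<Sum>j\<le>N. real (j choose k) * (\<Sum>u\<in>X. bprob F p (%w. u \<in> lv w {x} j) * ?T u))"
 proof (intro sum_mono mult_left_mono)
  fix j
  have "bexp F p (%w. \<Sum>n\<in>{j<..N}. of_bool (y \<in> lv w {x} n)) <= bprob F p (%w. \<exists>n\<in>{j<..N}. y \<in> lv w {x} n)"
   by (rule bexp_mono[OF p], rule sum_of_bool_le_1, simp, erule (1) lv_unique)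
  also note step
  finally show "bexp F p (%w. \<Sum>n\<in>{j<..N}. of_bool (y \<in> lv w {x} n)) <= (\<Sum>u\<in>X. bprob F p (%w. u \<in> lv w {x} j) * ?T u)" .
 qed simp
 also have "... = (\<Sum>u\<in>X. level_sum F p N k x u * ?T u)"
  unfolding level_sum_def sum_distrib_left sum_distrib_right by (subst sum.swap) (simp add: mult_ac)
 finally show ?thesis .
qed

text \<open>Vertices of \<open>A\<close> are explored one after the other.\<close>

lemma all_die_ge:
 fixes p :: real
 assumes F: "finite F" "\<And>e. e \<in> F ==> finite e" and p: "0 <= p" "p <= 1" and A: "finite A" "A \<subseteq> V"
  and g: "g <= 1" "\<And>F' v. F' \<subseteq> F ==> v \<in> V ==> bprob F' p (%w. lv w {v} n \<noteq> {}) <= g"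
 shows "(1 - g) ^ card A <= bprob F p (%w. CL w A \<subseteq> (\<Union>m<n. reach w A m))"
 using A(1) F g(2) A(2)
proof (induction "card A" arbitrary: A F rule: less_induct)
 case less
 show ?case
 proof (cases "A = {}")
  case True
  then show ?thesis using less.prems by (simp add: bexp_const)
 next
  case False
  then obtain a where a: "a \<in> A" by auto
  define h where "h = (%w1 w2. of_bool (CL w1 {a} \<subseteq> (\<Union>m<n. reach w1 {a} m)) *
   of_bool (CL w2 (A - CL w1 {a}) \<subseteq> (\<Union>m<n. reach w2 (A - CL w1 {a}) m)) :: real)"
  have fin: "finite F" by fact
  have "bprob F p (%w. lv w {a} n = {}) = 1 - bprob F p (%w. lv w {a} n \<noteq> {})"
   using bprob_not[OF fin, of p "%w. lv w {a} n \<noteq> {}"] by simp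
  then have 1: "1 - g <= bprob F p (%w. lv w {a} n = {})" using less.prems(4)[of F a] less.prems(5) a by auto
  have "(1 - g) ^ card A = (1 - g) * (1 - g) ^ card (A - {a})"
   using a less.prems(1) by (metis card.remove power_Suc)
  also have "... <= bprob F p (%w. lv w {a} n = {}) * (1 - g) ^ card (A - {a})"
   using 1 g(1) by (intro mult_right_mono) auto
  also have "... = bexp F p (%w. of_bool (lv w {a} n = {}) * (1 - g) ^ card (A - {a}))"
   by (rule bexp_multc[symmetric])
  also have "... <= bexp F p (%w. bexp (nt F (CL w {a})) p (h (tch w (CL w {a}))))"
  proof (rule bexp_mono[OF p])
   fix w assume x: "w \<subseteq> F"
   let ?K = "CL w {a}" and ?t = "tch w (CL w {a})"
   have K: "CL ?t {a} = ?K" by (rule CL_tch)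
   have lt: "lv w {a} n = {} ==> ?K \<subseteq> (\<Union>m<n. reach ?t {a} m)"
   proof -
    assume *: "lv w {a} n = {}"
    have "lv ?t {a} n = {}"
    proof (rule ccontr)
     assume "lv ?t {a} n \<noteq> {}"
     then obtain y where y: "y \<in> lv ?t {a} n" by auto
     then have "y \<in> ?K" using subsetD[OF lv_subset_CL y] K by simp
     then obtain k where k: "y \<in> lv w {a} k" by (rule CL_lvE)
     have kn: "k < n" using * lv_empty_mono[of w "{a}" n k] k by (cases "k < n") auto
     have lev: "z \<in> reach ?t {a} j" if "z \<in> reach w {a} j" for z j
      using that
     proof (induction j arbitrary: z)
      case (Suc j)
      then obtain u where u: "u \<in> reach w {a} j" "{u, z} \<in> w" by (auto simp: reach_Suc)
      then have "u \<in> ?K" by (auto simp: CL_reach)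
      then have "{u, z} \<in> ?t" using u by (simp add: tch_def)
      then show ?case using Suc.IH[OF u(1)] by (auto simp: reach_Suc)
     qed simp
     have "y \<in> reach ?t {a} k" using subsetD[OF lv_subset_reach k] by (rule lev)
     then show False using y kn by (auto simp: lv_def)
    qed
    then show ?thesis using CL_lv_bounded[of ?t "{a}" n] K by simp
   qed
   \<comment> \<open>Vertices of \<open>A\<close> absorbed by the cluster of \<open>a\<close> need
     no exploration of their own, so at most as many factors \<open>1 - g\<close> remain as
     \<open>A - {a}\<close> would ask for.\<close>
   have le: "card (A - ?K) <= card (A - {a})"
    using less.prems(1) CL_self[of "{a}" w] by (intro card_mono) auto
   have "(1 - g) ^ card (A - {a}) <= (1 - g) ^ card (A - ?K)"
    using g(1) le less.prems(4)[of F a] bprob_nonneg[OF p, of F "%w. lv w {a} n \<noteq> {}"] a less.prems(5)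
    by (intro power_decreasing) auto
   also have "... <= bprob (nt F ?K) p (%w. CL w (A - ?K) \<subseteq> (\<Union>m<n. reach w (A - ?K) m))"
   proof (rule less.hyps)
    have "card (A - ?K) <= card (A - {a})" by (rule le)
    also have "... < card A" using a less.prems(1) by (intro psubset_card_mono) auto
    finally show "card (A - ?K) < card A" .
    show "bprob F' p (%w. lv w {v} n \<noteq> {}) <= g" if "F' \<subseteq> nt F ?K" "v \<in> V" for F' v
     by (rule less.prems(4)[OF order_trans[OF that(1) nt_subset] that(2)])
    show "finite e" if "e \<in> nt F ?K" for e using that less.prems(3) by (simp add: nt_def)
   qed (use less.prems in \<open>auto simp: finite_nt\<close>)
   finally have *: "(1 - g) ^ card (A - {a}) <= bprob (nt F ?K) p (%w. CL w (A - ?K) \<subseteq> (\<Union>m<n. reach w (A - ?K) m))" .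
   show "of_bool (lv w {a} n = {}) * (1 - g) ^ card (A - {a}) <= bexp (nt F ?K) p (h ?t)"
   proof (cases "lv w {a} n = {}")
    case True
    then show ?thesis unfolding h_def K bexp_cmult using * lt[OF True] by simp
   next
    case False
    then show ?thesis unfolding h_def K using p by (simp add: bexp_nonneg)
   qed
  qed
  also have "... = bexp F p (%w. h (tch w (CL w {a})) (nt w (CL w {a})))"
   by (rule bexp_explore[OF fin, symmetric])
  also have "... <= bprob F p (%w. CL w A \<subseteq> (\<Union>m<n. reach w A m))"
  proof (rule bexp_mono[OF p])
   fix w
   let ?K = "CL w {a}"
   have K: "CL (tch w ?K) {a} = ?K" by (rule CL_tch)
   show "h (tch w ?K) (nt w ?K) <= of_bool (CL w A \<subseteq> (\<Union>m<n. reach w A m))"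
   proof (cases "?K \<subseteq> (\<Union>m<n. reach (tch w ?K) {a} m) \<and> CL (nt w ?K) (A - ?K) \<subseteq> (\<Union>m<n. reach (nt w ?K) (A - ?K) m)")
    case True
    have r1: "reach (tch w ?K) {a} m \<subseteq> reach w A m" for m using a by (intro reach_mono tch_subset) auto
    have r2: "reach (nt w ?K) (A - ?K) m \<subseteq> reach w A m" for m by (intro reach_mono nt_subset) auto
    have "A = {a} \<union> A" using a by auto
    then have "CL w A = ?K \<union> CL (nt w ?K) (A - ?K)" using CL_decomp[of w "{a}" A] by simp
    also have "... \<subseteq> (\<Union>m<n. reach w A m)" using True r1 r2 by blast
    finally show ?thesis unfolding h_def by simp
   qed (auto simp: h_def K)
  qed
  finally show ?thesis .
 qed
qed

section \<open>Consequences of the two-point bound\<close>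

text \<open>All that the estimates take from the graph. Symmetry is present only as uniformity in
  the vertices: the degree bound \<open>d\<close>, the comparison of mean cluster sizes up to
  \<open>\<kappa>\<close>, and the escape constant \<open>\<theta>\<close>. The operator norm
  appears as a form bound for nonnegative functions on finite sets, which keeps infinite sums out,
  and \<open>\<tau>\<close> dominates the two-point functions of all finite volumes for every
  density up to \<open>p1\<close>.\<close>

locale l2_percolation =
 fixes V :: "'v set" and E :: "'v set set" and d :: nat and \<tau> :: "'v => 'v => real"
  and C pc p1 \<kappa> \<theta> :: real
 assumes edge: "\<And>e. e \<in> E ==> e \<subseteq> V \<and> card e = 2"
  and deg_finite: "\<And>v. finite {e \<in> E. v \<in> e}" and deg: "\<And>v. card {e \<in> E. v \<in> e} <= d"
  and nonempty: "V \<noteq> {}"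
  and pc: "0 < pc" "pc < p1" "p1 < 1"
  and C: "1 <= C"
  and L2: "\<And>X f g. finite X ==> X \<subseteq> V ==> (\<And>x. 0 <= f x) ==> (\<And>x. 0 <= g x) ==>
   (\<Sum>x\<in>X. \<Sum>y\<in>X. f x * \<tau> x y * g y) <= C * L2_set f X * L2_set g X"
  and tau: "\<And>F p x y. finite F ==> F \<subseteq> E ==> 0 <= p ==> p <= p1 ==> x \<in> V ==> y \<in> V ==>
   bprob F p (%w. y \<in> CL w {x}) <= \<tau> x y"
  and chi_finite: "\<And>p. 0 <= p ==> p < pc ==>
   \<exists>X. \<forall>F v. finite F --> F \<subseteq> E --> v \<in> V --> bexp F p (%w. real (card (CL w {v}))) <= X"
  and comparable: "0 < \<kappa>" "\<And>p F u v. pc / 2 <= p ==> p <= p1 ==> finite F ==> F \<subseteq> E ==> u \<in> V ==> v \<in> V ==>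
   \<exists>F'. finite F' \<and> F' \<subseteq> E \<and> \<kappa> * bexp F p (%w. real (card (CL w {u}))) <= bexp F' p (%w. real (card (CL w {v})))"
  and theta: "0 < \<theta>" "\<And>p \<Lambda> v. pc < p ==> p <= p1 ==> finite \<Lambda> ==> \<Lambda> \<subseteq> V ==> v \<in> \<Lambda> ==>
   \<theta> * (p - pc) <= bprob (tch E \<Lambda>) p (%w. v \<in> CL w (V - \<Lambda>))"
begin

lemma p1_pos: "0 < p1"
 using pc by simp

lemma edge_fin: "F \<subseteq> E ==> e \<in> F ==> finite e" and edge_card: "F \<subseteq> E ==> e \<in> F ==> card e = 2"
 using edge[of e] card_ge_0_finite[of e] by auto

lemma edges_V: "F \<subseteq> E ==> \<Union>F \<subseteq> V"
 using edge by auto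

lemma finite_vertices: "finite F ==> F \<subseteq> E ==> finite (\<Union>F)"
 using edge_fin by auto

lemma CL_V: "w \<subseteq> E ==> A \<subseteq> V ==> CL w A \<subseteq> V"
 by (rule order_trans[OF CL_bound]) (simp add: edges_V)

lemma CL_finite: "finite F ==> F \<subseteq> E ==> w \<subseteq> F ==> finite A ==> finite (CL w A)"
 by (rule finite_CL) (auto intro: finite_subset edge_fin)

lemma tau_nonneg: "x \<in> V ==> y \<in> V ==> 0 <= \<tau> x y"
 using tau[of "{}" 0 x y] p1_pos by (auto intro: order_trans[rotated])

text \<open>The two-point matrix acting on functions on the finite set \<open>X\<close>. The value
  \<open>0\<close> off \<open>V\<close>, where nothing is known about the sign of
  \<open>\<tau>\<close>, keeps all iterates nonnegative.\<close>

definition app :: "'v set => ('v => real) => 'v => real" where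
 "app X h x = (if x \<in> V then \<Sum>y\<in>X. \<tau> x y * h y else 0)"

lemma app_nonneg:
 assumes "X \<subseteq> V" "\<And>y. 0 <= h y" shows "0 <= app X h x"
 unfolding app_def using assms tau_nonneg by (auto intro!: sum_nonneg mult_nonneg_nonneg)

text \<open>Testing the form against \<open>app X h\<close> itself turns the bilinear bound into a
  bound on the operator.\<close>

lemma app_L2:
 assumes "finite X" "X \<subseteq> V" "\<And>y. 0 <= h y"
 shows "L2_set (app X h) X <= C * L2_set h X"
proof -
 let ?f = "app X h"
 have f: "0 <= ?f x" for x using assms by (intro app_nonneg)
 have "(L2_set ?f X)\<^sup>2 = (\<Sum>x\<in>X. ?f x * ?f x)"
  unfolding L2_set_def by (simp add: sum_nonneg power2_eq_square)
 also have "... = (\<Sum>x\<in>X. \<Sum>y\<in>X. ?f x * \<tau> x y * h y)"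
  using assms(2) by (intro sum.cong) (auto simp: app_def sum_distrib_left mult_ac subset_iff)
 also have "... <= C * L2_set ?f X * L2_set h X" using assms f by (intro L2)
 finally have *: "L2_set ?f X * L2_set ?f X <= L2_set ?f X * (C * L2_set h X)"
  by (simp add: power2_eq_square mult_ac)
 show ?thesis
 proof (cases "L2_set ?f X = 0")
  case True
  then show ?thesis using C L2_set_nonneg[of h X] by simp
 next
  case False
  then have "0 < L2_set ?f X" using L2_set_nonneg[of ?f X] by linarith
  then show ?thesis using * by (simp add: mult_le_cancel_left_pos)
 qed
qed

lemma app_iter:
 assumes "finite X" "X \<subseteq> V" "\<And>y. 0 <= h y"
 shows "0 <= (app X ^^ k) h x" "L2_set ((app X ^^ k) h) X <= C ^ k * L2_set h X"
proof -
 have nn: "0 <= (app X ^^ k) h x" for k x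
  using assms by (induction k arbitrary: x) (auto intro!: app_nonneg)
 then show "0 <= (app X ^^ k) h x" .
 show "L2_set ((app X ^^ k) h) X <= C ^ k * L2_set h X"
 proof (induction k)
  case (Suc k)
  have "L2_set (app X ((app X ^^ k) h)) X <= C * L2_set ((app X ^^ k) h) X"
   using assms nn by (intro app_L2)
  also have "... <= C * (C ^ k * L2_set h X)" using Suc C by (intro mult_left_mono) auto
  finally show ?case by simp
 qed simp
qed

lemma level_sum_app:
 assumes F: "finite F" "F \<subseteq> E" and X: "finite X" "X \<subseteq> V" "\<Union>F \<subseteq> X" and p: "0 <= p" "p <= p1"
  and x: "x \<in> X" and h: "\<And>y. 0 <= h y"
 shows "(\<Sum>y\<in>X. level_sum F p N k x y * h y) <= (app X ^^ Suc k) h x"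
 using x h
proof (induction k arbitrary: h x)
 case 0
 have p': "p <= 1" using p pc by simp
 have "(\<Sum>y\<in>X. level_sum F p N 0 x y * h y) <= (\<Sum>y\<in>X. \<tau> x y * h y)"
 proof (intro sum_mono mult_right_mono 0)
  fix y assume "y \<in> X"
  then show "level_sum F p N 0 x y <= \<tau> x y"
   using level_sum_0[OF F(1) p(1) p', of N x y] tau[OF F p, of x y] X(2) 0(1) by (auto simp: subset_iff)
 qed
 then show ?case using 0 X by (auto simp: app_def)
next
 case (Suc k)
 have p': "p <= 1" using p pc by simp
 have "(\<Sum>y\<in>X. level_sum F p N (Suc k) x y * h y)
  <= (\<Sum>y\<in>X. (\<Sum>u\<in>X. level_sum F p N k x u * bprob F p (%w. y \<in> CL w {u})) * h y)"
  by (intro sum_mono mult_right_mono level_sum_Suc F X p p' Suc.prems)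
 also have "... = (\<Sum>u\<in>X. level_sum F p N k x u * (\<Sum>y\<in>X. bprob F p (%w. y \<in> CL w {u}) * h y))"
  unfolding sum_distrib_left sum_distrib_right by (subst sum.swap) (simp add: mult_ac)
 also have "... <= (\<Sum>u\<in>X. level_sum F p N k x u * app X h u)"
 proof (intro sum_mono mult_left_mono level_sum_nonneg p(1) p')
  fix u assume u: "u \<in> X"
  have "(\<Sum>y\<in>X. bprob F p (%w. y \<in> CL w {u}) * h y) <= (\<Sum>y\<in>X. \<tau> u y * h y)"
   using u X(2) by (intro sum_mono mult_right_mono Suc.prems tau[OF F p]) auto
  then show "(\<Sum>y\<in>X. bprob F p (%w. y \<in> CL w {u}) * h y) <= app X h u" using u X(2) by (auto simp: app_def)
 qed
 also have "... <= (app X ^^ Suc k) (app X h) x"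
  by (rule Suc.IH[OF Suc.prems(1)]) (rule app_nonneg[OF X(2) Suc.prems(2)])
 also have "... = (app X ^^ Suc (Suc k)) h x" by (simp add: funpow_swap1)
 finally show ?case .
qed

lemma level_sum_quad:
 assumes F: "finite F" "F \<subseteq> E" and X: "finite X" "X \<subseteq> V" "\<Union>F \<subseteq> X" and p: "0 <= p" "p <= p1" and h: "\<And>y. 0 <= h y"
 shows "(\<Sum>x\<in>X. \<Sum>y\<in>X. h x * h y * level_sum F p N k x y) <= C ^ Suc k * (\<Sum>x\<in>X. (h x)\<^sup>2)"
proof -
 let ?g = "(app X ^^ Suc k) h"
 have g: "0 <= ?g x" "L2_set ?g X <= C ^ Suc k * L2_set h X" for x
  using app_iter(1)[of X h "Suc k" x] app_iter(2)[of X h "Suc k"] X(1,2) h by auto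
 have "(\<Sum>x\<in>X. \<Sum>y\<in>X. h x * h y * level_sum F p N k x y) = (\<Sum>x\<in>X. h x * (\<Sum>y\<in>X. level_sum F p N k x y * h y))"
  by (simp add: sum_distrib_left mult_ac)
 also have "... <= (\<Sum>x\<in>X. h x * ?g x)"
  by (intro sum_mono mult_left_mono level_sum_app F X p h)
 also have "... <= (\<Sum>x\<in>X. \<bar>h x\<bar> * \<bar>?g x\<bar>)" using h g(1) by (intro sum_mono) simp
 also have "... <= L2_set h X * L2_set ?g X" by (rule L2_set_mult_ineq)
 also have "... <= L2_set h X * (C ^ Suc k * L2_set h X)" by (intro mult_left_mono g(2) L2_set_nonneg)
 also have "... = C ^ Suc k * (L2_set h X)\<^sup>2" by (simp add: power2_eq_square)
 also have "(L2_set h X)\<^sup>2 = (\<Sum>x\<in>X. (h x)\<^sup>2)" unfolding L2_set_def by (simp add: sum_nonneg)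
 finally show ?thesis .
qed

lemma L2_set_indicator: "finite X ==> U \<subseteq> X ==> L2_set (%x. of_bool (x \<in> U)) X = sqrt (card U)"
proof -
 assume a: "finite X" "U \<subseteq> X"
 have "(\<Sum>x\<in>X. (of_bool (x \<in> U))\<^sup>2) = (\<Sum>x\<in>X. of_bool (x \<in> U) :: real)" by (intro sum.cong) auto
 also have "... = card U" using a by (simp add: sum_of_bool_eq Int_absorb1)
 finally show ?thesis by (simp add: L2_set_def)
qed

text \<open>Since \<open>(1 + a)\<^sup>n = \<Sum>\<^sub>k (n choose k) a\<^sup>k\<close>, the bound on all \<open>level_sum\<close>s gives an
 exponential moment of the intrinsic distance.\<close>

lemma level_exp_decay:
 assumes F: "finite F" "F \<subseteq> E" and p: "0 <= p" "p <= p1" and v: "v \<in> V" and U: "finite U" "U \<subseteq> V"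
 shows "(1 + 1 / (2 * C)) ^ n * (\<Sum>u\<in>U. bprob F p (%w. u \<in> lv w {v} n)) <= 2 * C * sqrt (card U)"
proof -
 define X where "X = insert v (U \<union> \<Union>F)"
 have X: "finite X" "X \<subseteq> V" "\<Union>F \<subseteq> X" "v \<in> X" "U \<subseteq> X"
  using finite_vertices[OF F] edges_V[OF F(2)] v U by (auto simp: X_def)
 have p': "p <= 1" using p pc by simp
 \<comment> \<open>Chosen so that \<open>a * C = 1 / 2\<close>: the powers of \<open>C\<close> lost
   in the \<open>k\<close>-th moment are then summed by a geometric series.\<close>
 define a where "a = 1 / (2 * C)"
 have a: "0 <= a" "a * C = 1 / 2" using C by (auto simp: a_def)
 let ?h = "%x. of_bool (x \<in> U) :: real"
 have bin: "(1 + a) ^ n = (\<Sum>k\<le>n. real (n choose k) * a ^ k)"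
  using binomial_ring[of a 1 n] by (simp add: add.commute)
 have single: "real (n choose k) * bprob F p (%w. u \<in> lv w {v} n) <= level_sum F p n k v u" for k u
  unfolding level_sum_def by (rule member_le_sum) (auto intro!: mult_nonneg_nonneg bprob_nonneg p p')
 have "(1 + a) ^ n * (\<Sum>u\<in>U. bprob F p (%w. u \<in> lv w {v} n)) =
  (\<Sum>k\<le>n. a ^ k * (\<Sum>u\<in>U. real (n choose k) * bprob F p (%w. u \<in> lv w {v} n)))"
  unfolding bin sum_distrib_left sum_distrib_right by (subst sum.swap) (simp add: mult_ac)
 also have "... <= (\<Sum>k\<le>n. a ^ k * (C ^ Suc k * sqrt (card U)))"
 proof (intro sum_mono mult_left_mono)
  fix k
  have "(\<Sum>u\<in>U. real (n choose k) * bprob F p (%w. u \<in> lv w {v} n)) <= (\<Sum>u\<in>U. level_sum F p n k v u * ?h u)"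
   using single by (intro sum_mono) auto
  also have "... <= (\<Sum>u\<in>X. level_sum F p n k v u * ?h u)"
   using X p p' by (intro sum_mono2) (auto intro!: mult_nonneg_nonneg level_sum_nonneg)
  also have "... <= (app X ^^ Suc k) ?h v" by (rule level_sum_app[OF F X(1-3) p X(4)]) simp
  also have "... <= L2_set ((app X ^^ Suc k) ?h) X"
  proof -
   have "((app X ^^ Suc k) ?h v)\<^sup>2 <= (\<Sum>x\<in>X. ((app X ^^ Suc k) ?h x)\<^sup>2)"
    using X(1,4) by (intro member_le_sum) auto
   then show ?thesis unfolding L2_set_def by (rule real_le_rsqrt)
  qed
  also have "... <= C ^ Suc k * L2_set ?h X" by (rule app_iter(2)[OF X(1,2)]) simp
  also have "L2_set ?h X = sqrt (card U)" by (rule L2_set_indicator[OF X(1,5)])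
  finally show "(\<Sum>u\<in>U. real (n choose k) * bprob F p (%w. u \<in> lv w {v} n)) <= C ^ Suc k * sqrt (card U)" .
 qed (use a in auto)
 also have "... = (\<Sum>k\<le>n. (1 / 2) ^ k) * (C * sqrt (card U))"
  unfolding sum_distrib_right a(2)[symmetric] by (intro sum.cong) (auto simp: power_mult_distrib)
 also have "... <= 2 * (C * sqrt (card U))"
 proof (rule mult_right_mono)
  have "(\<Sum>k\<le>n. (1 / 2 :: real) ^ k) = 2 - (1 / 2) ^ n"
   by (induction n) (auto simp: field_simps)
  then show "(\<Sum>k\<le>n. (1 / 2 :: real) ^ k) <= 2" by simp
 qed (use C in auto)
 finally show ?thesis by (simp add: a_def mult_ac)
qed

definition nbd :: "'v set set => 'v set => 'v => 'v set" where
 "nbd F S z = {z'. z' \<notin> S \<and> {z, z'} \<in> F}"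

lemma bd_Sigma: "bd F S = (SIGMA z:S. nbd F S z)"
 by (auto simp: bd_def nbd_def)

lemma nbd_card:
 assumes "F \<subseteq> E" shows "finite (nbd F S z)" "card (nbd F S z) <= d"
proof -
 have inj: "inj_on (%z'. {z, z'}) (nbd F S z)"
 proof (rule inj_onI)
  fix x y assume "{z, x} = {z, y}"
  then show "x = y" by (auto simp: doubleton_eq_iff)
 qed
 have sub: "(%z'. {z, z'}) ` nbd F S z \<subseteq> {e \<in> E. z \<in> e}" using assms by (auto simp: nbd_def)
 show "finite (nbd F S z)" using inj sub deg_finite by (rule inj_on_finite)
 have "card (nbd F S z) <= card {e \<in> E. z \<in> e}" using inj sub deg_finite by (rule card_inj_on_le)
 then show "card (nbd F S z) <= d" using deg[of z] by simp
qed

lemma bd_card: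
 assumes "F \<subseteq> E" "finite S" shows "finite (bd F S)" "card (bd F S) <= d * card S"
proof -
 show "finite (bd F S)" unfolding bd_Sigma using assms nbd_card(1) by auto
 have "card (bd F S) = (\<Sum>z\<in>S. card (nbd F S z))" unfolding bd_Sigma using assms nbd_card(1) by (intro card_SigmaI) auto
 also have "... <= (\<Sum>z\<in>S. d)" using nbd_card(2)[OF assms(1)] by (intro sum_mono)
 finally show "card (bd F S) <= d * card S" by (simp add: mult.commute)
qed

text \<open>Test the form on the indicator of \<open>S1\<close> and on \<open>b\<close>, the sum of
  \<open>\<phi>\<close> over outer neighbours. Since \<open>b\<close> is at most
  \<open>d * \<Phi>\<close>, its squared norm is at most \<open>d * \<Phi>\<close> times its sum.
  The geometric mean that results will turn a lower bound on the left into a lower bound for the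
  boundary sum of \<open>\<phi>\<close>.\<close>

lemma boundary_L2:
 fixes \<phi> :: "'v => real" and \<Phi> :: real
 assumes F: "finite F" "F \<subseteq> E" and p: "0 <= p" "p <= p1" and S: "finite S" "S \<subseteq> V" "S1 \<subseteq> S"
  and \<phi>: "\<And>z z'. (z, z') \<in> bd F S ==> 0 <= \<phi> z' \<and> \<phi> z' <= \<Phi>" "0 <= \<Phi>"
 shows "(\<Sum>x\<in>S1. \<Sum>(z, z')\<in>bd F S. bprob F p (%w. z \<in> CL w {x}) * \<phi> z')
  <= C * sqrt (card S1) * sqrt (d * \<Phi> * (\<Sum>(z, z')\<in>bd F S. \<phi> z'))"
proof -
 define b where "b = (%z. if z \<in> S then \<Sum>z'\<in>nbd F S z. \<phi> z' else 0)"
 have nn: "0 <= \<phi> z'" "\<phi> z' <= \<Phi>" if "z \<in> S" "z' \<in> nbd F S z" for z z'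
  using that \<phi>(1)[of z z'] by (auto simp: bd_Sigma)
 have b0: "0 <= b z" for z unfolding b_def using nn by (auto intro!: sum_nonneg)
 have bd: "b z <= d * \<Phi>" for z
 proof (cases "z \<in> S")
  case True
  have "(\<Sum>z'\<in>nbd F S z. \<phi> z') <= real (card (nbd F S z)) * \<Phi>" using nn[OF True] by (intro sum_bounded_above)
  also have "... <= d * \<Phi>" using nbd_card(2)[OF F(2)] \<phi>(2) by (intro mult_right_mono) auto
  finally show ?thesis using True by (simp add: b_def)
 next
  case False
  then show ?thesis using \<phi>(2) by (simp add: b_def)
 qed
 have bsum: "(\<Sum>z\<in>S. b z) = (\<Sum>(z, z')\<in>bd F S. \<phi> z')"
  unfolding bd_Sigma using S(1) nbd_card(1)[OF F(2)] by (subst sum.Sigma[symmetric]) (auto simp: b_def)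
 have "(\<Sum>x\<in>S1. \<Sum>(z, z')\<in>bd F S. bprob F p (%w. z \<in> CL w {x}) * \<phi> z')
  = (\<Sum>x\<in>S1. \<Sum>z\<in>S. \<Sum>z'\<in>nbd F S z. bprob F p (%w. z \<in> CL w {x}) * \<phi> z')"
  unfolding bd_Sigma using S(1) nbd_card(1)[OF F(2)] by (subst sum.Sigma) auto
 also have "... = (\<Sum>x\<in>S1. \<Sum>z\<in>S. bprob F p (%w. z \<in> CL w {x}) * b z)"
  by (simp add: b_def sum_distrib_left)
 also have "... <= (\<Sum>x\<in>S1. \<Sum>z\<in>S. \<tau> x z * b z)"
  using S by (intro sum_mono mult_right_mono tau F p b0) auto
 also have "... = (\<Sum>x\<in>S. \<Sum>z\<in>S. of_bool (x \<in> S1) * \<tau> x z * b z)"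
 proof -
  have "(\<Sum>x\<in>S. \<Sum>z\<in>S. of_bool (x \<in> S1) * \<tau> x z * b z) = (\<Sum>x\<in>S. of_bool (x \<in> S1) * (\<Sum>z\<in>S. \<tau> x z * b z))"
   by (simp only: sum_distrib_left mult.assoc)
  also have "... = (\<Sum>x\<in>S \<inter> S1. \<Sum>z\<in>S. \<tau> x z * b z)"
   unfolding sum.inter_restrict[OF S(1)] by (intro sum.cong) auto
  also have "S \<inter> S1 = S1" using S(3) by auto
  finally show ?thesis by simp
 qed
 also have "... <= C * L2_set (%x. of_bool (x \<in> S1)) S * L2_set b S"
  using S b0 by (intro L2) auto
 also have "L2_set (%x. of_bool (x \<in> S1)) S = sqrt (card S1)" by (rule L2_set_indicator[OF S(1,3)])
 also have "C * sqrt (card S1) * L2_set b S <= C * sqrt (card S1) * sqrt (d * \<Phi> * (\<Sum>(z, z')\<in>bd F S. \<phi> z'))"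
 proof (rule mult_left_mono)
  have "(\<Sum>z\<in>S. (b z)\<^sup>2) <= (\<Sum>z\<in>S. d * \<Phi> * b z)"
   unfolding power2_eq_square using bd b0 by (intro sum_mono mult_right_mono)
  also have "... = d * \<Phi> * (\<Sum>(z, z')\<in>bd F S. \<phi> z')" by (simp add: sum_distrib_left[symmetric] bsum)
  finally show "L2_set b S <= sqrt (d * \<Phi> * (\<Sum>(z, z')\<in>bd F S. \<phi> z'))" unfolding L2_set_def by (rule real_sqrt_le_mono)
 qed (use C in auto)
 finally show ?thesis .
qed

end

section \<open>Mean cluster size below criticality\<close>

text \<open>Opening a boundary edge \<open>{z, z'}\<close> attaches to the cluster the whole cluster
  of \<open>z'\<close> off it, and different boundary pairs are different edges. So the boundary sum
  is at most the integrand in Russo's formula.\<close>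

lemma card_CL_pivotal:
 assumes F: "finite F" "\<And>e. e \<in> F ==> card e = 2" and w: "w \<subseteq> F"
 shows "(\<Sum>(z, z')\<in>bd F (CL w {v}). real (card (CL (nt w (CL w {v})) {z'})))
  <= (\<Sum>e\<in>F. real (card (CL (insert e w) {v})) - real (card (CL (w - {e}) {v})))"
proof -
 let ?K = "CL w {v}" and ?g = "%e. real (card (CL (insert e w) {v})) - real (card (CL (w - {e}) {v}))"
 have fe: "finite e" if "e \<in> F" for e using F(2)[OF that] card_ge_0_finite[of e] by simp
 have fin: "finite (CL w' {x})" if "w' \<subseteq> F" for w' x
  using that F(1) fe by (intro finite_CL) (auto dest: finite_subset)
 have inj: "inj_on (%(z, z'). {z, z'}) (bd F ?K)"
 proof (rule inj_onI)
  fix a b assume "a \<in> bd F ?K" "b \<in> bd F ?K" and eq: "(case a of (z, z') => {z, z'}) = (case b of (z, z') => {z, z'})"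
  then have "fst a \<in> ?K" "snd a \<notin> ?K" "fst b \<in> ?K" "snd b \<notin> ?K" by (auto simp: bd_def)
  moreover have "{fst a, snd a} = {fst b, snd b}" using eq by (simp add: case_prod_beta)
  ultimately have "fst a = fst b \<and> snd a = snd b" by (metis doubleton_eq_iff)
  then show "a = b" by (simp add: prod_eq_iff)
 qed
 have "(\<Sum>(z, z')\<in>bd F ?K. real (card (CL (nt w ?K) {z'}))) <= (\<Sum>(z, z')\<in>bd F ?K. ?g {z, z'})"
 proof (intro sum_mono, clarify)
  fix z z' assume "(z, z') \<in> bd F ?K"
  then have z: "z \<in> ?K" "z' \<notin> ?K" "{z, z'} \<in> F" by (auto simp: bd_def)
  have "{z, z'} \<notin> w" using CL_closed[OF z(1)] z(2) by auto
  then have [simp]: "w - {{z, z'}} = w" by auto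
  let ?u = "insert {z, z'} w" and ?L = "CL (nt w ?K) {z'}"
  have sub: "?K \<subseteq> CL ?u {v}" by (rule CL_mono) auto
  then have "z' \<in> CL ?u {v}" using CL_closed[of z ?u "{v}" z'] z(1) by auto
  then have "CL ?u {z'} \<subseteq> CL ?u {v}" by (intro CL_trans) auto
  moreover have "?L \<subseteq> CL ?u {z'}" by (rule CL_mono) (auto simp: nt_def)
  ultimately have "?K \<union> ?L \<subseteq> CL ?u {v}" using sub by auto
  moreover have "?K \<inter> ?L = {}" using CL_nt_avoid[of "{z'}" ?K w] z(2) by auto
  moreover have "finite (CL ?u {v})" "finite ?K" "finite ?L"
   using z(3) w by (auto intro!: fin simp: nt_def)
  ultimately have "card ?K + card ?L <= card (CL ?u {v})"
   by (metis card_Un_disjoint card_mono)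
  then show "real (card ?L) <= ?g {z, z'}" by simp
 qed
 also have "... = (\<Sum>e\<in>(%(z, z'). {z, z'}) ` bd F ?K. ?g e)"
  using inj by (subst sum.reindex) (auto simp: case_prod_beta)
 also have "... <= (\<Sum>e\<in>F. ?g e)"
 proof (rule sum_mono2[OF F(1)])
  show "(%(z, z'). {z, z'}) ` bd F ?K \<subseteq> F" by (auto simp: bd_def)
  fix e assume "e \<in> F - (%(z, z'). {z, z'}) ` bd F ?K"
  then have "finite (CL (insert e w) {v})" using w by (intro fin) auto
  moreover have "CL (w - {e}) {v} \<subseteq> CL (insert e w) {v}" by (rule CL_mono) auto
  ultimately show "0 <= ?g e" by (simp add: card_mono)
 qed
 finally show ?thesis .
qed

text \<open>Divide by \<open>sqrt s\<close>; as \<open>4 * C <= q\<close>, the first term on the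
  right is at most half of the left side and is absorbed there.\<close>

lemma boundary_arith:
 fixes s M :: real
 assumes "0 <= s" "0 <= M" "1 <= C" "4 * C <= q" "0 <= D"
  and "q * s <= C * sqrt s * sqrt (2 * s) + C * sqrt s * sqrt (D * M)"
 shows "q\<^sup>2 * s <= 4 * C\<^sup>2 * D * M"
proof (cases "s = 0")
 case True
 then show ?thesis using assms by simp
next
 case False
 then have s: "0 < sqrt s" "sqrt s * sqrt s = s" using assms(1) by auto
 have "sqrt (2 * s) = sqrt 2 * sqrt s" by (simp add: real_sqrt_mult)
 moreover have "sqrt 2 <= 2" by (rule real_le_lsqrt) auto
 ultimately have "sqrt (2 * s) <= 2 * sqrt s" using s(1) by simp
 then have "C * sqrt s * sqrt (2 * s) <= C * sqrt s * (2 * sqrt s)"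
  using assms s by (intro mult_left_mono) auto
 then have "sqrt s * (q * sqrt s) <= sqrt s * (2 * C * sqrt s + C * sqrt (D * M))"
  using assms(6) s(2) by (simp add: algebra_simps)
 then have "q * sqrt s <= 2 * C * sqrt s + C * sqrt (D * M)" using s(1) by (simp only: mult_le_cancel_left_pos)
 moreover have "4 * C * sqrt s <= q * sqrt s" using assms s by (intro mult_right_mono) auto
 ultimately have "q * sqrt s <= 2 * (C * sqrt (D * M))" by simp
 then have "(q * sqrt s)\<^sup>2 <= (2 * (C * sqrt (D * M)))\<^sup>2" using assms s by (intro power_mono) auto
 then show ?thesis using assms by (simp add: power_mult_distrib)
qed

context l2_percolation
begin

definition XF :: "'v set set => real => 'v => real" where
 "XF F p v = bexp F p (%w. real (card (CL w {v})))"

text \<open>The mean cluster size as a supremum over finite volumes and over starting vertices,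
  since different vertices need not look alike.\<close>

definition chi :: "real => real" where
 "chi p = Sup {XF F p v |F v. finite F \<and> F \<subseteq> E \<and> v \<in> V}"

lemma incr_card: "finite F ==> F \<subseteq> E ==> finite D ==> incr_on F (%w. real (card (CL w D \<inter> B)))"
 by (rule incr_card_CL) (auto intro: edge_fin)

lemma incr_card': "finite F ==> F \<subseteq> E ==> finite D ==> incr_on F (%w. real (card (CL w D)))"
 using incr_card[of F D UNIV] by simp

lemma XF_le_chi: "0 <= p ==> p < pc ==> finite F ==> F \<subseteq> E ==> v \<in> V ==> XF F p v <= chi p"
proof -
 assume a: "0 <= p" "p < pc" and F: "finite F" "F \<subseteq> E" "v \<in> V"
 obtain X where "\<forall>F v. finite F --> F \<subseteq> E --> v \<in> V --> XF F p v <= X"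
  using chi_finite[OF a] unfolding XF_def by auto
 then have "bdd_above {XF F p v |F v. finite F \<and> F \<subseteq> E \<and> v \<in> V}" by (intro bdd_aboveI[of _ X]) auto
 then show ?thesis unfolding chi_def using F by (intro cSup_upper) auto
qed

lemma chi_attained:
 assumes "0 <= p" "p < pc" "y < chi p"
 obtains F v where "finite F" "F \<subseteq> E" "v \<in> V" "y < XF F p v"
proof -
 obtain v where "v \<in> V" using nonempty by auto
 then have "XF {} p v \<in> {XF F p v |F v. finite F \<and> F \<subseteq> E \<and> v \<in> V}" by auto
 then have "{XF F p v |F v. finite F \<and> F \<subseteq> E \<and> v \<in> V} \<noteq> {}" by (metis empty_iff)
 then show ?thesis using less_cSupD[OF _ assms(3)[unfolded chi_def]] that by auto
qed

lemma XF_ge_1: "0 <= p ==> p <= 1 ==> finite F ==> F \<subseteq> E ==> 1 <= XF F p v"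
proof -
 assume p: "0 <= p" "p <= 1" and F: "finite F" "F \<subseteq> E"
 have "bexp F p (%w. 1) <= XF F p v"
  unfolding XF_def
 proof (rule bexp_mono[OF p])
  fix w assume "w \<subseteq> F"
  then have "finite (CL w {v})" using F by (intro CL_finite) auto
  moreover have "{v} \<subseteq> CL w {v}" by (rule CL_self)
  ultimately have "card {v} <= card (CL w {v})" by (rule card_mono)
  then show "1 <= real (card (CL w {v}))" by simp
 qed
 then show ?thesis using F by (simp add: bexp_const)
qed

lemma chi_ge_1: "0 <= p ==> p < pc ==> 1 <= chi p"
 using nonempty XF_ge_1[of p "{}"] XF_le_chi[of p "{}"] pc by (metis all_not_in_conv empty_subsetI finite.emptyI less_le_trans not_less order_trans less_imp_le)

lemma XF_mono:
 assumes "0 <= p" "p <= q" "q <= 1" "F \<subseteq> G" "finite G" "G \<subseteq> E"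
 shows "XF F p v <= XF G q v"
proof -
 have "XF F p v <= XF F q v" unfolding XF_def
  using assms by (intro bexp_mono_p incr_card') (auto dest: finite_subset)
 also have "... <= XF G q v" unfolding XF_def
  using assms by (intro bexp_mono_F incr_card') auto
 finally show ?thesis .
qed

text \<open>A cluster boundary is seen efficiently: every \<open>x\<close> in
  \<open>K \<inter> B\<close> has mean cluster size at least \<open>q\<close>, but by the
  \<open>L2\<close> bound the part inside \<open>K\<close> averages to at most a constant multiple
  of \<open>C\<close>. So at least half of the mass lies outside \<open>K\<close> and is reached
  through its boundary, where \<open>boundary_L2\<close> applies. \<open>B\<close> is the region on
  which the finite volume \<open>F\<close> already shows large clusters.\<close>

lemma boundary_lower_chi:
 fixes q X \<xi> :: real
 assumes F: "finite F" "F \<subseteq> E" and p: "0 <= \<xi>" "\<xi> <= p1" and K: "finite K" "K \<subseteq> V"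
  and X: "\<And>F v. finite F ==> F \<subseteq> E ==> v \<in> V ==> XF F \<xi> v <= X" "0 <= X"
  and q: "4 * C <= q" "\<And>x. x \<in> K \<inter> B ==> q <= XF F \<xi> x" and half: "card (K - B) <= card (K \<inter> B)"
 shows "q\<^sup>2 * card (K \<inter> B) <= 4 * C\<^sup>2 * (d * X) * (\<Sum>(z, z')\<in>bd F K. XF (nt F K) \<xi> z')"
proof (rule boundary_arith[where q = q])
 let ?S = "K \<inter> B" and ?M = "\<Sum>(z, z')\<in>bd F K. XF (nt F K) \<xi> z'"
 have p': "\<xi> <= 1" using p pc by simp
 have nt: "finite (nt F K)" "nt F K \<subseteq> E" using F nt_subset[of F K] by (auto simp: finite_nt)
 have z': "z' \<in> V" if "(z, z') \<in> bd F K" for z z' using that edges_V[OF F(2)] by (auto simp: bd_def)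
 have b: "0 <= XF (nt F K) \<xi> z' \<and> XF (nt F K) \<xi> z' <= X" if "(z, z') \<in> bd F K" for z z'
  using X(1)[OF nt z'[OF that]] XF_ge_1[OF p(1) p' nt, of z'] by simp
 show "0 <= ?M" using b by (intro sum_nonneg) auto
 have "q * card ?S <= (\<Sum>x\<in>?S. XF F \<xi> x)"
  using q(2) sum_bounded_below[of ?S q "XF F \<xi>"] by (simp add: mult.commute)
 also have "... = (\<Sum>x\<in>?S. \<Sum>y\<in>K. bprob F \<xi> (%w. y \<in> CL w {x})) + (\<Sum>x\<in>?S. bexp F \<xi> (%w. real (card (CL w {x} - K))))"
  unfolding sum.distrib[symmetric]
 proof (rule sum.cong[OF refl])
  fix x assume x: "x \<in> ?S"
  have "XF F \<xi> x = bexp F \<xi> (%w. real (card (CL w {x} \<inter> K)) + real (card (CL w {x} - K)))"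
   unfolding XF_def
  proof (rule bexp_cong)
   fix w assume "w \<subseteq> F"
   then have "finite (CL w {x})" using F by (intro CL_finite) auto
   then have "card (CL w {x}) = card (CL w {x} \<inter> K) + card (CL w {x} - K)"
    by (subst card_Un_disjoint[symmetric]) (auto intro: arg_cong[where f = card])
   then show "real (card (CL w {x})) = real (card (CL w {x} \<inter> K)) + real (card (CL w {x} - K))" by simp
  qed
  also have "... = bexp F \<xi> (%w. real (card (CL w {x} \<inter> K))) + bexp F \<xi> (%w. real (card (CL w {x} - K)))"
   by (rule bexp_add)
  also have "bexp F \<xi> (%w. real (card (CL w {x} \<inter> K))) = (\<Sum>y\<in>(K \<union> \<Union>F) \<inter> K. bprob F \<xi> (%w. y \<in> CL w {x}))"
   using F x K finite_vertices[OF F] edge_fin[OF F(2)] by (intro bexp_card_CL) auto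
  also have "(K \<union> \<Union>F) \<inter> K = K" by auto
  finally show "XF F \<xi> x = (\<Sum>y\<in>K. bprob F \<xi> (%w. y \<in> CL w {x})) + bexp F \<xi> (%w. real (card (CL w {x} - K)))" .
 qed
 also have "(\<Sum>x\<in>?S. \<Sum>y\<in>K. bprob F \<xi> (%w. y \<in> CL w {x})) <= C * sqrt (card ?S) * sqrt (2 * card ?S)"
 proof -
  have "(\<Sum>x\<in>?S. \<Sum>y\<in>K. bprob F \<xi> (%w. y \<in> CL w {x})) <= (\<Sum>x\<in>?S. \<Sum>y\<in>K. \<tau> x y)"
   using K by (intro sum_mono tau F p) auto
  also have "... = (\<Sum>x\<in>K. of_bool (x \<in> B) * (\<Sum>y\<in>K. \<tau> x y))"
   unfolding sum.inter_restrict[OF K(1)] by (intro sum.cong) auto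
  also have "... = (\<Sum>x\<in>K. \<Sum>y\<in>K. of_bool (x \<in> ?S) * \<tau> x y * of_bool (y \<in> K))"
   unfolding sum_distrib_left by (intro sum.cong) auto
  also have "... <= C * L2_set (%x. of_bool (x \<in> ?S)) K * L2_set (%y. of_bool (y \<in> K)) K"
   using K by (intro L2) auto
  also have "... = C * sqrt (card ?S) * sqrt (card K)"
   by (simp only: L2_set_indicator[OF K(1) Int_lower1] L2_set_indicator[OF K(1) order_refl])
  also have "... <= C * sqrt (card ?S) * sqrt (2 * card ?S)"
  proof -
   have "card K = card ?S + card (K - B)"
    using K(1) by (subst card_Un_disjoint[symmetric]) (auto intro: arg_cong[where f = card])
   then have "real (card K) <= 2 * card ?S" using half by simp
   then show ?thesis using C by (intro mult_left_mono) auto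
  qed
  finally show ?thesis .
 qed
 also have "(\<Sum>x\<in>?S. bexp F \<xi> (%w. real (card (CL w {x} - K))))
  <= (\<Sum>x\<in>?S. \<Sum>(z, z')\<in>bd F K. bprob F \<xi> (%w. z \<in> CL w {x}) * XF (nt F K) \<xi> z')"
  unfolding XF_def using edge_fin[OF F(2)]
  by (intro sum_mono boundary_decomposition_card F(1) p(1) p') auto
 also have "... <= C * sqrt (card ?S) * sqrt (d * X * ?M)"
  by (intro boundary_L2 F p K b X(2)) auto
 finally show "q * real (card ?S) <= C * sqrt (card ?S) * sqrt (2 * real (card ?S)) + C * sqrt (card ?S) * sqrt (d * X * ?M)"
  by simp
qed (use C q X in auto)

text \<open>Russo's formula with \<open>card_CL_pivotal\<close>; since the edges off the explored
  cluster are fresh, the cluster sizes of the outer endpoints may be replaced by their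
  means.\<close>

lemma XF_deriv:
 assumes F: "finite F" "F \<subseteq> E"
 shows "\<exists>D. ((%p. XF F p v) has_real_derivative D) (at p) \<and>
  (0 <= p --> p <= 1 --> bexp F p (%w. \<Sum>(z, z')\<in>bd F (CL w {v}). XF (nt F (CL w {v})) p z') <= D)"
proof -
 let ?g = "%w. real (card (CL w {v}))"
 let ?D = "\<Sum>e\<in>F. bexp F p (%w. ?g (insert e w) - ?g (w - {e}))"
 have 1: "((%p. XF F p v) has_real_derivative ?D) (at p)" unfolding XF_def by (rule russo[OF F(1)])
 have 2: "bexp F p (%w. \<Sum>(z, z')\<in>bd F (CL w {v}). XF (nt F (CL w {v})) p z') <= ?D" if p: "0 <= p" "p <= 1"
 proof -
  define h where "h = (%w1 w2. \<Sum>(z, z')\<in>bd F (CL w1 {v}). real (card (CL w2 {z'})))"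
  have "bexp F p (%w. \<Sum>(z, z')\<in>bd F (CL w {v}). XF (nt F (CL w {v})) p z')
   = bexp F p (%w. bexp (nt F (CL w {v})) p (h (tch w (CL w {v}))))"
   unfolding h_def CL_tch XF_def by (simp add: bexp_sum case_prod_beta)
  also have "... = bexp F p (%w. h (tch w (CL w {v})) (nt w (CL w {v})))"
   by (rule bexp_explore[OF F(1), symmetric])
  also have "... <= bexp F p (%w. \<Sum>e\<in>F. ?g (insert e w) - ?g (w - {e}))"
   unfolding h_def CL_tch by (rule bexp_mono[OF p], rule card_CL_pivotal[OF F(1) edge_card[OF F(2)]])
  also have "... = ?D" by (simp only: bexp_sum)
  finally show ?thesis .
 qed
 with 1 show ?thesis by (intro exI[of _ ?D]) simp
qed

text \<open>The integrated form of a differential inequality \<open>chi' >= const * chi ^ 2\<close>.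
  A supremum over volumes has no derivative at hand, so one finite volume is fixed for the whole
  interval from \<open>p\<close> to \<open>q\<close>, and the mean value theorem is applied to its
  mean cluster size.\<close>

lemma chi_step:
 assumes p: "pc / 2 <= p" "p < q" "q < pc" and big: "8 * C <= \<kappa> * chi p"
 shows "(q - p) * \<kappa> ^ 3 * chi p ^ 3 <= 64 * C\<^sup>2 * d * (chi q)\<^sup>2"
proof -
 define k where "k = \<kappa> / 2 * chi p"
 have pp: "0 <= p" "p < pc" "0 <= q" "q <= 1" "p <= p1" "q <= p1" using p pc by auto
 have chi1: "1 <= chi p" "1 <= chi q" using pp p by (auto intro: chi_ge_1)
 have k: "0 < k" "4 * C <= k" using comparable(1) chi1 big by (auto simp: k_def)
 have good: "\<exists>F. finite F \<and> F \<subseteq> E \<and> k <= XF F p x" if x: "x \<in> V" for x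
 proof -
  have "chi p / 2 < chi p" using chi1 by simp
  then obtain F u where F: "finite F" "F \<subseteq> E" "u \<in> V" "chi p / 2 < XF F p u" using chi_attained[OF pp(1,2)] by metis
  then obtain F' where F': "finite F'" "F' \<subseteq> E" "\<kappa> * XF F p u <= XF F' p x"
   using comparable(2)[OF p(1) pp(5) F(1,2,3) x] unfolding XF_def by auto
  have "k <= \<kappa> * XF F p u" using F(4) comparable(1) by (simp add: k_def)
  then show ?thesis using F' by (intro exI[of _ F']) auto
 qed
 obtain v where v: "v \<in> V" using nonempty by auto
 obtain G where G: "\<And>x. x \<in> V ==> finite (G x) \<and> G x \<subseteq> E \<and> k <= XF (G x) p x"
  using good by metis
 \<comment> \<open>\<open>F0\<close> nearly attains the supremum at \<open>q\<close> for the vertex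
   \<open>v\<close>, so enlarging the volume adds little, and little of the cluster of
   \<open>v\<close> lies outside the vertex set \<open>B\<close> of \<open>F0\<close>. The volume
   \<open>F\<close> is then chosen so that every vertex of \<open>B\<close> has mean cluster size at
   least \<open>k\<close>.\<close>
 define Y where "Y = Sup {XF F q v |F. finite F \<and> F \<subseteq> E}"
 have bdd: "bdd_above {XF F q v |F. finite F \<and> F \<subseteq> E}"
  using XF_le_chi[OF pp(3) p(3) _ _ v] by (intro bdd_aboveI[of _ "chi q"]) auto
 have Yup: "XF F q v <= Y" if "finite F" "F \<subseteq> E" for F
  unfolding Y_def using that by (intro cSup_upper bdd) auto
 have "Y - k / 4 < Y" using k by simp
 then obtain y where "y \<in> {XF F q v |F. finite F \<and> F \<subseteq> E}" "Y - k / 4 < y"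
  using less_cSupD[of "{XF F q v |F. finite F \<and> F \<subseteq> E}" "Y - k / 4"] unfolding Y_def by auto
 then obtain F0 where F0: "finite F0" "F0 \<subseteq> E" "Y - k / 4 < XF F0 q v" by auto
 define B where "B = insert v (\<Union>F0)"
 have B: "finite B" "B \<subseteq> V" using finite_vertices[OF F0(1,2)] edges_V[OF F0(2)] v by (auto simp: B_def)
 define F where "F = (\<Union>x\<in>B. G x)"
 have F: "finite F" "F \<subseteq> E" using G B by (auto simp: F_def)
 have low: "k <= XF F \<xi> x" if "x \<in> B" "p <= \<xi>" "\<xi> <= q" for x \<xi>
 proof -
  have "k <= XF (G x) p x" using G B that by auto
  also have "... <= XF F \<xi> x" using that pp F by (intro XF_mono) (auto simp: F_def)
  finally show ?thesis .
 qed
 have tail: "bexp F \<xi> (%w. real (card (CL w {v} - B))) <= k / 4" if \<xi>: "p <= \<xi>" "\<xi> <= q" for \<xi>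
 proof -
  let ?H = "F \<union> F0"
  have H: "finite ?H" "?H \<subseteq> E" using F F0 by auto
  have i: "incr_on F' (%w. real (card (CL w {v} - B)))" if "finite F'" "F' \<subseteq> E" for F'
   unfolding Diff_eq using that by (intro incr_card) auto
  have "bexp F \<xi> (%w. real (card (CL w {v} - B))) <= bexp F q (%w. real (card (CL w {v} - B)))"
   using \<xi> pp by (intro bexp_mono_p i F) auto
  also have "... <= bexp ?H q (%w. real (card (CL w {v} - B)))"
   using pp by (intro bexp_mono_F i H) auto
  also have "... = XF ?H q v - bexp ?H q (%w. real (card (CL w {v} \<inter> B)))"
   unfolding XF_def bexp_diff[symmetric]
  proof (rule bexp_cong)
   fix w assume "w \<subseteq> ?H"
   then have "finite (CL w {v})" using H by (intro CL_finite) auto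
   then have "card (CL w {v}) = card (CL w {v} - B) + card (CL w {v} \<inter> B)"
    by (subst card_Un_disjoint[symmetric]) (auto intro: arg_cong[where f = card])
   then show "real (card (CL w {v} - B)) = real (card (CL w {v})) - real (card (CL w {v} \<inter> B))" by simp
  qed
  also have "... <= Y - XF F0 q v"
  proof -
   have "XF F0 q v = bexp F0 q (%w. real (card (CL w {v} \<inter> B)))"
    unfolding XF_def
   proof (rule bexp_cong)
    fix w assume "w \<subseteq> F0"
    then have "CL w {v} \<subseteq> B" using CL_bound[of w "{v}"] by (auto simp: B_def)
    then show "real (card (CL w {v})) = real (card (CL w {v} \<inter> B))" by (simp add: Int_absorb2)
   qed
   also have "... <= bexp ?H q (%w. real (card (CL w {v} \<inter> B)))"
    using pp H by (intro bexp_mono_F incr_card) auto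
   finally show ?thesis using Yup[OF H] by simp
  qed
  finally show ?thesis using F0(3) by simp
 qed
 have deriv: "\<exists>D. ((%p. XF F p v) has_real_derivative D) (at \<xi>) \<and> (p <= \<xi> --> \<xi> <= q --> k ^ 3 <= 8 * C\<^sup>2 * (d * chi q) * D)" for \<xi>
 proof -
  obtain D where D: "((%p. XF F p v) has_real_derivative D) (at \<xi>)"
   "0 <= \<xi> ==> \<xi> <= 1 ==> bexp F \<xi> (%w. \<Sum>(z, z')\<in>bd F (CL w {v}). XF (nt F (CL w {v})) \<xi> z') <= D"
   using XF_deriv[OF F, of v \<xi>] by auto
  have "k ^ 3 <= 8 * C\<^sup>2 * (d * chi q) * D" if \<xi>: "p <= \<xi>" "\<xi> <= q"
  proof -
   have x: "0 <= \<xi>" "\<xi> <= 1" "\<xi> <= p1" using \<xi> pp by auto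
   let ?M = "%w. \<Sum>(z, z')\<in>bd F (CL w {v}). XF (nt F (CL w {v})) \<xi> z'"
   let ?a = "%w. real (card (CL w {v} \<inter> B))" and ?b = "%w. real (card (CL w {v} - B))"
   have Xq: "XF F' \<xi> u <= chi q" if "finite F'" "F' \<subseteq> E" "u \<in> V" for F' u
    using XF_mono[of \<xi> q F' F' u] XF_le_chi[of q F' u] that x \<xi> pp p by simp
   have M0: "0 <= ?M w" if "w \<subseteq> F" for w
   proof (intro sum_nonneg, clarify)
    fix z z'
    have "finite (nt F (CL w {v}))" "nt F (CL w {v}) \<subseteq> E" using F nt_subset[of F "CL w {v}"] by (auto simp: finite_nt)
    from XF_ge_1[OF x(1,2) this, of z'] show "0 <= XF (nt F (CL w {v})) \<xi> z'" by simp
   qed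
   \<comment> \<open>Weighting with \<open>?a - ?b\<close> instead of \<open>?a\<close> disposes of
     the clusters that lie mostly outside \<open>B\<close>: their weight is not positive. The price
     is twice the tail \<open>k / 4\<close>.\<close>
   have "k\<^sup>2 * (k - k / 4 - k / 4) <= k\<^sup>2 * (bexp F \<xi> ?a - bexp F \<xi> ?b)"
   proof (rule mult_left_mono)
    have "k <= XF F \<xi> v" using low[OF _ \<xi>, of v] by (simp add: B_def)
    also have "... = bexp F \<xi> (%w. ?a w + ?b w)"
     unfolding XF_def
    proof (rule bexp_cong)
     fix w assume "w \<subseteq> F"
     then have "finite (CL w {v})" using F by (intro CL_finite) auto
     then have "card (CL w {v}) = card (CL w {v} \<inter> B) + card (CL w {v} - B)"
      by (subst card_Un_disjoint[symmetric]) (auto intro: arg_cong[where f = card])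
     then show "real (card (CL w {v})) = ?a w + ?b w" by simp
    qed
    finally show "k - k / 4 - k / 4 <= bexp F \<xi> ?a - bexp F \<xi> ?b"
     using tail[OF \<xi>] by (simp add: bexp_add)
   qed simp
   also have "... = bexp F \<xi> (%w. k\<^sup>2 * (?a w - ?b w))" by (simp only: bexp_cmult bexp_diff)
   also have "... <= bexp F \<xi> (%w. 4 * C\<^sup>2 * (d * chi q) * ?M w)"
   proof (rule bexp_mono[OF x(1,2)])
    fix w assume s: "w \<subseteq> F"
    let ?K = "CL w {v}"
    have K: "finite ?K" "?K \<subseteq> V" using CL_finite[OF F s, of "{v}"] CL_V[of w "{v}"] s F(2) v by simp_all
    show "k\<^sup>2 * (?a w - ?b w) <= 4 * C\<^sup>2 * (d * chi q) * ?M w"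
    proof (cases "card (?K - B) <= card (?K \<inter> B)")
     case True
     have "k\<^sup>2 * (?a w - ?b w) <= k\<^sup>2 * ?a w" by (intro mult_left_mono) auto
     also have "... <= 4 * C\<^sup>2 * (d * chi q) * ?M w"
     proof (rule boundary_lower_chi[OF F x(1,3) K Xq _ k(2) _ True])
      show "0 <= chi q" using chi1 by simp
      show "k <= XF F \<xi> x" if "x \<in> ?K \<inter> B" for x using low[of x \<xi>] that \<xi> by auto
     qed
     finally show ?thesis .
    next
     case False
     then have "k\<^sup>2 * (?a w - ?b w) <= 0" by (intro mult_nonneg_nonpos) auto
     also have "0 <= 4 * C\<^sup>2 * (d * chi q) * ?M w" using chi1 M0[OF s] by simp
     finally show ?thesis .
    qed
   qed
   also have "... = 4 * C\<^sup>2 * (d * chi q) * bexp F \<xi> ?M" by (rule bexp_cmult)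
   also have "... <= 4 * C\<^sup>2 * (d * chi q) * D" using D(2)[OF x(1,2)] chi1 by (intro mult_left_mono) auto
   finally show ?thesis by (simp add: power2_eq_square power3_eq_cube algebra_simps)
  qed
  then show ?thesis using D(1) by auto
 qed
 obtain D where D: "\<And>\<xi>. ((%p. XF F p v) has_real_derivative D \<xi>) (at \<xi>)"
  "\<And>\<xi>. p <= \<xi> ==> \<xi> <= q ==> k ^ 3 <= 8 * C\<^sup>2 * (d * chi q) * D \<xi>"
  using deriv by metis
 obtain \<xi> where \<xi>: "p < \<xi>" "\<xi> < q" "XF F q v - XF F p v = (q - p) * D \<xi>"
  using MVT2[OF p(2), of "%p. XF F p v" D] D(1) by auto
 have "(q - p) * k ^ 3 <= (q - p) * (8 * C\<^sup>2 * (d * chi q) * D \<xi>)"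
  using D(2)[of \<xi>] \<xi> p by (intro mult_left_mono) auto
 also have "... = 8 * C\<^sup>2 * (d * chi q) * (XF F q v - XF F p v)" unfolding \<xi>(3) by simp
 also have "... <= 8 * C\<^sup>2 * (d * chi q) * chi q"
  using XF_ge_1[of p F v] XF_le_chi[of q F v] F v pp p chi1 by (intro mult_left_mono) auto
 finally show ?thesis by (simp add: k_def power2_eq_square power3_eq_cube algebra_simps)
qed

end

section \<open>Decision trees and the critical volume tail\<close>

text \<open>
 \<open>dmart\<close> is the martingale of centred answers along a run of the tree. The derivative of \<open>P(Q)\<close> is the covariance of \<open>Q\<close> with
 the sum of all centred edges, and the edges that the tree does not query drop out.
\<close>

datatype 'e dtree = Leaf real | Node 'e "'e dtree" "'e dtree"

primrec dval :: "'e dtree => 'e set => real" where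
 "dval (Leaf r) w = r"
| "dval (Node e l r) w = (if e \<in> w then dval l w else dval r w)"

primrec dmart :: "real => 'e dtree => 'e set => real" where
 "dmart p (Leaf r) w = 0"
| "dmart p (Node e l r) w = (if e \<in> w then 1 - p + dmart p l w else - p + dmart p r w)"

primrec ddepth :: "'e dtree => 'e set => nat" where
 "ddepth (Leaf r) w = 0"
| "ddepth (Node e l r) w = Suc (if e \<in> w then ddepth l w else ddepth r w)"

text \<open>No edge is queried twice along a branch, so every answer is a fresh coin.\<close>

primrec dqueries :: "'e dtree => 'e set => bool" where
 "dqueries (Leaf r) F \<longleftrightarrow> True"
| "dqueries (Node e l r) F \<longleftrightarrow> e \<in> F \<and> dqueries l (F - {e}) \<and> dqueries r (F - {e})"

lemma dtree_local:
 assumes "dqueries t F" "w \<inter> F = w' \<inter> F"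
 shows "dval t w = dval t w'" "dmart p t w = dmart p t w'" "ddepth t w = ddepth t w'"
proof -
 have "dval t w = dval t w' \<and> dmart p t w = dmart p t w' \<and> ddepth t w = ddepth t w'"
  using assms
 proof (induction t arbitrary: F)
  case (Node e l r)
  have "w \<inter> (F - {e}) = w' \<inter> (F - {e})" "e \<in> w \<longleftrightarrow> e \<in> w'" using Node.prems by auto
  then show ?case using Node.IH(1)[of "F - {e}"] Node.IH(2)[of "F - {e}"] Node.prems(1) by auto
 qed simp
 then show "dval t w = dval t w'" "dmart p t w = dmart p t w'" "ddepth t w = ddepth t w'" by auto
qed

lemma dtree_insert:
 assumes "dqueries t (F - {e})"
 shows "dval t (insert e w) = dval t w" "dmart p t (insert e w) = dmart p t w" "ddepth t (insert e w) = ddepth t w"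
proof -
 have "insert e w \<inter> (F - {e}) = w \<inter> (F - {e})" by auto
 from dtree_local[OF assms this]
 show "dval t (insert e w) = dval t w" "dmart p t (insert e w) = dmart p t w" "ddepth t (insert e w) = ddepth t w" by auto
qed

lemma bexp_remove:
 assumes "finite F" "e \<in> F"
 shows "bexp F p f = p * bexp (F - {e}) p (%w. f (insert e w)) + (1 - p) * bexp (F - {e}) p f"
 using bexp_insert[of "F - {e}" e p f] assms by (simp add: insert_absorb)

lemma bexp_Node:
 assumes "finite F" "e \<in> F"
  and "\<And>w. w \<subseteq> F - {e} ==> f (insert e w) = g w" "\<And>w. w \<subseteq> F - {e} ==> f w = h w"
 shows "bexp F p f = p * bexp (F - {e}) p g + (1 - p) * bexp (F - {e}) p h"
 using bexp_remove[OF assms(1,2), of p f] bexp_cong[of "F - {e}" "%w. f (insert e w)" g p] bexp_cong[of "F - {e}" f h p] assms(3,4)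
 by simp

lemma dmart_mean:
 assumes "finite F" "dqueries t F" shows "bexp F p (dmart p t) = 0"
 using assms
proof (induction t arbitrary: F)
 case (Leaf r)
 then show ?case by (simp add: bexp_const)
next
 case (Node e l r)
 let ?G = "F - {e}"
 have q: "e \<in> F" "dqueries l ?G" "dqueries r ?G" and fin: "finite ?G" using Node.prems by auto
 have "bexp F p (dmart p (Node e l r)) = p * bexp ?G p (%w. (1 - p) + dmart p l w) + (1 - p) * bexp ?G p (%w. - p + dmart p r w)"
  using Node.prems(1) q by (intro bexp_Node) (auto simp: dtree_insert[OF q(2)])
 also have "... = p * (1 - p) + (1 - p) * (- p)"
  using Node.IH(1)[OF fin q(2)] Node.IH(2)[OF fin q(3)] fin by (simp only: bexp_add bexp_const add_0_right)
 also have "... = 0" by simp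
 finally show ?case .
qed

text \<open>Martingale increments are orthogonal, and each query contributes the variance
  \<open>p * (1 - p)\<close> of one coin.\<close>

lemma dmart_square:
 assumes "finite F" "dqueries t F"
 shows "bexp F p (%w. (dmart p t w)\<^sup>2) = p * (1 - p) * bexp F p (%w. real (ddepth t w))"
 using assms
proof (induction t arbitrary: F)
 case (Leaf r)
 then show ?case by (simp add: bexp_const)
next
 case (Node e l r)
 let ?G = "F - {e}"
 have q: "e \<in> F" "dqueries l ?G" "dqueries r ?G" and fin: "finite ?G" using Node.prems by auto
 have sq: "bexp ?G p (%w. (c + dmart p t w)\<^sup>2) = c\<^sup>2 + bexp ?G p (%w. (dmart p t w)\<^sup>2)" if "dqueries t ?G" for c t
 proof -
  have "bexp ?G p (%w. (c + dmart p t w)\<^sup>2) = bexp ?G p (%w. c\<^sup>2 + (2 * c * dmart p t w + (dmart p t w)\<^sup>2))"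
   by (simp add: power2_sum algebra_simps)
  also have "... = c\<^sup>2 + (2 * c * bexp ?G p (dmart p t) + bexp ?G p (%w. (dmart p t w)\<^sup>2))"
   by (simp only: bexp_add bexp_const[OF fin] bexp_cmult)
  finally show ?thesis using dmart_mean[OF fin that] by simp
 qed
 have "bexp F p (%w. (dmart p (Node e l r) w)\<^sup>2) = p * bexp ?G p (%w. ((1 - p) + dmart p l w)\<^sup>2) + (1 - p) * bexp ?G p (%w. (- p + dmart p r w)\<^sup>2)"
  using Node.prems(1) q by (intro bexp_Node) (auto simp: dtree_insert[OF q(2)])
 also have "... = p * ((1 - p)\<^sup>2 + p * (1 - p) * bexp ?G p (%w. real (ddepth l w))) + (1 - p) * ((- p)\<^sup>2 + p * (1 - p) * bexp ?G p (%w. real (ddepth r w)))"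
  unfolding sq[OF q(2)] sq[OF q(3)] Node.IH(1)[OF fin q(2)] Node.IH(2)[OF fin q(3)] ..
 also have "... = p * (1 - p) * (p * (1 + bexp ?G p (%w. real (ddepth l w))) + (1 - p) * (1 + bexp ?G p (%w. real (ddepth r w))))"
  by (simp add: power2_eq_square algebra_simps)
 also have "p * (1 + bexp ?G p (%w. real (ddepth l w))) + (1 - p) * (1 + bexp ?G p (%w. real (ddepth r w)))
  = p * bexp ?G p (%w. 1 + real (ddepth l w)) + (1 - p) * bexp ?G p (%w. 1 + real (ddepth r w))"
  by (simp only: bexp_add bexp_const[OF fin])
 also have "... = bexp F p (%w. real (ddepth (Node e l r) w))"
  using Node.prems(1) q by (intro bexp_Node[symmetric]) (auto simp: dtree_insert[OF q(2)])
 finally show ?case .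
qed

definition centered :: "'e set => real => 'e set => real" where
 "centered F p w = (\<Sum>e\<in>F. of_bool (e \<in> w) - p)"

lemma centered_remove:
 assumes "finite F" "e \<in> F" "w \<subseteq> F - {e}"
 shows "centered F p (insert e w) = 1 - p + centered (F - {e}) p w" "centered F p w = - p + centered (F - {e}) p w"
proof -
 have "e \<notin> w" using assms by auto
 moreover have "(\<Sum>f\<in>F - {e}. of_bool (f \<in> insert e w) - p) = (\<Sum>f\<in>F - {e}. of_bool (f \<in> w) - p)"
  by (intro sum.cong) auto
 ultimately show "centered F p (insert e w) = 1 - p + centered (F - {e}) p w" "centered F p w = - p + centered (F - {e}) p w"
  unfolding centered_def using assms(1,2) by (simp_all add: sum.remove)
qed

text \<open>Russo's formula as a covariance: averaging over the state of \<open>e\<close> alone, the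
  centred indicator of \<open>e\<close> picks out \<open>p * (1 - p)\<close> times the influence of
  \<open>e\<close>.\<close>

lemma bexp_centered:
 assumes "finite F"
 shows "bexp F p (%w. f w * centered F p w) = p * (1 - p) * (\<Sum>e\<in>F. bexp F p (%w. f (insert e w) - f (w - {e})))"
proof -
 have "bexp F p (%w. f w * centered F p w) = (\<Sum>e\<in>F. bexp F p (%w. f w * (of_bool (e \<in> w) - p)))"
  unfolding centered_def sum_distrib_left by (rule bexp_sum)
 also have "... = (\<Sum>e\<in>F. p * (1 - p) * bexp F p (%w. f (insert e w) - f (w - {e})))"
 proof (rule sum.cong[OF refl])
  fix e assume e: "e \<in> F"
  let ?G = "F - {e}"
  have "bexp F p (%w. f w * (of_bool (e \<in> w) - p)) = p * bexp ?G p (%w. (1 - p) * f (insert e w)) + (1 - p) * bexp ?G p (%w. - p * f w)"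
   using assms e by (intro bexp_Node) auto
  also have "... = p * (1 - p) * (bexp ?G p (%w. f (insert e w) - f w))"
   by (simp only: bexp_cmult bexp_diff) (simp add: algebra_simps)
  also have "bexp ?G p (%w. f (insert e w) - f w) = p * bexp ?G p (%w. f (insert e w) - f w) + (1 - p) * bexp ?G p (%w. f (insert e w) - f w)"
   by (simp add: algebra_simps)
  also have "... = bexp F p (%w. f (insert e w) - f (w - {e}))"
  proof (rule bexp_Node[symmetric, OF assms e, where f = "%w. f (insert e w) - f (w - {e})" and g = "%w. f (insert e w) - f w" and h = "%w. f (insert e w) - f w"])
   fix w assume "w \<subseteq> F - {e}"
   then have *: "insert e w - {e} = w" "w - {e} = w" by auto
   show "f (insert e (insert e w)) - f (insert e w - {e}) = f (insert e w) - f w" by (simp only: * insert_absorb2)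
   show "f (insert e w) - f (w - {e}) = f (insert e w) - f w" by (simp only: *)
  qed
  finally show "bexp F p (%w. f w * (of_bool (e \<in> w) - p)) = p * (1 - p) * bexp F p (%w. f (insert e w) - f (w - {e}))" .
 qed
 finally show ?thesis by (simp add: sum_distrib_left)
qed

lemma bexp_centered_dtree:
 assumes "finite F" "dqueries t F"
 shows "bexp F p (%w. dval t w * centered F p w) = bexp F p (%w. dval t w * dmart p t w)"
 using assms
proof (induction t arbitrary: F)
 case (Leaf r)
 then show ?case using bexp_centered[of F p "%_. r"] by (simp add: bexp_const)
next
 case (Node e l r)
 let ?G = "F - {e}"
 have q: "e \<in> F" "dqueries l ?G" "dqueries r ?G" and fin: "finite ?G" using Node.prems by auto
 have "bexp F p (%w. dval (Node e l r) w * centered F p w)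
  = p * bexp ?G p (%w. (1 - p) * dval l w + dval l w * centered ?G p w) + (1 - p) * bexp ?G p (%w. - p * dval r w + dval r w * centered ?G p w)"
  using Node.prems(1) q
  by (intro bexp_Node) (auto simp: dtree_insert[OF q(2)] centered_remove algebra_simps)
 also have "... = p * bexp ?G p (%w. (1 - p) * dval l w + dval l w * dmart p l w) + (1 - p) * bexp ?G p (%w. - p * dval r w + dval r w * dmart p r w)"
  by (simp only: bexp_add Node.IH(1)[OF fin q(2)] Node.IH(2)[OF fin q(3)])
 also have "... = bexp F p (%w. dval (Node e l r) w * dmart p (Node e l r) w)"
  using Node.prems(1) q
  by (intro bexp_Node[symmetric]) (auto simp: dtree_insert[OF q(2)] algebra_simps)
 finally show ?case .
qed

lemma bexp_Cauchy_Schwarz: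
 assumes "0 <= p" "p <= 1"
 shows "bexp F p (%w. f w * g w) <= sqrt (bexp F p (%w. (f w)\<^sup>2)) * sqrt (bexp F p (%w. (g w)\<^sup>2))"
proof -
 define u where "u = (%w. p ^ card w * (1 - p) ^ card (F - w))"
 have u: "0 <= u w" for w using assms by (simp add: u_def)
 have ex: "bexp F p h = (\<Sum>w\<in>Pow F. u w * h w)" for h by (simp add: bexp_def u_def)
 have "bexp F p (%w. f w * g w) <= (\<Sum>w\<in>Pow F. \<bar>sqrt (u w) * f w\<bar> * \<bar>sqrt (u w) * g w\<bar>)"
  unfolding ex
 proof (rule sum_mono)
  fix w
  have "u w * (f w * g w) <= u w * (\<bar>f w\<bar> * \<bar>g w\<bar>)"
   using u by (intro mult_left_mono) (simp_all add: abs_mult[symmetric])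
  also have "u w = sqrt (u w) * sqrt (u w)" using u by simp
  finally show "u w * (f w * g w) <= \<bar>sqrt (u w) * f w\<bar> * \<bar>sqrt (u w) * g w\<bar>"
   using u by (simp add: abs_mult mult_ac)
 qed
 also have "... <= L2_set (%w. sqrt (u w) * f w) (Pow F) * L2_set (%w. sqrt (u w) * g w) (Pow F)"
  by (rule L2_set_mult_ineq)
 also have "... = sqrt (bexp F p (%w. (f w)\<^sup>2)) * sqrt (bexp F p (%w. (g w)\<^sup>2))"
  unfolding L2_set_def ex using u by (simp add: power_mult_distrib)
 finally show ?thesis .
qed

text \<open>Cauchy--Schwarz for the covariance of \<open>Q\<close> with the martingale of the tree:
  the square of the derivative is at most the probability times the mean number of queries, up to
  \<open>p * (1 - p)\<close>.\<close>

lemma dtree_derivative_bound: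
 assumes F: "finite F" "dqueries t F" and p: "0 < p" "p < 1"
  and f: "\<And>w. w \<subseteq> F ==> dval t w = of_bool (Q w)"
  and D: "D = (\<Sum>e\<in>F. bexp F p (%w. of_bool (Q (insert e w)) - of_bool (Q (w - {e}))))" "0 <= D"
 shows "D\<^sup>2 * (p * (1 - p)) <= bprob F p Q * bexp F p (%w. real (ddepth t w))"
proof -
 have pq: "0 < p * (1 - p)" using p by simp
 have "p * (1 - p) * D = bexp F p (%w. of_bool (Q w) * centered F p w)"
  unfolding D(1) by (rule bexp_centered[OF F(1), symmetric])
 also have "... = bexp F p (%w. dval t w * centered F p w)" by (intro bexp_cong) (simp add: f)
 also have "... = bexp F p (%w. dval t w * dmart p t w)" by (rule bexp_centered_dtree[OF F])
 also have "... <= sqrt (bexp F p (%w. (dval t w)\<^sup>2)) * sqrt (bexp F p (%w. (dmart p t w)\<^sup>2))"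
  using p by (intro bexp_Cauchy_Schwarz) auto
 also have "bexp F p (%w. (dval t w)\<^sup>2) = bprob F p Q" by (intro bexp_cong) (simp add: f)
 also have "bexp F p (%w. (dmart p t w)\<^sup>2) = p * (1 - p) * bexp F p (%w. real (ddepth t w))" by (rule dmart_square[OF F])
 finally have *: "p * (1 - p) * D <= sqrt (bprob F p Q) * sqrt (p * (1 - p) * bexp F p (%w. real (ddepth t w)))" .
 have nn: "0 <= bprob F p Q" "0 <= bexp F p (%w. real (ddepth t w))" using p by (auto intro!: bexp_nonneg)
 have "(p * (1 - p) * D)\<^sup>2 <= (sqrt (bprob F p Q) * sqrt (p * (1 - p) * bexp F p (%w. real (ddepth t w))))\<^sup>2"
  using * pq D(2) by (intro power_mono) auto
 also have "... = bprob F p Q * (p * (1 - p) * bexp F p (%w. real (ddepth t w)))"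
  using nn pq by (simp add: power_mult_distrib)
 finally have "(p * (1 - p)) * (D\<^sup>2 * (p * (1 - p))) <= (p * (1 - p)) * (bprob F p Q * bexp F p (%w. real (ddepth t w)))"
  by (simp add: power2_eq_square mult_ac)
 then show ?thesis using pq by (simp only: mult_le_cancel_left_pos)
qed

text \<open>Explore the cluster of \<open>v\<close> edge by edge until it is exhausted or \<open>n\<close> vertices are found.
 \<open>Op\<close> and \<open>Cl\<close> are the open and closed edges found so far.\<close>

lemma exploration_dtree:
 fixes F :: "'v set set"
 assumes F: "finite F" "\<And>e. e \<in> F ==> finite e" and sub: "Op \<subseteq> F" "Cl \<subseteq> F"
 shows "\<exists>t. dqueries t (F - (Op \<union> Cl)) \<and> (\<forall>w\<subseteq>F - (Op \<union> Cl).
  dval t w = of_bool (n <= card (CL (Op \<union> w) {v})) \<and>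
  (ddepth t w = 0 \<or> (\<exists>U. CL Op {v} \<subseteq> U \<and> U \<subseteq> CL (Op \<union> w) {v} \<and> card U < n \<and> ddepth t w <= card (tch (F - (Op \<union> Cl)) U))))"
 using sub
proof (induction "card (F - (Op \<union> Cl))" arbitrary: Op Cl rule: less_induct)
 case less
 let ?R = "F - (Op \<union> Cl)"
 have fin: "finite (CL w {v})" if "w \<subseteq> F" for w
  using that F by (intro finite_CL) (auto dest: finite_subset)
 have mono: "CL Op {v} \<subseteq> CL (Op \<union> w) {v}" for w by (rule CL_mono) auto
 show ?case
 proof (cases "n <= card (CL Op {v})")
  case True
  have "n <= card (CL (Op \<union> w) {v})" if "w \<subseteq> ?R" for w
  proof -
   have "Op \<union> w \<subseteq> F" using that less.prems by auto
   then have "card (CL Op {v}) <= card (CL (Op \<union> w) {v})" by (intro card_mono fin mono)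
   then show ?thesis using True by simp
  qed
  then show ?thesis by (intro exI[of _ "Leaf 1"]) auto
 next
  case small: False
  show ?thesis
  proof (cases "tch ?R (CL Op {v}) = {}")
   case True
   have "CL (Op \<union> w) {v} = CL Op {v}" if "w \<subseteq> ?R" for w
   proof (rule antisym[OF _ mono])
    show "CL (Op \<union> w) {v} \<subseteq> CL Op {v}"
    proof (rule CL_least[OF CL_self])
     fix x y assume x: "x \<in> CL Op {v}" "{x, y} \<in> Op \<union> w"
     have "{x, y} \<notin> w" using True that x(1) by (auto simp: tch_def)
     then show "y \<in> CL Op {v}" using x CL_closed[of x Op "{v}" y] by auto
    qed
   qed
   then show ?thesis using small by (intro exI[of _ "Leaf 0"]) auto
  next
   case False
   then obtain e where e: "e \<in> ?R" "e \<inter> CL Op {v} \<noteq> {}" by (auto simp: tch_def)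
   have R: "F - (insert e Op \<union> Cl) = ?R - {e}" "F - (Op \<union> insert e Cl) = ?R - {e}" by auto
   have c: "card (?R - {e}) < card ?R" using e(1) F(1) by (intro psubset_card_mono) auto
   obtain l where l: "dqueries l (?R - {e})" "\<And>w. w \<subseteq> ?R - {e} ==>
    dval l w = of_bool (n <= card (CL (insert e Op \<union> w) {v})) \<and>
    (ddepth l w = 0 \<or> (\<exists>U. CL (insert e Op) {v} \<subseteq> U \<and> U \<subseteq> CL (insert e Op \<union> w) {v} \<and> card U < n \<and> ddepth l w <= card (tch (?R - {e}) U)))"
    using less.hyps[of "insert e Op" Cl] less.prems e(1) c unfolding R by auto
   obtain r where r: "dqueries r (?R - {e})" "\<And>w. w \<subseteq> ?R - {e} ==>
    dval r w = of_bool (n <= card (CL (Op \<union> w) {v})) \<and>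
    (ddepth r w = 0 \<or> (\<exists>U. CL Op {v} \<subseteq> U \<and> U \<subseteq> CL (Op \<union> w) {v} \<and> card U < n \<and> ddepth r w <= card (tch (?R - {e}) U)))"
    using less.hyps[of Op "insert e Cl"] less.prems e(1) c unfolding R by auto
   \<comment> \<open>The queried edge \<open>e\<close> touches every \<open>U\<close> that contains
     the cluster known so far, so it accounts for the additional query.\<close>
   have card_tch: "Suc (card (tch (?R - {e}) U)) <= card (tch ?R U)" if "CL Op {v} \<subseteq> U" for U
   proof -
    have "e \<in> tch ?R U" using e that by (auto simp: tch_def)
    moreover have "tch (?R - {e}) U = tch ?R U - {e}" by (auto simp: tch_def)
    moreover have "finite (tch ?R U)" using F(1) by (simp add: finite_tch)
    ultimately show ?thesis by (metis card_Suc_Diff1 order_refl)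
   qed
   have step: "Suc k = 0 \<or> (\<exists>U. CL Op {v} \<subseteq> U \<and> U \<subseteq> CL (Op \<union> w) {v} \<and> card U < n \<and> Suc k <= card (tch ?R U))"
    if "k = 0 \<or> (\<exists>U. CL Op {v} \<subseteq> U \<and> U \<subseteq> CL (Op \<union> w) {v} \<and> card U < n \<and> k <= card (tch (?R - {e}) U))" for k w
    using that
   proof
    assume "k = 0"
    then show ?thesis using card_tch[of "CL Op {v}"] small mono[of w] by (intro disjI2 exI[of _ "CL Op {v}"]) auto
   next
    assume "\<exists>U. CL Op {v} \<subseteq> U \<and> U \<subseteq> CL (Op \<union> w) {v} \<and> card U < n \<and> k <= card (tch (?R - {e}) U)"
    then obtain U where "CL Op {v} \<subseteq> U" "U \<subseteq> CL (Op \<union> w) {v}" "card U < n" "k <= card (tch (?R - {e}) U)" by auto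
    then show ?thesis using card_tch[of U] by (intro disjI2 exI[of _ U]) auto
   qed
   show ?thesis
   proof (intro exI[of _ "Node e l r"] conjI allI impI)
    show "dqueries (Node e l r) ?R" using e(1) l(1) r(1) by simp
    fix w assume u: "w \<subseteq> ?R"
    have "dval (Node e l r) w = of_bool (n <= card (CL (Op \<union> w) {v})) \<and>
     (\<exists>k. ddepth (Node e l r) w = Suc k \<and> (k = 0 \<or> (\<exists>U. CL Op {v} \<subseteq> U \<and> U \<subseteq> CL (Op \<union> w) {v} \<and> card U < n \<and> k <= card (tch (?R - {e}) U))))"
    proof (cases "e \<in> w")
     case True
     let ?u = "w - {e}"
     have "insert e Op \<union> ?u = Op \<union> w" "insert e ?u = w" using True by auto
     moreover have "dval l w = dval l ?u" "ddepth l w = ddepth l ?u"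
      using dtree_insert(1)[OF l(1), of ?u] dtree_insert(3)[OF l(1), of ?u] \<open>insert e ?u = w\<close> by auto
     moreover have "CL Op {v} \<subseteq> CL (insert e Op) {v}" by (rule CL_mono) auto
     moreover have "?u \<subseteq> ?R - {e}" using u by auto
     ultimately show ?thesis using l(2)[of ?u] True by (auto dest: order_trans)
    next
     case False
     then have "w \<subseteq> ?R - {e}" using u by auto
     then show ?thesis using r(2)[of w] False by auto
    qed
    then show "dval (Node e l r) w = of_bool (n <= card (CL (Op \<union> w) {v}))"
     "ddepth (Node e l r) w = 0 \<or> (\<exists>U. CL Op {v} \<subseteq> U \<and> U \<subseteq> CL (Op \<union> w) {v} \<and> card U < n \<and> ddepth (Node e l r) w <= card (tch ?R U))"
     using step by auto
   qed
  qed
 qed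
qed

lemma sum_inverse_sqrt: "(\<Sum>k=1..n. 1 / sqrt (real k)) <= 2 * sqrt (real n)"
proof (induction n)
 case (Suc n)
 have "sqrt (real n) * sqrt (real (Suc n)) <= real n + 1 / 2"
 proof -
  have "sqrt (real n) * sqrt (real (Suc n)) = sqrt (real n * real (Suc n))" by (simp add: real_sqrt_mult)
  also have "... <= real n + 1 / 2"
   by (rule real_le_lsqrt) (auto simp: power2_eq_square algebra_simps)
  finally show ?thesis .
 qed
 then have "1 <= 2 * (sqrt (real (Suc n)) - sqrt (real n)) * sqrt (real (Suc n))"
  by (simp add: algebra_simps)
 then have "1 / sqrt (real (Suc n)) <= 2 * (sqrt (real (Suc n)) - sqrt (real n))"
  by (simp add: divide_le_eq)
 then show ?case using Suc by simp
qed simp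

lemma markov_card:
 fixes p :: real
 assumes "0 <= p" "p <= 1"
 shows "real n * bprob F p (%w. n <= N w) <= bexp F p (%w. real (N w))"
 unfolding bexp_cmult[symmetric] using assms by (intro bexp_mono) (auto simp: of_bool_def)

context l2_percolation
begin

lemma chi_mono: "0 <= p ==> p <= q ==> q < pc ==> chi p <= chi q"
proof (rule ccontr)
 assume a: "0 <= p" "p <= q" "q < pc" and "\<not> chi p <= chi q"
 then obtain F v where F: "finite F" "F \<subseteq> E" "v \<in> V" "chi q < XF F p v"
  using chi_attained[of p "chi q"] by (metis le_less_trans not_le)
 have "XF F p v <= XF F q v" using a F pc by (intro XF_mono) auto
 also have "... <= chi q" using a F by (intro XF_le_chi) auto
 finally show False using F by simp
qed

text \<open>If \<open>chi p\<close> exceeded \<open>A / (pc - p)\<close>, then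
  \<open>chi_step\<close> would force \<open>chi\<close> to double again and again at points whose
  gaps shrink geometrically, so that all of them lie before the midpoint of \<open>p\<close> and
  \<open>pc\<close>. But \<open>chi\<close> is monotone and finite at that midpoint.\<close>

lemma chi_bound: "\<exists>A>0. \<forall>p. pc / 2 <= p --> p < pc --> chi p <= A / (pc - p)"
proof -
 define c where "c = \<kappa> ^ 3 / (64 * C\<^sup>2 * (real d + 1))"
 have c: "0 < c" using comparable(1) C by (auto simp: c_def)
 \<comment> \<open>\<open>8 * C / \<kappa>\<close> meets the size condition of
   \<open>chi_step\<close>; \<open>16 / c\<close> makes the doubling steps add up to at most half of
   \<open>pc - p\<close>.\<close>
 define A where "A = 16 / c + 8 * C / \<kappa>"
 have A: "16 / c <= A" "8 * C / \<kappa> <= A" using c C comparable(1) by (auto simp: A_def)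
 have A0: "0 < A" using A(1) c by (meson divide_pos_pos less_le_trans zero_less_numeral)
 have step: "c * (q - p) * chi p ^ 3 <= (chi q)\<^sup>2"
  if "pc / 2 <= p" "p < q" "q < pc" "A <= chi p" for p q
 proof -
  have big: "8 * C <= \<kappa> * chi p"
  proof -
   have "8 * C <= \<kappa> * A" using A(2) comparable(1) by (simp add: divide_le_eq mult.commute)
   also have "... <= \<kappa> * chi p" using that(4) comparable(1) by (intro mult_left_mono) auto
   finally show ?thesis .
  qed
  have "(q - p) * \<kappa> ^ 3 * chi p ^ 3 <= 64 * C\<^sup>2 * d * (chi q)\<^sup>2" by (rule chi_step[OF that(1-3) big])
  also have "... <= 64 * C\<^sup>2 * (real d + 1) * (chi q)\<^sup>2" by (intro mult_right_mono mult_left_mono) auto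
  finally have *: "(q - p) * \<kappa> ^ 3 * chi p ^ 3 <= 64 * C\<^sup>2 * (real d + 1) * (chi q)\<^sup>2" .
  have "0 < 64 * C\<^sup>2 * (real d + 1)" using C by (intro mult_pos_pos) auto
  then show ?thesis using * unfolding c_def by (simp add: divide_le_eq mult_ac)
 qed
 have "chi p <= A / (pc - p)" if p: "pc / 2 <= p" "p < pc" for p
 proof (rule ccontr)
  assume "\<not> chi p <= A / (pc - p)"
  define D where "D = pc - p"
  have D: "0 < D" "D <= 1" using p pc by (auto simp: D_def)
  have x: "A < D * chi p" using \<open>\<not> chi p <= A / (pc - p)\<close> D by (simp add: D_def[symmetric] divide_less_eq not_le mult.commute)
  have p0: "0 <= p" using p pc by simp
  have chi0: "1 <= chi p" using p p0 by (intro chi_ge_1)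
  have "D * chi p <= 1 * chi p" using D chi0 by (intro mult_right_mono) auto
  then have Achi: "A <= chi p" using x by simp
  have claim: "\<exists>q. p <= q \<and> q <= p + D / 2 * (1 - (1 / 2) ^ k) \<and> 2 ^ k * chi p <= chi q" for k
  proof (induction k)
   case 0
   then show ?case by (intro exI[of _ p]) auto
  next
   case (Suc k)
   then obtain q where q: "p <= q" "q <= p + D / 2 * (1 - (1 / 2) ^ k)" "2 ^ k * chi p <= chi q" by auto
   \<comment> \<open>With this step the left side of the inequality at \<open>q\<close> and
     \<open>r\<close> becomes exactly \<open>(2 * chi q) ^ 2\<close>.\<close>
   define r where "r = q + 4 / (c * chi q)"
   have two: "(1::real) <= 2 ^ k" by simp
   have "1 * chi p <= 2 ^ k * chi p" using two chi0 by (intro mult_right_mono) auto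
   then have cq: "chi p <= chi q" "1 <= chi q" using q(3) chi0 by linarith+
   have h: "D / 2 * (1 / 2) ^ Suc k = D / (4 * 2 ^ k)" by (simp add: power_one_over field_simps)
   have "16 * 2 ^ k <= c * A * 2 ^ k" using A(1) c by (intro mult_right_mono) (auto simp: divide_le_eq mult.commute)
   also have "... <= c * (D * chi p) * 2 ^ k" using x c by (intro mult_right_mono mult_left_mono) auto
   also have "... = c * D * (2 ^ k * chi p)" by simp
   also have "... <= c * D * chi q" using q(3) c D by (intro mult_left_mono) auto
   finally have "16 * 2 ^ k <= c * D * chi q" .
   then have "4 / (c * chi q) <= D / (4 * 2 ^ k)" using c cq(2) by (simp add: field_simps)
   then have rq: "r <= p + D / 2 * (1 - (1 / 2) ^ Suc k)"
    using q(2) h unfolding r_def by (simp add: algebra_simps)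
   have "D / 2 * (1 - (1 / 2) ^ Suc k) <= D / 2 * 1" using D by (intro mult_left_mono) auto
   then have "r < p + D" using rq D by linarith
   then have rpc: "r < pc" by (simp add: D_def)
   have qr: "q < r" using c cq by (simp add: r_def)
   have "c * (r - q) * chi q ^ 3 <= (chi r)\<^sup>2"
    using p q(1) qr rpc Achi cq(1) by (intro step) auto
   moreover have "c * (r - q) * chi q ^ 3 = (2 * chi q)\<^sup>2"
    using c cq(2) unfolding r_def by (simp add: power2_eq_square power3_eq_cube)
   ultimately have "(2 * chi q)\<^sup>2 <= (chi r)\<^sup>2" by simp
   moreover have "0 <= chi r" using chi_ge_1[of r] rpc qr q(1) p0 by simp
   ultimately have "2 * chi q <= chi r" by (rule power2_le_imp_le)
   then have "2 ^ Suc k * chi p <= chi r" using q(3) by simp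
   then show ?case using rq qr q(1) by (intro exI[of _ r]) auto
  qed
  obtain k where k: "chi (p + D / 2) < 2 ^ k" using real_arch_pow[of 2 "chi (p + D / 2)"] by auto
  obtain q where q: "p <= q" "q <= p + D / 2 * (1 - (1 / 2) ^ k)" "2 ^ k * chi p <= chi q" using claim by auto
  have "D / 2 * (1 - (1 / 2) ^ k) <= D / 2 * 1" using D by (intro mult_left_mono) auto
  then have "q <= p + D / 2" using q(2) by simp
  moreover have "p + D / 2 < pc" using D(1) unfolding D_def by (simp add: field_simps)
  ultimately have "chi q <= chi (p + D / 2)" using p0 q(1) by (intro chi_mono) auto
  moreover have "2 ^ k * 1 <= 2 ^ k * chi p" using chi0 by (intro mult_left_mono) auto
  ultimately show False using q(3) k by simp
 qed
 then show ?thesis using A0 by auto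
qed

lemma tch_card:
 assumes "F \<subseteq> E" "finite U" shows "finite (tch F U)" "card (tch F U) <= d * card U"
proof -
 have sub: "tch F U \<subseteq> (\<Union>u\<in>U. {e \<in> E. u \<in> e})" using assms(1) by (auto simp: tch_def)
 have fin: "finite (\<Union>u\<in>U. {e \<in> E. u \<in> e})" using assms(2) deg_finite by auto
 show "finite (tch F U)" using sub fin by (rule finite_subset)
 have "card (tch F U) <= card (\<Union>u\<in>U. {e \<in> E. u \<in> e})" using fin sub by (rule card_mono)
 also have "... <= (\<Sum>u\<in>U. card {e \<in> E. u \<in> e})" by (rule card_UN_le[OF assms(2)])
 also have "... <= (\<Sum>u\<in>U. d)" by (intro sum_mono deg)
 finally show "card (tch F U) <= d * card U" by (simp add: mult.commute)
qed

lemma incr_size: "finite F ==> F \<subseteq> E ==> incr_on F (%w. of_bool (n <= card (CL w {v})))"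
proof (rule incr_onI)
 fix A B assume F: "finite F" "F \<subseteq> E" and AB: "A \<subseteq> B" "B \<subseteq> F"
 have "card (CL A {v}) <= card (CL B {v})"
  using AB by (intro card_mono CL_finite[OF F] CL_mono) auto
 then show "of_bool (n <= card (CL A {v})) <= (of_bool (n <= card (CL B {v})) :: real)" by auto
qed

text \<open>The exploration stops at \<open>n\<close> vertices, so it makes at most
  \<open>d * min n (card K)\<close> queries, where \<open>K\<close> is the cluster of
  \<open>v\<close>; the mean of this minimum is the sum of the volume tails up to
  \<open>n\<close>.\<close>

lemma size_deriv:
 assumes F: "finite F" "F \<subseteq> E" and p: "0 < p" "p < 1"
 shows "\<exists>D. ((%p. bprob F p (%w. n <= card (CL w {v}))) has_real_derivative D) (at p) \<and> 0 <= D \<and>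
  D\<^sup>2 * (p * (1 - p)) <= bprob F p (%w. n <= card (CL w {v})) * (d * (\<Sum>k=1..n. bprob F p (%w. k <= card (CL w {v}))))"
proof -
 let ?Q = "%w. n <= card (CL w {v})"
 obtain t where t: "dqueries t F" "\<And>w. w \<subseteq> F ==> dval t w = of_bool (?Q w) \<and>
  (ddepth t w = 0 \<or> (\<exists>U. CL {} {v} \<subseteq> U \<and> U \<subseteq> CL w {v} \<and> card U < n \<and> ddepth t w <= card (tch F U)))"
  using exploration_dtree[OF F(1) edge_fin[OF F(2)], of "{}" "{}" n v] by auto
 define D where "D = (\<Sum>e\<in>F. bexp F p (%w. of_bool (?Q (insert e w)) - of_bool (?Q (w - {e}))))"
 have 1: "((%p. bprob F p ?Q) has_real_derivative D) (at p)" unfolding D_def by (rule russo[OF F(1)])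
 have 2: "0 <= D"
  unfolding D_def
 proof (intro sum_nonneg bexp_nonneg)
  fix e w assume "e \<in> F" "w \<subseteq> F"
  then show "(0::real) <= of_bool (?Q (insert e w)) - of_bool (?Q (w - {e}))"
   using incr_onD[OF incr_size[OF F, of n v], of "w - {e}" "insert e w"] by auto
 qed (use p in auto)
 have "D\<^sup>2 * (p * (1 - p)) <= bprob F p ?Q * bexp F p (%w. real (ddepth t w))"
  using t(2) by (intro dtree_derivative_bound[OF F(1) t(1) p _ D_def 2]) auto
 also have "... <= bprob F p ?Q * (d * (\<Sum>k=1..n. bprob F p (%w. k <= card (CL w {v}))))"
 proof (rule mult_left_mono)
  have "bexp F p (%w. real (ddepth t w)) <= bexp F p (%w. real d * (\<Sum>k=1..n. of_bool (k <= card (CL w {v}))))"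
  proof (rule bexp_mono)
   fix w assume u: "w \<subseteq> F"
   have fin: "finite (CL w {v})" by (rule CL_finite[OF F u]) simp
   have m: "(\<Sum>k=1..n. of_bool (k <= card (CL w {v}))) = real (min n (card (CL w {v})))"
   proof -
    have "{1..n} \<inter> {k. k <= card (CL w {v})} = {1..min n (card (CL w {v}))}" by auto
    then show ?thesis by (simp add: sum_of_bool_eq)
   qed
   have "ddepth t w <= d * min n (card (CL w {v}))"
   proof (cases "ddepth t w = 0")
    case False
    then obtain U where U: "U \<subseteq> CL w {v}" "card U < n" "ddepth t w <= card (tch F U)" using t(2)[OF u] by auto
    have "finite U" using U(1) fin by (rule finite_subset)
    then have "ddepth t w <= d * card U" using U(3) tch_card(2)[OF F(2), of U] by simp
    moreover have "card U <= min n (card (CL w {v}))" using U card_mono[OF fin U(1)] by simp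
    ultimately show ?thesis by (meson mult_le_mono2 order_trans)
   qed simp
   then have "real (ddepth t w) <= real (d * min n (card (CL w {v})))" by (rule of_nat_mono)
   then show "real (ddepth t w) <= real d * (\<Sum>k=1..n. of_bool (k <= card (CL w {v})))" unfolding m by simp
  qed (use p in auto)
  then show "bexp F p (%w. real (ddepth t w)) <= real d * (\<Sum>k=1..n. bprob F p (%w. k <= card (CL w {v})))"
   by (simp only: bexp_cmult bexp_sum)
 qed (use p in \<open>auto intro: bprob_nonneg\<close>)
 finally show ?thesis using 1 2 by auto
qed

text \<open>Take \<open>n\<close> maximising \<open>sqrt n P(|K| \<ge> n)\<close>. At such a record the derivative bound shows that
 \<open>P\<^sub>p(|K| \<ge> n)\<close> is still of the same order at \<open>p = pc - const / sqrt n\<close>, where Markov's inequality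
 and the bound on \<open>chi\<close> apply.\<close>

lemma volume_tail: "\<exists>B>0. \<forall>F v n. finite F --> F \<subseteq> E --> v \<in> V --> 1 <= n -->
 bprob F pc (%w. n <= card (CL w {v})) <= B / sqrt n"
proof -
 obtain A where A: "0 < A" "\<And>p. pc / 2 <= p ==> p < pc ==> chi p <= A / (pc - p)" using chi_bound by auto
 define u where "u = pc / 2 * (1 - pc)"
 have u: "0 < u" using pc by (simp add: u_def)
 \<comment> \<open>The first term bounds the derivative at a record, with \<open>u\<close> a lower
   bound for \<open>p * (1 - p)\<close> between \<open>pc / 2\<close> and \<open>pc\<close>. The
   second keeps \<open>pc - eps\<close> above \<open>pc / 2\<close>.\<close>
 define L where "L = max (sqrt (2 * d / u)) (1 / pc)"
 have L: "sqrt (2 * d / u) <= L" "1 / pc <= L" by (auto simp: L_def)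
 have L0: "0 < L" using L(2) pc by (meson divide_pos_pos less_le_trans zero_less_one)
 have main: "bprob F pc (%w. m <= card (CL w {v})) <= 4 * L * A / sqrt m"
  if F: "finite F" "F \<subseteq> E" and v: "v \<in> V" and m: "1 <= m" for F v m
 proof -
  define b where "b = (%k p. bprob F p (%w. k <= card (CL w {v})))"
  define S where "S = (%k. sqrt (real k) * b k pc) ` {1..m}"
  define \<beta> where "\<beta> = Max S"
  have S: "finite S" "S \<noteq> {}" using m by (auto simp: S_def)
  have "\<beta> \<in> S" unfolding \<beta>_def using S by (rule Max_in)
  then obtain n where n: "1 <= n" "\<beta> = sqrt (real n) * b n pc" and "n <= m" by (auto simp: S_def)
  have \<beta>0: "0 <= \<beta>" using n pc by (auto simp: b_def intro!: mult_nonneg_nonneg bprob_nonneg)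
  have rec: "b k pc <= \<beta> / sqrt k" if "k \<in> {1..m}" for k
  proof -
   have "sqrt (real k) * b k pc <= \<beta>" unfolding \<beta>_def using S(1) that by (intro Max_ge) (auto simp: S_def)
   then show ?thesis using that by (simp add: field_simps)
  qed
  have bmono: "b k \<xi> <= b k pc" if "0 <= \<xi>" "\<xi> <= pc" for k \<xi>
   unfolding b_def using that pc by (intro bexp_mono_p F incr_size) auto
  \<comment> \<open>The derivative is at most \<open>\<beta> * L\<close>, so going down from
    \<open>pc\<close> by \<open>eps\<close> loses at most half of the record value
    \<open>\<beta> / sqrt n\<close>.\<close>
  define eps where "eps = 1 / (2 * L * sqrt (real n))"
  have sn: "1 <= sqrt (real n)" using n(1) by simp
  have eps0: "0 < eps" using L0 sn by (simp add: eps_def)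
  have "1 <= L * pc" using L(2) pc by (simp add: field_simps)
  also have "... * 1 <= L * pc * sqrt (real n)" using sn L0 pc by (intro mult_left_mono) auto
  finally have "1 <= L * pc * sqrt (real n)" by simp
  then have eps: "eps <= pc / 2" using L0 sn by (simp add: eps_def field_simps)
  have deriv: "\<exists>D. (b n has_real_derivative D) (at \<xi>) \<and> D <= \<beta> * L" if \<xi>: "pc / 2 <= \<xi>" "\<xi> <= pc" for \<xi>
  proof -
   have x: "0 < \<xi>" "\<xi> < 1" using \<xi> pc by auto
   obtain D where D: "(b n has_real_derivative D) (at \<xi>)" "0 <= D" "D\<^sup>2 * (\<xi> * (1 - \<xi>)) <= b n \<xi> * (d * (\<Sum>k=1..n. b k \<xi>))"
    using size_deriv[OF F x, of n v] unfolding b_def by auto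
   have "D\<^sup>2 * u <= D\<^sup>2 * (\<xi> * (1 - \<xi>))"
    unfolding u_def using \<xi> pc by (intro mult_left_mono mult_mono) auto
   also have "... <= b n \<xi> * (d * (\<Sum>k=1..n. b k \<xi>))" by (rule D(3))
   also have "... <= (\<beta> / sqrt n) * (d * (\<beta> * (2 * sqrt n)))"
   proof (intro mult_mono)
    show "b n \<xi> <= \<beta> / sqrt n" using bmono[of \<xi> n] rec[of n] x \<xi> n(1) \<open>n <= m\<close> by auto
    have "(\<Sum>k=1..n. b k \<xi>) <= (\<Sum>k=1..n. \<beta> * (1 / sqrt k))"
    proof (rule sum_mono)
     fix k assume "k \<in> {1..n}"
     then show "b k \<xi> <= \<beta> * (1 / sqrt k)" using bmono[of \<xi> k] rec[of k] x \<xi> \<open>n <= m\<close> by auto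
    qed
    also have "... = \<beta> * (\<Sum>k=1..n. 1 / sqrt (real k))" by (simp add: sum_distrib_left)
    also have "... <= \<beta> * (2 * sqrt n)" using \<beta>0 by (intro mult_left_mono sum_inverse_sqrt)
    finally show "(\<Sum>k=1..n. b k \<xi>) <= \<beta> * (2 * sqrt n)" .
   qed (use \<beta>0 x in \<open>auto simp: b_def intro!: sum_nonneg mult_nonneg_nonneg bprob_nonneg\<close>)
   also have "... = \<beta>\<^sup>2 * (2 * d)" using sn by (simp add: power2_eq_square)
   finally have "D\<^sup>2 <= \<beta>\<^sup>2 * (2 * d / u)" using u by (simp add: field_simps)
   also have "... = (\<beta> * sqrt (2 * d / u))\<^sup>2"
   proof -
    have "0 <= 2 * real d / u" using u by simp
    then show ?thesis by (simp only: power_mult_distrib real_sqrt_pow2 of_nat_mult of_nat_numeral)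
   qed
   finally have "D\<^sup>2 <= (\<beta> * sqrt (2 * d / u))\<^sup>2" .
   moreover have "0 <= \<beta> * sqrt (2 * d / u)" using \<beta>0 u by (intro mult_nonneg_nonneg real_sqrt_ge_zero) auto
   ultimately have "D <= \<beta> * sqrt (2 * d / u)" by (rule power2_le_imp_le)
   also have "... <= \<beta> * L" using L(1) \<beta>0 by (rule mult_left_mono)
   finally have "D <= \<beta> * L" .
   with D(1) show ?thesis by (intro exI[of _ D] conjI)
  qed
  define D where "D = (%\<xi>. SOME D. (b n has_real_derivative D) (at \<xi>) \<and> D <= \<beta> * L)"
  have D: "(b n has_real_derivative D \<xi>) (at \<xi>) \<and> D \<xi> <= \<beta> * L" if "pc / 2 <= \<xi>" "\<xi> <= pc" for \<xi>
   unfolding D_def by (rule someI_ex, rule deriv[OF that])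
  obtain \<xi> where \<xi>: "pc - eps < \<xi>" "\<xi> < pc" "b n pc - b n (pc - eps) = (pc - (pc - eps)) * D \<xi>"
   using MVT2[of "pc - eps" pc "b n" D] D eps eps0 by auto
  have "b n pc - b n (pc - eps) <= eps * (\<beta> * L)" using \<xi> D[of \<xi>] eps eps0 by (simp add: mult_left_mono)
  also have "... = \<beta> / (2 * sqrt n)" using L0 by (simp add: eps_def)
  finally have 1: "b n pc - \<beta> / (2 * sqrt n) <= b n (pc - eps)" by simp
  have "b n pc = \<beta> / sqrt n" using n sn by (simp add: field_simps)
  then have 2: "\<beta> / (2 * sqrt n) <= b n (pc - eps)" using 1 by (simp add: field_simps)
  have pe: "pc / 2 <= pc - eps" "pc - eps < pc" "0 <= pc - eps" "pc - eps <= 1" using eps eps0 pc by auto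
  have "real n * b n (pc - eps) <= XF F (pc - eps) v" unfolding b_def XF_def using pe by (intro markov_card)
  also have "... <= chi (pc - eps)" using pe F v by (intro XF_le_chi)
  also have "... <= A / eps" using A(2)[OF pe(1,2)] by simp
  also have "... = 2 * L * A * sqrt n" by (simp add: eps_def)
  finally have "real n * b n (pc - eps) <= 2 * L * A * sqrt n" .
  moreover have "sqrt n * (sqrt n * b n (pc - eps)) = real n * b n (pc - eps)"
   unfolding mult.assoc[symmetric] by simp
  moreover have "2 * L * A * sqrt n = sqrt n * (2 * L * A)" by (rule mult.commute)
  ultimately have "sqrt n * (sqrt n * b n (pc - eps)) <= sqrt n * (2 * L * A)" by (simp only:)
  then have "sqrt n * b n (pc - eps) <= 2 * L * A" using sn by (simp only: mult_le_cancel_left_pos)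
  moreover have "\<beta> / 2 <= sqrt n * b n (pc - eps)" using 2 sn by (simp add: field_simps)
  ultimately have "\<beta> <= 4 * L * A" by simp
  then have "\<beta> / sqrt m <= 4 * L * A / sqrt m" by (intro divide_right_mono) auto
  moreover have "b m pc <= \<beta> / sqrt m" using m by (intro rec) auto
  ultimately show ?thesis unfolding b_def by simp
 qed
 have "0 < 4 * L * A" using L0 A by simp
 then show ?thesis using main by (intro exI[of _ "4 * L * A"]) auto
qed

end

section \<open>One-arm estimates\<close>

lemma lv_arm_iff:
 assumes "lv w A n \<noteq> {}" shows "\<exists>a\<in>A. lv w {a} n \<noteq> {}"
proof -
 obtain y where y: "y \<in> lv w A n" using assms by auto
 then have "y \<in> reach w A n" by (simp add: lv_def)
 then obtain a where a: "a \<in> A" "y \<in> reach w {a} n" unfolding reach_iff[of y w A] by auto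
 have "y \<notin> reach w {a} m" if m: "m < n" for m
 proof
  assume "y \<in> reach w {a} m"
  then have "y \<in> reach w A m" using a(1) unfolding reach_iff[of y w A] by auto
  then show False using y m by (auto simp: lv_def)
 qed
 then have "y \<in> lv w {a} n" using a(2) by (auto simp: lv_def)
 then show ?thesis using a(1) by auto
qed

lemma lv_arm_mono: "lv w A n \<noteq> {} ==> m <= n ==> lv w A m \<noteq> {}"
 using lv_empty_mono[of w A m n] by auto

lemma arm_union:
 fixes p g :: real and A :: "'v set"
 assumes p: "0 <= p" "p <= 1" and A: "finite A"
  and g: "\<And>a. a \<in> A ==> bprob F p (%w. lv w {a} n \<noteq> {}) <= g"
 shows "bprob F p (%w. lv w A n \<noteq> {}) <= card A * g"
proof -
 have "bprob F p (%w. lv w A n \<noteq> {}) <= bexp F p (%w. \<Sum>a\<in>A. of_bool (lv w {a} n \<noteq> {}))"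
 proof (rule bexp_mono[OF p])
  fix w
  show "of_bool (lv w A n \<noteq> {}) <= (\<Sum>a\<in>A. of_bool (lv w {a} n \<noteq> {}) :: real)"
  proof (cases "lv w A n = {}")
   case False
   then obtain a where a: "a \<in> A" "lv w {a} n \<noteq> {}" using lv_arm_iff[of w A n] by auto
   have "(of_bool (lv w {a} n \<noteq> {}) :: real) <= (\<Sum>a\<in>A. of_bool (lv w {a} n \<noteq> {}))"
    using A a(1) by (intro member_le_sum) auto
   then show ?thesis using a False by simp
  qed (simp add: sum_nonneg)
 qed
 also have "... = (\<Sum>a\<in>A. bprob F p (%w. lv w {a} n \<noteq> {}))" by (rule bexp_sum)
 also have "... <= card A * g" using sum_bounded_above[of A _ g, OF g] by simp
 finally show ?thesis .
qed

text \<open>A certificate of at most \<open>n\<close> open edges survives thinning with probability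
  at least \<open>s ^ n\<close>. \<open>R\<close> sees both configurations, because in the
  supercritical argument the thinned one has to be long while the original one has to stay
  bounded.\<close>

lemma thin_witness:
 fixes p s :: real and F :: "'e set set"
 assumes F: "finite F" and p: "0 <= p" "p <= 1" and s: "0 <= s" "s <= 1"
  and S: "\<And>w. Q w ==> \<exists>S\<subseteq>w. card S <= n \<and> (\<forall>\<sigma>. S \<subseteq> \<sigma> --> \<sigma> \<subseteq> w --> R \<sigma> w)"
 shows "s ^ n * bprob F p Q <= bexp F p (%w. bprob F s (%\<sigma>. R (w \<inter> \<sigma>) w))"
proof -
 have "s ^ n * bprob F p Q = bexp F p (%w. s ^ n * of_bool (Q w))" by (rule bexp_cmult[symmetric])
 also have "... <= bexp F p (%w. bprob F s (%\<sigma>. R (w \<inter> \<sigma>) w))"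
 proof (rule bexp_mono[OF p])
  fix w assume w: "w \<subseteq> F"
  show "s ^ n * of_bool (Q w) <= bprob F s (%\<sigma>. R (w \<inter> \<sigma>) w)"
  proof (cases "Q w")
   case False
   then show ?thesis using s by (simp add: bprob_nonneg)
  next
   case True
   from S[OF this] obtain S where S: "S \<subseteq> w" "card S <= n" "\<forall>\<sigma>. S \<subseteq> \<sigma> --> \<sigma> \<subseteq> w --> R \<sigma> w"
    by (elim exE conjE) (rule that, assumption+)
   have "s ^ n <= s ^ card S" using s S(2) by (intro power_decreasing)
   also have "... = bprob F s (%\<sigma>. S \<subseteq> \<sigma>)" using bprob_open[OF F, of S s] S(1) w by simp
   also have "... <= bprob F s (%\<sigma>. R (w \<inter> \<sigma>) w)" using S by (intro bprob_mono[OF s]) auto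
   finally show ?thesis using True by simp
  qed
 qed
 finally show ?thesis .
qed

lemma thin_level_and:
 fixes p s :: real and A :: "'v set" and F :: "'v set set"
 assumes "finite F" "0 <= p" "p <= 1" "0 <= s" "s <= 1"
 shows "s ^ n * bprob F p (%w. lv w A n \<noteq> {} \<and> R w) <= bexp F p (%w. bprob F s (%\<sigma>. lv (w \<inter> \<sigma>) A n \<noteq> {} \<and> R w))"
proof (rule thin_witness[OF assms, where R = "%\<sigma> w. lv \<sigma> A n \<noteq> {} \<and> R w"])
 fix w assume "lv w A n \<noteq> {} \<and> R w"
 then obtain y where y: "y \<in> lv w A n" and R: "R w" by auto
 then have "y \<in> reach w A n" by (simp add: lv_def)
 then obtain S where S: "S \<subseteq> w" "card S <= n" "y \<in> reach S A n"
  using reach_witness[of y w A n] by auto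
 have "lv \<sigma> A n \<noteq> {} \<and> R w" if "S \<subseteq> \<sigma>" "\<sigma> \<subseteq> w" for \<sigma>
  using lv_thin[OF y S(3) that] R by auto
 then show "\<exists>S\<subseteq>w. card S <= n \<and> (\<forall>\<sigma>. S \<subseteq> \<sigma> --> \<sigma> \<subseteq> w --> lv \<sigma> A n \<noteq> {} \<and> R w)"
  using S by (intro exI[of _ S]) auto
qed

lemma thin_level:
 fixes p s :: real and A :: "'v set" and F :: "'v set set"
 assumes F: "finite F" and p: "0 <= p" "p <= 1" and s: "0 <= s" "s <= 1"
 shows "s ^ n * bprob F p (%w. lv w A n \<noteq> {}) <= bprob F (p * s) (%w. lv w A n \<noteq> {})"
 using thin_level_and[OF assms, of n A "%_. True"] bexp_thin[OF F, of p s] by simp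

context l2_percolation
begin

text \<open>Quantified over all finite edge sets: a bound for one volume does not pass to its
  subsets, as the event is not monotone, yet every exploration leaves percolation on a
  subset.\<close>

definition arm_le :: "real => nat => real => bool" where
 "arm_le p n g \<longleftrightarrow> (\<forall>F v. finite F --> F \<subseteq> E --> v \<in> V --> bprob F p (%w. lv w {v} n \<noteq> {}) <= g)"

lemma arm_leD: "arm_le p n g ==> finite F ==> F \<subseteq> E ==> v \<in> V ==> bprob F p (%w. lv w {v} n \<noteq> {}) <= g"
 by (simp add: arm_le_def)

lemma arm_le_nonneg:
 assumes "arm_le p n g" "0 <= p" "p <= 1" shows "0 <= g"
proof -
 obtain v where v: "v \<in> V" using nonempty by auto
 have "0 <= bprob {} p (%w. lv w {v} n \<noteq> {})" using assms by (intro bprob_nonneg)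
 also have "... <= g" using assms v by (intro arm_leD) auto
 finally show ?thesis .
qed

lemma arm_le_mono:
 assumes "arm_le p m g" "0 <= p" "p <= 1" "m <= n" "g <= h" shows "arm_le p n h"
 unfolding arm_le_def
proof (intro allI impI)
 fix F v assume F: "finite F" "F \<subseteq> E" "v \<in> V"
 have "bprob F p (%w. lv w {v} n \<noteq> {}) <= bprob F p (%w. lv w {v} m \<noteq> {})"
  by (rule bprob_mono[OF assms(2,3)]) (rule lv_arm_mono[OF _ assms(4)])
 also have "... <= g" using assms F by (intro arm_leD)
 finally show "bprob F p (%w. lv w {v} n \<noteq> {}) <= h" using assms by simp
qed

lemma arm_set:
 fixes g p :: real
 assumes "arm_le p n g" "0 <= p" "p <= 1" "finite F" "F \<subseteq> E" "finite A" "A \<subseteq> V"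
 shows "bprob F p (%w. lv w A n \<noteq> {}) <= card A * g"
 using assms by (intro arm_union arm_leD) auto

text \<open>Stop at the first level with at most \<open>N\<close> vertices; at least
  \<open>k\<close> further levels must be survived from there, which by a union bound over its
  vertices costs \<open>N * g\<close>.\<close>

lemma thin_level_stop:
 fixes g p N :: real
 assumes g: "arm_le p k g" and p: "0 <= p" "p <= 1" and W: "finite W" "W \<subseteq> V" and N: "0 <= N"
  and F: "finite F" "F \<subseteq> E" "\<Union>F \<subseteq> W" and A: "A \<subseteq> W"
 shows "bprob F p (%w. (\<exists>j<m. real (card (lv w A j)) <= N) \<and> lv w A (m + k) \<noteq> {}) <= N * g"
 using F A
proof (induction m arbitrary: F A)
 case 0
 then show ?case using N arm_le_nonneg[OF g p] by (simp add: bexp_const)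
next
 case (Suc m)
 have g0: "0 <= g" by (rule arm_le_nonneg[OF g p])
 have A: "finite A" "A \<subseteq> V" using Suc.prems W by (auto intro: finite_subset)
 show ?case
 proof (cases "real (card A) <= N")
  case True
  have "bprob F p (%w. (\<exists>j<Suc m. real (card (lv w A j)) <= N) \<and> lv w A (Suc m + k) \<noteq> {})
   <= bprob F p (%w. lv w A (Suc m + k) \<noteq> {})" using p by (intro bprob_mono) auto
  also have "... <= card A * g"
  proof (rule arm_set[OF _ p Suc.prems(1,2) A])
   show "arm_le p (Suc m + k) g" by (rule arm_le_mono[OF g p]) auto
  qed
  also have "... <= N * g" using True g0 by (rule mult_right_mono)
  finally show ?thesis .
 next
  case False
  let ?\<Psi> = "%B w. of_bool ((\<exists>j<m. real (card (lv w B j)) <= N) \<and> lv w B (m + k) \<noteq> {}) :: real"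
  have "bprob F p (%w. (\<exists>j<Suc m. real (card (lv w A j)) <= N) \<and> lv w A (Suc m + k) \<noteq> {})
   <= bexp F p (%w. ?\<Psi> (lv w A 1) (rs w A 1))"
  proof (rule bexp_mono[OF p])
   fix w
   have s: "lv (rs w A 1) (lv w A 1) i = lv w A (Suc i)" for i
    using lv_add[of w A 1 i] by simp
   show "of_bool ((\<exists>j<Suc m. real (card (lv w A j)) <= N) \<and> lv w A (Suc m + k) \<noteq> {})
    <= ?\<Psi> (lv w A 1) (rs w A 1)"
    unfolding s using False by (auto simp: less_Suc_eq_0_disj)
  qed
  also have "... <= bexp F p (%w. (%_. N * g) (lv w A 1))"
  proof (rule bexp_level[OF Suc.prems(1) p Suc.prems(3,4)])
   fix F' B assume B: "F' \<subseteq> F" "B \<subseteq> W"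
   then have "finite F'" "F' \<subseteq> E" "\<Union>F' \<subseteq> W"
    using Suc.prems finite_subset[of F' F] Union_mono[of F' F] by blast+
   then show "bexp F' p (?\<Psi> B) <= N * g" using B by (intro Suc.IH)
  qed
  also have "... = N * g" using Suc.prems by (simp add: bexp_const)
  finally show ?thesis .
 qed
qed

lemma level_card_sum:
 assumes "finite w" "w \<subseteq> E" "finite J"
 shows "(\<Sum>j\<in>J. card (lv w {v} j)) <= card (CL w {v})"
proof -
 have f: "finite (lv w {v} j)" for j using assms edge_fin[OF assms(2)] by (intro lv_finite) auto
 have "(\<Sum>j\<in>J. card (lv w {v} j)) = card (\<Union>j\<in>J. lv w {v} j)"
  using assms(3) f by (intro card_UN_disjoint[symmetric]) (simp_all add: lv_disjoint)
 also have "... <= card (CL w {v})"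
 proof (rule card_mono)
  show "finite (CL w {v})" using assms by (intro CL_finite[of w]) auto
  show "(\<Union>j\<in>J. lv w {v} j) \<subseteq> CL w {v}" by (intro UN_least lv_subset_CL)
 qed
 finally show ?thesis .
qed

text \<open>Three stretches of length \<open>r\<close>. Reaching level \<open>r\<close> costs
  \<open>g\<close>. If the volume stays below \<open>\<mu> * r ^ 2\<close>, one of the next
  \<open>r\<close> levels has at most \<open>\<mu> * r\<close> vertices, and surviving from it for
  another \<open>r\<close> levels costs \<open>\<mu> * r * g\<close>.\<close>

lemma one_arm_step:
 fixes D B \<mu> p :: real and r :: nat
 assumes p: "0 <= p" "p <= 1" and B: "\<And>F v n. finite F ==> F \<subseteq> E ==> v \<in> V ==> 1 <= n ==>
   bprob F p (%w. n <= card (CL w {v})) <= B / sqrt n" "0 < B"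
  and r: "1 <= r" and g: "arm_le p r g" and \<mu>: "0 < \<mu>"
 shows "arm_le p (3 * r) (B / (sqrt \<mu> * r) + g * (\<mu> * r * g))"
 unfolding arm_le_def
proof (intro allI impI)
 fix F :: "'v set set" and v assume F: "finite F" "F \<subseteq> E" and v: "v \<in> V"
 define n where "n = nat \<lceil>\<mu> * r\<^sup>2\<rceil>"
 have n: "\<mu> * r\<^sup>2 <= n" unfolding n_def by linarith
 have lr: "0 < \<mu> * r\<^sup>2" using \<mu> r by simp
 then have n1: "1 <= n" unfolding n_def by linarith
 define W where "W = insert v (\<Union>F)"
 have W: "finite W" "W \<subseteq> V" "\<Union>F \<subseteq> W" "{v} \<subseteq> W"
  using F v finite_vertices edges_V unfolding W_def by auto
 let ?\<Psi> = "%A w. of_bool ((\<exists>j<r. real (card (lv w A j)) <= \<mu> * r) \<and> lv w A (r + r) \<noteq> {}) :: real"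
 have g0: "0 <= g" by (rule arm_le_nonneg[OF g p])
 have "bprob F p (%w. lv w {v} (3 * r) \<noteq> {})
  <= bexp F p (%w. of_bool (n <= card (CL w {v})) + ?\<Psi> (lv w {v} r) (rs w {v} r))"
 proof (rule bexp_mono[OF p])
  fix w assume w: "w \<subseteq> F"
  have s: "lv (rs w {v} r) (lv w {v} r) i = lv w {v} (r + i)" for i
   using lv_add[of w "{v}" r i] by simp
  have "(\<exists>j<r. real (card (lv w {v} (r + j))) <= \<mu> * r)" if "\<not> n <= card (CL w {v})"
  proof (rule ccontr)
   assume no: "\<not> ?thesis"
   have "w \<subseteq> E" "finite w" using w F by (auto intro: finite_subset)
   have "real (\<Sum>j\<in>(%j. r + j) ` {..<r}. card (lv w {v} j)) <= card (CL w {v})"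
    unfolding of_nat_le_iff using \<open>w \<subseteq> E\<close> \<open>finite w\<close> by (intro level_card_sum) auto
   moreover have "real (\<Sum>j\<in>(%j. r + j) ` {..<r}. card (lv w {v} j)) = (\<Sum>j<r. real (card (lv w {v} (r + j))))"
    by (subst sum.reindex) auto
   moreover have "(\<Sum>j<r. real (card (lv w {v} (r + j)))) \<ge> (\<Sum>j<r. \<mu> * r)"
    using no by (intro sum_mono) (auto simp: not_le less_imp_le)
   ultimately have "\<mu> * r\<^sup>2 <= card (CL w {v})" by (simp add: power2_eq_square mult_ac)
   then have "n <= card (CL w {v})" unfolding n_def by linarith
   then show False using that by simp
  qed
  moreover have 3: "3 * r = r + (r + r)" by simp
  ultimately show "of_bool (lv w {v} (3 * r) \<noteq> {})
   <= of_bool (n <= card (CL w {v})) + ?\<Psi> (lv w {v} r) (rs w {v} r)"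
   unfolding s 3 by auto
 qed
 also have "... = bprob F p (%w. n <= card (CL w {v})) + bexp F p (%w. ?\<Psi> (lv w {v} r) (rs w {v} r))"
  by (rule bexp_add)
 also have "... <= B / (sqrt \<mu> * r) + g * (\<mu> * r * g)"
 proof (rule add_mono)
  have "bprob F p (%w. n <= card (CL w {v})) <= B / sqrt n" by (rule B(1)[OF F v n1])
  also have "... <= B / sqrt (\<mu> * r\<^sup>2)"
   using B n n1 lr by (intro divide_left_mono mult_pos_pos) auto
  also have "sqrt (\<mu> * r\<^sup>2) = sqrt \<mu> * r" by (simp add: real_sqrt_mult)
  finally show "bprob F p (%w. n <= card (CL w {v})) <= B / (sqrt \<mu> * r)" .
  have lg: "0 <= \<mu> * r * g" using \<mu> g0 by simp
  have "bexp F p (%w. ?\<Psi> (lv w {v} r) (rs w {v} r))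
   <= bexp F p (%w. (%A. of_bool (A \<noteq> {}) * (\<mu> * r * g)) (lv w {v} r))"
  proof (rule bexp_level[OF F(1) p W(3,4)])
   fix F' B assume B: "F' \<subseteq> F" "B \<subseteq> W"
   show "bexp F' p (?\<Psi> B) <= of_bool (B \<noteq> {}) * (\<mu> * r * g)"
   proof (cases "B = {}")
    case True
    then show ?thesis using B F by (simp add: bexp_const finite_subset)
   next
    case False
    have "bexp F' p (?\<Psi> B) <= \<mu> * r * g"
     using \<mu> W B F by (intro thin_level_stop[OF g p W(1,2)]) (auto intro: finite_subset)
    then show ?thesis using False by simp
   qed
  qed
  also have "... = bprob F p (%w. lv w {v} r \<noteq> {}) * (\<mu> * r * g)" by (simp add: bexp_multc)
  also have "... <= g * (\<mu> * r * g)" using lg by (intro mult_right_mono arm_leD[OF g F v])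
  finally show "bexp F p (%w. ?\<Psi> (lv w {v} r) (rs w {v} r)) <= g * (\<mu> * r * g)" .
 qed
 finally show "bprob F p (%w. lv w {v} (3 * r) \<noteq> {}) <= B / (sqrt \<mu> * r) + g * (\<mu> * r * g)" .
qed

lemma arm_le_1: "0 <= p ==> p <= 1 ==> 1 <= g ==> arm_le p n g"
 unfolding arm_le_def by (auto intro: order_trans[OF bprob_le_1])

lemma one_arm_critical: "\<exists>D\<ge>1. \<forall>n\<ge>1. \<forall>p. 0 <= p --> p <= pc --> arm_le p n (D / n)"
proof -
 obtain B where B: "0 < B" "\<forall>F v n. finite F --> F \<subseteq> E --> v \<in> V --> 1 <= n -->
  bprob F pc (%w. n <= card (CL w {v})) <= B / sqrt n" using volume_tail by auto
 \<comment> \<open>With \<open>\<mu> = (12 * B / D) ^ 2\<close> both terms of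
   \<open>one_arm_step\<close> are at most \<open>D / (12 * r)\<close>, the second because
   \<open>D >= 1728 * B ^ 2\<close>. They add up to \<open>D / (6 * r)\<close>, and
   \<open>n <= 6 * r\<close>. The \<open>3\<close> makes the claim trivial for
   \<open>n < 3\<close>.\<close>
 define D where "D = max 3 (1728 * B\<^sup>2)"
 have D: "3 <= D" "1728 * B\<^sup>2 <= D" by (auto simp: D_def)
 define \<mu> where "\<mu> = (12 * B / D)\<^sup>2"
 have \<mu>0: "0 < \<mu>" using B D by (simp add: \<mu>_def)
 have sq: "sqrt \<mu> = 12 * B / D" using B D by (simp add: \<mu>_def)
 have "arm_le p n (D / n)" if n: "1 <= n" and p: "0 <= p" "p <= pc" for n :: nat and p
  using n
 proof (induction n rule: less_induct)
  case (less n)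
  have p1: "p <= 1" using p pc by simp
  \<comment> \<open>The volume event is monotone in \<open>p\<close>, unlike the level event. So the
    volume bound is carried from \<open>pc\<close> down to \<open>p\<close>, and the induction is
    run at \<open>p\<close> itself.\<close>
  have Bp: "bprob F p (%w. n <= card (CL w {v})) <= B / sqrt n"
   if F: "finite F" "F \<subseteq> E" and v: "v \<in> V" and n: "1 <= n" for F v and n :: nat
  proof -
   have "bprob F p (%w. n <= card (CL w {v})) <= bprob F pc (%w. n <= card (CL w {v}))"
    using p pc by (intro bexp_mono_p F incr_size) auto
   also have "... <= B / sqrt n" using B F v n by simp
   finally show ?thesis .
  qed
  show ?case
  proof (cases "n < 3")
   case True
   then have "1 <= D / n" using D less.prems by (simp add: field_simps)
   then show ?thesis using p p1 by (intro arm_le_1)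
  next
   case False
   define r where "r = n div 3"
   have "n = 3 * r + n mod 3" "n mod 3 < 3" by (simp_all add: r_def)
   moreover from this have "1 <= r" using False by (cases r) auto
   ultimately have r: "1 <= r" "r < n" "3 * r <= n" "n <= 6 * r" by linarith+
   have g: "arm_le p r (D / r)" using r by (intro less.IH)
   have "arm_le p (3 * r) (B / (sqrt \<mu> * r) + D / r * (\<mu> * r * (D / r)))"
    by (rule one_arm_step[OF p(1) p1 Bp B(1) r(1) g \<mu>0])
   then show ?thesis
   proof (rule arm_le_mono[OF _ p(1) p1 r(3)])
    have r0: "0 < real r" "0 < real n" "0 < D" using r D by auto
    have "B / (sqrt \<mu> * r) = D / 12 / r" using B D r0 unfolding sq by (simp add: field_simps)
    moreover have "D / r * (\<mu> * r * (D / r)) = 144 * B\<^sup>2 / r"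
     using r0 unfolding \<mu>_def by (simp add: field_simps power2_eq_square)
    moreover have "144 * B\<^sup>2 / r <= D / 12 / r" using D r0 by (intro divide_right_mono) auto
    moreover have "D / 12 / r + D / 12 / r = D / (6 * r)" by simp
    moreover have "D / (6 * r) <= D / n"
     using r(4) r0 by (intro divide_left_mono) auto
    ultimately show "B / (sqrt \<mu> * r) + D / r * (\<mu> * r * (D / r)) <= D / n" by linarith
   qed
  qed
 qed
 then show ?thesis using D by (intro exI[of _ D]) auto
qed

lemma incr_lv_arm:
 fixes p q :: real
 assumes "finite F" "0 <= p" "p <= q" "q <= 1" "0 < q"
 shows "(p / q) ^ n * bprob F q (%w. lv w A n \<noteq> {}) <= bprob F p (%w. lv w A n \<noteq> {})"
 using thin_level[of F q "p / q" n A] assms by simp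

text \<open>Thin from \<open>p\<close> to \<open>pc\<close>. As long as
  \<open>(p - pc) * n <= 1\<close> this costs a factor of at most
  \<open>exp (1 / pc)\<close>.\<close>

lemma one_arm_near_critical:
 "\<exists>D\<ge>1. \<forall>n\<ge>1. \<forall>p. pc <= p --> p <= 1 --> (p - pc) * n <= 1 --> arm_le p n (D / n)"
proof -
 obtain D where D: "1 <= D" "\<forall>n\<ge>1. \<forall>p. 0 <= p --> p <= pc --> arm_le p n (D / n)"
  using one_arm_critical by auto
 let ?c = "exp (1 / pc)"
 have c: "1 <= ?c" using pc by simp
 have "arm_le p n (?c * D / n)" if n: "1 <= n" and p: "pc <= p" "p <= 1" "(p - pc) * n <= 1" for n :: nat and p
  unfolding arm_le_def
 proof (intro allI impI)
  fix F v assume F: "finite F" "F \<subseteq> E" and v: "v \<in> V"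
  let ?b = "bprob F p (%w. lv w {v} n \<noteq> {})"
  have b0: "0 <= ?b" using p pc by (intro bprob_nonneg) auto
  have "(pc / p) ^ n * ?b <= bprob F pc (%w. lv w {v} n \<noteq> {})" using F p pc by (intro incr_lv_arm) auto
  also have "... <= D / n" using D n F v pc by (intro arm_leD) auto
  finally have 1: "(pc / p) ^ n * ?b <= D / n" .
  have "(p / pc) ^ n <= exp ((p - pc) / pc) ^ n"
  proof (rule power_mono)
   have "p / pc = 1 + (p - pc) / pc" using pc by (simp add: field_simps)
   then show "p / pc <= exp ((p - pc) / pc)" using exp_ge_add_one_self[of "(p - pc) / pc"] by simp
  qed (use p pc in auto)
  also have "... = exp (((p - pc) * n) / pc)" by (simp add: exp_of_nat_mult[symmetric] mult_ac)
  also have "... <= ?c" using p pc by (simp add: divide_right_mono)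
  finally have 2: "(p / pc) ^ n <= ?c" .
  have "(p / pc) ^ n * (pc / p) ^ n = 1" using p pc by (simp add: power_mult_distrib[symmetric])
  then have "?b = (p / pc) ^ n * ((pc / p) ^ n * ?b)" by (simp add: mult.assoc[symmetric])
  also have "... <= ?c * (D / n)" using 1 2 b0 p pc by (intro mult_mono) auto
  finally show "?b <= ?c * D / n" by simp
 qed
 moreover have "1 <= ?c * D" using c D mult_mono[of 1 ?c 1 D] by simp
 ultimately show ?thesis by (intro exI[of _ "?c * D"]) auto
qed

text \<open>The mean level sizes add up to at most \<open>chi p\<close>, so among
  \<open>M >= 4 * chi p\<close> levels one has mean size at most \<open>1 / 4\<close>; restart the
  search from it.\<close>

lemma subcritical_step:
 fixes p A g :: real
 assumes p: "0 <= p" "p < pc" and A: "chi p <= A / (pc - p)" and M: "4 * A / (pc - p) <= real M" "1 <= M"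
  and g: "arm_le p k g"
 shows "arm_le p (M + k) (g / 4)"
 unfolding arm_le_def
proof (intro allI impI)
 fix F :: "'v set set" and v assume F: "finite F" "F \<subseteq> E" and v: "v \<in> V"
 have p1: "p <= 1" using p pc by simp
 have g0: "0 <= g" by (rule arm_le_nonneg[OF g p(1) p1])
 define W where "W = insert v (\<Union>F)"
 have W: "finite W" "W \<subseteq> V" "\<Union>F \<subseteq> W" "{v} \<subseteq> W"
  using F v finite_vertices edges_V unfolding W_def by auto
 define z where "z j = bexp F p (%w. real (card (lv w {v} j)))" for j
 have "\<exists>j<M. z j <= 1 / 4"
 proof (rule ccontr)
  assume no: "\<not> ?thesis"
  have "real M * (1 / 4) = (\<Sum>j<M. 1 / 4)" by simp
  also have "... < (\<Sum>j<M. z j)" using no M by (intro sum_strict_mono) (auto simp: not_le lessThan_empty_iff)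
  also have "... = bexp F p (%w. \<Sum>j<M. real (card (lv w {v} j)))" unfolding z_def by (rule bexp_sum[symmetric])
  also have "... <= XF F p v" unfolding XF_def
  proof (rule bexp_mono[OF p(1) p1])
   fix w assume "w \<subseteq> F"
   then have "(\<Sum>j<M. card (lv w {v} j)) <= card (CL w {v})"
    using F by (intro level_card_sum) (auto intro: finite_subset)
   then show "(\<Sum>j<M. real (card (lv w {v} j))) <= real (card (CL w {v}))"
    unfolding of_nat_sum[symmetric] of_nat_le_iff .
  qed
  also have "... <= chi p" by (rule XF_le_chi[OF p F v])
  also have "... <= A / (pc - p)" by (rule A)
  finally have "real M < 4 * (A / (pc - p))" by linarith
  then show False using M by simp
 qed
 then obtain j where j: "j < M" "z j <= 1 / 4" by auto
 have "bprob F p (%w. lv w {v} (M + k) \<noteq> {}) <= bprob F p (%w. lv w {v} (j + k) \<noteq> {})"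
  by (rule bprob_mono[OF p(1) p1], rule lv_arm_mono[of _ _ "M + k"]) (use j in auto)
 also have "... = bexp F p (%w. (%A w. of_bool (lv w A k \<noteq> {})) (lv w {v} j) (rs w {v} j))"
  by (simp add: lv_add)
 also have "... <= bexp F p (%w. (%A. real (card A) * g) (lv w {v} j))"
 proof (rule bexp_level[OF F(1) p(1) p1 W(3,4)])
  fix F' B assume B: "F' \<subseteq> F" "B \<subseteq> W"
  show "bprob F' p (%w. lv w B k \<noteq> {}) <= card B * g"
   using B F W by (intro arm_set[OF g p(1) p1]) (auto intro: finite_subset)
 qed
 also have "... = z j * g" by (simp add: z_def bexp_multc)
 also have "... <= 1 / 4 * g" using j(2) g0 by (rule mult_right_mono)
 finally show "bprob F p (%w. lv w {v} (M + k) \<noteq> {}) <= g / 4" by simp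
qed

text \<open>Each block of \<open>M\<close> levels gains a factor \<open>4\<close>. One factor
  \<open>2\<close> of it pays for replacing \<open>D / M\<close>, the bound for a single block, by a
  multiple of \<open>D / n\<close>; the other one is the exponential decay.\<close>

lemma subcritical_decay:
 "\<exists>D c. 0 < D \<and> 0 < c \<and> (\<forall>n\<ge>1. \<forall>p. pc / 2 <= p --> p <= pc --> arm_le p n (D / n * exp (- c * (pc - p) * n)))"
proof -
 obtain D where D: "1 <= D" "\<forall>n\<ge>1. \<forall>p. 0 <= p --> p <= pc --> arm_le p n (D / n)"
  using one_arm_critical by auto
 obtain A where A: "0 < A" "\<forall>p. pc / 2 <= p --> p < pc --> chi p <= A / (pc - p)" using chi_bound by auto
 define L where "L = 4 * A + 1"
 have L: "0 < L" using A by (simp add: L_def)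
 define c where "c = ln 2 / L"
 have c: "0 < c" using L by (simp add: c_def)
 have "arm_le p n (8 * D / n * exp (- c * (pc - p) * n))" if n: "1 <= n" and p: "pc / 2 <= p" "p <= pc" for n :: nat and p
 proof (cases "p = pc")
  case True
  have "arm_le pc n (D / n)" using D n pc by simp
  then have "arm_le pc n (8 * D / n)" using pc D(1) by (rule_tac arm_le_mono) (auto intro!: divide_right_mono)
  then show ?thesis using True by simp
 next
  case False
  define eps where "eps = pc - p"
  have eps: "0 < eps" "eps <= 1" using False p pc by (auto simp: eps_def)
  have p01: "0 <= p" "p < pc" "p <= 1" using p pc eps by (auto simp: eps_def)
  define M where "M = nat \<lceil>4 * A / eps\<rceil>"
  have Aeps: "0 < 4 * A / eps" using A eps by simp
  have M1: "1 <= M" "4 * A / eps <= real M" using Aeps unfolding M_def by linarith+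
  have "real M <= 4 * A / eps + 1" using Aeps unfolding M_def by linarith
  then have "eps * real M <= eps * (4 * A / eps + 1)" using eps by (intro mult_left_mono) auto
  also have "... = 4 * A + eps" using eps by (simp add: field_simps)
  finally have M: "eps * real M <= L" using eps by (simp add: L_def)
  have step: "arm_le p (M + k) (g / 4)" if "arm_le p k g" for k g
   by (rule subcritical_step[OF p01(1,2) _ _ M1(1) that, of A]) (use A(2) p01 p M1 in \<open>auto simp: eps_def\<close>)
  have iter: "arm_le p (i * M + k) (g / 4 ^ i)" if "arm_le p k g" for i k g
  proof (induction i)
   case (Suc i)
   then show ?case using step[OF Suc.IH] by (simp add: add.assoc mult_ac)
  qed (simp add: that)
  define i where "i = n div M"
  have nlt: "n < (i + 1) * M" using M1 dividend_less_div_times[of M n] by (simp add: i_def)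
  have "c * eps * n <= ln 2 * (i + 1)"
  proof -
   have "eps * real n <= eps * (real (i + 1) * M)"
    using nlt eps unfolding of_nat_mult[symmetric] by (intro mult_left_mono of_nat_mono) auto
   also have "... = real (i + 1) * (eps * real M)" by simp
   also have "... <= real (i + 1) * L" using M by (intro mult_left_mono) auto
   finally have "eps * real n / L <= real (i + 1)" using L by (simp add: field_simps)
   then have "ln 2 * (eps * real n / L) <= ln 2 * real (i + 1)" by (intro mult_left_mono) auto
   then show ?thesis by (simp add: c_def mult_ac)
  qed
  then have "exp (- (ln 2 * (i + 1))) <= exp (- (c * eps * n))" by simp
  moreover have "exp (- (ln 2 * real (i + 1))) = 1 / 2 ^ (i + 1)"
   unfolding exp_minus mult.commute[of "ln 2"] exp_of_nat_mult by (simp add: divide_simps)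
  ultimately have e: "1 / 2 ^ (i + 1) <= exp (- (c * eps * n))" by (simp only:)
  have "arm_le p n (8 * D / n * (1 / 2 ^ (i + 1)))"
  proof (cases "i = 0")
   case True
   have "arm_le p n (D / n)" using D n p01 by simp
   then show ?thesis using True p01 D by (rule_tac arm_le_mono) (auto intro!: divide_right_mono)
  next
   case False
   then obtain j where j: "i = Suc j" by (cases i) auto
   have "arm_le p M (D / M)" using D M1 p01 by simp
   then have *: "arm_le p (j * M + M) (D / M / 4 ^ j)" by (rule iter)
   show ?thesis
   proof (rule arm_le_mono[OF * p01(1,3)])
    have "i * M <= n" by (simp add: i_def)
    then show "j * M + M <= n" by (simp add: j)
    have "real (j + 2) <= 2 * 2 ^ j" by (induction j) auto
    then have "real (j + 2) * real M <= 2 * 2 ^ j * real M" by (intro mult_right_mono) auto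
    then have "real ((i + 1) * M) <= 2 * 2 ^ j * M" using j by (simp add: algebra_simps)
    moreover have "real n <= real ((i + 1) * M)" using nlt by linarith
    ultimately have "real n <= 2 * 2 ^ j * M" by simp
    then have "real n * 2 ^ j <= 2 * 4 ^ j * M"
     using mult_right_mono[of "real n" "2 * 2 ^ j * M" "2 ^ j"] by (simp add: power_mult_distrib[symmetric] mult_ac)
    then have "D * (real n * 2 ^ j) <= D * (2 * 4 ^ j * M)" using D by (intro mult_left_mono) auto
    then show "D / M / 4 ^ j <= 8 * D / n * (1 / 2 ^ (i + 1))"
     using M1 n by (simp add: j field_simps)
   qed
  qed
  then show ?thesis
  proof (rule arm_le_mono[OF _ p01(1,3) order_refl])
   have "8 * D / n * (1 / 2 ^ (i + 1)) <= 8 * D / n * exp (- (c * eps * n))"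
    using e D by (intro mult_left_mono) auto
   then show "8 * D / n * (1 / 2 ^ (i + 1)) <= 8 * D / n * exp (- c * (pc - p) * n)" by (simp add: eps_def)
  qed
 qed
 then show ?thesis using D c by (intro exI[of _ "8 * D"] exI[of _ c]) auto
qed

end

section \<open>Sprinkling above criticality\<close>

text \<open>A Gronwall argument: the hypothesis bounds the logarithmic derivative of the mean of
  \<open>(1 - h) ^ N\<close> in \<open>h\<close> by \<open>- k\<close>, and at \<open>h = 0\<close>
  this mean is \<open>1\<close>.\<close>

lemma exp_sprinkle_bound:
 fixes N :: "'i set => nat" and p k \<eta> :: real
 assumes F: "finite F" and p: "0 <= p" "p <= 1" and \<eta>: "0 <= \<eta>" "\<eta> < 1"
  and k: "\<And>h. 0 <= h ==> h <= \<eta> ==>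
   k * bexp F p (%w. (1 - h) ^ N w) <= bexp F p (%w. real (N w) * (1 - h) ^ N w)"
 shows "bexp F p (%w. (1 - \<eta>) ^ N w) <= exp (- k * \<eta>)"
proof -
 define \<phi> where "\<phi> h = bexp F p (%w. (1 - h) ^ N w)" for h :: real
 define \<phi>' where "\<phi>' h = bexp F p (%w. - (real (N w) * (1 - h) ^ (N w - 1)))" for h :: real
 have d: "(\<phi> has_real_derivative \<phi>' h) (at h)" for h
  unfolding \<phi>_def \<phi>'_def bexp_def by (auto intro!: derivative_eq_intros sum.cong)
 have "\<phi> \<eta> * exp (k * \<eta>) <= \<phi> 0 * exp (k * 0)"
 proof (rule DERIV_nonpos_imp_nonincreasing[OF \<eta>(1)])
  fix h assume h: "0 <= h" "h <= \<eta>"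
  have "k * \<phi> h <= bexp F p (%w. real (N w) * (1 - h) ^ N w)" unfolding \<phi>_def by (rule k[OF h])
  also have "... <= bexp F p (%w. real (N w) * (1 - h) ^ (N w - 1))"
   using h \<eta> by (intro bexp_mono[OF p] mult_left_mono power_decreasing) auto
  also have "... = - \<phi>' h" unfolding \<phi>'_def using bexp_cmult[of F p "-1"] by simp
  finally have "\<phi>' h + \<phi> h * k <= 0" by (simp add: mult.commute)
  then have "\<phi>' h * exp (k * h) + \<phi> h * (k * exp (k * h)) <= 0"
   using mult_right_mono[of "\<phi>' h + \<phi> h * k" 0 "exp (k * h)"] by (simp add: algebra_simps)
  moreover have "((%h. \<phi> h * exp (k * h)) has_real_derivative (\<phi>' h * exp (k * h) + \<phi> h * (k * exp (k * h)))) (at h)"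
   by (auto intro!: derivative_eq_intros d)
  ultimately show "\<exists>y. ((%h. \<phi> h * exp (k * h)) has_real_derivative y) (at h) \<and> y <= 0" by blast
 qed
 also have "... = 1" unfolding \<phi>_def using F by (simp add: bexp_const)
 finally have "\<phi> \<eta> <= exp (- k * \<eta>)" by (simp add: exp_minus field_simps)
 then show ?thesis by (simp add: \<phi>_def)
qed

text \<open>Explore the cluster of \<open>a\<close>. Every other \<open>y i\<close> connected to
  \<open>D\<close> is connected to it by unexplored edges, so \<open>N\<close> is at most the count
  in that cluster plus a fresh copy of \<open>N\<close> on fewer edges, and on fewer edges the mean
  of \<open>x ^ N\<close> is at least as large.\<close>

lemma explore_count:
 fixes p x :: real and y :: "'i => 'v" and D :: "'v set"
 assumes F: "finite F" and p: "0 <= p" "p <= 1" and x: "0 <= x" "x <= 1" and I: "finite I"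
 defines "N \<equiv> %w. card {i \<in> I. y i \<in> CL w D}"
 shows "bexp F p (%w. x ^ N w) * bexp F p (%w. of_bool (a \<in> CL w D) * x ^ card {j \<in> I. y j \<in> CL w {a}})
  <= bexp F p (%w. of_bool (a \<in> CL w D) * x ^ N w)"
proof -
 let ?J = "%w. card {j \<in> I. y j \<in> CL w {a}}"
 define \<phi> where "\<phi> = bexp F p (%w. x ^ N w)"
 define h where "h = (%w1 w2. of_bool (a \<in> CL w1 D) * x ^ ?J w1 * x ^ N w2)"
 have t: "CL (tch w (CL w {a})) {a} = CL w {a}" for w by (rule CL_tch)
 have D: "a \<in> CL w D \<longleftrightarrow> CL w {a} \<inter> D \<noteq> {}" for w
  unfolding CL_iff[of a w D] CL_sym[of a w] by auto
 have D2: "a \<in> CL (tch w (CL w {a})) D \<longleftrightarrow> a \<in> CL w D" for w unfolding D t by simp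
 have decr: "incr_on F (%w. - (x ^ N w))"
 proof (rule incr_onI)
  fix A B :: "'v set set" assume "A \<subseteq> B" "B \<subseteq> F"
  then have "N A <= N B" unfolding N_def using I CL_mono[of A B D D] by (intro card_mono) auto
  then show "- (x ^ N A) <= - (x ^ N B)" using x by (simp add: power_decreasing)
 qed
 have "\<phi> * bexp F p (%w. of_bool (a \<in> CL w D) * x ^ ?J w)
  = bexp F p (%w. (of_bool (a \<in> CL w D) * x ^ ?J w) * \<phi>)"
  by (subst bexp_multc) (rule mult.commute)
 also have "... <= bexp F p (%w. bexp (nt F (CL w {a})) p (h (tch w (CL w {a}))))"
 proof (rule bexp_mono[OF p])
  fix w assume "w \<subseteq> F"
  have "bexp (nt F (CL w {a})) p (%w. - (x ^ N w)) <= bexp F p (%w. - (x ^ N w))"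
   by (rule bexp_mono_F[OF F nt_subset p decr])
  then have "\<phi> <= bexp (nt F (CL w {a})) p (%w. x ^ N w)"
   unfolding \<phi>_def using bexp_cmult[of F p "-1" "%w. x ^ N w"]
    bexp_cmult[of "nt F (CL w {a})" p "-1" "%w. x ^ N w"] by simp
  then have "(of_bool (a \<in> CL w D) * x ^ ?J w) * \<phi>
   <= (of_bool (a \<in> CL w D) * x ^ ?J w) * bexp (nt F (CL w {a})) p (%w. x ^ N w)"
   using x by (intro mult_left_mono) auto
  also have "... = bexp (nt F (CL w {a})) p (h (tch w (CL w {a})))"
   unfolding h_def D2 t by (rule bexp_cmult[symmetric])
  finally show "(of_bool (a \<in> CL w D) * x ^ ?J w) * \<phi> <= bexp (nt F (CL w {a})) p (h (tch w (CL w {a})))" .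
 qed
 also have "... = bexp F p (%w. h (tch w (CL w {a})) (nt w (CL w {a})))"
  by (rule bexp_explore[OF F, symmetric])
 also have "... <= bexp F p (%w. of_bool (a \<in> CL w D) * x ^ N w)"
 proof (rule bexp_mono[OF p])
  fix w
  let ?K = "CL w {a}"
  have "N w <= ?J w + N (nt w ?K)"
  proof -
   have "y j \<in> CL (nt w ?K) D" if j: "y j \<in> CL w D" "y j \<notin> ?K" for j
   proof -
    have "{y j} \<inter> CL w {a} = {}" using j by auto
    then have "CL w {y j} = CL (nt w ?K) {y j}" by (rule CL_off)
    moreover obtain b where "b \<in> D" "y j \<in> CL w {b}" using j(1) unfolding CL_iff[of "y j" w D] by auto
    ultimately have "b \<in> D" "y j \<in> CL (nt w ?K) {b}" unfolding CL_sym[of "y j" _ b] by auto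
    then show ?thesis unfolding CL_iff[of "y j" _ D] by auto
   qed
   then have "{j \<in> I. y j \<in> CL w D} \<subseteq> {j \<in> I. y j \<in> ?K} \<union> {j \<in> I. y j \<in> CL (nt w ?K) D}" by auto
   then have "N w <= card ({j \<in> I. y j \<in> ?K} \<union> {j \<in> I. y j \<in> CL (nt w ?K) D})"
    unfolding N_def using I by (intro card_mono) auto
   also have "... <= ?J w + N (nt w ?K)" unfolding N_def by (rule card_Un_le)
   finally show ?thesis .
  qed
  then have "x ^ (?J w + N (nt w ?K)) <= x ^ N w" using x by (intro power_decreasing)
  then show "h (tch w ?K) (nt w ?K) <= of_bool (a \<in> CL w D) * x ^ N w"
   unfolding h_def D2 t by (simp add: power_add)
 qed
 finally show ?thesis unfolding \<phi>_def .
qed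

text \<open>\<open>b\<close> bounds the mean count from below, \<open>U\<close> bounds the mean
  number of pairs in a common cluster joined to \<open>D\<close>. By \<open>explore_count\<close>
  and Bernoulli's inequality, size-biasing multiplies the mean of \<open>(1 - h) ^ N\<close> by at
  least \<open>b - h * U\<close>, hence by at least \<open>b / 2\<close>. Counting only pairs in a
  common cluster makes \<open>U\<close> small enough.\<close>

lemma sprinkle_product:
 fixes p b U \<eta>0 \<eta> :: real and y :: "'i => 'v" and D :: "'v set"
 assumes F: "finite F" and p: "0 <= p" "p <= 1" and I: "finite I" and \<eta>: "0 <= \<eta>" "\<eta> < 1" "2 * \<eta> * U <= b"
  and b: "b <= (\<Sum>i\<in>I. bprob F p (%w. y i \<in> CL w D))"
  and U: "(\<Sum>i\<in>I. \<Sum>j\<in>I. bprob F p (%w. y j \<in> CL w {y i} \<and> y i \<in> CL w D)) <= U"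
 shows "bexp F p (%w. (1 - \<eta>) ^ card {i \<in> I. y i \<in> CL w D}) <= exp (- (b / 2) * \<eta>)"
proof (rule exp_sprinkle_bound[OF F p \<eta>(1,2)])
 fix h :: real assume h: "0 <= h" "h <= \<eta>"
 let ?N = "%w. card {i \<in> I. y i \<in> CL w D}" and ?J = "%w i. card {j \<in> I. y j \<in> CL w {y i}}"
 let ?\<phi> = "bexp F p (%w. (1 - h) ^ ?N w)"
 have c: "real (card {i \<in> I. P i}) = (\<Sum>i\<in>I. of_bool (P i))" for P using I by (simp add: sum.If_cases of_bool_def Int_def)
 have \<phi>: "0 <= ?\<phi>" using h \<eta> by (intro bexp_nonneg[OF p]) auto
 have U0: "0 <= U" by (rule order_trans[OF _ U]) (auto intro!: sum_nonneg bprob_nonneg p)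
 have "h * U <= \<eta> * U" using h U0 by (intro mult_right_mono)
 then have hU: "b / 2 <= b - h * U" using \<eta> by simp
 have i: "?\<phi> * (bprob F p (%w. y i \<in> CL w D) - h * (\<Sum>j\<in>I. bprob F p (%w. y j \<in> CL w {y i} \<and> y i \<in> CL w D)))
  <= bexp F p (%w. of_bool (y i \<in> CL w D) * (1 - h) ^ ?N w)" for i
 proof -
  have "bprob F p (%w. y i \<in> CL w D) - h * (\<Sum>j\<in>I. bprob F p (%w. y j \<in> CL w {y i} \<and> y i \<in> CL w D))
   = bexp F p (%w. of_bool (y i \<in> CL w D) - h * (\<Sum>j\<in>I. of_bool (y j \<in> CL w {y i} \<and> y i \<in> CL w D)))"
   by (simp only: bexp_diff bexp_cmult bexp_sum)
  also have "... <= bexp F p (%w. of_bool (y i \<in> CL w D) * (1 - h) ^ ?J w i)"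
  proof (rule bexp_mono[OF p])
   fix w
   have "1 + real (?J w i) * (- h) <= (1 + (- h)) ^ ?J w i" using h \<eta> by (intro Bernoulli_inequality) auto
   then have "1 - h * (\<Sum>j\<in>I. of_bool (y j \<in> CL w {y i})) <= (1 - h) ^ ?J w i"
    unfolding c by (simp add: mult.commute)
   then show "of_bool (y i \<in> CL w D) - h * (\<Sum>j\<in>I. of_bool (y j \<in> CL w {y i} \<and> y i \<in> CL w D))
    <= of_bool (y i \<in> CL w D) * (1 - h) ^ ?J w i" by simp
  qed
  finally have *: "bprob F p (%w. y i \<in> CL w D) - h * (\<Sum>j\<in>I. bprob F p (%w. y j \<in> CL w {y i} \<and> y i \<in> CL w D))
   <= bexp F p (%w. of_bool (y i \<in> CL w D) * (1 - h) ^ ?J w i)" .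
  show ?thesis
   using mult_left_mono[OF * \<phi>] explore_count[OF F p _ _ I, where x = "1 - h" and y = y and D = D and a = "y i"] h \<eta> by linarith
 qed
 have "b / 2 * ?\<phi> <= (b - h * U) * ?\<phi>" using hU \<phi> by (rule mult_right_mono)
 also have "... <= ((\<Sum>i\<in>I. bprob F p (%w. y i \<in> CL w D)) -
   h * (\<Sum>i\<in>I. \<Sum>j\<in>I. bprob F p (%w. y j \<in> CL w {y i} \<and> y i \<in> CL w D))) * ?\<phi>"
  using \<phi> b mult_left_mono[OF U h(1)] by (intro mult_right_mono) linarith+
 also have "... = (\<Sum>i\<in>I. ?\<phi> * (bprob F p (%w. y i \<in> CL w D) -
   h * (\<Sum>j\<in>I. bprob F p (%w. y j \<in> CL w {y i} \<and> y i \<in> CL w D))))"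
  unfolding sum_distrib_left[symmetric] sum_subtractf by (rule mult.commute)
 also have "... <= (\<Sum>i\<in>I. bexp F p (%w. of_bool (y i \<in> CL w D) * (1 - h) ^ ?N w))"
  by (rule sum_mono) (rule i)
 also have "... = bexp F p (%w. \<Sum>i\<in>I. of_bool (y i \<in> CL w D) * (1 - h) ^ ?N w)" by (rule bexp_sum[symmetric])
 also have "... = bexp F p (%w. real (?N w) * (1 - h) ^ ?N w)"
  unfolding c sum_distrib_right by simp
 finally show "b / 2 * ?\<phi> <= bexp F p (%w. real (?N w) * (1 - h) ^ ?N w)" .
qed

lemma far_arm:
 assumes w: "w \<subseteq> F" and far: "\<And>m. m < M ==> reach F {u} m \<inter> D = {}" and u: "u \<in> CL w D"
 shows "lv w {u} M \<noteq> {}"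
proof -
 obtain b where b: "b \<in> D" "u \<in> CL w {b}" using u unfolding CL_iff[of u w D] by auto
 then have "b \<in> CL w {u}" using CL_sym[of b w u] by simp
 then obtain n where n: "b \<in> lv w {u} n" by (rule CL_lvE)
 have "b \<in> reach F {u} n" using subsetD[OF lv_subset_reach n] reach_mono[OF w order_refl, of "{u}" n] by auto
 then have "M <= n" using far[of n] b(1) by (cases "n < M") auto
 then show ?thesis using n lv_arm_mono[of w "{u}" n M] by auto
qed

context l2_percolation
begin

lemma far_arm_prob:
 assumes g: "arm_le p M g" "0 <= p" "p <= 1" and F: "finite F'" "F' \<subseteq> F" "F \<subseteq> E" "u \<in> V"
  and far: "\<And>m. m < M ==> reach F {u} m \<inter> D = {}"
 shows "bprob F' p (%w. u \<in> CL w D) <= g"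
proof -
 have "bprob F' p (%w. u \<in> CL w D) <= bprob F' p (%w. lv w {u} M \<noteq> {})"
 proof (rule bprob_mono[OF g(2,3)])
  fix w assume "w \<subseteq> F'" "u \<in> CL w D"
  then show "lv w {u} M \<noteq> {}" using F by (intro far_arm[OF _ far]) auto
 qed
 also have "... <= g" using F by (intro arm_leD[OF g(1)]) auto
 finally show ?thesis .
qed

text \<open>Every vertex of \<open>S\<close> escapes to \<open>D\<close> with probability at least
  \<open>b\<close>, and must do so through the boundary; \<open>boundary_L2\<close> turns this into
  a lower bound for the sum of escape probabilities. With \<open>b\<close> and \<open>\<Phi>\<close>
  both of order \<open>p - pc\<close> the sum is of order \<open>(p - pc) * card S\<close>.\<close>

lemma boundary_sum_lower:
 fixes b \<Phi> p :: real
 assumes F: "finite F" "F \<subseteq> E" and p: "0 <= p" "p <= p1" and S: "finite S" "S \<subseteq> V" "D \<inter> S = {}"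
  and b: "0 <= b" "\<And>x. x \<in> S ==> b <= bprob F p (%w. x \<in> CL w D)"
  and \<Phi>: "0 <= \<Phi>" "\<And>z z'. (z, z') \<in> bd F S ==> bprob (nt F S) p (%w. z' \<in> CL w D) <= \<Phi>"
 shows "b\<^sup>2 * card S <= C\<^sup>2 * d * \<Phi> * (\<Sum>i\<in>bd F S. bprob (nt F S) p (%w. snd i \<in> CL w D))"
proof -
 have p': "p <= 1" using p pc by simp
 let ?P = "%z'. bprob (nt F S) p (%w. z' \<in> CL w D)"
 define \<Sigma> where "\<Sigma> = (\<Sum>(z, z')\<in>bd F S. ?P z')"
 have \<Sigma>0: "0 <= \<Sigma>" unfolding \<Sigma>_def by (auto intro!: sum_nonneg bprob_nonneg p p')
 define X where "X = d * \<Phi> * \<Sigma>"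
 have X0: "0 <= X" using \<Phi>(1) \<Sigma>0 by (simp add: X_def)
 have "card S * b = (\<Sum>x\<in>S. b)" by simp
 also have "... <= (\<Sum>x\<in>S. bprob F p (%w. x \<in> CL w D))" by (rule sum_mono) (rule b)
 also have "... <= (\<Sum>x\<in>S. \<Sum>(z, z')\<in>bd F S. bprob F p (%w. z \<in> CL w {x}) * ?P z')"
 proof (rule sum_mono)
  fix x assume "x \<in> S"
  then show "bprob F p (%w. x \<in> CL w D) <= (\<Sum>(z, z')\<in>bd F S. bprob F p (%w. z \<in> CL w {x}) * ?P z')"
   using F edge_fin S(3) p(1) p' by (intro boundary_decomposition) auto
 qed
 also have "... <= C * sqrt (card S) * sqrt X"
  unfolding X_def \<Sigma>_def using \<Phi> p p' by (intro boundary_L2[OF F p S(1,2) order_refl]) (auto intro: bprob_nonneg)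
 finally have "card S * b <= C * sqrt (card S) * sqrt X" .
 then have "(card S * b)\<^sup>2 <= (C * sqrt (card S) * sqrt X)\<^sup>2" using b(1) by (intro power_mono) auto
 also have "... = C\<^sup>2 * card S * X" unfolding power_mult_distrib using X0 by simp
 finally have 1: "card S * (b\<^sup>2 * card S) <= card S * (C\<^sup>2 * X)" by (simp add: power2_eq_square mult_ac)
 have "b\<^sup>2 * card S <= C\<^sup>2 * X"
 proof (cases "card S = 0")
  case True
  then show ?thesis using X0 by simp
 next
  case False
  then have "0 < real (card S)" by simp
  then show ?thesis using 1 by (simp only: mult_le_cancel_left_pos)
 qed
 also have "... = C\<^sup>2 * d * \<Phi> * (\<Sum>i\<in>bd F S. ?P (snd i))" unfolding X_def \<Sigma>_def by (simp add: case_prod_beta mult_ac)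
 finally show ?thesis .
qed

text \<open>\<open>connect_and_reach_le\<close> bounds each pair by binomial moments of their
  distance, \<open>path_weight_le\<close> supplies the small factor \<open>g + 1 / M\<close>, and
  \<open>level_sum_quad\<close> sums the moments over pairs of boundary endpoints at a cost linear
  in \<open>card S\<close>.\<close>

lemma pair_sum_upper:
 fixes g p :: real and M :: nat
 assumes F: "finite F" "F \<subseteq> E" and p: "0 <= p" "p <= p1" and S: "finite S" "S \<subseteq> V"
  and g: "0 <= g" and M: "1 <= M"
  and loc: "\<And>\<gamma> z z' u m. \<gamma> \<subseteq> nt F S ==> m <= M ==> (z, z') \<in> bd F S ==> u \<in> reach (nt F S) {z'} m ==>
   bprob (nt F S - \<gamma>) p (%w. u \<in> CL w D) <= g"
 shows "(\<Sum>i\<in>bd F S. \<Sum>j\<in>bd F S. bprob (nt F S) p (%w. snd j \<in> CL w {snd i} \<and> snd i \<in> CL w D))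
  <= (g + 1 / M) * (10 * C ^ 3) * (real d ^ 2 * card S)"
proof -
 let ?F = "nt F S"
 have p': "p <= 1" using p pc by simp
 have F': "finite ?F" "?F \<subseteq> E" using F finite_nt nt_subset[of F S] by auto
 define X where "X = \<Union>F"
 have X: "finite X" "X \<subseteq> V" "\<Union>?F \<subseteq> X"
  using finite_vertices[OF F] edges_V[OF F(2)] by (auto simp: X_def nt_def)
 have fb: "finite (bd F S)" and cb: "card (bd F S) <= d * card S" by (rule bd_card[OF F(2) S(1)])+
 have sX: "snd ` bd F S \<subseteq> X" by (auto simp: bd_def X_def)
 \<comment> \<open>An outer endpoint can end up to \<open>d\<close> boundary edges; grouping by
   endpoint leads to a quadratic form in this multiplicity, whose squared norm is at most
   \<open>d ^ 2 * card S\<close>.\<close>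
 define h where "h x = real (card {i \<in> bd F S. snd i = x})" for x
 have grp: "(\<Sum>i\<in>bd F S. f (snd i)) = (\<Sum>x\<in>X. h x * f x)" for f :: "'v => real"
 proof -
  have "(\<Sum>i\<in>bd F S. f (snd i)) = (\<Sum>x\<in>X. \<Sum>i\<in>{i \<in> bd F S. snd i = x}. f (snd i))"
   by (rule sum.group[OF fb X(1) sX, symmetric])
  also have "... = (\<Sum>x\<in>X. h x * f x)" by (intro sum.cong) (auto simp: h_def)
  finally show ?thesis .
 qed
 have h0: "0 <= h x" for x by (simp add: h_def)
 have hd: "h x <= d" for x
 proof -
  have "card {i \<in> bd F S. snd i = x} <= card {e \<in> E. x \<in> e}"
  proof (rule card_inj_on_le[of "%i. {fst i, snd i}"])
   show "inj_on (%i. {fst i, snd i}) {i \<in> bd F S. snd i = x}"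
    by (rule inj_onI) (auto simp: bd_def doubleton_eq_iff)
   show "(%i. {fst i, snd i}) ` {i \<in> bd F S. snd i = x} \<subseteq> {e \<in> E. x \<in> e}"
    using F(2) by (auto simp: bd_def)
  qed (rule deg_finite)
  also have "... <= d" by (rule deg)
  finally show ?thesis by (simp add: h_def)
 qed
 have "(\<Sum>x\<in>X. (h x)\<^sup>2) <= (\<Sum>x\<in>X. h x * real d)"
  using h0 hd by (intro sum_mono) (auto simp: power2_eq_square intro!: mult_left_mono)
 also have "... = (\<Sum>i\<in>bd F S. real d)" by (rule grp[symmetric])
 also have "... <= real d ^ 2 * card S"
  using mult_left_mono[OF of_nat_mono[OF cb, where 'a = real], of "real d"]
  by (simp add: power2_eq_square mult_ac)
 finally have h2: "(\<Sum>x\<in>X. (h x)\<^sup>2) <= real d ^ 2 * card S" .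
 have C1: "C <= C ^ 3" "C\<^sup>2 <= C ^ 3" using C power_increasing[of 1 3 C] power_increasing[of 2 3 C] by auto
 let ?N = "card ?F"
 have lsq: "(\<Sum>x\<in>X. \<Sum>y\<in>X. h x * h y * level_sum ?F p ?N k x y) <= C ^ 3 * (real d ^ 2 * card S)" if "k <= 2" for k
 proof -
  have "(\<Sum>x\<in>X. \<Sum>y\<in>X. h x * h y * level_sum ?F p ?N k x y) <= C ^ Suc k * (\<Sum>x\<in>X. (h x)\<^sup>2)"
   by (rule level_sum_quad[OF F' X p h0])
  also have "... <= C ^ 3 * (real d ^ 2 * card S)"
   using h2 that C by (intro mult_mono power_increasing sum_nonneg) auto
  finally show ?thesis .
 qed
 define G where "G = g + 1 / real M"
 have G0: "0 <= G" using g by (simp add: G_def)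
 have "(\<Sum>i\<in>bd F S. \<Sum>j\<in>bd F S. bprob ?F p (%w. snd j \<in> CL w {snd i} \<and> snd i \<in> CL w D))
  <= (\<Sum>i\<in>bd F S. \<Sum>j\<in>bd F S. G * (4 * level_sum ?F p ?N 2 (snd i) (snd j)
   + 5 * level_sum ?F p ?N 1 (snd i) (snd j) + level_sum ?F p ?N 0 (snd i) (snd j)))"
 proof (intro sum_mono)
  fix i j assume i: "i \<in> bd F S" and j: "j \<in> bd F S"
  let ?x = "snd i" and ?y = "snd j"
  have "bprob ?F p (%w. ?y \<in> CL w {?x} \<and> ?x \<in> CL w D)
   <= (\<Sum>n\<le>?N. path_weight g M n * bprob ?F p (%w. ?y \<in> lv w {?x} n))"
  proof (rule connect_and_reach_le[OF F'(1) _ p(1) p' g])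
   show "\<And>e. e \<in> ?F ==> card e = 2" using edge_card[OF F'(2)] by auto
   fix \<gamma> u m assume "\<gamma> \<subseteq> ?F" "m <= M" "u \<in> reach ?F {?x} m"
   then show "bprob (?F - \<gamma>) p (%w. u \<in> CL w D) <= g" using i by (intro loc[of \<gamma> m "fst i" "snd i"]) auto
  qed
  also have "... <= (\<Sum>n\<le>?N. G * (4 * real (n choose 2) + 5 * real (n choose 1) + real (n choose 0))
    * bprob ?F p (%w. ?y \<in> lv w {?x} n))"
   unfolding G_def by (intro sum_mono mult_right_mono path_weight_le g M bprob_nonneg p(1) p')
  also have "... = G * (4 * level_sum ?F p ?N 2 ?x ?y + 5 * level_sum ?F p ?N 1 ?x ?y + level_sum ?F p ?N 0 ?x ?y)"
   unfolding level_sum_def sum_distrib_left sum.distrib[symmetric] by (intro sum.cong) (simp_all add: algebra_simps)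
  finally show "bprob ?F p (%w. ?y \<in> CL w {?x} \<and> ?x \<in> CL w D)
   <= G * (4 * level_sum ?F p ?N 2 ?x ?y + 5 * level_sum ?F p ?N 1 ?x ?y + level_sum ?F p ?N 0 ?x ?y)" .
 qed
 also have "... = (\<Sum>x\<in>X. h x * (\<Sum>y\<in>X. h y * (G * (4 * level_sum ?F p ?N 2 x y
   + 5 * level_sum ?F p ?N 1 x y + level_sum ?F p ?N 0 x y))))"
  by (subst grp) (simp only: grp[symmetric])
 also have "... = G * (4 * (\<Sum>x\<in>X. \<Sum>y\<in>X. h x * h y * level_sum ?F p ?N 2 x y)
   + 5 * (\<Sum>x\<in>X. \<Sum>y\<in>X. h x * h y * level_sum ?F p ?N 1 x y) + (\<Sum>x\<in>X. \<Sum>y\<in>X. h x * h y * level_sum ?F p ?N 0 x y))"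
  unfolding sum_distrib_left sum.distrib[symmetric] by (intro sum.cong) (simp_all add: algebra_simps)
 also have "... <= G * (4 * (C ^ 3 * (real d ^ 2 * card S)) + 5 * (C ^ 3 * (real d ^ 2 * card S)) + C ^ 3 * (real d ^ 2 * card S))"
  using G0 by (intro mult_left_mono add_mono lsq) auto
 also have "... = G * (10 * C ^ 3) * (real d ^ 2 * card S)" by (simp add: algebra_simps)
 finally show ?thesis unfolding G_def .
qed

end

lemma bprob_closed:
 assumes "finite F" "X \<subseteq> F"
 shows "bprob F p (%w. X \<inter> w = {}) = (1 - p) ^ card X"
proof -
 have "bprob F p (%w. X \<inter> w = {}) = bprob X p (%w. X \<inter> w = {})"
  by (rule bexp_ignore[OF assms]) (simp add: Int_commute Int_left_commute)
 also have "... = (\<Sum>w\<in>{{}}. p ^ card w * (1 - p) ^ card (X - w) * of_bool (X \<inter> w = {}))"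
  unfolding bexp_def using finite_subset[OF assms(2,1)] by (intro sum.mono_neutral_right) auto
 finally show ?thesis by simp
qed

lemma reach_tch: "reach (tch w (CL w A)) A n = reach w A n"
proof (induction n)
 case (Suc n)
 have "y \<in> reach (tch w (CL w A)) A (Suc n) \<longleftrightarrow> y \<in> reach w A (Suc n)" for y
  unfolding reach_Suc Suc.IH by (auto simp: tch_def CL_reach)
 then show ?case by auto
qed simp

lemma lv_tch: "lv (tch w (CL w A)) A n = lv w A n"
 by (simp add: lv_def reach_tch)

lemma reach_trans: "y \<in> reach w {u} m ==> u \<in> reach w A n ==> y \<in> reach w A (n + m)"
 unfolding reach_def by (auto intro: relpow_trans)

text \<open>View the original configuration as the thinned one plus a sprinkling of density
  \<open>t\<close>. Explore the thinned cluster \<open>S\<close> of \<open>v\<close>: if the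
  original cluster misses \<open>D\<close>, no boundary edge of \<open>S\<close> whose outer end is
  joined to \<open>D\<close> off \<open>S\<close> may be sprinkled. Off \<open>S\<close> the two
  layers together have density \<open>p\<close>, and at the boundary the sprinkling is fresh, which
  leaves a factor \<open>1 - t\<close> per such edge.\<close>

lemma sprinkle_escape:
 fixes p s t :: real and v :: 'v and D :: "'v set" and F :: "'v set set"
 assumes F: "finite F" and p: "0 <= p" "p <= 1" and s: "0 <= s" "s <= 1" and t: "0 <= t" "t <= 1"
  and cpl: "(1 - p * s) * t = p * (1 - s)"
  and Q: "\<And>w. Q (tch w (CL w {v})) = Q w"
 defines "\<psi> \<equiv> %S. bexp (nt F S) p (%w. (1 - t) ^ card {i \<in> bd F S. snd i \<in> CL w D})"
 shows "bexp F p (%w. bprob F s (%\<sigma>. Q (w \<inter> \<sigma>) \<and> CL w {v} \<inter> D = {}))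
  <= bexp F (p * s) (%w. of_bool (Q w) * \<psi> (CL w {v}))"
proof -
 \<comment> \<open>\<open>w\<close> is the thinned configuration off \<open>S\<close>; of the
   sprinkling, \<open>nt \<sigma> S\<close> is joined to it, while the edges touching
   \<open>S\<close> are kept for the test.\<close>
 define G where "G = (%S w \<sigma>. \<forall>i\<in>bd F S. snd i \<in> CL (w \<union> nt \<sigma> S) D --> {fst i, snd i} \<notin> \<sigma>)"
 define h where "h = (%w1 w2. of_bool (Q w1) * bprob F t (G (CL w1 {v}) w2))"
 have ps: "0 <= p * s" "p * s <= 1" using p s by (simp_all add: mult_le_one)
 have G\<psi>: "bexp (nt F S) (p * s) (%w. bprob F t (G S w)) = \<psi> S" for S
 proof -
  define H where "H = (%w. bprob (tch F S) t (%\<sigma>. \<forall>i\<in>bd F S. snd i \<in> CL w D --> {fst i, snd i} \<notin> \<sigma>))"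
  have H: "H w = (1 - t) ^ card {i \<in> bd F S. snd i \<in> CL w D}" for w
  proof -
   let ?I = "{i \<in> bd F S. snd i \<in> CL w D}" and ?e = "%i. {fst i, snd i}"
   have "H w = bprob (tch F S) t (%\<sigma>. ?e ` ?I \<inter> \<sigma> = {})"
    unfolding H_def by (intro bexp_cong) (auto simp: disjoint_iff, force+)
   also have "... = (1 - t) ^ card (?e ` ?I)"
    by (rule bprob_closed[OF finite_tch[OF F]]) (auto simp: bd_def tch_def)
   also have "card (?e ` ?I) = card ?I"
    by (rule card_image, rule inj_onI) (auto simp: bd_def doubleton_eq_iff)
   finally show ?thesis .
  qed
  have g: "G S w (\<sigma>1 \<union> \<sigma>2) \<longleftrightarrow> (\<forall>i\<in>bd F S. snd i \<in> CL (w \<union> \<sigma>2) D --> {fst i, snd i} \<notin> \<sigma>1)"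
   if "\<sigma>1 \<subseteq> tch F S" "\<sigma>2 \<subseteq> nt F S" for w \<sigma>1 \<sigma>2
   unfolding G_def nt_split[OF that] using that(2) by (auto simp: bd_def nt_def)
  have "bprob F t (G S w) = bexp (nt F S) t (%\<sigma>2. H (w \<union> \<sigma>2))" for w
  proof -
   have "bprob F t (G S w) = bexp (tch F S) t (%\<sigma>1. bprob (nt F S) t (%\<sigma>2. G S w (\<sigma>1 \<union> \<sigma>2)))"
    by (rule bexp_split[OF F])
   also have "... = bexp (tch F S) t (%\<sigma>1. bprob (nt F S) t
    (%\<sigma>2. \<forall>i\<in>bd F S. snd i \<in> CL (w \<union> \<sigma>2) D --> {fst i, snd i} \<notin> \<sigma>1))"
    by (intro bexp_cong) (simp add: g)
   also have "... = bexp (nt F S) t (%\<sigma>2. H (w \<union> \<sigma>2))" unfolding H_def by (rule bexp_swap)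
   finally show ?thesis .
  qed
  then have "bexp (nt F S) (p * s) (%w. bprob F t (G S w))
   = bexp (nt F S) (p * s) (%w. bexp (nt F S) t (%\<sigma>. H (w \<union> \<sigma>)))" by (intro bexp_cong)
  also have "... = bexp (nt F S) p (%w. bexp (nt F S) s (%\<sigma>. H w))"
   using bexp_coupling[OF finite_nt[OF F] cpl, of S "%_ w. H w"] by simp
  also have "... = bexp (nt F S) p H" using finite_nt[OF F] by (simp add: bexp_const)
  finally show ?thesis unfolding \<psi>_def H .
 qed
 have "bexp F p (%w. bprob F s (%\<sigma>. Q (w \<inter> \<sigma>) \<and> CL w {v} \<inter> D = {}))
  = bexp F (p * s) (%w. bprob F t (%\<sigma>. Q w \<and> CL (w \<union> \<sigma>) {v} \<inter> D = {}))"
  using bexp_coupling[OF F cpl, of "%a b. of_bool (Q a \<and> CL b {v} \<inter> D = {})"] by simp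
 also have "... <= bexp F (p * s) (%w. h (tch w (CL w {v})) (nt w (CL w {v})))"
 proof (rule bexp_mono[OF ps])
  fix w assume "w \<subseteq> F"
  let ?K = "CL w {v}"
  have "G ?K (nt w ?K) \<sigma>" if "CL (w \<union> \<sigma>) {v} \<inter> D = {}" for \<sigma>
   unfolding G_def
  proof (intro ballI impI notI)
   fix i assume i: "i \<in> bd F ?K" and c: "snd i \<in> CL (nt w ?K \<union> nt \<sigma> ?K) D" and e: "{fst i, snd i} \<in> \<sigma>"
   have "fst i \<in> ?K" using i by (auto simp: bd_def)
   then have f: "fst i \<in> CL (w \<union> \<sigma>) {v}" using CL_mono[of w "w \<union> \<sigma>" "{v}" "{v}"] by auto
   have sv: "snd i \<in> CL (w \<union> \<sigma>) {v}" by (rule CL_closed[OF f]) (use e in simp)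
   have "nt w ?K \<union> nt \<sigma> ?K \<subseteq> w \<union> \<sigma>" using nt_subset[of w] nt_subset[of \<sigma>] by auto
   then have "snd i \<in> CL (w \<union> \<sigma>) D" using c CL_mono[of "nt w ?K \<union> nt \<sigma> ?K" "w \<union> \<sigma>" D D] by auto
   then obtain b where b: "b \<in> D" "snd i \<in> CL (w \<union> \<sigma>) {b}" unfolding CL_iff[of "snd i" _ D] by auto
   then have "b \<in> CL (w \<union> \<sigma>) {snd i}" using CL_sym[of b _ "snd i"] by simp
   then have "b \<in> CL (w \<union> \<sigma>) {v}" unfolding CL_eq[OF sv] .
   then show False using b that by auto
  qed
  then have "bprob F t (%\<sigma>. Q w \<and> CL (w \<union> \<sigma>) {v} \<inter> D = {}) <= bprob F t (%\<sigma>. Q w \<and> G ?K (nt w ?K) \<sigma>)"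
   by (intro bprob_mono[OF t]) auto
  also have "... = h (tch w ?K) (nt w ?K)"
   unfolding h_def Q CL_tch of_bool_conj by (rule bexp_cmult)
  finally show "bprob F t (%\<sigma>. Q w \<and> CL (w \<union> \<sigma>) {v} \<inter> D = {}) <= h (tch w ?K) (nt w ?K)" .
 qed
 also have "... = bexp F (p * s) (%w. bexp (nt F (CL w {v})) (p * s) (h (tch w (CL w {v}))))"
  by (rule bexp_explore[OF F])
 also have "... = bexp F (p * s) (%w. of_bool (Q w) * \<psi> (CL w {v}))"
  by (rule bexp_cong) (simp only: h_def Q CL_tch bexp_cmult G\<psi>)
 finally show ?thesis .
qed

section \<open>Thin clusters die out on the critical scale\<close>

lemma prod_lessThan_add:
 fixes f :: "nat => real"
 shows "(\<Prod>j<n + m. f j) = (\<Prod>j<n. f j) * (\<Prod>j<m. f (n + j))"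
 by (induction m) (simp_all add: mult.assoc)

context l2_percolation
begin

definition wt :: "real => 'v set => real" where
 "wt s B = exp (- s * card B)"

lemma wt_nonneg: "0 <= wt s B" and wt_le_1: "0 <= s ==> wt s B <= 1"
 by (simp_all add: wt_def)

lemma prod_wt: "0 <= (\<Prod>j<n. wt s (f j))" "0 <= s ==> (\<Prod>j<n. wt s (f j)) <= 1"
 by (auto intro!: prod_nonneg prod_le_1 wt_nonneg wt_le_1)

text \<open>Either all of the first \<open>m\<close> levels have more than \<open>N\<close>
  vertices, and their weights multiply to at most \<open>exp (- s * N) ^ m\<close>; or some level
  has at most \<open>N\<close> vertices, and with probability at least \<open>(1 - g) ^ N\<close>
  all of them die within the \<open>R\<close> levels that are still to come.\<close>

lemma skinny_step:
 fixes g p s :: real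
 assumes g: "arm_le p R g" "g <= 1" and p: "0 <= p" "p <= 1" and s: "0 <= s"
  and W: "finite W" "W \<subseteq> V" and F: "finite F" "F \<subseteq> E" "\<Union>F \<subseteq> W" and A: "A \<subseteq> W"
 shows "bexp F p (%w. (\<Prod>j<m + R. wt s (lv w A j)) * of_bool (lv w A (m + R) \<noteq> {}))
  <= max (exp (- s * N) ^ m) (1 - (1 - g) ^ N)"
 using F A
proof (induction m arbitrary: F A)
 case 0
 have "bexp F p (%w. (\<Prod>j<0 + R. wt s (lv w A j)) * of_bool (lv w A (0 + R) \<noteq> {})) <= bexp F p (%w. 1)"
  using prod_wt(2)[OF s, where n = R] by (intro bexp_mono[OF p]) auto
 then show ?case using 0 by (simp add: bexp_const)
next
 case (Suc m)
 have g0: "0 <= g" by (rule arm_le_nonneg[OF g(1) p])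
 have A: "finite A" "A \<subseteq> V" using Suc.prems W by (auto intro: finite_subset)
 let ?q = "1 - (1 - g) ^ N"
 show ?case
 proof (cases "card A <= N")
  case True
  have "bexp F p (%w. (\<Prod>j<Suc m + R. wt s (lv w A j)) * of_bool (lv w A (Suc m + R) \<noteq> {}))
   <= bprob F p (%w. \<not> CL w A \<subseteq> (\<Union>i<R. reach w A i))"
  proof (rule bexp_mono[OF p])
   fix w
   have "\<not> CL w A \<subseteq> (\<Union>i<R. reach w A i)" if "lv w A (Suc m + R) \<noteq> {}"
   proof -
    have "lv w A R \<noteq> {}" using that by (rule lv_arm_mono) simp
    then obtain y where "y \<in> lv w A R" by auto
    then have "y \<in> CL w A" "y \<notin> (\<Union>i<R. reach w A i)" by (auto simp: lv_def CL_reach)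
    then show ?thesis by auto
   qed
   then show "(\<Prod>j<Suc m + R. wt s (lv w A j)) * of_bool (lv w A (Suc m + R) \<noteq> {})
     <= of_bool (\<not> CL w A \<subseteq> (\<Union>i<R. reach w A i))"
    using prod_wt(2)[OF s, where f = "lv w A" and n = "Suc m + R"] by auto
  qed
  also have "... = 1 - bprob F p (%w. CL w A \<subseteq> (\<Union>i<R. reach w A i))" by (rule bprob_not[OF Suc.prems(1)])
  also have "... <= 1 - (1 - g) ^ card A"
  proof -
   have "(1 - g) ^ card A <= bprob F p (%w. CL w A \<subseteq> (\<Union>i<R. reach w A i))"
    using Suc.prems g(2) edge_fin by (intro all_die_ge[OF _ _ p A] arm_leD[OF g(1)]) (auto intro: finite_subset)
   then show ?thesis by simp
  qed
  also have "... <= ?q" using True g g0 by (simp add: power_decreasing)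
  finally show ?thesis by simp
 next
  case False
  let ?\<Psi> = "%B w. (\<Prod>j<m + R. wt s (lv w B j)) * of_bool (lv w B (m + R) \<noteq> {})"
  let ?k = "max (exp (- s * N) ^ m) ?q"
  have q1: "?q <= 1" "0 <= ?q" using g g0 by (auto intro: power_le_one)
  have k0: "0 <= ?k" by (simp add: max.coboundedI1)
  have wA: "wt s A <= exp (- s * N)" using False s by (simp add: wt_def mult_left_mono)
  have r1: "lv (rs w A 1) (lv w A 1) i = lv w A (Suc i)" for w i
   using lv_add[of w A 1 i] by simp
  have "bexp F p (%w. (\<Prod>j<Suc m + R. wt s (lv w A j)) * of_bool (lv w A (Suc m + R) \<noteq> {}))
   = bexp F p (%w. wt s A * ?\<Psi> (lv w A 1) (rs w A 1))"
   unfolding r1 by (simp add: prod.lessThan_Suc_shift mult.assoc del: prod.lessThan_Suc)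
  also have "... = wt s A * bexp F p (%w. ?\<Psi> (lv w A 1) (rs w A 1))" by (rule bexp_cmult)
  also have "... <= wt s A * bexp F p (%w. (%_. ?k) (lv w A 1))"
  proof (rule mult_left_mono[OF _ wt_nonneg], rule bexp_level[OF Suc.prems(1) p Suc.prems(3,4)])
   fix F' B assume B: "F' \<subseteq> F" "B \<subseteq> W"
   then have "finite F'" "F' \<subseteq> E" "\<Union>F' \<subseteq> W"
    using Suc.prems finite_subset[of F' F] Union_mono[of F' F] by blast+
   then show "bexp F' p (?\<Psi> B) <= ?k" using B by (intro Suc.IH)
  qed
  also have "... = wt s A * ?k" using Suc.prems(1) by (simp add: bexp_const)
  also have "... <= exp (- s * N) * ?k" using wA k0 by (rule mult_right_mono)
  also have "... <= max (exp (- s * N) ^ Suc m) ?q"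
  proof -
   have "exp (- s * N) <= 1" using s by simp
   then have "exp (- s * N) * ?q <= ?q" using q1(2) mult_right_mono[of "exp (- s * N)" 1 ?q] by simp
   then show ?thesis
    by (cases "?q <= exp (- s * N) ^ m") (simp_all add: max.absorb1 max.absorb2 max.coboundedI2)
  qed
  finally show ?thesis .
 qed
qed

text \<open>The first \<open>R\<close> levels contribute \<open>g\<close>, and each further block of
  \<open>2 * R\<close> levels one factor from \<open>skinny_step\<close> with \<open>m = R\<close>:
  \<open>R\<close> levels for the weights, \<open>R\<close> levels for dying out.\<close>

lemma skinny:
 fixes g p s :: real
 assumes g: "arm_le p R g" "g <= 1" and p: "0 <= p" "p <= 1" and s: "0 <= s"
  and F: "finite F" "F \<subseteq> E" and v: "v \<in> V"
 shows "bexp F p (%w. (\<Prod>j<R + k * (R + R). wt s (lv w {v} j)) * of_bool (lv w {v} (R + k * (R + R)) \<noteq> {}))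
  <= max (exp (- s * N) ^ R) (1 - (1 - g) ^ N) ^ k * g"
proof -
 let ?\<rho> = "max (exp (- s * N) ^ R) (1 - (1 - g) ^ N)"
 have \<rho>: "0 <= ?\<rho>" by (simp add: max.coboundedI1)
 define W where "W = insert v (\<Union>F)"
 have W: "finite W" "W \<subseteq> V" "\<Union>F \<subseteq> W" "{v} \<subseteq> W"
  using F v finite_vertices edges_V unfolding W_def by auto
 show ?thesis
 proof (induction k)
  case 0
  have "bexp F p (%w. (\<Prod>j<R. wt s (lv w {v} j)) * of_bool (lv w {v} R \<noteq> {})) <= bprob F p (%w. lv w {v} R \<noteq> {})"
   using prod_wt(2)[OF s, where n = R] by (intro bexp_mono[OF p]) auto
  also have "... <= g" by (rule arm_leD[OF g(1) F v])
  finally show ?case by simp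
 next
  case (Suc k)
  let ?n = "R + k * (R + R)"
  let ?\<Psi> = "%B w. (\<Prod>j<R + R. wt s (lv w B j)) * of_bool (lv w B (R + R) \<noteq> {})"
  let ?P = "%w. \<Prod>j<?n. wt s (lv w {v} j)"
  have n: "R + Suc k * (R + R) = ?n + (R + R)" by simp
  have r1: "lv (rs w {v} ?n) (lv w {v} ?n) i = lv w {v} (?n + i)" for w i
   using lv_add[of w "{v}" ?n i] by simp
  have "bexp F p (%w. (\<Prod>j<?n + (R + R). wt s (lv w {v} j)) * of_bool (lv w {v} (?n + (R + R)) \<noteq> {}))
   = bexp F p (%w. ?P w * ?\<Psi> (lv w {v} ?n) (rs w {v} ?n))"
   unfolding r1 prod_lessThan_add[of _ ?n] by (simp add: mult.assoc)
  also have "... <= bexp F p (%w. ?P w * (%B. of_bool (B \<noteq> {}) * ?\<rho>) (lv w {v} ?n))"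
  proof (rule bexp_level_weighted[OF F(1) p W(3,4) wt_nonneg])
   fix F' B assume B: "F' \<subseteq> F" "B \<subseteq> W"
   show "bexp F' p (?\<Psi> B) <= of_bool (B \<noteq> {}) * ?\<rho>"
   proof (cases "B = {}")
    case True
    then show ?thesis using B F by (simp add: bexp_const finite_subset)
   next
    case False
    have "finite F'" "F' \<subseteq> E" "\<Union>F' \<subseteq> W"
     using B F W(3) finite_subset[of F' F] Union_mono[of F' F] by blast+
    then have "bexp F' p (?\<Psi> B) <= ?\<rho>" using B(2) by (intro skinny_step[OF g p s W(1,2)])
    then show ?thesis using False by simp
   qed
  qed
  also have "... = bexp F p (%w. ?P w * of_bool (lv w {v} ?n \<noteq> {})) * ?\<rho>"
   unfolding bexp_multc[symmetric] by (simp add: mult.assoc)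
  also have "... <= (?\<rho> ^ k * g) * ?\<rho>" using Suc.IH \<rho> by (rule mult_right_mono)
  also have "... = ?\<rho> ^ Suc k * g" by (simp add: mult_ac)
  finally show ?case unfolding n .
 qed
qed

end

lemma exp_le_one_minus:
 fixes g :: real
 assumes "0 <= g" "g <= 1 / 2" shows "exp (- 2 * g) <= 1 - g"
proof -
 have "1 <= (1 - g) * (1 + 2 * g)"
  using mult_left_mono[of g "1 / 2" g] assms by (simp add: algebra_simps)
 also have "... <= (1 - g) * exp (2 * g)" using assms exp_ge_add_one_self[of "2 * g"] by (intro mult_left_mono) auto
 finally show ?thesis by (simp add: exp_minus field_simps)
qed

lemma linear_exp_bound:
 fixes b x :: real
 assumes "0 < b" shows "x * exp (- b * x) <= 2 / b * exp (- (b / 2) * x)"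
proof -
 have "b / 2 * x <= exp (b / 2 * x)" using exp_ge_add_one_self[of "b / 2 * x"] by linarith
 then have "2 / b * (b / 2 * x) <= 2 / b * exp (b / 2 * x)" using assms by (intro mult_left_mono) auto
 then have "x <= 2 / b * exp (b / 2 * x)" using assms by simp
 then have "x * exp (- b * x) <= 2 / b * exp (b / 2 * x) * exp (- b * x)" by (intro mult_right_mono) auto
 also have "... = 2 / b * exp (- (b / 2) * x)" by (simp add: mult.assoc exp_add[symmetric])
 finally show ?thesis .
qed

definition inv_floor :: "real => nat" where
 "inv_floor eps = nat \<lfloor>1 / eps\<rfloor>"

lemma inv_floor:
 fixes eps :: real
 assumes "0 < eps" "eps <= 1"
 shows "1 <= inv_floor eps" "eps * inv_floor eps <= 1" "1 <= 2 * eps * inv_floor eps"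
  "1 / inv_floor eps <= 2 * eps"
proof -
 have 1: "1 <= 1 / eps" using assms by simp
 then have f: "1 <= \<lfloor>1 / eps\<rfloor>" by simp
 then show M: "1 <= inv_floor eps" unfolding inv_floor_def by linarith
 have r: "real (inv_floor eps) = of_int \<lfloor>1 / eps\<rfloor>"
  unfolding inv_floor_def by (rule of_nat_nat) (use f in linarith)
 have "real (inv_floor eps) <= 1 / eps" unfolding r by simp
 then show "eps * inv_floor eps <= 1" using assms by (simp add: field_simps)
 have "1 / eps <= real (inv_floor eps) + 1" unfolding r by linarith
 then have "1 / eps <= 2 * real (inv_floor eps)" using M by linarith
 then show 2: "1 <= 2 * eps * inv_floor eps" using assms by (simp add: field_simps)
 then show "1 / inv_floor eps <= 2 * eps" using M by (simp add: field_simps)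
qed

context l2_percolation
begin

text \<open>In the second part \<open>q\<close> may be any value between \<open>pc\<close> and
  \<open>p\<close> while the scale is that of \<open>p\<close>: the thinned parameter is used on the
  scale of the original one.\<close>

lemma near_critical_arm:
 "\<exists>D\<ge>1. (\<forall>n\<ge>1. \<forall>p. pc <= p --> p <= 1 --> (p - pc) * n <= 1 --> arm_le p n (D / n)) \<and>
  (\<forall>p q. pc <= q --> q <= p --> pc < p --> p <= 1 --> arm_le q (inv_floor (p - pc)) (2 * D * (p - pc)))"
proof -
 obtain D where D: "1 <= D" "\<forall>n\<ge>1. \<forall>p. pc <= p --> p <= 1 --> (p - pc) * n <= 1 --> arm_le p n (D / n)"
  using one_arm_near_critical by auto
 have "arm_le q (inv_floor (p - pc)) (2 * D * (p - pc))" if q: "pc <= q" "q <= p" "pc < p" "p <= 1" for p q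
 proof -
  have eps: "0 < p - pc" "p - pc <= 1" using q pc by auto
  note M = inv_floor[OF eps]
  have "(q - pc) * inv_floor (p - pc) <= (p - pc) * inv_floor (p - pc)" using q by (intro mult_right_mono) auto
  then have "(q - pc) * inv_floor (p - pc) <= 1" using M(2) by linarith
  then have "arm_le q (inv_floor (p - pc)) (D / inv_floor (p - pc))" using D(2) M(1) q by auto
  then show ?thesis
  proof (rule arm_le_mono)
   show "D / inv_floor (p - pc) <= 2 * D * (p - pc)" using mult_left_mono[OF M(4), of D] D(1) by (simp add: mult_ac)
  qed (use q pc in auto)
 qed
 then show ?thesis using D by (intro exI[of _ D]) auto
qed

text \<open>The conclusion bounds the chance that a sprinkling of density \<open>\<eta>\<close>
  fails to join \<open>S\<close> to the distant set \<open>D\<close> across the boundary of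
  \<open>S\<close>. The exponent is linear in \<open>\<eta>\<close> up to a constant
  \<open>\<eta>0\<close> independent of \<open>p\<close>.\<close>

definition sprinkles :: "real => real => bool" where
 "sprinkles c \<eta>0 \<longleftrightarrow> (\<forall>F p S D \<eta>. finite F --> F \<subseteq> E --> pc < p --> p <= p1 --> finite S --> S \<subseteq> V -->
  D \<inter> S = {} --> (\<forall>x\<in>S. \<theta> * (p - pc) <= bprob F p (%w. x \<in> CL w D)) -->
  (\<forall>m\<le>2 * inv_floor (p - pc) + 1. reach F S m \<inter> D = {}) --> 0 <= \<eta> --> \<eta> <= \<eta>0 -->
  bexp (nt F S) p (%w. (1 - \<eta>) ^ card {i \<in> bd F S. snd i \<in> CL w D}) <= exp (- c * (p - pc) * card S * \<eta>))"

lemma sprinkle_bound: "\<exists>c \<eta>0. 0 < c \<and> 0 < \<eta>0 \<and> \<eta>0 < 1 \<and> sprinkles c \<eta>0"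
proof -
 obtain D0 where D0: "1 <= D0"
  "\<forall>p q. pc <= q --> q <= p --> pc < p --> p <= 1 --> arm_le q (inv_floor (p - pc)) (2 * D0 * (p - pc))"
  using near_critical_arm by auto
 \<comment> \<open>\<open>c1\<close> comes from \<open>boundary_sum_lower\<close> with escape
   probability \<open>\<theta> * eps\<close> and arm bound \<open>2 * D0 * eps\<close>,
   \<open>c2\<close> from \<open>pair_sum_upper\<close> with
   \<open>g + 1 / M <= (2 * D0 + 2) * eps\<close>. Both sums have order \<open>eps * card S\<close>,
   so the condition \<open>2 * \<eta> * U <= b\<close> becomes \<open>2 * \<eta> * c2 <= c1\<close>,
   free of \<open>eps\<close>.\<close>
 define c1 where "c1 = \<theta>\<^sup>2 / (C\<^sup>2 * (real d + 1) * (2 * D0))"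
 define c2 where "c2 = (2 * D0 + 2) * (10 * C ^ 3) * (real d ^ 2 + 1)"
 define \<eta>0 where "\<eta>0 = min (1 / 2) (c1 / (2 * c2))"
 have den: "0 < C\<^sup>2 * (real d + 1) * (2 * D0)" using C D0 by (intro mult_pos_pos) auto
 have c1: "0 < c1" unfolding c1_def using den theta(1) by (intro divide_pos_pos) auto
 have c2: "0 < c2" unfolding c2_def using D0 C by (intro mult_pos_pos) (auto intro: add_nonneg_pos)
 have \<eta>0: "0 < \<eta>0" "\<eta>0 < 1" "2 * \<eta>0 * c2 <= c1"
 proof -
  show "0 < \<eta>0" "\<eta>0 < 1" using c1 c2 by (auto simp: \<eta>0_def)
  have "\<eta>0 <= c1 / (2 * c2)" by (simp add: \<eta>0_def)
  then show "2 * \<eta>0 * c2 <= c1" using c2 by (simp add: field_simps)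
 qed
 have main: "bexp (nt F S) p (%w. (1 - \<eta>) ^ card {i \<in> bd F S. snd i \<in> CL w D}) <= exp (- (c1 / 2) * (p - pc) * card S * \<eta>)"
  if F: "finite F" "F \<subseteq> E" and p: "pc < p" "p <= p1" and S: "finite S" "S \<subseteq> V" "D \<inter> S = {}"
   and low: "\<forall>x\<in>S. \<theta> * (p - pc) <= bprob F p (%w. x \<in> CL w D)"
   and far: "\<forall>m\<le>2 * inv_floor (p - pc) + 1. reach F S m \<inter> D = {}" and \<eta>: "0 <= \<eta>" "\<eta> <= \<eta>0"
  for F :: "'v set set" and p \<eta> :: real and S D :: "'v set"
 proof -
  define eps where "eps = p - pc"
  define M where "M = inv_floor eps"
  define g where "g = 2 * D0 * eps"
  have eps: "0 < eps" "eps <= 1" using p pc by (auto simp: eps_def)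
  have M: "1 <= M" "1 / real M <= 2 * eps" unfolding M_def using inv_floor[OF eps] by auto
  have p01: "0 <= p" "p <= 1" using p pc by auto
  have g: "arm_le p M g" unfolding M_def g_def eps_def using D0(2) p p01 by simp
  have g0: "0 <= g" using D0 eps by (simp add: g_def)
  have F': "nt F S \<subseteq> F" "finite (nt F S)" using F nt_subset[of F S] finite_nt by auto
  have loc: "bprob F'' p (%w. u \<in> CL w D) <= g"
   if F'': "F'' \<subseteq> F" and m: "m <= M" and z: "(z, z') \<in> bd F S" and u: "u \<in> reach F {z'} m" for F'' m z z' u
  proof (rule far_arm_prob[OF g p01 _ F'' F(2)])
   show "finite F''" using F F'' by (auto intro: finite_subset)
   \<comment> \<open>One step from \<open>S\<close> to \<open>z'\<close>, at most \<open>M\<close>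
     steps along a connection and fewer than \<open>M\<close> for the arm: this is covered by the
     distance \<open>2 * inv_floor (p - pc) + 1\<close> demanded in
     \<open>sprinkles\<close>.\<close>
   have z': "z' \<in> reach F S 1" using z by (auto simp: bd_def reach_Suc[of _ _ _ 0, simplified])
   then have w1: "u \<in> reach F S (1 + m)" using u by (intro reach_trans)
   show "u \<in> V"
   proof (cases m)
    case 0
    then show ?thesis using u z edges_V[OF F(2)] by (auto simp: bd_def)
   next
    case (Suc n)
    then show ?thesis using u edges_V[OF F(2)] by (auto simp: reach_Suc)
   qed
   fix j assume j: "j < M"
   have "reach F {u} j \<subseteq> reach F S (1 + m + j)" using reach_trans[OF _ w1] by (intro subsetI)
   moreover have "reach F S (1 + m + j) \<inter> D = {}" using far m j by (simp add: M_def eps_def)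
   ultimately show "reach F {u} j \<inter> D = {}" by auto
  qed
  let ?P = "\<Sum>i\<in>bd F S. bprob (nt F S) p (%w. snd i \<in> CL w D)"
  have P0: "0 <= ?P" using p01 by (auto intro!: sum_nonneg bprob_nonneg)
  have "(\<theta> * eps)\<^sup>2 * card S <= C\<^sup>2 * d * g * ?P"
  proof (rule boundary_sum_lower[OF F p01(1) p(2) S])
   show "0 <= \<theta> * eps" using theta eps by simp
   show "\<And>x. x \<in> S ==> \<theta> * eps <= bprob F p (%w. x \<in> CL w D)" using low by (simp add: eps_def)
   show "\<And>z z'. (z, z') \<in> bd F S ==> bprob (nt F S) p (%w. z' \<in> CL w D) <= g"
    by (rule loc[OF F'(1), of 0]) auto
  qed (rule g0)
  also have "... <= C\<^sup>2 * (real d + 1) * g * ?P" using g0 P0 by (intro mult_right_mono mult_left_mono) auto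
  finally have "eps * (eps * \<theta>\<^sup>2 * card S) <= eps * (C\<^sup>2 * (real d + 1) * (2 * D0) * ?P)"
   by (simp add: g_def power2_eq_square mult_ac)
  then have "eps * \<theta>\<^sup>2 * card S <= ?P * (C\<^sup>2 * (real d + 1) * (2 * D0))"
   using eps by (simp only: mult_le_cancel_left_pos mult.commute)
  then have b: "c1 * eps * card S <= ?P" using den unfolding c1_def by (simp add: pos_divide_le_eq mult_ac)
  define U where "U = c2 * eps * card S"
  have "(\<Sum>i\<in>bd F S. \<Sum>j\<in>bd F S. bprob (nt F S) p (%w. snd j \<in> CL w {snd i} \<and> snd i \<in> CL w D))
   <= (g + 1 / M) * (10 * C ^ 3) * (real d ^ 2 * card S)"
  proof (rule pair_sum_upper[OF F p01(1) p(2) S(1,2) g0 M(1)])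
   fix \<gamma> z z' u m assume *: "\<gamma> \<subseteq> nt F S" "m <= M" "(z, z') \<in> bd F S" "u \<in> reach (nt F S) {z'} m"
   then have "u \<in> reach F {z'} m" using reach_mono[OF F'(1) order_refl, of "{z'}" m] by auto
   then show "bprob (nt F S - \<gamma>) p (%w. u \<in> CL w D) <= g" using * F' by (intro loc[of _ m z z']) auto
  qed
  also have "... <= (2 * D0 * eps + 2 * eps) * (10 * C ^ 3) * ((real d ^ 2 + 1) * card S)"
   using M C D0 eps by (intro mult_mono) (auto simp: g_def)
  also have "... = U" by (simp add: U_def c2_def algebra_simps)
  finally have U: "(\<Sum>i\<in>bd F S. \<Sum>j\<in>bd F S. bprob (nt F S) p (%w. snd j \<in> CL w {snd i} \<and> snd i \<in> CL w D)) <= U" .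
  have "2 * \<eta> * c2 <= c1" using \<eta> \<eta>0(3) c2 mult_right_mono[of "2 * \<eta>" "2 * \<eta>0" c2] by linarith
  then have "2 * \<eta> * c2 * (eps * card S) <= c1 * (eps * card S)" using eps by (intro mult_right_mono) auto
  then have 2: "2 * \<eta> * U <= c1 * eps * card S" by (simp add: U_def mult_ac)
  have "\<eta> < 1" using \<eta> \<eta>0 by simp
  then have "bexp (nt F S) p (%w. (1 - \<eta>) ^ card {i \<in> bd F S. snd i \<in> CL w D}) <= exp (- (c1 * eps * card S / 2) * \<eta>)"
   by (intro sprinkle_product[OF F'(2) p01 _ \<eta>(1) _ 2 b U] bd_card(1)[OF F(2) S(1)])
  then show ?thesis by (simp add: eps_def)
 qed
 have "0 < c1 / 2" using c1 by simp
 then show ?thesis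
  using main \<eta>0(1,2) unfolding sprinkles_def by (intro exI[of _ "c1 / 2"] exI[of _ \<eta>0] conjI allI impI) auto
qed

lemma finite_reach:
 assumes "finite A" "A \<subseteq> V" shows "finite (reach E A n)" "reach E A n \<subseteq> V"
proof (induction n)
 case (Suc n)
 have "reach E A (Suc n) \<subseteq> \<Union>(tch E (reach E A n))" by (fastforce simp: reach_Suc tch_def)
 moreover have "finite (\<Union>(tch E (reach E A n)))"
  using tch_card(1)[OF order_refl Suc(1)] edge_fin[OF order_refl] by (auto simp: tch_def)
 moreover have "\<Union>(tch E (reach E A n)) \<subseteq> V" using edge by (auto simp: tch_def)
 ultimately show "finite (reach E A (Suc n))" "reach E A (Suc n) \<subseteq> V" by (auto intro: finite_subset)
qed (use assms in auto)

text \<open>Thinning to \<open>p'\<close> keeps the cluster long at the cost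
  \<open>(p' / p) ^ n\<close>. That the sprinkling back to \<open>p\<close> misses infinity,
  represented by a distant set \<open>D\<close>, costs \<open>exp (- \<sigma> * card K)\<close> for
  the thinned cluster \<open>K\<close>, and this weight makes long clusters unlikely through
  \<open>skinny\<close>.\<close>

lemma supercritical_thinning:
 fixes p p' c \<sigma> g :: real
 assumes p: "pc < p" "p <= p1" "pc <= p'" "p' <= p" and v: "v \<in> V" and B: "finite B" "B \<subseteq> V"
  and R: "arm_le p' R g" "g <= 1" "R + k * (R + R) <= n"
  and c: "0 <= \<sigma>" "\<sigma> <= c * (p - pc) * ((p - p') / (1 - p'))" "(p - p') / (1 - p') <= \<eta>0"
  and sb: "sprinkles c \<eta>0"
 shows "\<exists>F. finite F \<and> F \<subseteq> E \<and> tch E B \<subseteq> F \<and>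
  (p' / p) ^ n * bprob F p (%w. lv w {v} n \<noteq> {} \<and> CL w {v} \<subseteq> B) <= max (exp (- \<sigma> * N) ^ R) (1 - (1 - g) ^ N) ^ k * g"
proof -
 let ?M = "2 * inv_floor (p - pc) + 1"
 \<comment> \<open>\<open>B\<close> enlarged by the distance that \<open>sprinkles\<close> demands
   between \<open>D\<close> and subsets of \<open>B\<close>.\<close>
 define \<Lambda> where "\<Lambda> = (\<Union>m\<le>?M. reach E B m)"
 define F where "F = tch E \<Lambda>"
 define D where "D = V - \<Lambda>"
 \<comment> \<open>The solution of \<open>(1 - p') * t = p - p'\<close>, so that sprinkling density
   \<open>t\<close> over \<open>p'\<close> restores \<open>p\<close>.\<close>
 define t where "t = (p - p') / (1 - p')"
 define s where "s = p' / p"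
 define Q where "Q = (%w. lv w {v} n \<noteq> {} \<and> CL w {v} \<subseteq> B)"
 have \<Lambda>: "finite \<Lambda>" "\<Lambda> \<subseteq> V" unfolding \<Lambda>_def using finite_reach[OF B] by auto
 have B\<Lambda>: "B \<subseteq> \<Lambda>" unfolding \<Lambda>_def by (intro subsetI UN_I[of 0]) auto
 have F: "finite F" "F \<subseteq> E" unfolding F_def using tch_card(1)[OF order_refl \<Lambda>(1)] tch_subset[of E \<Lambda>] by auto
 have BF: "tch E B \<subseteq> F" using B\<Lambda> by (auto simp: F_def tch_def)
 have p01: "0 <= p" "p <= 1" "0 <= p'" "p' <= 1" "p' < 1" "0 < p" using p pc by auto
 have s01: "0 <= s" "s <= 1" using p01 p by (auto simp: s_def)
 have t01: "0 <= t" "t <= 1" using p01 p by (auto simp: t_def)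
 have ps: "p * s = p'" using p01 by (simp add: s_def)
 have cpl: "(1 - p * s) * t = p * (1 - s)" unfolding ps using p01 by (simp add: t_def s_def field_simps)
 define \<psi> where "\<psi> = (%S. bexp (nt F S) p (%w. (1 - t) ^ card {i \<in> bd F S. snd i \<in> CL w D}))"
 have \<psi>: "\<psi> S <= exp (- \<sigma> * card S)" if S: "S \<subseteq> B" for S
 proof -
  have S': "finite S" "S \<subseteq> V" "S \<subseteq> \<Lambda>" using S B B\<Lambda> by (auto intro: finite_subset)
  have "\<psi> S <= exp (- c * (p - pc) * card S * t)"
   unfolding \<psi>_def
  proof (rule sb[unfolded sprinkles_def, rule_format, OF F p(1,2) S'(1,2)])
   show "D \<inter> S = {}" using S'(3) by (auto simp: D_def)
   show "0 <= t" "t <= \<eta>0" using t01 c(3) by (auto simp: t_def)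
   fix x assume "x \<in> S"
   then show "\<theta> * (p - pc) <= bprob F p (%w. x \<in> CL w D)"
    unfolding F_def D_def using S'(3) p by (intro theta(2) \<Lambda>) auto
  next
   fix m assume m: "m <= ?M"
   have "reach F S m \<subseteq> reach E B m" by (rule reach_mono[OF F(2) S])
   also have "... \<subseteq> \<Lambda>" unfolding \<Lambda>_def using m by auto
   finally show "reach F S m \<inter> D = {}" by (auto simp: D_def)
  qed
  also have "... <= exp (- \<sigma> * card S)"
   using mult_right_mono[OF c(2), of "real (card S)"] by (simp add: t_def mult_ac)
  finally show ?thesis .
 qed
 have Q: "Q (tch w (CL w {v})) = Q w" for w by (simp add: Q_def lv_tch CL_tch)
 have "(p' / p) ^ n * bprob F p (%w. lv w {v} n \<noteq> {} \<and> CL w {v} \<subseteq> B)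
  <= bexp F p (%w. bprob F s (%\<sigma>. lv (w \<inter> \<sigma>) {v} n \<noteq> {} \<and> CL w {v} \<subseteq> B))"
  unfolding s_def[symmetric] by (rule thin_level_and[OF F(1) p01(1,2) s01])
 also have "... <= bexp F p (%w. bprob F s (%\<sigma>. Q (w \<inter> \<sigma>) \<and> CL w {v} \<inter> D = {}))"
 proof (intro bexp_mono[OF p01(1,2)] bprob_mono[OF s01])
  fix w \<sigma> :: "'v set set"
  assume *: "lv (w \<inter> \<sigma>) {v} n \<noteq> {} \<and> CL w {v} \<subseteq> B"
  have "CL (w \<inter> \<sigma>) {v} \<subseteq> CL w {v}" by (rule CL_mono) auto
  then show "Q (w \<inter> \<sigma>) \<and> CL w {v} \<inter> D = {}" using * B\<Lambda> unfolding Q_def D_def by auto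
 qed
 also have "... <= bexp F (p * s) (%w. of_bool (Q w) * \<psi> (CL w {v}))"
  unfolding \<psi>_def by (rule sprinkle_escape[where Q = Q and v = v, OF F(1) p01(1,2) s01 t01 cpl Q])
 also have "... <= bexp F p' (%w. (\<Prod>j<R + k * (R + R). wt \<sigma> (lv w {v} j)) * of_bool (lv w {v} (R + k * (R + R)) \<noteq> {}))"
  unfolding ps
 proof (rule bexp_mono[OF p01(3,4)])
  fix w assume w: "w \<subseteq> F"
  let ?n = "R + k * (R + R)"
  have nn: "0 <= (\<Prod>j<?n. wt \<sigma> (lv w {v} j)) * of_bool (lv w {v} ?n \<noteq> {})"
   using prod_wt(1)[where f = "lv w {v}"] by simp
  show "of_bool (Q w) * \<psi> (CL w {v}) <= (\<Prod>j<?n. wt \<sigma> (lv w {v} j)) * of_bool (lv w {v} ?n \<noteq> {})"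
  proof (cases "Q w")
   case True
   have n: "lv w {v} ?n \<noteq> {}" using True R(3) lv_arm_mono[of w "{v}" n ?n] by (simp add: Q_def)
   have "\<psi> (CL w {v}) <= exp (- \<sigma> * card (CL w {v}))" using True by (intro \<psi>) (simp add: Q_def)
   \<comment> \<open>Levels are disjoint parts of the cluster, so the volume weight splits into one
     weight per level.\<close>
   also have "... <= exp (- \<sigma> * real (\<Sum>j<?n. card (lv w {v} j)))"
   proof -
    have "(\<Sum>j<?n. card (lv w {v} j)) <= card (CL w {v})"
     using w F by (intro level_card_sum) (auto intro: finite_subset)
    then show ?thesis using c(1) by (simp add: mult_left_mono del: of_nat_sum)
   qed
   also have "... = (\<Prod>j<?n. wt \<sigma> (lv w {v} j))"
    by (simp add: wt_def exp_sum[symmetric] sum_distrib_left sum_negf)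
   finally show ?thesis using True n by simp
  qed (use nn in simp)
 qed
 also have "... <= max (exp (- \<sigma> * N) ^ R) (1 - (1 - g) ^ N) ^ k * g"
  by (rule skinny[OF R(1,2) p01(3,4) c(1) F v])
 finally show ?thesis using F BF by blast
qed

lemma supercritical_decay:
 "\<exists>\<delta> K c. 0 < \<delta> \<and> 0 < K \<and> 0 < c \<and> (\<forall>p v n B. pc < p --> p < pc + \<delta> --> v \<in> V --> 1 <= n --> finite B --> B \<subseteq> V -->
  (\<exists>F. finite F \<and> F \<subseteq> E \<and> tch E B \<subseteq> F \<and>
   bprob F p (%w. lv w {v} n \<noteq> {} \<and> CL w {v} \<subseteq> B) <= K / real n * exp (- c * (p - pc) * real n)))"
proof -
 obtain D0 where D0: "1 <= D0"
  "\<forall>n\<ge>1. \<forall>p. pc <= p --> p <= 1 --> (p - pc) * n <= 1 --> arm_le p n (D0 / n)"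
  "\<forall>p q. pc <= q --> q <= p --> pc < p --> p <= 1 --> arm_le q (inv_floor (p - pc)) (2 * D0 * (p - pc))"
  using near_critical_arm by auto
 obtain c0 \<eta>0 where c0: "0 < c0" "0 < \<eta>0" "\<eta>0 < 1" and sb: "sprinkles c0 \<eta>0"
  using sprinkle_bound by auto
 \<comment> \<open>Per block of \<open>2 * M\<close> levels thinning loses at most about
   \<open>exp (2 * b)\<close>, and the gain aimed at is \<open>exp (- a)\<close> with
   \<open>a = 4 * b\<close>. Thick levels, of more than \<open>\<Delta> / eps\<close> vertices, give
   \<open>exp (- c0 * \<kappa>' * \<Delta> / 2)\<close>, and this value of \<open>\<Delta>\<close>
   makes it \<open>exp (- a)\<close>. Thin levels die out with probability at least
   \<open>exp (- 2 * L)\<close>, where \<open>L\<close> does not involve \<open>\<kappa>'\<close>;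
   so \<open>\<kappa>'\<close> is taken small enough for this to be at least
   \<open>a\<close>.\<close>
 define \<Delta> where "\<Delta> = 8 / (c0 * pc)"
 define L where "L = 2 * D0 * (\<Delta> + 1)"
 define \<kappa>' where "\<kappa>' = min (1 / 2) (pc * exp (- 2 * L) / 4)"
 define a where "a = 4 * \<kappa>' / pc"
 define b where "b = \<kappa>' / pc"
 \<comment> \<open>In this order: \<open>eps <= 1\<close>, \<open>p <= p1\<close>,
   \<open>g <= 1 / 2\<close>, and sprinkling density at most \<open>\<eta>0\<close>.\<close>
 define \<delta> where "\<delta> = min (min 1 (p1 - pc)) (min (1 / (4 * D0)) (\<eta>0 * (1 - p1)))"
 have \<Delta>: "0 < \<Delta>" using c0 pc by (simp add: \<Delta>_def)
 have \<kappa>': "0 < \<kappa>'" "\<kappa>' <= 1 / 2" "4 * \<kappa>' / pc <= exp (- 2 * L)"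
 proof -
  show "0 < \<kappa>'" "\<kappa>' <= 1 / 2" using pc by (auto simp: \<kappa>'_def)
  have "\<kappa>' <= pc * exp (- 2 * L) / 4" by (simp add: \<kappa>'_def)
  then show "4 * \<kappa>' / pc <= exp (- 2 * L)" using pc by (simp add: field_simps)
 qed
 have a0: "0 < a" and b0: "0 < b" using \<kappa>' pc by (auto simp: a_def b_def)
 have \<delta>: "0 < \<delta>" using D0 c0 pc by (simp add: \<delta>_def)
 define K where "K = 2 * D0 * exp (3 * a / 2) * (2 / b) + D0 * exp 1"
 define c where "c = min (b / 2) 1"
 have K: "0 < K" using D0 b0 by (simp add: K_def add_pos_pos)
 have cpos: "0 < c" using b0 by (simp add: c_def)
 have main: "\<exists>F. finite F \<and> F \<subseteq> E \<and> tch E B \<subseteq> F \<and>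
   bprob F p (%w. lv w {v} n \<noteq> {} \<and> CL w {v} \<subseteq> B) <= K / real n * exp (- c * (p - pc) * real n)"
  if p: "pc < p" "p < pc + \<delta>" and v: "v \<in> V" and n: "1 <= n" and B: "finite B" "B \<subseteq> V"
  for p v n B
 proof -
  define eps where "eps = p - pc"
  define M where "M = inv_floor eps"
  define g where "g = 2 * D0 * eps"
  define p' where "p' = p - \<kappa>' * eps"
  define N where "N = nat \<lceil>\<Delta> / eps\<rceil>"
  define \<sigma> where "\<sigma> = c0 * eps * (\<kappa>' * eps)"
  have eps: "0 < eps" "eps <= 1" "p <= p1" "g <= 1 / 2" "eps <= \<eta>0 * (1 - p1)"
  proof -
   show "0 < eps" "eps <= 1" "p <= p1" "eps <= \<eta>0 * (1 - p1)" using p by (auto simp: eps_def \<delta>_def)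
   have "eps <= 1 / (4 * D0)" using p by (simp add: eps_def \<delta>_def)
   then show "g <= 1 / 2" using D0(1) by (simp add: g_def field_simps)
  qed
  note M = inv_floor[OF eps(1,2), folded M_def]
  have g0: "0 <= g" using D0 eps by (simp add: g_def)
  have p01: "0 <= p" "p <= 1" "p1 < 1" "0 < p" using p eps pc by auto
  have epsn: "0 < real n" using n by simp
  have exp_le: "exp (- y * eps * n) <= exp (- c * eps * n)" if "c <= y" for y
   using that eps by (simp add: mult_right_mono)
  show ?thesis
  proof (cases "n < M")
   \<comment> \<open>Below the scale \<open>1 / eps\<close> the near-critical bound suffices, and
     the exponential is of constant order.\<close>
   case True
   have "eps * n <= eps * M" using True eps by (intro mult_left_mono) auto
   then have epsn1: "eps * n <= 1" using M(2) by linarith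
   then have arm: "arm_le p n (D0 / n)" using D0(2) n p p01 by (simp add: eps_def)
   have F: "finite (tch E B)" "tch E B \<subseteq> E" using tch_card(1)[OF order_refl B(1)] tch_subset[of E B] by auto
   have "bprob (tch E B) p (%w. lv w {v} n \<noteq> {} \<and> CL w {v} \<subseteq> B) <= bprob (tch E B) p (%w. lv w {v} n \<noteq> {})"
    using p01 by (intro bprob_mono) auto
   also have "... <= D0 / n" by (rule arm_leD[OF arm F v])
   also have "... <= D0 / n * (exp 1 * exp (- 1 * eps * n))"
   proof -
    have "1 <= exp 1 * exp (- 1 * eps * n)" using epsn1 by (simp add: exp_add[symmetric])
    then show ?thesis using D0(1) mult_left_mono[of 1 "exp 1 * exp (- 1 * eps * n)" "D0 / n"] by simp
   qed
   also have "... = D0 * exp 1 / n * exp (- 1 * eps * n)" by simp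
   also have "... <= K / n * exp (- c * eps * n)"
    using D0(1) b0 by (intro mult_mono divide_right_mono exp_le) (auto simp: K_def c_def)
   finally show ?thesis using F by (auto simp: eps_def)
  next
   case False
   define k where "k = (n - M) div (M + M)"
   have kM: "M + k * (M + M) <= n" using False div_times_less_eq_dividend[of "n - M" "M + M"] by (simp only: k_def)
   have "n - M < M + M + (n - M) div (M + M) * (M + M)"
    using M(1) dividend_less_div_times[of "M + M" "n - M"] by simp
   then have "n < 3 * M + k * (2 * M)" using False by (simp add: k_def mult_2)
   then have "real n <= 3 * real M + real k * (2 * real M)" unfolding of_nat_less_iff[symmetric, where 'a = real] by simp
   then have "eps * n <= eps * (3 * real M + real k * (2 * real M))" using eps by (intro mult_left_mono) auto
   also have "... = (3 + 2 * real k) * (eps * M)" by (simp add: algebra_simps)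
   also have "... <= (3 + 2 * real k) * 1" using M(2) by (intro mult_left_mono) auto
   finally have k: "eps * n <= 3 + 2 * real k" by simp
   have \<kappa>eps: "0 <= \<kappa>' * eps" "\<kappa>' * eps <= eps" using \<kappa>' eps mult_right_mono[of \<kappa>' 1 eps] by auto
   have p': "pc <= p'" "p' <= p" using \<kappa>eps by (auto simp: p'_def eps_def)
   have p'1: "0 < 1 - p1" "1 - p1 <= 1 - p'" "0 < 1 - p'" "1 - p' <= 1" using p' pc eps(3) by auto
   have arm: "arm_le p' M g" unfolding M_def g_def eps_def using D0(3) p p' p01 by simp
   have pp': "p - p' = \<kappa>' * eps" by (simp add: p'_def)
   have \<sigma>0: "0 <= \<sigma>" using c0 eps \<kappa>' by (simp add: \<sigma>_def)
   have "\<kappa>' * eps <= \<kappa>' * eps / (1 - p')" using mult_left_le[OF p'1(4) \<kappa>eps(1)] p'1(3) by (simp only: pos_le_divide_eq)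
   then have \<sigma>1: "\<sigma> <= c0 * (p - pc) * ((p - p') / (1 - p'))"
    unfolding pp' \<sigma>_def eps_def[symmetric] using c0 eps by (intro mult_left_mono) auto
   have "\<kappa>' * eps / (1 - p') <= eps / (1 - p1)" using \<kappa>eps p'1 eps by (intro frac_le) auto
   also have "... <= \<eta>0" using eps(5) p'1 by (simp add: field_simps)
   finally have \<eta>: "(p - p') / (1 - p') <= \<eta>0" by (simp add: pp')
   have "\<exists>F. finite F \<and> F \<subseteq> E \<and> tch E B \<subseteq> F \<and>
    (p' / p) ^ n * bprob F p (%w. lv w {v} n \<noteq> {} \<and> CL w {v} \<subseteq> B) <= max (exp (- \<sigma> * N) ^ M) (1 - (1 - g) ^ N) ^ k * g"
    using eps(4) by (intro supercritical_thinning[OF p(1) eps(3) p' v B arm _ kM \<sigma>0 \<sigma>1 \<eta> sb]) auto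
   then obtain F where F: "finite F" "F \<subseteq> E" "tch E B \<subseteq> F"
    "(p' / p) ^ n * bprob F p (%w. lv w {v} n \<noteq> {} \<and> CL w {v} \<subseteq> B) <= max (exp (- \<sigma> * N) ^ M) (1 - (1 - g) ^ N) ^ k * g"
    by auto
   let ?P = "bprob F p (%w. lv w {v} n \<noteq> {} \<and> CL w {v} \<subseteq> B)"
   have P0: "0 <= ?P" by (rule bprob_nonneg[OF p01(1,2)])
   have N: "\<Delta> / eps <= N" "N <= \<Delta> / eps + 1" using \<Delta> eps unfolding N_def by (simp_all add: of_nat_ceiling)
   have "a <= \<sigma> * N * M"
   proof -
    have "a = c0 * \<kappa>' * \<Delta> / 2" using c0 pc by (simp add: a_def \<Delta>_def)
    also have "... <= c0 * \<kappa>' * \<Delta> / 2 * (2 * eps * M)"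
     using M(3) c0 \<kappa>' \<Delta> mult_left_mono[of 1 "2 * eps * M" "c0 * \<kappa>' * \<Delta> / 2"] by simp
    also have "... = \<sigma> * (\<Delta> / eps) * M" using eps by (simp add: \<sigma>_def)
    also have "... <= \<sigma> * N * M" using N \<sigma>0 by (intro mult_right_mono mult_left_mono) auto
    finally show ?thesis .
   qed
   then have r1: "exp (- \<sigma> * N) ^ M <= exp (- a)" by (simp add: exp_of_nat_mult[symmetric] mult_ac)
   have "g * N <= g * (\<Delta> / eps + 1)" using N g0 by (intro mult_left_mono)
   also have "... = 2 * D0 * (\<Delta> + eps)" using eps by (simp add: g_def field_simps)
   also have "... <= L" unfolding L_def using eps D0 by (intro mult_left_mono) auto
   finally have "exp (- 2 * L) <= exp (- 2 * g) ^ N" by (simp add: exp_of_nat_mult[symmetric] mult_ac)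
   also have "... <= (1 - g) ^ N" using exp_le_one_minus[OF g0 eps(4)] by (intro power_mono) auto
   finally have "1 - (1 - g) ^ N <= 1 - exp (- 2 * L)" by simp
   also have "... <= 1 - a" using \<kappa>'(3) by (simp add: a_def)
   also have "... <= exp (- a)" using exp_ge_add_one_self[of "- a"] by simp
   finally have "max (exp (- \<sigma> * N) ^ M) (1 - (1 - g) ^ N) <= exp (- a)" using r1 by simp
   then have "max (exp (- \<sigma> * N) ^ M) (1 - (1 - g) ^ N) ^ k <= exp (- a) ^ k"
    by (intro power_mono) (simp_all add: max.coboundedI1)
   also have "... = exp (- a * k)" by (simp add: exp_of_nat_mult[symmetric] mult_ac)
   also have "... <= exp (3 * a / 2 - 2 * b * (eps * n))"
   proof -
    have "a / 2 * (eps * n) <= a / 2 * (3 + 2 * real k)" using k a0 by (intro mult_left_mono) auto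
    moreover have "a / 2 = 2 * b" by (simp add: a_def b_def)
    ultimately show ?thesis by (simp add: algebra_simps)
   qed
   finally have "max (exp (- \<sigma> * N) ^ M) (1 - (1 - g) ^ N) ^ k * g <= exp (3 * a / 2 - 2 * b * (eps * n)) * g"
    using g0 by (rule mult_right_mono)
   then have 1: "(p' / p) ^ n * ?P <= exp (3 * a / 2 - 2 * b * (eps * n)) * g" using F(4) by linarith
   have p'0: "0 < p'" using p' pc by simp
   have 2: "(p / p') ^ n <= exp (b * (eps * n))"
   proof -
    have "p / p' = 1 + \<kappa>' * eps / p'" using pp' p'0 by (simp add: field_simps)
    also have "... <= exp (\<kappa>' * eps / p')" by (rule exp_ge_add_one_self)
    also have "... <= exp (b * eps)"
     unfolding b_def using \<kappa>eps(1) p' pc by (simp add: frac_le)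
    finally have "(p / p') ^ n <= exp (b * eps) ^ n" using p01 p'0 by (intro power_mono) auto
    then show ?thesis by (simp add: exp_of_nat_mult[symmetric] mult_ac)
   qed
   have "(p / p') ^ n * (p' / p) ^ n = 1" using p01 p'0 by (simp add: power_mult_distrib[symmetric])
   then have "?P = (p / p') ^ n * ((p' / p) ^ n * ?P)" by (simp add: mult.assoc[symmetric])
   also have "... <= exp (b * (eps * n)) * (exp (3 * a / 2 - 2 * b * (eps * n)) * g)"
    by (rule mult_mono[OF 2 1]) (use P0 p01 p'0 in auto)
   \<comment> \<open>The prefactor so far is of order \<open>eps\<close>; written as
     \<open>(eps * n) / n\<close> it becomes the desired \<open>1 / n\<close>, and
     \<open>eps * n\<close> is absorbed by half of the exponential.\<close>
   also have "... = 2 * D0 * exp (3 * a / 2) / n * ((eps * n) * exp (- b * (eps * n)))"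
   proof -
    have "exp (b * (eps * n)) * exp (3 * a / 2 - 2 * b * (eps * n)) = exp (3 * a / 2) * exp (- b * (eps * n))"
     unfolding exp_add[symmetric] by simp
    then show ?thesis using n by (simp add: g_def mult.assoc[symmetric])
   qed
   also have "... <= 2 * D0 * exp (3 * a / 2) / n * (2 / b * exp (- (b / 2) * (eps * n)))"
    using D0 by (intro mult_left_mono linear_exp_bound[OF b0]) auto
   also have "... = 2 * D0 * exp (3 * a / 2) * (2 / b) / n * exp (- (b / 2) * eps * n)" by (simp add: mult.assoc)
   also have "... <= K / n * exp (- c * eps * n)"
    using D0(1) b0 by (intro mult_mono divide_right_mono exp_le) (auto simp: K_def c_def)
   finally show ?thesis using F by (auto simp: eps_def)
  qed
 qed
 show ?thesis
  by (rule exI[of _ \<delta>], rule exI[of _ K], rule exI[of _ c], intro conjI allI impI \<delta> K cpos, rule main)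
qed

end

section \<open>Lower bounds\<close>

lemma thin_reach:
 fixes p s :: real and A U :: "'v set" and F :: "'v set set"
 assumes F: "finite F" and p: "0 <= p" "p <= 1" and s: "0 <= s" "s <= 1"
 shows "s ^ n * bprob F p (%w. \<exists>y\<in>U. \<exists>m\<le>n. y \<in> reach w A m) <= bprob F (p * s) (%w. \<exists>y\<in>U. \<exists>m\<le>n. y \<in> reach w A m)"
 unfolding bexp_thin[OF F]
proof (rule thin_witness[OF assms])
 fix w assume "\<exists>y\<in>U. \<exists>m\<le>n. y \<in> reach w A m"
 then obtain y m where y: "y \<in> U" "m <= n" "y \<in> reach w A m" by auto
 then obtain S where S: "S \<subseteq> w" "card S <= m" "y \<in> reach S A m"
  using reach_witness[of y w A m] by auto
 have "\<exists>y\<in>U. \<exists>m\<le>n. y \<in> reach \<sigma> A m" if "S \<subseteq> \<sigma>" for \<sigma>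
  using S(3) y reach_mono[OF that order_refl, of A m] by auto
 then show "\<exists>S\<subseteq>w. card S <= n \<and> (\<forall>\<sigma>. S \<subseteq> \<sigma> --> \<sigma> \<subseteq> w --> (\<exists>y\<in>U. \<exists>m\<le>n. y \<in> reach \<sigma> A m))"
  using S y by (intro exI[of _ S]) auto
qed

lemma incr_reach_within:
 fixes F :: "'v set set"
 shows "incr_on F (%w. of_bool (\<exists>y\<in>U. \<exists>m\<le>n. y \<in> reach w A m))"
proof (rule incr_onI)
 fix X Y :: "'v set set" assume "X \<subseteq> Y" "Y \<subseteq> F"
 then show "of_bool (\<exists>y\<in>U. \<exists>m\<le>n. y \<in> reach X A m) <= (of_bool (\<exists>y\<in>U. \<exists>m\<le>n. y \<in> reach Y A m) :: real)"
  using reach_mono[of X Y A A] by fastforce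
qed

lemma geometric_tail:
 fixes a :: real
 assumes "0 < a"
 shows "a * (\<Sum>m\<in>{N<..M}. inverse (1 + a) ^ m) <= inverse (1 + a) ^ N"
proof (cases "N <= M")
 case True
 then have "a * (\<Sum>m\<in>{N<..M}. inverse (1 + a) ^ m) = inverse (1 + a) ^ N - inverse (1 + a) ^ M"
 proof (induction M rule: dec_induct)
  case (step M)
  have "{N<..Suc M} = insert (Suc M) {N<..M}" using step(1) by auto
  then have "a * (\<Sum>m\<in>{N<..Suc M}. inverse (1 + a) ^ m)
   = a * inverse (1 + a) ^ Suc M + (inverse (1 + a) ^ N - inverse (1 + a) ^ M)"
   using step.IH by (simp add: algebra_simps)
  also have "a * inverse (1 + a) ^ Suc M = inverse (1 + a) ^ M - inverse (1 + a) ^ Suc M"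
  proof -
   have "a * inverse (1 + a) = 1 - inverse (1 + a)" using assms by (simp add: field_simps)
   then have "a * inverse (1 + a) * inverse (1 + a) ^ M = (1 - inverse (1 + a)) * inverse (1 + a) ^ M" by simp
   then show ?thesis by (simp add: algebra_simps)
  qed
  finally show ?case by simp
 qed simp
 then show ?thesis using assms by simp
qed (use assms in simp)

context l2_percolation
begin

lemma ball_card:
 assumes "v \<in> V" shows "card (\<Union>m<k. reach E {v} m) <= (d + 2) ^ k"
proof -
 have fin: "finite (reach E {v} m)" for m using finite_reach(1)[of "{v}" m] assms by simp
 have r: "card (reach E {v} m) <= d ^ m" for m
 proof (induction m)
  case (Suc m)
  have "reach E {v} (Suc m) \<subseteq> (\<Union>x\<in>reach E {v} m. nbd E (reach E {v} (Suc m) \<inter> {}) x)"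
   by (auto simp: reach_Suc nbd_def)
  also have "... = (\<Union>x\<in>reach E {v} m. nbd E {} x)" by simp
  finally have "card (reach E {v} (Suc m)) <= card (\<Union>x\<in>reach E {v} m. nbd E {} x)"
   using fin nbd_card(1)[OF order_refl] by (intro card_mono) auto
  also have "... <= (\<Sum>x\<in>reach E {v} m. card (nbd E {} x))" by (rule card_UN_le[OF fin])
  also have "... <= card (reach E {v} m) * d" using sum_bounded_above[of "reach E {v} m" "%x. card (nbd E {} x)" d] nbd_card(2)[OF order_refl] by simp
  also have "... <= d ^ m * d" using Suc.IH by (rule mult_right_mono) simp
  finally show ?case by (simp add: mult.commute)
 qed simp
 show ?thesis
 proof (induction k)
  case (Suc k)
  have "card (\<Union>m<Suc k. reach E {v} m) <= card (\<Union>m<k. reach E {v} m) + card (reach E {v} k)"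
   using card_Un_le[of "reach E {v} k" "\<Union>m<k. reach E {v} m"] by (simp add: lessThan_Suc)
  also have "... <= (d + 2) ^ k + d ^ k" using Suc.IH r[of k] by simp
  also have "... <= (d + 2) ^ k + (d + 2) ^ k" by (simp add: power_mono)
  also have "... <= (d + 2) ^ Suc k" by simp
  finally show ?case .
 qed simp
qed

text \<open>At \<open>p = pc + 1 / k\<close> the ball is left with probability at least
  \<open>\<theta> / k\<close>. There are at most exponentially many exit vertices, and the
  exponential moment of the distance makes it unlikely that one of them is at intrinsic distance
  above \<open>L * k\<close>, if \<open>L\<close> is large. Hence an exit of length
  \<open>L * k\<close> exists with probability at least \<open>\<theta> / (2 * k)\<close>, and
  thinning from \<open>p\<close> to \<open>pc\<close> costs only a constant.\<close>

lemma short_connection: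
 "\<exists>L\<ge>1. \<exists>c>0. \<forall>k v. 1 <= k --> 1 / real k <= p1 - pc --> v \<in> V -->
  c / k <= bprob (tch E (\<Union>m<k. reach E {v} m)) pc (%w. \<exists>y\<in>V - (\<Union>m<k. reach E {v} m). \<exists>m\<le>L * k. y \<in> reach w {v} m)"
proof -
 define a where "a = 1 / (2 * C)"
 define r where "r = inverse (1 + a)"
 define \<theta>' where "\<theta>' = min \<theta> 1"
 define G where "G = 16 * C\<^sup>2 * real (d + 2)"
 have a: "0 < a" using C by (simp add: a_def)
 have r: "0 < r" "r < 1" using a by (auto simp: r_def inverse_less_1_iff)
 have \<theta>': "0 < \<theta>'" "\<theta>' <= 1" "\<theta>' <= \<theta>" using theta by (auto simp: \<theta>'_def)
 have "1 <= C\<^sup>2" using C by simp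
 then have "1 * 1 <= (16 * C\<^sup>2) * real (d + 2)" by (intro mult_mono) auto
 then have G: "1 <= G" by (simp add: G_def)
 have "0 < \<theta>' / (2 * real (d + 2) * G)" using \<theta>' G by simp
 \<comment> \<open>\<open>L\<close> has to beat the growth rate \<open>d + 2\<close> of balls, the
   factor \<open>k <= 2 ^ k\<close> and the constant \<open>G\<close>. Taking
   \<open>\<theta>' <= 1\<close> makes \<open>(\<theta>' / G) ^ k\<close> at most
   \<open>\<theta>' / G\<close>.\<close>
 then obtain L0 where L0: "r ^ L0 < \<theta>' / (2 * real (d + 2) * G)" using real_arch_pow_inv[of _ r] r by blast
 define L where "L = Suc L0"
 have "r ^ L <= r ^ L0" using r unfolding L_def by (intro power_decreasing) auto
 then have "r ^ L <= \<theta>' / (2 * real (d + 2) * G)" using L0 by simp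
 moreover have "0 < 2 * real (d + 2) * G" using G by simp
 ultimately have "r ^ L * (2 * real (d + 2) * G) <= \<theta>'" by (simp only: pos_le_divide_eq)
 then have "(2 * real (d + 2) * r ^ L) * G <= \<theta>'" by (simp only: mult_ac)
 then have L: "2 * real (d + 2) * r ^ L <= \<theta>' / G" using G by (simp only: pos_le_divide_eq)
 define c where "c = exp (- real L / pc) * (\<theta> / 2)"
 have c: "0 < c" using theta by (simp add: c_def)
 have main: "c / k <= bprob (tch E (\<Union>m<k. reach E {v} m)) pc (%w. \<exists>y\<in>V - (\<Union>m<k. reach E {v} m). \<exists>m\<le>L * k. y \<in> reach w {v} m)"
  if k: "1 <= k" "1 / real k <= p1 - pc" and v: "v \<in> V" for k v
 proof -
  define \<Lambda> where "\<Lambda> = (\<Union>m<k. reach E {v} m)"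
  define F where "F = tch E \<Lambda>"
  \<comment> \<open>Vertices just outside the ball; any connection inside \<open>F\<close> that
    leaves the ball ends in one of them.\<close>
  define U where "U = \<Union>F - \<Lambda>"
  define N where "N = L * k"
  define p where "p = pc + 1 / real k"
  have v': "finite {v}" "{v} \<subseteq> V" using v by auto
  have \<Lambda>: "finite \<Lambda>" "\<Lambda> \<subseteq> V" "v \<in> \<Lambda>"
   unfolding \<Lambda>_def using finite_reach[OF v'] k by (auto intro!: bexI[of _ 0])
  have F: "finite F" "F \<subseteq> E" unfolding F_def using tch_card(1)[OF order_refl \<Lambda>(1)] tch_subset[of E \<Lambda>] by auto
  have U: "finite U" "U \<subseteq> V" unfolding U_def using finite_vertices[OF F] edges_V[OF F(2)] by auto
  have k0: "0 < real k" using k by simp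
  have p: "pc < p" "p <= p1" "0 <= p" "p <= 1" using k k0 pc by (auto simp: p_def)
  let ?Q = "%w. \<exists>y\<in>V - \<Lambda>. \<exists>m\<le>N. y \<in> reach w {v} m"
  have cU: "card U <= 2 * (d + 2) ^ (k + 1)"
  proof -
   have "card U <= card (\<Union>F)" unfolding U_def using finite_vertices[OF F] by (intro card_mono) auto
   also have "... <= (\<Sum>e\<in>F. card e)" by (rule card_Union_le_sum_card)
   also have "... = 2 * card F" using edge_card[OF F(2)] by simp
   also have "... <= 2 * (d * card \<Lambda>)" using tch_card(2)[OF order_refl \<Lambda>(1)] by (simp add: F_def)
   also have "... <= 2 * ((d + 2) * (d + 2) ^ k)"
    using ball_card[OF v, of k] by (intro mult_left_mono mult_mono) (auto simp: \<Lambda>_def)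
   finally show ?thesis by simp
  qed
  have far: "v \<in> CL w (V - \<Lambda>) ==> ?Q w \<or> (\<exists>m\<in>{N<..card F}. \<exists>u\<in>U. u \<in> lv w {v} m)" if w: "w \<subseteq> F" for w
  proof -
   assume "v \<in> CL w (V - \<Lambda>)"
   then obtain u where u: "u \<in> V - \<Lambda>" "v \<in> CL w {u}" unfolding CL_iff[of v w "V - \<Lambda>"] by auto
   then have uv: "u \<in> CL w {v}" using CL_sym[of u w v] by simp
   then have "u \<in> {v} \<union> \<Union>w" using CL_bound[of w "{v}"] by auto
   then have uU: "u \<in> U" using u(1) \<Lambda>(3) w by (auto simp: U_def)
   obtain m where m: "u \<in> lv w {v} m" using uv by (rule CL_lvE)
   have fw: "finite w" using F(1) w by (rule finite_subset[rotated])
   have "m <= card w" by (rule lv_index_le[OF fw m])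
   also have "... <= card F" using F(1) w by (rule card_mono)
   finally have mF: "m <= card F" .
   show ?thesis
   proof (cases "m <= N")
    case True
    then show ?thesis using subsetD[OF lv_subset_reach m] u(1) by auto
   next
    case False
    then have "m \<in> {N<..card F}" using mF by simp
    then show ?thesis using uU m by auto
   qed
  qed
  have "\<theta> / k = \<theta> * (p - pc)" by (simp add: p_def)
  also have "... <= bprob F p (%w. v \<in> CL w (V - \<Lambda>))" unfolding F_def by (rule theta(2)[OF p(1,2) \<Lambda>])
  also have "... <= bexp F p (%w. of_bool (?Q w) + (\<Sum>m\<in>{N<..card F}. \<Sum>u\<in>U. of_bool (u \<in> lv w {v} m)))"
  proof (rule bexp_mono[OF p(3,4)])
   fix w assume w: "w \<subseteq> F"
   let ?S = "\<Sum>m\<in>{N<..card F}. \<Sum>u\<in>U. of_bool (u \<in> lv w {v} m) :: real"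
   have S0: "0 <= ?S" by (intro sum_nonneg) simp
   have S1: "1 <= ?S" if m: "m \<in> {N<..card F}" and u: "u \<in> U" "u \<in> lv w {v} m" for m u
   proof -
    have "1 = (of_bool (u \<in> lv w {v} m) :: real)" using u by simp
    also have "... <= (\<Sum>u\<in>U. of_bool (u \<in> lv w {v} m))" using U u by (intro member_le_sum) auto
    also have "... <= ?S" by (rule member_le_sum[OF m]) (auto intro: sum_nonneg)
    finally show ?thesis .
   qed
   show "of_bool (v \<in> CL w (V - \<Lambda>)) <= of_bool (?Q w) + ?S"
   proof (cases "v \<in> CL w (V - \<Lambda>)")
    case True
    then show ?thesis using far[OF w] S0 S1 by fastforce
   qed (use S0 in simp)
  qed
  also have "... = bprob F p ?Q + (\<Sum>m\<in>{N<..card F}. \<Sum>u\<in>U. bprob F p (%w. u \<in> lv w {v} m))"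
   by (simp only: bexp_add bexp_sum)
  finally have 1: "\<theta> / k <= bprob F p ?Q + (\<Sum>m\<in>{N<..card F}. \<Sum>u\<in>U. bprob F p (%w. u \<in> lv w {v} m))" .
  have "(\<Sum>m\<in>{N<..card F}. \<Sum>u\<in>U. bprob F p (%w. u \<in> lv w {v} m)) <= (\<Sum>m\<in>{N<..card F}. 2 * C * sqrt (card U) * r ^ m)"
  proof (rule sum_mono)
   fix m
   have "(1 + a) ^ m * (\<Sum>u\<in>U. bprob F p (%w. u \<in> lv w {v} m)) <= 2 * C * sqrt (card U)"
    unfolding a_def by (rule level_exp_decay[OF F p(3,2) v U])
   then show "(\<Sum>u\<in>U. bprob F p (%w. u \<in> lv w {v} m)) <= 2 * C * sqrt (card U) * r ^ m"
    using a by (simp add: r_def power_inverse field_simps)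
  qed
  also have "... = 2 * C * sqrt (card U) * (2 * C) * (a * (\<Sum>m\<in>{N<..card F}. r ^ m))"
   using C by (subst sum_distrib_left[symmetric]) (simp add: a_def)
  also have "... <= 2 * C * sqrt (card U) * (2 * C) * r ^ N"
   unfolding r_def using C by (intro mult_left_mono geometric_tail[OF a]) auto
  also have "... = 4 * C\<^sup>2 * sqrt (card U) * r ^ N" by (simp add: power2_eq_square)
  also have "... <= 4 * C\<^sup>2 * (2 * real (d + 2) ^ (k + 1)) * r ^ N"
  proof (intro mult_right_mono mult_left_mono)
   have "sqrt (card U) <= sqrt (2 * real (d + 2) ^ (k + 1))"
    using of_nat_mono[OF cU, where 'a = real]
    by (intro real_sqrt_le_mono) (simp only: of_nat_mult of_nat_power of_nat_numeral)
   also have "... <= 2 * real (d + 2) ^ (k + 1)"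
   proof -
    have "1 <= 2 * real (d + 2) ^ (k + 1)" using one_le_power[of "real (d + 2)" "k + 1"] by simp
    then show ?thesis by (intro real_le_lsqrt self_le_power) auto
   qed
   finally show "sqrt (card U) <= 2 * real (d + 2) ^ (k + 1)" .
  qed (use r in auto)
  also have "... = G / 2 * (real (d + 2) * r ^ L) ^ k"
   by (simp add: G_def N_def power_mult power_mult_distrib)
  also have "... <= \<theta> / (2 * k)"
  proof -
   have "real k * (real (d + 2) * r ^ L) ^ k <= 2 ^ k * (real (d + 2) * r ^ L) ^ k"
    using r of_nat_less_two_power[of k, where 'a = real] by (intro mult_right_mono) auto
   also have "... = (2 * real (d + 2) * r ^ L) ^ k" unfolding mult.assoc by (rule power_mult_distrib[symmetric])
   also have "... <= (\<theta>' / G) ^ k" using L r by (intro power_mono) auto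
   also have "... <= (\<theta>' / G) ^ 1" using k \<theta>' G by (intro power_decreasing) auto
   also have "... <= \<theta> / G" using \<theta>' G by (simp add: divide_right_mono)
   finally show ?thesis using G k0 by (simp add: field_simps)
  qed
  finally have "\<theta> / (2 * k) <= bprob F p ?Q" using 1 by simp
  then have "(pc / p) ^ N * (\<theta> / (2 * k)) <= (pc / p) ^ N * bprob F p ?Q" using p pc by (intro mult_left_mono) auto
  also have "... <= bprob F (p * (pc / p)) ?Q" using p pc by (intro thin_reach F) auto
  also have "p * (pc / p) = pc" using p pc by simp
  finally have 2: "(pc / p) ^ N * (\<theta> / (2 * k)) <= bprob F pc ?Q" .
  have "exp (- real L / pc) <= (pc / p) ^ N"
  proof -
   have "p / pc = 1 + 1 / (k * pc)" using pc k0 by (simp add: p_def field_simps)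
   also have "... <= exp (1 / (k * pc))" by (rule exp_ge_add_one_self)
   finally have "exp (- (1 / (k * pc))) <= pc / p" using p pc by (simp add: exp_minus field_simps)
   then have "exp (- (1 / (k * pc))) ^ N <= (pc / p) ^ N" by (intro power_mono) auto
   moreover have "exp (- (1 / (k * pc))) ^ N = exp (- real L / pc)"
    unfolding exp_of_nat_mult[symmetric] using k0 by (simp add: N_def)
   ultimately show ?thesis by simp
  qed
  then have "exp (- real L / pc) * (\<theta> / (2 * k)) <= (pc / p) ^ N * (\<theta> / (2 * k))"
   using theta by (intro mult_right_mono) auto
  then show ?thesis using 2 unfolding c_def F_def N_def \<Lambda>_def by simp
 qed
 show ?thesis by (rule exI[of _ L], intro conjI exI[of _ c] allI impI c, simp add: L_def, rule main)
qed

text \<open>Start from a short exit at \<open>pc\<close>. Its event is increasing, so it persists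
  for larger \<open>p\<close>, and for smaller \<open>p\<close> it is thinned at an exponential
  cost. Then require that no vertex of the path is joined to a far set \<open>D\<close>; this bounds
  the cluster. The event speaks of extrinsic balls, which serves both radii.\<close>

lemma lower_bound:
 "\<exists>\<delta> c C1. 0 < \<delta> \<and> 0 < c \<and> 0 < C1 \<and> (\<forall>p v k. \<bar>p - pc\<bar> < \<delta> --> v \<in> V --> 1 <= k -->
  (\<exists>B. finite B \<and> B \<subseteq> V \<and> c / real k * exp (- C1 * \<bar>p - pc\<bar> * real k) <=
   bprob (tch E B) p (%w. (\<exists>u\<in>CL w {v}. u \<notin> (\<Union>m<k. reach E {v} m)) \<and> CL w {v} \<subseteq> B)))"
proof -
 obtain D0 where D0: "1 <= D0"
  "\<forall>p q. pc <= q --> q <= p --> pc < p --> p <= 1 --> arm_le q (inv_floor (p - pc)) (2 * D0 * (p - pc))"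
  using near_critical_arm by auto
 obtain D1 where D1: "1 <= D1" "\<forall>n\<ge>1. \<forall>p. 0 <= p --> p <= pc --> arm_le p n (D1 / n)"
  using one_arm_critical by auto
 obtain L c0 where L: "1 <= L" and c0: "0 < c0" and sc: "\<forall>k v. 1 <= k --> 1 / real k <= p1 - pc --> v \<in> V -->
  c0 / k <= bprob (tch E (\<Union>m<k. reach E {v} m)) pc (%w. \<exists>y\<in>V - (\<Union>m<k. reach E {v} m). \<exists>m\<le>L * k. y \<in> reach w {v} m)"
  using short_connection by auto
 define k0 where "k0 = nat \<lceil>1 / (p1 - pc)\<rceil>"
 have k0: "1 <= k0" "1 / (p1 - pc) <= real k0"
 proof -
  have "0 < 1 / (p1 - pc)" using pc by simp
  then show "1 <= k0" "1 / (p1 - pc) <= real k0" unfolding k0_def by linarith+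
 qed
 define \<delta> where "\<delta> = min (min (p1 - pc) (pc / 2)) (1 / (4 * D0))"
 have \<delta>: "0 < \<delta>" using pc D0 by (simp add: \<delta>_def)
 define c where "c = c0 / (2 * real k0)"
 have c: "0 < c" using c0 k0 by (simp add: c_def)
 define b where "b = 2 / pc + 12 * D0"
 have b: "0 < b" using pc D0 by (simp add: b_def add_pos_pos)
 define C1 where "C1 = b * (real L * real k0)"
 have C1: "0 < C1" using b L k0 by (simp add: C1_def)
 have main: "\<exists>B. finite B \<and> B \<subseteq> V \<and> c / real k * exp (- C1 * \<bar>p - pc\<bar> * real k) <=
   bprob (tch E B) p (%w. (\<exists>u\<in>CL w {v}. u \<notin> (\<Union>m<k. reach E {v} m)) \<and> CL w {v} \<subseteq> B)"
  if p: "\<bar>p - pc\<bar> < \<delta>" and v: "v \<in> V" and k: "1 <= k" for p v k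
 proof -
  define eps where "eps = \<bar>p - pc\<bar>"
  define K where "K = max k k0"
  define N where "N = L * K"
  define \<Lambda> where "\<Lambda> = (\<Union>m<K. reach E {v} m)"
  let ?Q = "%w. \<exists>y\<in>V - \<Lambda>. \<exists>m\<le>N. y \<in> reach w {v} m"
  have eps: "0 <= eps" "eps <= p1 - pc" "eps <= pc / 2" "2 * D0 * eps <= 1 / 2"
  proof -
   show "0 <= eps" "eps <= p1 - pc" "eps <= pc / 2" using p by (auto simp: eps_def \<delta>_def)
   have "eps <= 1 / (4 * D0)" using p by (simp add: eps_def \<delta>_def)
   then show "2 * D0 * eps <= 1 / 2" using D0(1) by (simp add: field_simps)
  qed
  have p01: "0 <= p" "p <= 1" "p <= p1" "pc / 2 <= p" "0 < p" using eps pc by (auto simp: eps_def abs_if split: if_splits)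
  have K: "1 <= K" "k <= K" "real K <= real k0 * real k" "1 / real K <= p1 - pc"
  proof -
   show "1 <= K" "k <= K" using k by (auto simp: K_def)
   have "K <= k0 * k" using k k0(1) by (auto simp: K_def)
   then show "real K <= real k0 * real k" unfolding of_nat_mult[symmetric] by (rule of_nat_mono)
   have "1 / (p1 - pc) <= real K" using k0(2) by (simp add: K_def)
   then show "1 / real K <= p1 - pc" using pc \<open>1 <= K\<close> by (simp add: field_simps)
  qed
  have N1: "1 <= N" using L K by (simp add: N_def)
  have v': "finite {v}" "{v} \<subseteq> V" using v by auto
  \<comment> \<open>Isolating at most \<open>2 * N + 1\<close> vertices. For \<open>p <= pc\<close>
    the arm length \<open>M\<close> may be taken so large that this costs at most a factor
    \<open>2\<close>. Above \<open>pc\<close> arms of length \<open>1 / eps\<close> have probability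
    at most \<open>g = 2 * D0 * eps\<close>, and \<open>exp (- 2 * g)\<close> to the power
    \<open>2 * N + 1 <= 3 * N\<close> gives the constant \<open>12\<close>.\<close>
  have arm: "\<exists>M g. arm_le p M g \<and> 0 <= g \<and> g <= 1 \<and> exp (- 12 * D0 * eps * N) / 2 <= (1 - g) ^ (2 * N + 1)"
  proof (cases "p <= pc")
   case True
   define M where "M = nat \<lceil>2 * D1 * (2 * real N + 1)\<rceil>"
   have D1N: "1 * 1 <= (2 * D1) * (2 * real N + 1)" using D1(1) by (intro mult_mono) auto
   have M: "2 * D1 * (2 * real N + 1) <= M" "1 <= M" unfolding M_def using D1N by linarith+
   define g where "g = D1 / M"
   have g1: "g * (2 * real N + 1) <= 1 / 2" using M by (simp add: g_def field_simps)
   have g0: "0 <= g" using D1 by (simp add: g_def)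
   have "g * 1 <= g * (2 * real N + 1)" using g0 by (intro mult_left_mono) auto
   then have g2: "g <= 1 / 2" using g1 by simp
   have "exp (- 12 * D0 * eps * N) <= 1" using D0 eps by simp
   moreover have "1 + real (2 * N + 1) * (- g) <= (1 + (- g)) ^ (2 * N + 1)" using g2 by (intro Bernoulli_inequality) auto
   moreover have "real (2 * N + 1) * (- g) = - (g * (2 * real N + 1))" "1 + (- g) = 1 - g" by (simp_all add: algebra_simps)
   ultimately have "exp (- 12 * D0 * eps * N) <= 1" "1 + - (g * (2 * real N + 1)) <= (1 - g) ^ (2 * N + 1)" by (simp_all only:)
   then have "exp (- 12 * D0 * eps * N) / 2 <= (1 - g) ^ (2 * N + 1)" using g1 by linarith
   moreover have "arm_le p M g" using D1(2) M(2) p01 True by (simp add: g_def)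
   ultimately show ?thesis using g0 g2 by (intro exI[of _ M] exI[of _ g]) auto
  next
   case False
   then have epsp: "eps = p - pc" by (simp add: eps_def)
   define g where "g = 2 * D0 * eps"
   have g0: "0 <= g" using D0 eps by (simp add: g_def)
   have g2: "g <= 1 / 2" using eps(4) by (simp add: g_def)
   have "g * real (2 * N + 1) <= g * (3 * real N)" using g0 N1 by (intro mult_left_mono) auto
   then have "exp (- 12 * D0 * eps * N) <= exp (- 2 * g) ^ (2 * N + 1)"
    unfolding exp_of_nat_mult[symmetric] exp_le_cancel_iff by (simp add: g_def algebra_simps)
   also have "... <= (1 - g) ^ (2 * N + 1)" using exp_le_one_minus[OF g0 g2] by (intro power_mono) auto
   finally have "exp (- 12 * D0 * eps * N) <= (1 - g) ^ (2 * N + 1)" .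
   then have "exp (- 12 * D0 * eps * N) / 2 <= (1 - g) ^ (2 * N + 1)" using exp_gt_zero[of "- 12 * D0 * eps * N"] by linarith
   moreover have "arm_le p (inv_floor eps) g" unfolding g_def epsp using D0(2) False p01 by simp
   ultimately show ?thesis using g0 g2 by (intro exI[of _ "inv_floor eps"] exI[of _ g]) auto
  qed
  then obtain M g where g: "arm_le p M g" "0 <= g" "g <= 1" "exp (- 12 * D0 * eps * N) / 2 <= (1 - g) ^ (2 * N + 1)" by auto
  \<comment> \<open>Large enough to contain the ball \<open>\<Lambda>\<close>, every vertex within
    \<open>N\<close> steps of \<open>v\<close>, and around these all points at distance less than
    \<open>M\<close>.\<close>
  define B where "B = (\<Union>m<K + N + M + 1. reach E {v} m)"
  define F where "F = tch E B"
  define D where "D = V - B"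
  have B: "finite B" "B \<subseteq> V" unfolding B_def using finite_reach[OF v'] by auto
  have F: "finite F" "F \<subseteq> E" unfolding F_def using tch_card(1)[OF order_refl B(1)] tch_subset[of E B] by auto
  have \<Lambda>B: "\<Lambda> \<subseteq> B" unfolding \<Lambda>_def B_def by (intro UN_mono) auto
  have \<Lambda>F: "tch E \<Lambda> \<subseteq> F" using \<Lambda>B by (auto simp: F_def tch_def)
  have "c0 / K <= bprob (tch E \<Lambda>) pc ?Q" unfolding \<Lambda>_def N_def using sc K v by simp
  also have "... <= bprob F pc ?Q" using pc by (intro bexp_mono_F F \<Lambda>F incr_reach_within) auto
  finally have 1: "c0 / K <= bprob F pc ?Q" .
  have 2: "exp (- (2 / pc) * eps * N) * bprob F pc ?Q <= bprob F p ?Q"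
  proof (cases "pc <= p")
   case True
   have "exp (- (2 / pc) * eps * N) * bprob F pc ?Q <= 1 * bprob F pc ?Q"
    using pc eps by (intro mult_right_mono bprob_nonneg) auto
   also have "... <= bprob F p ?Q"
    using bexp_mono_p[OF F(1) _ True p01(2) incr_reach_within] pc by simp
   finally show ?thesis .
  next
   case False
   then have epsp: "eps = pc - p" by (simp add: eps_def)
   have "pc / p = 1 + eps / p" using p01 by (simp add: epsp field_simps)
   also have "... <= exp (eps / p)" by (rule exp_ge_add_one_self)
   also have "... <= exp (eps / (pc / 2))" unfolding exp_le_cancel_iff
    using eps(1) p01 pc by (intro divide_left_mono mult_pos_pos) auto
   finally have "exp (- (2 / pc) * eps) <= p / pc" using p01 pc by (simp add: exp_minus field_simps)
   then have "exp (- (2 / pc) * eps) ^ N <= (p / pc) ^ N" by (intro power_mono) auto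
   then have "exp (- (2 / pc) * eps * N) <= (p / pc) ^ N" by (simp add: exp_of_nat_mult[symmetric] mult_ac)
   then have "exp (- (2 / pc) * eps * N) * bprob F pc ?Q <= (p / pc) ^ N * bprob F pc ?Q"
    using pc by (intro mult_right_mono bprob_nonneg) auto
   also have "... <= bprob F (pc * (p / pc)) ?Q" using False p01 pc by (intro thin_reach F) auto
   also have "pc * (p / pc) = p" using pc by simp
   finally show ?thesis .
  qed
  have 3: "(1 - g) ^ (2 * N + 1) * bprob F p ?Q <= bprob F p (%w. ?Q w \<and> v \<notin> CL w D)"
  proof (rule path_and_isolated_ge[OF F(1) _ p01(1,2) g(2,3)])
   show "\<And>e. e \<in> F ==> card e = 2" using edge_card[OF F(2)] by auto
   fix \<gamma> x m assume *: "\<gamma> \<subseteq> F" "m <= N" "x \<in> reach F {v} m"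
   have x: "x \<in> reach E {v} m" using *(3) reach_mono[OF F(2) order_refl] by auto
   show "bprob (F - \<gamma>) p (%w. x \<in> CL w D) <= g"
   proof (rule far_arm_prob[OF g(1) p01(1,2) _ _ order_refl])
    show "finite (F - \<gamma>)" "F - \<gamma> \<subseteq> E" using F by auto
    show "x \<in> V" using x finite_reach(2)[OF v'] by auto
    fix j assume "j < M"
    then have "reach E {x} j \<subseteq> B" using reach_trans[OF _ x] *(2) unfolding B_def by fastforce
    then show "reach E {x} j \<inter> D = {}" by (auto simp: D_def)
   qed
  qed
  have "c / real k * exp (- C1 * eps * real k) <= c0 / (2 * real K) * exp (- b * eps * N)"
  proof (rule mult_mono)
   have "c0 / (2 * (real k0 * real k)) <= c0 / (2 * real K)" using K k k0 c0 by (intro divide_left_mono) auto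
   then show "c / real k <= c0 / (2 * real K)" by (simp add: c_def mult_ac)
   have "real N <= real L * real k0 * real k" using K(3) mult_left_mono[OF K(3), of "real L"] by (simp add: N_def mult_ac)
   then have "b * eps * N <= b * eps * (real L * real k0 * real k)" using b eps by (intro mult_left_mono) auto
   then show "exp (- C1 * eps * real k) <= exp (- b * eps * N)" by (simp add: C1_def mult_ac)
  qed (use c0 in auto)
  also have "... = exp (- 12 * D0 * eps * N) / 2 * (exp (- (2 / pc) * eps * N) * (c0 / K))"
  proof -
   have "exp (- b * eps * N) = exp (- 12 * D0 * eps * N) * exp (- (2 / pc) * eps * N)"
    unfolding exp_add[symmetric] by (simp add: b_def algebra_simps)
   then show ?thesis by simp
  qed
  also have "... <= exp (- 12 * D0 * eps * N) / 2 * (exp (- (2 / pc) * eps * N) * bprob F pc ?Q)"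
   using 1 by (intro mult_left_mono) auto
  also have "... <= exp (- 12 * D0 * eps * N) / 2 * bprob F p ?Q" using 2 by (intro mult_left_mono) auto
  also have "... <= (1 - g) ^ (2 * N + 1) * bprob F p ?Q" by (rule mult_right_mono[OF g(4) bprob_nonneg[OF p01(1,2)]])
  also note 3
  also have "bprob F p (%w. ?Q w \<and> v \<notin> CL w D)
   <= bprob F p (%w. (\<exists>u\<in>CL w {v}. u \<notin> (\<Union>m<k. reach E {v} m)) \<and> CL w {v} \<subseteq> B)"
  proof (rule bprob_mono[OF p01(1,2)])
   fix w assume w: "w \<subseteq> F" and q: "?Q w \<and> v \<notin> CL w D"
   then obtain y m where y: "y \<in> V - \<Lambda>" "y \<in> reach w {v} m" by auto
   have "y \<in> CL w {v}" using y(2) by (auto simp: CL_reach)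
   moreover have "y \<notin> (\<Union>m<k. reach E {v} m)" using y(1) K(2) by (auto simp: \<Lambda>_def)
   moreover have "CL w {v} \<subseteq> B"
   proof
    fix u assume u: "u \<in> CL w {v}"
    have "u \<in> V" using u CL_V[of w "{v}"] w F(2) v by auto
    moreover have "u \<notin> D"
    proof
     assume "u \<in> D"
     moreover have "v \<in> CL w {u}" using u CL_sym[of v w u] by simp
     ultimately have "v \<in> CL w D" unfolding CL_iff[of v w D] by auto
     then show False using q by simp
    qed
    ultimately show "u \<in> B" by (simp add: D_def)
   qed
   ultimately show "(\<exists>u\<in>CL w {v}. u \<notin> (\<Union>m<k. reach E {v} m)) \<and> CL w {v} \<subseteq> B" by auto
  qed
  finally show ?thesis using B unfolding F_def eps_def by (intro exI[of _ B]) simp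
 qed
 show ?thesis
  by (rule exI[of _ \<delta>], rule exI[of _ c], rule exI[of _ C1], intro conjI allI impI \<delta> c C1, rule main)
qed

end

section \<open>From finite edge sets to the product measure\<close>

lemma space_percolation: "space (percolation E p) = (\<Pi>\<^sub>E e\<in>E. UNIV)"
 by (simp add: percolation_def space_PiM)

lemma prob_space_percolation: "prob_space (percolation E p)"
 unfolding percolation_def by (intro prob_space_PiM prob_space_measure_pmf)

lemma cluster_CL: "cluster E w v = CL (open_edges E w) {v}"
 by (auto simp: cluster_def CL_def)

lemma open_edges_subset: "open_edges E w \<subseteq> E"
 by (auto simp: open_edges_def)

lemma cylinder:
 fixes F w0 :: "'v set set"
 assumes p: "0 <= p" "p <= 1" and F: "finite F" "F \<subseteq> E" and w0: "w0 \<subseteq> F"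
 defines "Z \<equiv> {w \<in> space (percolation E p). open_edges E w \<inter> F = w0}"
 shows "Z \<in> sets (percolation E p)" "measure (percolation E p) Z = p ^ card w0 * (1 - p) ^ card (F - w0)"
proof -
 interpret product_prob_space "%_. measure_pmf (bernoulli_pmf p)" E
  by (simp add: product_prob_space_def product_prob_space_axioms_def product_sigma_finite_def
    prob_space_measure_pmf prob_space_imp_sigma_finite)
 let ?X = "%e. {e \<in> w0}"
 have Z: "Z = prod_emb E (%_. measure_pmf (bernoulli_pmf p)) F (Pi\<^sub>E F ?X)"
  unfolding Z_def space_percolation prod_emb_def using F(2) w0
  by (auto simp: open_edges_def PiE_iff restrict_def extensional_def)
 show "Z \<in> sets (percolation E p)"
  unfolding Z percolation_def using F by (intro sets_PiM_I) auto
 have "measure (percolation E p) Z = (\<Prod>e\<in>F. measure (measure_pmf (bernoulli_pmf p)) (?X e))"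
  unfolding Z percolation_def using F by (intro measure_PiM_emb) auto
 also have "... = (\<Prod>e\<in>F. if e \<in> w0 then p else 1 - p)"
  using p by (intro prod.cong) (auto simp: measure_pmf_single)
 also have "... = p ^ card w0 * (1 - p) ^ card (F - w0)"
  using F(1) w0 by (simp add: prod.If_cases Int_absorb1 Diff_eq Collect_neg_eq)
 finally show "measure (percolation E p) Z = p ^ card w0 * (1 - p) ^ card (F - w0)" .
qed

lemma local_event:
 fixes F :: "'v set set"
 assumes p: "0 <= p" "p <= 1" and F: "finite F" "F \<subseteq> E" and A: "\<And>w. w \<subseteq> E ==> A w = A (w \<inter> F)"
 defines "S \<equiv> {w \<in> space (percolation E p). A (open_edges E w)}"
 shows "S \<in> sets (percolation E p)" "measure (percolation E p) S = bprob F p A"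
proof -
 interpret prob_space "percolation E p" by (rule prob_space_percolation)
 define Z where "Z w0 = {w \<in> space (percolation E p). open_edges E w \<inter> F = w0}" for w0
 define I where "I = {w0. w0 \<subseteq> F \<and> A w0}"
 have I: "finite I" unfolding I_def using F(1) by (rule_tac finite_subset[of _ "Pow F"]) auto
 have S: "S = (\<Union>w0\<in>I. Z w0)"
 proof (intro equalityI subsetI)
  fix w assume "w \<in> S"
  then have w: "w \<in> space (percolation E p)" "A (open_edges E w)" by (simp_all add: S_def)
  then have "open_edges E w \<inter> F \<in> I" using A[OF open_edges_subset, of w] by (simp add: I_def)
  then show "w \<in> (\<Union>w0\<in>I. Z w0)" using w(1) by (intro UN_I) (auto simp: Z_def)
 next
  fix w assume "w \<in> (\<Union>w0\<in>I. Z w0)"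
  then have w: "w \<in> space (percolation E p)" "A (open_edges E w \<inter> F)" by (auto simp: Z_def I_def)
  then show "w \<in> S" using A[OF open_edges_subset, of w] by (simp add: S_def)
 qed
 have Z: "Z w0 \<in> sets (percolation E p)" "measure (percolation E p) (Z w0) = p ^ card w0 * (1 - p) ^ card (F - w0)"
  if "w0 \<in> I" for w0
  unfolding Z_def using cylinder[OF p F, of w0] that by (simp_all add: I_def)
 show "S \<in> sets (percolation E p)" unfolding S by (rule sets.finite_UN[OF I Z(1)])
 have "measure (percolation E p) S = (\<Sum>w0\<in>I. measure (percolation E p) (Z w0))"
  unfolding S
 proof (rule finite_measure_finite_Union[OF I])
  show "Z ` I \<subseteq> sets (percolation E p)" using Z(1) by (rule image_subsetI)
  show "disjoint_family_on Z I" by (auto simp: disjoint_family_on_def Z_def)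
 qed
 also have "... = (\<Sum>w0\<in>I. p ^ card w0 * (1 - p) ^ card (F - w0) * of_bool (A w0))"
  by (rule sum.cong[OF refl]) (simp add: Z(2), simp add: I_def)
 also have "... = bprob F p A"
  unfolding bexp_def I_def using F(1) by (intro sum.mono_neutral_left) auto
 finally show "measure (percolation E p) S = bprob F p A" .
qed

text \<open>If the cluster seen in \<open>F\<close> stays in \<open>B\<close>, then every open edge
  leaving it would touch \<open>B\<close> and hence belong to \<open>F\<close>. So containment in
  \<open>B\<close> can be tested on finitely many edges.\<close>

lemma CL_local:
 assumes "w \<subseteq> E" "tch E B \<subseteq> F" "CL (w \<inter> F) A \<subseteq> B"
 shows "CL w A = CL (w \<inter> F) A"
proof
 show "CL w A \<subseteq> CL (w \<inter> F) A"
 proof (rule CL_least[OF CL_self])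
  fix x y assume *: "x \<in> CL (w \<inter> F) A" "{x, y} \<in> w"
  then have "x \<in> B" using assms(3) by auto
  then have "{x, y} \<in> tch E B" using * assms(1) by (auto simp: tch_def)
  then have "{x, y} \<in> w \<inter> F" using * assms(2) by auto
  then show "y \<in> CL (w \<inter> F) A" by (rule CL_closed[OF *(1)])
 qed
 show "CL (w \<inter> F) A \<subseteq> CL w A" by (rule CL_mono) auto
qed

lemma CL_local_iff:
 assumes "w \<subseteq> E" "tch E B \<subseteq> F" shows "CL w A \<subseteq> B \<longleftrightarrow> CL (w \<inter> F) A \<subseteq> B"
 using CL_local[OF assms, of A] CL_mono[of "w \<inter> F" w A A] by auto

lemma reach_local:
 assumes "w \<subseteq> E" "tch E B \<subseteq> F" "CL w A \<subseteq> B" shows "reach (w \<inter> F) A n = reach w A n"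
proof (induction n)
 case (Suc n)
 have "{x, y} \<in> w \<longleftrightarrow> {x, y} \<in> w \<inter> F" if "x \<in> reach w A n" for x y
 proof -
  have "x \<in> B" using that assms(3) by (auto simp: CL_reach)
  then show ?thesis using assms(1,2) by (auto simp: tch_def)
 qed
 then have "y \<in> reach (w \<inter> F) A (Suc n) \<longleftrightarrow> y \<in> reach w A (Suc n)" for y
  unfolding reach_Suc Suc.IH by blast
 then show ?case by auto
qed simp

lemma lv_local:
 assumes "w \<subseteq> E" "tch E B \<subseteq> F" "CL w A \<subseteq> B" shows "lv (w \<inter> F) A n = lv w A n"
 unfolding lv_def reach_local[OF assms] ..

text \<open>Restricted to clusters contained in a finite \<open>B\<close>, the intrinsic radius
  event depends on finitely many edges; finiteness of the cluster is recovered later by exhausting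
  \<open>V\<close> with balls.\<close>

lemma event_int:
 fixes F :: "'v set set" and v :: 'v and n :: nat
 assumes p: "0 <= p" "p <= 1" and F: "finite F" "F \<subseteq> E" "tch E B \<subseteq> F"
 defines "S \<equiv> {w \<in> space (percolation E p). lv (open_edges E w) {v} n \<noteq> {} \<and> CL (open_edges E w) {v} \<subseteq> B}"
 shows "S \<in> sets (percolation E p)" "measure (percolation E p) S = bprob F p (%w. lv w {v} n \<noteq> {} \<and> CL w {v} \<subseteq> B)"
proof -
 have "(lv w {v} n \<noteq> {} \<and> CL w {v} \<subseteq> B) = (lv (w \<inter> F) {v} n \<noteq> {} \<and> CL (w \<inter> F) {v} \<subseteq> B)" if "w \<subseteq> E" for w
  using CL_local_iff[OF that F(3), of "{v}"] lv_local[OF that F(3), of "{v}" n] by auto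
 from local_event[OF p F(1,2), of "%w. lv w {v} n \<noteq> {} \<and> CL w {v} \<subseteq> B", OF this]
 show "S \<in> sets (percolation E p)" "measure (percolation E p) S = bprob F p (%w. lv w {v} n \<noteq> {} \<and> CL w {v} \<subseteq> B)"
  unfolding S_def by auto
qed

lemma event_ext:
 fixes F :: "'v set set" and v :: 'v and U :: "'v set"
 assumes p: "0 <= p" "p <= 1" and F: "finite F" "F \<subseteq> E" "tch E B \<subseteq> F"
 defines "S \<equiv> {w \<in> space (percolation E p). (\<exists>u\<in>CL (open_edges E w) {v}. u \<notin> U) \<and> CL (open_edges E w) {v} \<subseteq> B}"
 shows "S \<in> sets (percolation E p)" "measure (percolation E p) S = bprob F p (%w. (\<exists>u\<in>CL w {v}. u \<notin> U) \<and> CL w {v} \<subseteq> B)"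
proof -
 have "((\<exists>u\<in>CL w {v}. u \<notin> U) \<and> CL w {v} \<subseteq> B) = ((\<exists>u\<in>CL (w \<inter> F) {v}. u \<notin> U) \<and> CL (w \<inter> F) {v} \<subseteq> B)" if "w \<subseteq> E" for w
  using CL_local_iff[OF that F(3), of "{v}"] CL_local[OF that F(3), of "{v}"] by auto
 from local_event[OF p F(1,2), of "%w. (\<exists>u\<in>CL w {v}. u \<notin> U) \<and> CL w {v} \<subseteq> B", OF this]
 show "S \<in> sets (percolation E p)" "measure (percolation E p) S = bprob F p (%w. (\<exists>u\<in>CL w {v}. u \<notin> U) \<and> CL w {v} \<subseteq> B)"
  unfolding S_def by auto
qed

lemma exhaustion:
 assumes "countable X"
 obtains Y :: "nat => 'a set" where "\<And>n. finite (Y n)" "incseq Y" "(\<Union>n. Y n) = X"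
proof (cases "X = {}")
 case True
 then show ?thesis using that[of "%_. {}"] by (auto simp: incseq_def)
next
 case False
 have "incseq (%n. from_nat_into X ` {..<n})" by (auto simp: incseq_def)
 moreover have "(\<Union>n. from_nat_into X ` {..<n}) = range (from_nat_into X)"
  by (auto intro: lessI)
 ultimately show ?thesis
  using that[of "%n. from_nat_into X ` {..<n}"] range_from_nat_into[OF False assms] by auto
qed

lemma CL_finite_witness:
 fixes Y :: "nat => 'v set set"
 assumes "incseq Y" "w \<subseteq> (\<Union>n. Y n)" "y \<in> CL w A"
 shows "\<exists>n. y \<in> CL (w \<inter> Y n) A"
proof -
 let ?S = "\<Union>n. CL (w \<inter> Y n) A"
 have "CL w A \<subseteq> ?S"
 proof (rule CL_least)
  show "A \<subseteq> ?S" using CL_self[of A "w \<inter> Y 0"] by auto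
  fix x y assume "x \<in> ?S" and xy: "{x, y} \<in> w"
  then obtain n where n: "x \<in> CL (w \<inter> Y n) A" by auto
  obtain m where m: "{x, y} \<in> Y m" using xy assms(2) by auto
  have sub: "Y n \<subseteq> Y (max n m)" "Y m \<subseteq> Y (max n m)" using assms(1) by (auto simp: incseq_def)
  have "w \<inter> Y n \<subseteq> w \<inter> Y (max n m)" using sub(1) by auto
  then have "x \<in> CL (w \<inter> Y (max n m)) A" using n CL_mono[of "w \<inter> Y n" "w \<inter> Y (max n m)" A A] by auto
  then have "y \<in> CL (w \<inter> Y (max n m)) A" by (rule CL_closed) (use xy m sub(2) in auto)
  then show "y \<in> ?S" by auto
 qed
 then show ?thesis using assms(3) by auto
qed

lemma local_CL_event:
 fixes F :: "'v set set"
 assumes p: "0 <= p" "p <= 1" and F: "finite F" "F \<subseteq> E"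
 shows "{w \<in> space (percolation E p). R (CL (open_edges E w \<inter> F) A)} \<in> sets (percolation E p)"
  "measure (percolation E p) {w \<in> space (percolation E p). R (CL (open_edges E w \<inter> F) A)} = bprob F p (%w. R (CL w A))"
proof -
 have "bprob F p (%w. R (CL (w \<inter> F) A)) = bprob F p (%w. R (CL w A))"
  by (intro bexp_cong) (simp add: Int_absorb2)
 then show "{w \<in> space (percolation E p). R (CL (open_edges E w \<inter> F) A)} \<in> sets (percolation E p)"
  "measure (percolation E p) {w \<in> space (percolation E p). R (CL (open_edges E w \<inter> F) A)} = bprob F p (%w. R (CL w A))"
  using local_event[OF p F, of "%w. R (CL (w \<inter> F) A)"] by auto
qed

lemma connected_event:
 fixes E :: "'v set set"
 assumes p: "0 <= p" "p <= 1" and E: "countable E"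
 shows "{w \<in> space (percolation E p). v \<in> cluster E w u} \<in> sets (percolation E p)"
proof -
 obtain Y :: "nat => 'v set set" where Y: "\<And>n. finite (Y n)" "incseq Y" "(\<Union>n. Y n) = E" using exhaustion[OF E] by blast
 have "{w \<in> space (percolation E p). v \<in> cluster E w u}
  = (\<Union>n. {w \<in> space (percolation E p). v \<in> CL (open_edges E w \<inter> Y n) {u}})"
 proof (intro equalityI subsetI)
  fix w assume "w \<in> {w \<in> space (percolation E p). v \<in> cluster E w u}"
  moreover from this have "\<exists>n. v \<in> CL (open_edges E w \<inter> Y n) {u}"
   using CL_finite_witness[OF Y(2), of "open_edges E w" v "{u}"] open_edges_subset[of E w] Y(3) by (simp add: cluster_CL)
  ultimately show "w \<in> (\<Union>n. {w \<in> space (percolation E p). v \<in> CL (open_edges E w \<inter> Y n) {u}})" by auto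
 next
  fix w assume "w \<in> (\<Union>n. {w \<in> space (percolation E p). v \<in> CL (open_edges E w \<inter> Y n) {u}})"
  then show "w \<in> {w \<in> space (percolation E p). v \<in> cluster E w u}"
   using CL_mono[of "open_edges E w \<inter> Y _" "open_edges E w" "{u}" "{u}"] by (auto simp: cluster_CL)
 qed
 also have "... \<in> sets (percolation E p)"
 proof (rule sets.countable_UN, rule image_subsetI)
  fix n
  have "Y n \<subseteq> E" using Y(3) by auto
  then show "{w \<in> space (percolation E p). v \<in> CL (open_edges E w \<inter> Y n) {u}} \<in> sets (percolation E p)"
   by (rule local_CL_event(1)[OF p Y(1), where R = "%X. v \<in> X"])
 qed
 finally show ?thesis .
qed

lemma two_point_ge:
 fixes F :: "'v set set"
 assumes p: "0 <= p" "p <= 1" and E: "countable E" and F: "finite F" "F \<subseteq> E"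
 shows "bprob F p (%w. y \<in> CL w {x}) <= two_point E p x y"
proof -
 interpret prob_space "percolation E p" by (rule prob_space_percolation)
 have "bprob F p (%w. y \<in> CL w {x}) = measure (percolation E p) {w \<in> space (percolation E p). y \<in> CL (open_edges E w \<inter> F) {x}}"
  using local_CL_event(2)[OF p F, where R = "%X. y \<in> X"] by simp
 also have "... <= two_point E p x y"
  unfolding two_point_def
 proof (rule finite_measure_mono[OF _ connected_event[OF p E]])
  show "{w \<in> space (percolation E p). y \<in> CL (open_edges E w \<inter> F) {x}} \<subseteq> {w \<in> space (percolation E p). y \<in> cluster E w x}"
   using CL_mono[of "open_edges E _ \<inter> F" "open_edges E _" "{x}" "{x}"] by (auto simp: cluster_CL)
 qed
 finally show ?thesis .
qed

lemma measure_incseq_le: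
 assumes "prob_space M" and A: "\<And>n. A n \<in> sets M" "incseq A" "\<And>n. measure M (A n) <= c"
 shows "measure M (\<Union>n. A n) <= c"
proof -
 interpret prob_space M by fact
 have "(%n. measure M (A n)) \<longlonglongrightarrow> measure M (\<Union>n. A n)"
  using A by (intro finite_Lim_measure_incseq) auto
 then show ?thesis using A(3) by (intro LIMSEQ_le_const2) auto
qed

section \<open>Quasi-transitive graphs and sharpness\<close>

lemma bexp_image:
 assumes "inj_on h F"
 shows "bexp (h ` F) p g = bexp F p (%w. g (h ` w))"
proof -
 have inj: "inj_on ((`) h) (Pow F)"
  by (rule inj_onI) (use inj_on_image_eq_iff[OF assms] in auto)
 have "bexp (h ` F) p g = (\<Sum>w\<in>(`) h ` Pow F. p ^ card w * (1 - p) ^ card (h ` F - w) * g w)"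
  unfolding bexp_def image_Pow_surj[OF refl] ..
 also have "... = (\<Sum>w\<in>Pow F. p ^ card (h ` w) * (1 - p) ^ card (h ` F - h ` w) * g (h ` w))"
  by (subst sum.reindex[OF inj]) simp
 also have "... = bexp F p (%w. g (h ` w))"
  unfolding bexp_def
 proof (rule sum.cong[OF refl])
  fix w assume "w \<in> Pow F"
  then have w: "w \<subseteq> F" by simp
  have "h ` F - h ` w = h ` (F - w)" using inj_on_image_set_diff[OF assms, of F w] w by simp
  then show "p ^ card (h ` w) * (1 - p) ^ card (h ` F - h ` w) * g (h ` w)
   = p ^ card w * (1 - p) ^ card (F - w) * g (h ` w)"
   using card_image[OF inj_on_subset[OF assms w]] card_image[OF inj_on_subset[OF assms, of "F - w"]] by auto
 qed
 finally show ?thesis .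
qed

locale quasi_transitive_graph =
 fixes V :: "'v set" and E :: "'v set set"
 assumes simple: "simple_graph V E" and connected: "connected_graph V E"
  and locally_finite: "locally_finite_graph V E" and qt: "quasi_transitive V E"
begin

abbreviation Aut where "Aut \<equiv> graph_automorphisms V E"

lemma edge: "e \<in> E ==> e \<subseteq> V \<and> card e = 2"
 using simple by (simp add: simple_graph_def)

lemma edge_finite: "e \<in> E ==> finite e"
 using edge[of e] card_ge_0_finite[of e] by simp

lemma edge_V: "{x, y} \<in> E ==> x \<in> V \<and> y \<in> V"
 using edge by auto

lemma edge_pair: "e \<in> E ==> \<exists>x y. e = {x, y} \<and> x \<in> V \<and> y \<in> V"
 using edge[of e] by (auto simp: card_2_iff)

lemma finite_incident: "finite {e \<in> E. v \<in> e}"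
proof (cases "v \<in> V")
 case False
 then have "{e \<in> E. v \<in> e} = {}" using edge by auto
 then show ?thesis by (simp only: finite.emptyI)
qed (use locally_finite in \<open>simp add: locally_finite_graph_def\<close>)

lemma finite_tch_E: "finite S ==> finite (tch E S)"
proof -
 assume "finite S"
 then have "finite (\<Union>v\<in>S. {e \<in> E. v \<in> e})" using finite_incident by auto
 moreover have "tch E S \<subseteq> (\<Union>v\<in>S. {e \<in> E. v \<in> e})" by (auto simp: tch_def)
 ultimately show ?thesis by (rule finite_subset[rotated])
qed

lemma finite_ball: "finite (reach E {v} n)" and ball_V: "v \<in> V ==> reach E {v} n \<subseteq> V"
proof (induction n)
 case (Suc n)
 have s: "reach E {v} (Suc n) \<subseteq> \<Union>(tch E (reach E {v} n))" by (fastforce simp: reach_Suc tch_def)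
 moreover have "finite (\<Union>(tch E (reach E {v} n)))"
  using finite_tch_E[OF Suc(1)] edge_finite subsetD[OF tch_subset] by (intro finite_Union) blast+
 ultimately show "finite (reach E {v} (Suc n))" by (rule finite_subset)
 have "\<Union>(tch E (reach E {v} n)) \<subseteq> V" using edge by (auto simp: tch_def)
 then show "reach E {v} (Suc n) \<subseteq> V" using s by auto
qed auto

lemma aut_bij: "\<phi> \<in> Aut ==> bij_betw \<phi> V V"
 and aut_iff: "\<phi> \<in> Aut ==> x \<in> V ==> y \<in> V ==> {\<phi> x, \<phi> y} \<in> E \<longleftrightarrow> {x, y} \<in> E"
 by (auto simp: graph_automorphisms_def)

lemma aut_V: "\<phi> \<in> Aut ==> x \<in> V ==> \<phi> x \<in> V"
 using aut_bij[of \<phi>] by (auto simp: bij_betw_def)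

lemma aut_inj: "\<phi> \<in> Aut ==> inj_on \<phi> V"
 using aut_bij[of \<phi>] by (auto simp: bij_betw_def)

lemma aut_comp: "\<phi> \<in> Aut ==> \<psi> \<in> Aut ==> \<psi> \<circ> \<phi> \<in> Aut"
 using bij_betw_trans[of \<phi> V V \<psi> V] aut_V[of \<phi>] by (auto simp: graph_automorphisms_def)

lemma aut_inv:
 assumes "\<phi> \<in> Aut"
 shows "inv_into V \<phi> \<in> Aut" "x \<in> V ==> \<phi> (inv_into V \<phi> x) = x" "x \<in> V ==> inv_into V \<phi> (\<phi> x) = x"
proof -
 have b: "bij_betw (inv_into V \<phi>) V V" by (rule bij_betw_inv_into[OF aut_bij[OF assms]])
 show r: "\<phi> (inv_into V \<phi> x) = x" if "x \<in> V" for x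
  using bij_betw_inv_into_right[OF aut_bij[OF assms] that] .
 show "inv_into V \<phi> (\<phi> x) = x" if "x \<in> V" for x
  using bij_betw_inv_into_left[OF aut_bij[OF assms] that] .
 have "{inv_into V \<phi> x, inv_into V \<phi> y} \<in> E \<longleftrightarrow> {x, y} \<in> E" if "x \<in> V" "y \<in> V" for x y
  using aut_iff[OF assms, of "inv_into V \<phi> x" "inv_into V \<phi> y"] r[OF that(1)] r[OF that(2)] that b
  by (auto simp: bij_betw_def)
 then show "inv_into V \<phi> \<in> Aut" using b by (simp add: graph_automorphisms_def)
qed

lemma aut_id: "id \<in> Aut"
 by (auto simp: graph_automorphisms_def)

lemma aut_reach:
 assumes \<phi>: "\<phi> \<in> Aut" and x: "x \<in> V" shows "y \<in> reach E {x} n ==> \<phi> y \<in> reach E {\<phi> x} n"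
proof (induction n arbitrary: y)
 case (Suc n)
 then obtain z where z: "z \<in> reach E {x} n" "{z, y} \<in> E" by (auto simp: reach_Suc)
 have "{\<phi> z, \<phi> y} \<in> E" using aut_iff[OF \<phi>] edge_V[OF z(2)] z(2) by auto
 then show ?case using Suc.IH[OF z(1)] by (auto simp: reach_Suc)
qed simp

lemma conn: "u \<in> V ==> v \<in> V ==> \<exists>n. v \<in> reach E {u} n"
 using connected by (auto simp: connected_graph_def reach_def dest!: rtrancl_imp_relpow)

lemma reps: "\<exists>R. finite R \<and> R \<subseteq> V \<and> (\<forall>v\<in>V. \<exists>o'\<in>R. \<exists>\<phi>\<in>Aut. v = \<phi> o')"
proof -
 have "finite (vertex_orbit V E ` V)" using qt by (simp add: quasi_transitive_def)
 then obtain R where R: "R \<subseteq> V" "finite R" "vertex_orbit V E ` V = vertex_orbit V E ` R"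
  using finite_subset_image[of "vertex_orbit V E ` V" "vertex_orbit V E" V] by auto
 have "\<exists>o'\<in>R. \<exists>\<phi>\<in>Aut. v = \<phi> o'" if v: "v \<in> V" for v
 proof -
  have "vertex_orbit V E v \<in> vertex_orbit V E ` R" using v R(3) by blast
  then obtain o' where o': "o' \<in> R" "vertex_orbit V E v = vertex_orbit V E o'" by blast
  have "v \<in> vertex_orbit V E v" unfolding vertex_orbit_def using aut_id by (intro CollectI exI[of _ id]) simp
  then show ?thesis using o' by (auto simp: vertex_orbit_def)
 qed
 then show ?thesis using R by blast
qed

text \<open>Connectedness bounds the distances between the finitely many orbit representatives, and
  automorphisms carry this bound to all pairs of vertices.\<close>

lemma near: "\<exists>D0. \<forall>u\<in>V. \<forall>v\<in>V. \<exists>\<phi>\<in>Aut. \<exists>n\<le>D0. v \<in> reach E {\<phi> u} n"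
proof -
 obtain R where R: "finite R" "R \<subseteq> V" "\<forall>v\<in>V. \<exists>o'\<in>R. \<exists>\<phi>\<in>Aut. v = \<phi> o'" using reps by blast
 define N where "N = (%(a, b). SOME n. b \<in> reach E {a} n)"
 have N: "b \<in> reach E {a} (N (a, b))" if "a \<in> R" "b \<in> R" for a b
  using someI_ex[OF conn[of a b]] that R(2) by (auto simp: N_def)
 define D0 where "D0 = (\<Sum>i\<in>R \<times> R. N i)"
 have "\<exists>\<phi>\<in>Aut. \<exists>n\<le>D0. v \<in> reach E {\<phi> u} n" if uv: "u \<in> V" "v \<in> V" for u v
 proof -
  obtain a \<alpha> where a: "a \<in> R" "\<alpha> \<in> Aut" "u = \<alpha> a" using R(3) uv(1) by blast
  obtain b \<beta> where b: "b \<in> R" "\<beta> \<in> Aut" "v = \<beta> b" using R(3) uv(2) by blast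
  have aV: "a \<in> V" using a R(2) by auto
  have "\<beta> b \<in> reach E {\<beta> a} (N (a, b))" by (rule aut_reach[OF b(2) aV N[OF a(1) b(1)]])
  moreover have "(\<beta> \<circ> inv_into V \<alpha>) u = \<beta> a" using aut_inv(3)[OF a(2) aV] a(3) by simp
  moreover have "\<beta> \<circ> inv_into V \<alpha> \<in> Aut" by (rule aut_comp[OF aut_inv(1)[OF a(2)] b(2)])
  moreover have "N (a, b) <= D0" unfolding D0_def using a b R(1) by (intro member_le_sum) auto
  ultimately show ?thesis using b(3) by (intro bexI[of _ "\<beta> \<circ> inv_into V \<alpha>"] exI[of _ "N (a, b)"]) auto
 qed
 then show ?thesis by blast
qed

lemma aut_edge:
 assumes \<phi>: "\<phi> \<in> Aut" and e: "e \<in> E" shows "\<phi> ` e \<in> E"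
proof -
 obtain x y where "e = {x, y}" "x \<in> V" "y \<in> V" using edge_pair[OF e] by blast
 then show ?thesis using aut_iff[OF \<phi>, of x y] e by simp
qed

lemma aut_inj_edges: "\<phi> \<in> Aut ==> inj_on ((`) \<phi>) E"
 using inj_on_image_eq_iff[OF aut_inj] edge by (intro inj_onI) blast

lemma aut_inv_edge:
 assumes \<phi>: "\<phi> \<in> Aut" and e: "e \<in> E" shows "\<exists>e'\<in>E. e = \<phi> ` e'"
proof (rule bexI)
 show "inv_into V \<phi> ` e \<in> E" by (rule aut_edge[OF aut_inv(1)[OF \<phi>] e])
 have "\<phi> ` inv_into V \<phi> ` e = (%x. x) ` e"
  unfolding image_image using aut_inv(2)[OF \<phi>] edge[OF e] by (intro image_cong) auto
 then show "e = \<phi> ` inv_into V \<phi> ` e" by simp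
qed

lemma degree_bound: "\<exists>d. \<forall>v. card {e \<in> E. v \<in> e} <= d"
proof -
 obtain R where R: "finite R" "R \<subseteq> V" "\<forall>v\<in>V. \<exists>o'\<in>R. \<exists>\<phi>\<in>Aut. v = \<phi> o'" using reps by blast
 define d where "d = (\<Sum>o'\<in>R. card {e \<in> E. o' \<in> e})"
 have "card {e \<in> E. v \<in> e} <= d" for v
 proof (cases "v \<in> V")
  case False
  then have "{e \<in> E. v \<in> e} = {}" using edge by auto
  then show ?thesis by (simp only: card.empty le0)
 next
  case True
  then obtain a \<phi> where a: "a \<in> R" "\<phi> \<in> Aut" "v = \<phi> a" using R(3) by blast
  have aV: "a \<in> V" using a R(2) by auto
  have "{e \<in> E. v \<in> e} \<subseteq> (`) \<phi> ` {e \<in> E. a \<in> e}"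
  proof
   fix e assume "e \<in> {e \<in> E. v \<in> e}"
   then have e: "e \<in> E" "v \<in> e" by auto
   obtain e' where e': "e' \<in> E" "e = \<phi> ` e'" using aut_inv_edge[OF a(2) e(1)] by blast
   then obtain x where x: "x \<in> e'" "\<phi> x = \<phi> a" using e(2) a(3) by auto
   have "x = a" using inj_onD[OF aut_inj[OF a(2)] x(2)] x(1) edge[OF e'(1)] aV by auto
   then show "e \<in> (`) \<phi> ` {e \<in> E. a \<in> e}" using x e' by auto
  qed
  then have "card {e \<in> E. v \<in> e} <= card ((`) \<phi> ` {e \<in> E. a \<in> e})"
   using finite_incident by (intro card_mono) auto
  also have "... <= card {e \<in> E. a \<in> e}" using finite_incident by (rule card_image_le)
  also have "... <= d" unfolding d_def using R(1) a(1) by (intro member_le_sum) auto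
  finally show ?thesis .
 qed
 then show ?thesis by blast
qed

lemma CL_in_V: "w \<subseteq> E ==> A \<subseteq> V ==> CL w A \<subseteq> V"
 using CL_bound[of w A] edge by blast

lemma CL_aut:
 assumes \<phi>: "\<phi> \<in> Aut" and w: "w \<subseteq> E" and A: "A \<subseteq> V"
 shows "CL ((`) \<phi> ` w) (\<phi> ` A) = \<phi> ` CL w A"
proof
 show "CL ((`) \<phi> ` w) (\<phi> ` A) \<subseteq> \<phi> ` CL w A"
 proof (rule CL_least)
  show "\<phi> ` A \<subseteq> \<phi> ` CL w A" by (rule image_mono[OF CL_self])
  fix x y assume "x \<in> \<phi> ` CL w A" and xy: "{x, y} \<in> (`) \<phi> ` w"
  then obtain x' where x': "x' \<in> CL w A" "x = \<phi> x'" by auto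
  obtain e where e: "e \<in> w" "{x, y} = \<phi> ` e" using xy by auto
  have eV: "e \<subseteq> V" using edge[of e] e(1) w by auto
  have x'V: "x' \<in> V" using CL_in_V[OF w A] x'(1) by auto
  have "\<phi> x' \<in> \<phi> ` e" using e(2) x'(2) by auto
  then have xe: "x' \<in> e" using inj_on_image_mem_iff[OF aut_inj[OF \<phi>] x'V eV] by simp
  obtain y' where y': "y' \<in> e" "y = \<phi> y'" using e(2) by auto
  obtain a b where ab: "e = {a, b}" using edge_pair[of e] e(1) w by blast
  show "y \<in> \<phi> ` CL w A"
  proof (cases "y' = x'")
   case True
   then show ?thesis using x' y' by auto
  next
   case False
   then have "{x', y'} = e" using xe y'(1) ab by auto
   then have "y' \<in> CL w A" using e(1) by (intro CL_closed[OF x'(1)]) simp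
   then show ?thesis using y' by auto
  qed
 qed
 have "CL w A \<subseteq> {y. \<phi> y \<in> CL ((`) \<phi> ` w) (\<phi> ` A)}"
 proof (rule CL_least)
  show "A \<subseteq> {y. \<phi> y \<in> CL ((`) \<phi> ` w) (\<phi> ` A)}" using CL_self[of "\<phi> ` A" "(`) \<phi> ` w"] by auto
  fix x y assume x: "x \<in> {y. \<phi> y \<in> CL ((`) \<phi> ` w) (\<phi> ` A)}" and xy: "{x, y} \<in> w"
  have "{\<phi> x, \<phi> y} = \<phi> ` {x, y}" by simp
  then have "{\<phi> x, \<phi> y} \<in> (`) \<phi> ` w" using xy by blast
  moreover have "\<phi> x \<in> CL ((`) \<phi> ` w) (\<phi> ` A)" using x by simp
  ultimately have "\<phi> y \<in> CL ((`) \<phi> ` w) (\<phi> ` A)" by (rule CL_closed[rotated])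
  then show "y \<in> {y. \<phi> y \<in> CL ((`) \<phi> ` w) (\<phi> ` A)}" by simp
 qed
 then show "\<phi> ` CL w A \<subseteq> CL ((`) \<phi> ` w) (\<phi> ` A)" by auto
qed

lemma aut_image_edges: "\<phi> \<in> Aut ==> F \<subseteq> E ==> (`) \<phi> ` F \<subseteq> E"
 using aut_edge by auto

lemma card_CL_aut:
 assumes \<phi>: "\<phi> \<in> Aut" and F: "F \<subseteq> E" and v: "v \<in> V"
 shows "bexp ((`) \<phi> ` F) p (%w. real (card (CL w {\<phi> v}))) = bexp F p (%w. real (card (CL w {v})))"
 unfolding bexp_image[OF inj_on_subset[OF aut_inj_edges[OF \<phi>] F]]
proof (rule bexp_cong)
 fix w assume "w \<subseteq> F"
 then have w: "w \<subseteq> E" using F by auto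
 have "CL ((`) \<phi> ` w) {\<phi> v} = \<phi> ` CL w {v}" using CL_aut[OF \<phi> w, of "{v}"] v by simp
 moreover have "card (\<phi> ` CL w {v}) = card (CL w {v})"
  using CL_in_V[OF w, of "{v}"] v by (intro card_image inj_on_subset[OF aut_inj[OF \<phi>]]) auto
 ultimately show "real (card (CL ((`) \<phi> ` w) {\<phi> v})) = real (card (CL w {v}))" by simp
qed

lemma escape_aut:
 assumes \<phi>: "\<phi> \<in> Aut" and \<Lambda>: "\<Lambda> \<subseteq> V" and v: "v \<in> V"
 shows "bprob (tch E (\<phi> ` \<Lambda>)) p (%w. \<phi> v \<in> CL w (V - \<phi> ` \<Lambda>)) = bprob (tch E \<Lambda>) p (%w. v \<in> CL w (V - \<Lambda>))"
proof -
 have t: "tch E (\<phi> ` \<Lambda>) = (`) \<phi> ` tch E \<Lambda>"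
 proof (intro equalityI subsetI)
  fix e assume "e \<in> tch E (\<phi> ` \<Lambda>)"
  then have e: "e \<in> E" "e \<inter> \<phi> ` \<Lambda> \<noteq> {}" by (auto simp: tch_def)
  obtain e' where e': "e' \<in> E" "e = \<phi> ` e'" using aut_inv_edge[OF \<phi> e(1)] by blast
  then obtain x y where xy: "x \<in> e'" "y \<in> \<Lambda>" "\<phi> x = \<phi> y" using e(2) by auto
  have "x = y" using inj_onD[OF aut_inj[OF \<phi>] xy(3)] xy edge[OF e'(1)] \<Lambda> by auto
  then show "e \<in> (`) \<phi> ` tch E \<Lambda>" using xy e' by (auto simp: tch_def)
 next
  fix e assume "e \<in> (`) \<phi> ` tch E \<Lambda>"
  then show "e \<in> tch E (\<phi> ` \<Lambda>)" using aut_edge[OF \<phi>] by (auto simp: tch_def)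
 qed
 have c: "V - \<phi> ` \<Lambda> = \<phi> ` (V - \<Lambda>)"
  using inj_on_image_set_diff[OF aut_inj[OF \<phi>] _ \<Lambda>, of V] aut_bij[OF \<phi>] by (auto simp: bij_betw_def)
 show ?thesis
  unfolding t bexp_image[OF inj_on_subset[OF aut_inj_edges[OF \<phi>] tch_subset]] c
 proof (rule bexp_cong)
  fix w assume "w \<subseteq> tch E \<Lambda>"
  then have w: "w \<subseteq> E" using tch_subset[of E \<Lambda>] by auto
  have "CL ((`) \<phi> ` w) (\<phi> ` (V - \<Lambda>)) = \<phi> ` CL w (V - \<Lambda>)" by (rule CL_aut[OF \<phi> w]) auto
  moreover have "\<phi> v \<in> \<phi> ` CL w (V - \<Lambda>) \<longleftrightarrow> v \<in> CL w (V - \<Lambda>)"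
   using CL_in_V[OF w, of "V - \<Lambda>"] v by (intro inj_on_image_mem_iff[OF aut_inj[OF \<phi>]]) auto
  ultimately show "of_bool (\<phi> v \<in> CL ((`) \<phi> ` w) (\<phi> ` (V - \<Lambda>))) = of_bool (v \<in> CL w (V - \<Lambda>))" by simp
 qed
qed

lemma path_edges:
 assumes "v \<in> reach E {w} n" shows "\<exists>\<gamma>\<subseteq>E. finite \<gamma> \<and> card \<gamma> <= n \<and> v \<in> CL \<gamma> {w}"
 using reach_witness[OF assms] by (auto simp: CL_reach)

text \<open>Move \<open>u\<close> and its volume by an automorphism next to \<open>v\<close>, then
  force open a path of at most \<open>D0\<close> edges between them, which merges the two
  clusters.\<close>

lemma comparable_clusters:
 "\<exists>D0. \<forall>p F u v. 0 <= p --> p <= 1 --> finite F --> F \<subseteq> E --> u \<in> V --> v \<in> V -->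
  (\<exists>F'. finite F' \<and> F' \<subseteq> E \<and> p ^ D0 * bexp F p (%w. real (card (CL w {u}))) <= bexp F' p (%w. real (card (CL w {v}))))"
proof -
 obtain D0 where D0: "\<forall>u\<in>V. \<forall>v\<in>V. \<exists>\<phi>\<in>Aut. \<exists>n\<le>D0. v \<in> reach E {\<phi> u} n" using near by blast
 have "\<exists>F'. finite F' \<and> F' \<subseteq> E \<and> p ^ D0 * bexp F p (%w. real (card (CL w {u}))) <= bexp F' p (%w. real (card (CL w {v})))"
  if p: "0 <= p" "p <= 1" and F: "finite F" "F \<subseteq> E" and u: "u \<in> V" and v: "v \<in> V" for p F u v
 proof -
  obtain \<phi> n where \<phi>: "\<phi> \<in> Aut" "n <= D0" "v \<in> reach E {\<phi> u} n" using D0 u v by blast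
  obtain \<gamma> where \<gamma>: "\<gamma> \<subseteq> E" "finite \<gamma>" "card \<gamma> <= n" "v \<in> CL \<gamma> {\<phi> u}" using path_edges[OF \<phi>(3)] by blast
  define F' where "F' = (`) \<phi> ` F \<union> \<gamma>"
  have F': "finite F'" "F' \<subseteq> E" using F \<gamma> aut_image_edges[OF \<phi>(1) F(2)] by (auto simp: F'_def)
  have fe: "\<And>e. e \<in> F' ==> finite e" using subsetD[OF F'(2)] edge_finite by auto
  let ?X = "%w. real (card (CL w {\<phi> u}))"
  have inc: "incr_on F' ?X" using incr_card_CL[OF F'(1) fe, of "{\<phi> u}" UNIV] by simp
  have "bexp F p (%w. real (card (CL w {u}))) = bexp ((`) \<phi> ` F) p ?X"
   by (rule card_CL_aut[OF \<phi>(1) F(2) u, symmetric])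
  also have "... <= bexp F' p ?X" by (rule bexp_mono_F[OF F'(1) _ p inc]) (simp add: F'_def)
  finally have 1: "bexp F p (%w. real (card (CL w {u}))) <= bexp F' p ?X" .
  have "p ^ D0 * bexp F p (%w. real (card (CL w {u}))) <= p ^ card \<gamma> * bexp F' p ?X"
   using 1 p \<gamma>(3) \<phi>(2) by (intro mult_mono power_decreasing bexp_nonneg) auto
  also have "... <= p ^ card \<gamma> * bexp F' p (%w. real (card (CL (\<gamma> \<union> w) {v})))"
  proof (intro mult_left_mono bexp_mono p)
   fix w assume w: "w \<subseteq> F'"
   have "v \<in> CL (\<gamma> \<union> w) {\<phi> u}" using \<gamma>(4) CL_mono[of \<gamma> "\<gamma> \<union> w" "{\<phi> u}" "{\<phi> u}"] by auto
   then have eq: "CL (\<gamma> \<union> w) {v} = CL (\<gamma> \<union> w) {\<phi> u}" by (rule CL_eq)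
   have "\<gamma> \<union> w \<subseteq> F'" using w by (auto simp: F'_def)
   then show "?X w <= real (card (CL (\<gamma> \<union> w) {v}))"
    unfolding eq using incr_onD[OF inc, of w "\<gamma> \<union> w"] by simp
  qed (use p in simp)
  also have "... <= bexp F' p (%w. real (card (CL w {v})))"
   by (rule bexp_force_open[OF F'(1) _ p]) (auto simp: F'_def)
  finally show ?thesis using F' by blast
 qed
 then show ?thesis by (intro exI[of _ D0]) blast
qed

lemma countable_V: "countable V" and countable_E: "countable E"
proof -
 show V: "countable V"
 proof (cases "V = {}")
  case False
  then obtain o' where o': "o' \<in> V" by auto
  have "V \<subseteq> (\<Union>n. reach E {o'} n)" using conn[OF o'] by auto
  moreover have "countable (\<Union>n. reach E {o'} n)" using finite_ball by (intro countable_UN) (auto intro: countable_finite)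
  ultimately show ?thesis by (rule countable_subset)
 qed simp
 have "E \<subseteq> (\<Union>v\<in>V. {e \<in> E. v \<in> e})"
 proof
  fix e assume e: "e \<in> E"
  then obtain x y where "e = {x, y}" "x \<in> V" using edge_pair by blast
  then show "e \<in> (\<Union>v\<in>V. {e \<in> E. v \<in> e})" using e by auto
 qed
 moreover have "countable (\<Union>v\<in>V. {e \<in> E. v \<in> e})" using V finite_incident by (intro countable_UN) (auto intro: countable_finite)
 ultimately show "countable E" by (rule countable_subset)
qed

section \<open>The Duminil-Copin--Tassion dichotomy\<close>

definition inside :: "'v set => 'v set set" where
 "inside S = {e \<in> E. e \<subseteq> S}"

text \<open>The functional of Duminil-Copin and Tassion; connections are required to stay inside \<open>S\<close>.\<close>

definition dct :: "real => 'v set => 'v => real" where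
 "dct p S v = (\<Sum>(z, z')\<in>bd E S. p * bprob (inside S) p (%w. z \<in> CL w {v}))"

text \<open>The finite criterion behind the dichotomy; for densities in the unit interval it holds
  below \<open>p_crit\<close> and fails above.\<close>

definition subcritical :: "real => bool" where
 "subcritical p \<longleftrightarrow> (\<forall>v\<in>V. \<exists>S. finite S \<and> S \<subseteq> V \<and> v \<in> S \<and> dct p S v < 1)"

lemma inside_tch: "inside S \<subseteq> tch E S"
proof
 fix e assume e: "e \<in> inside S"
 then obtain x y where "e = {x, y}" using edge_pair[of e] by (auto simp: inside_def)
 then show "e \<in> tch E S" using e by (auto simp: inside_def tch_def)
qed

lemma finite_inside: "finite S ==> finite (inside S)"
 by (rule finite_subset[OF inside_tch finite_tch_E])

lemma finite_bd_E: "finite S ==> finite (bd E S)"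
proof -
 assume S: "finite S"
 have "bd E S \<subseteq> bd (tch E S) S" by (auto simp: bd_def tch_def)
 moreover have "finite (bd (tch E S) S)"
  using finite_tch_E[OF S] edge_finite subsetD[OF tch_subset] by (intro finite_bd) blast+
 ultimately show ?thesis by (rule finite_subset)
qed

text \<open>Cut a path to a vertex of the cluster at its last visit to \<open>C\<close>. The next
  edge leaves \<open>S\<close>, since otherwise it would have extended \<open>C\<close>, and the
  rest of the path avoids \<open>C\<close>.\<close>

lemma card_le_exit:
 assumes F: "finite F" "F \<subseteq> E" and S: "finite S" "x \<in> S" and w: "w \<subseteq> F"
 defines "C \<equiv> CL (w \<inter> inside S) {x}"
 shows "card (CL w {x}) <= card S +
  (\<Sum>(z, z')\<in>bd F S. of_bool (z \<in> C) * (of_bool ({z, z'} \<in> w) * card (CL (nt w C) {z'})))"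
proof -
 have fe: "\<And>e. e \<in> F ==> finite e" using subsetD[OF F(2)] edge_finite by auto
 have fbd: "finite (bd F S)" by (rule finite_bd[OF F(1) fe])
 have fw: "finite w" using F(1) w by (rule finite_subset[rotated])
 have CS: "C \<subseteq> S" unfolding C_def using S(2) by (intro CL_least) (auto simp: inside_def)
 define I where "I = {i \<in> bd F S. fst i \<in> C \<and> {fst i, snd i} \<in> w}"
 have I: "finite I" unfolding I_def using fbd by simp
 have "CL w {x} \<subseteq> C \<union> (\<Union>i\<in>I. CL (nt w C) {snd i})"
 proof (rule CL_least)
  show "{x} \<subseteq> C \<union> (\<Union>i\<in>I. CL (nt w C) {snd i})" unfolding C_def using CL_self[of "{x}"] by auto
  fix a b assume a: "a \<in> C \<union> (\<Union>i\<in>I. CL (nt w C) {snd i})" and ab: "{a, b} \<in> w"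
  show "b \<in> C \<union> (\<Union>i\<in>I. CL (nt w C) {snd i})"
  proof (cases "b \<in> C")
   case False
   show ?thesis
   proof (cases "a \<in> C")
    case True
    have "b \<notin> S"
    proof
     assume "b \<in> S"
     then have "{a, b} \<in> w \<inter> inside S" using True CS ab w F(2) by (auto simp: inside_def)
     then show False using False True CL_closed[of a "w \<inter> inside S" "{x}" b] by (simp add: C_def)
    qed
    then have "(a, b) \<in> I" using True CS ab w by (auto simp: I_def bd_def)
    then show ?thesis using CL_self[of "{b}" "nt w C"] by (intro UnI2 UN_I[of "(a, b)"]) auto
   next
    case aC: False
    then obtain i where i: "i \<in> I" "a \<in> CL (nt w C) {snd i}" using a by auto
    have "{a, b} \<in> nt w C" using aC False ab by (simp add: nt_def)
    then have "b \<in> CL (nt w C) {snd i}" by (rule CL_closed[OF i(2)])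
    then show ?thesis using i(1) by auto
   qed
  qed simp
 qed
 also have "... \<subseteq> S \<union> (\<Union>i\<in>I. CL (nt w C) {snd i})" using CS by auto
 finally have sub: "CL w {x} \<subseteq> S \<union> (\<Union>i\<in>I. CL (nt w C) {snd i})" .
 have fin: "finite (CL (nt w C) {y})" for y
  using fw w fe subsetD[OF nt_subset[of w C]] by (intro finite_CL finite_nt) auto
 have "card (CL w {x}) <= card (S \<union> (\<Union>i\<in>I. CL (nt w C) {snd i}))"
  using sub S(1) I fin by (intro card_mono) auto
 also have "... <= card S + card (\<Union>i\<in>I. CL (nt w C) {snd i})" by (rule card_Un_le)
 also have "card (\<Union>i\<in>I. CL (nt w C) {snd i}) <= (\<Sum>i\<in>I. card (CL (nt w C) {snd i}))" by (rule card_UN_le[OF I])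
 also have "... = (\<Sum>i\<in>I. of_bool (fst i \<in> C) * (of_bool ({fst i, snd i} \<in> w) * card (CL (nt w C) {snd i})))"
  by (rule sum.cong) (auto simp: I_def)
 also have "... <= (\<Sum>i\<in>bd F S. of_bool (fst i \<in> C) * (of_bool ({fst i, snd i} \<in> w) * card (CL (nt w C) {snd i})))"
  using fbd by (intro sum_mono2) (auto simp: I_def)
 finally show ?thesis by (simp add: case_prod_beta)
qed

text \<open>Three sources of independent randomness: \<open>C\<close> is explored inside
  \<open>S\<close>; the exit edge is not inside \<open>S\<close> and hence fresh; the edges avoiding
  \<open>C\<close> are fresh, and the exit edge is not among them.\<close>

lemma exit_term:
 fixes p X :: real and g :: "'v set set => real"
 assumes F: "finite F" "F \<subseteq> E" and p: "0 <= p" "p <= 1" and zz': "(z, z') \<in> bd F S"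
  and X: "\<And>F'. F' \<subseteq> F ==> bexp F' p g <= X" and g: "\<And>w. 0 <= g w"
 shows "bexp F p (%w. of_bool (z \<in> CL (w \<inter> inside S) {x}) *
   (of_bool ({z, z'} \<in> w) * g (nt w (CL (w \<inter> inside S) {x}))))
  <= bprob (F \<inter> inside S) p (%w. z \<in> CL w {x}) * (p * X)"
proof -
 define F1 where "F1 = F \<inter> inside S"
 define F2 where "F2 = F - inside S"
 have F12: "finite F1" "finite F2" "F1 \<inter> F2 = {}" "F = F1 \<union> F2" using F by (auto simp: F1_def F2_def)
 let ?e = "{z, z'}"
 have e: "?e \<in> F2" "?e \<notin> F1" using zz' by (auto simp: F1_def F2_def bd_def inside_def)
 define G where "G = (%a1 a2. of_bool (z \<in> CL a1 {x}) *
  bexp F2 p (%b. of_bool (?e \<in> b) * g (a2 \<union> nt b (CL a1 {x}))))"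
 have "bexp F p (%w. of_bool (z \<in> CL (w \<inter> inside S) {x}) * (of_bool (?e \<in> w) * g (nt w (CL (w \<inter> inside S) {x}))))
  = bexp F1 p (%a. bexp F2 p (%b. of_bool (z \<in> CL a {x}) * (of_bool (?e \<in> b) * g (nt a (CL a {x}) \<union> nt b (CL a {x})))))"
  unfolding F12(4) bexp_union[OF F12(1-3)]
 proof (intro bexp_cong)
  fix a b assume ab: "a \<subseteq> F1" "b \<subseteq> F2"
  have 1: "(a \<union> b) \<inter> inside S = a" using ab by (auto simp: F1_def F2_def)
  have 2: "?e \<in> a \<union> b \<longleftrightarrow> ?e \<in> b" using ab e by auto
  have 3: "nt (a \<union> b) K = nt a K \<union> nt b K" for K by (auto simp: nt_def)
  show "of_bool (z \<in> CL ((a \<union> b) \<inter> inside S) {x}) * (of_bool (?e \<in> a \<union> b) * g (nt (a \<union> b) (CL ((a \<union> b) \<inter> inside S) {x})))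
   = of_bool (z \<in> CL a {x}) * (of_bool (?e \<in> b) * g (nt a (CL a {x}) \<union> nt b (CL a {x})))"
   unfolding 1 2 3 ..
 qed
 also have "... = bexp F1 p (%a. G (tch a (CL a {x})) (nt a (CL a {x})))"
  by (intro bexp_cong) (simp only: G_def CL_tch bexp_cmult)
 also have "... = bexp F1 p (%a. bexp (nt F1 (CL a {x})) p (G (tch a (CL a {x}))))"
  by (rule bexp_explore[OF F12(1)])
 also have "... <= bexp F1 p (%a. of_bool (z \<in> CL a {x}) * (p * X))"
 proof (rule bexp_mono[OF p])
  fix a assume a: "a \<subseteq> F1"
  let ?K = "CL a {x}"
  show "bexp (nt F1 ?K) p (G (tch a ?K)) <= of_bool (z \<in> ?K) * (p * X)"
  proof (cases "z \<in> ?K")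
   case False
   then show ?thesis unfolding G_def CL_tch using finite_nt[OF F12(1)] by (simp add: bexp_const)
  next
   case True
   have et: "?e \<in> tch F2 ?K" using e True by (auto simp: tch_def)
   have ft: "finite (tch F2 ?K)" by (rule finite_tch[OF F12(2)])
   have inner: "bexp F2 p (%b. of_bool (?e \<in> b) * g (a2 \<union> nt b ?K)) = p * bexp (nt F2 ?K) p (%b. g (a2 \<union> b))" for a2
   proof -
    have "bexp F2 p (%b. of_bool (?e \<in> b) * g (a2 \<union> nt b ?K))
     = bexp (tch F2 ?K) p (%b1. bexp (nt F2 ?K) p (%b2. of_bool (?e \<in> b1) * g (a2 \<union> b2)))"
     unfolding bexp_split[OF F12(2), of p _ ?K]
    proof (intro bexp_cong)
     fix b1 b2 assume b: "b1 \<subseteq> tch F2 ?K" "b2 \<subseteq> nt F2 ?K"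
     have "?e \<notin> b2" using b(2) True by (auto simp: nt_def)
     then show "of_bool (?e \<in> b1 \<union> b2) * g (a2 \<union> nt (b1 \<union> b2) ?K) = of_bool (?e \<in> b1) * g (a2 \<union> b2)"
      unfolding nt_split[OF b] by simp
    qed
    also have "... = bprob (tch F2 ?K) p (%b1. {?e} \<subseteq> b1) * bexp (nt F2 ?K) p (%b. g (a2 \<union> b))"
     by (simp add: bexp_cmult bexp_multc)
    also have "bprob (tch F2 ?K) p (%b1. {?e} \<subseteq> b1) = p"
     using bprob_open[OF ft, of "{?e}" p] et by simp
    finally show ?thesis .
   qed
   have u: "finite (nt F1 ?K)" "finite (nt F2 ?K)" "nt F1 ?K \<inter> nt F2 ?K = {}" "nt F1 ?K \<union> nt F2 ?K \<subseteq> F"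
    using F12 finite_nt by (auto simp: nt_def)
   have "bexp (nt F1 ?K) p (G (tch a ?K)) = p * bexp (nt F1 ?K \<union> nt F2 ?K) p g"
    unfolding G_def CL_tch inner bexp_union[OF u(1-3)] using True by (simp add: bexp_cmult)
   also have "... <= p * X" using X[OF u(4)] p(1) by (rule mult_left_mono)
   finally show ?thesis using True by simp
  qed
 qed
 also have "... = bprob F1 p (%a. z \<in> CL a {x}) * (p * X)" by (rule bexp_multc)
 finally show ?thesis unfolding F1_def .
qed

lemma dct_decomposition:
 fixes p X :: real
 assumes F: "finite F" "F \<subseteq> E" and p: "0 <= p" "p <= 1" and S: "finite S" "S \<subseteq> V" "x \<in> S"
  and X: "\<And>F' v. F' \<subseteq> F ==> v \<in> V ==> bexp F' p (%w. real (card (CL w {v}))) <= X" "0 <= X"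
 shows "bexp F p (%w. real (card (CL w {x}))) <= card S + dct p S x * X"
proof -
 let ?C = "%w. CL (w \<inter> inside S) {x}"
 have fe: "\<And>e. e \<in> F ==> finite e" using subsetD[OF F(2)] edge_finite by auto
 have fbd: "finite (bd F S)" by (rule finite_bd[OF F(1) fe])
 have "bexp F p (%w. real (card (CL w {x}))) <= bexp F p (%w. card S +
  (\<Sum>(z, z')\<in>bd F S. of_bool (z \<in> ?C w) * (of_bool ({z, z'} \<in> w) * real (card (CL (nt w (?C w)) {z'})))))"
 proof (rule bexp_mono[OF p])
  fix w assume "w \<subseteq> F"
  from of_nat_mono[OF card_le_exit[OF F S(1,3) this], where 'a = real]
  show "real (card (CL w {x})) <= card S +
   (\<Sum>(z, z')\<in>bd F S. of_bool (z \<in> ?C w) * (of_bool ({z, z'} \<in> w) * real (card (CL (nt w (?C w)) {z'}))))"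
   by (simp add: case_prod_beta)
 qed
 also have "... = card S + (\<Sum>(z, z')\<in>bd F S. bexp F p (%w. of_bool (z \<in> ?C w) *
   (of_bool ({z, z'} \<in> w) * real (card (CL (nt w (?C w)) {z'})))))"
  unfolding bexp_add bexp_const[OF F(1)] case_prod_beta bexp_sum ..
 also have "... <= card S + (\<Sum>(z, z')\<in>bd F S. bprob (F \<inter> inside S) p (%w. z \<in> CL w {x}) * (p * X))"
 proof (intro add_left_mono sum_mono, clarify)
  fix z z' assume zz': "(z, z') \<in> bd F S"
  then have z': "z' \<in> V" using F(2) edge by (auto simp: bd_def)
  show "bexp F p (%w. of_bool (z \<in> ?C w) * (of_bool ({z, z'} \<in> w) * real (card (CL (nt w (?C w)) {z'}))))
   <= bprob (F \<inter> inside S) p (%w. z \<in> CL w {x}) * (p * X)"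
   by (rule exit_term[OF F p zz', of "%w. real (card (CL w {z'}))"]) (use X(1) z' in auto)
 qed
 also have "... <= card S + (\<Sum>(z, z')\<in>bd F S. bprob (inside S) p (%w. z \<in> CL w {x}) * (p * X))"
 proof (intro add_left_mono sum_mono, clarify)
  fix z z'
  have "bprob (F \<inter> inside S) p (%w. z \<in> CL w {x}) <= bprob (inside S) p (%w. z \<in> CL w {x})"
   by (rule bexp_mono_F[OF finite_inside[OF S(1)] _ p incr_CL]) simp
  then show "bprob (F \<inter> inside S) p (%w. z \<in> CL w {x}) * (p * X) <= bprob (inside S) p (%w. z \<in> CL w {x}) * (p * X)"
   using p X(2) by (intro mult_right_mono) auto
 qed
 also have "... <= card S + (\<Sum>(z, z')\<in>bd E S. bprob (inside S) p (%w. z \<in> CL w {x}) * (p * X))"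
  using finite_bd_E[OF S(1)] p X(2) F(2) by (intro add_left_mono sum_mono2) (auto simp: bd_def bprob_nonneg)
 also have "... = card S + dct p S x * X"
  unfolding dct_def sum_distrib_right by (simp add: case_prod_beta mult_ac)
 finally show ?thesis .
qed

text \<open>\<open>dct_decomposition\<close> gives \<open>B <= a + \<phi> * B\<close> with
  \<open>\<phi> < 1\<close> for a truncated supremum \<open>B\<close>, hence the bound
  \<open>a / (1 - \<phi>)\<close>, free of the truncation. Finitely many sets \<open>S\<close>, one
  per orbit representative, suffice.\<close>

lemma subcritical_bounded:
 assumes p: "0 <= p" "p <= 1" and sub: "subcritical p"
 shows "\<exists>X. \<forall>F v. finite F --> F \<subseteq> E --> v \<in> V --> bexp F p (%w. real (card (CL w {v}))) <= X"
proof (cases "V = {}")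
 case False
 obtain R where R: "finite R" "R \<subseteq> V" "\<forall>v\<in>V. \<exists>o'\<in>R. \<exists>\<phi>\<in>Aut. v = \<phi> o'" using reps by blast
 have Rne: "R \<noteq> {}" using False R(3) by blast
 define S where "S = (%v. SOME S. finite S \<and> S \<subseteq> V \<and> v \<in> S \<and> dct p S v < 1)"
 have S: "finite (S v)" "S v \<subseteq> V" "v \<in> S v" "dct p (S v) v < 1" if "v \<in> R" for v
 proof -
  have "\<exists>S. finite S \<and> S \<subseteq> V \<and> v \<in> S \<and> dct p S v < 1" using sub that R(2) by (auto simp: subcritical_def)
  from someI_ex[OF this] show "finite (S v)" "S v \<subseteq> V" "v \<in> S v" "dct p (S v) v < 1" unfolding S_def by auto
 qed
 define a where "a = (\<Sum>o'\<in>R. real (card (S o')))"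
 define \<phi> where "\<phi> = Max ((%o'. dct p (S o') o') ` R)"
 have a: "real (card (S o')) <= a" if "o' \<in> R" for o'
  unfolding a_def by (rule member_le_sum[OF that _ R(1)]) auto
 have \<phi>: "dct p (S o') o' <= \<phi>" if "o' \<in> R" for o' unfolding \<phi>_def using R(1) that by (intro Max_ge) auto
 have \<phi>1: "\<phi> < 1" unfolding \<phi>_def using R(1) Rne S(4) by (subst Max_less_iff) auto
 have bound: "bexp F p (%w. real (card (CL w {v}))) <= a / (1 - \<phi>)" if F: "finite F" "F \<subseteq> E" and v: "v \<in> V" for F v
 proof -
  define N where "N = card F"
  \<comment> \<open>Truncated by the number of edges: this makes the supremum finite, and the class
    is closed under automorphisms and under subsets, which a fixed volume would not be.\<close>
  define A where "A = {bexp F p (%w. real (card (CL w {v}))) |F v. finite F \<and> F \<subseteq> E \<and> card F <= N \<and> v \<in> V}"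
  define B where "B = Sup A"
  have Ale: "x <= 2 * N + 1" if "x \<in> A" for x
  proof -
   obtain F v where x: "x = bexp F p (%w. real (card (CL w {v})))" and F: "finite F" "F \<subseteq> E" "card F <= N"
    using \<open>x \<in> A\<close> by (auto simp: A_def)
   have "x <= bexp F p (%w. real (2 * N + 1))"
    unfolding x
   proof (rule bexp_mono[OF p])
    fix w assume w: "w \<subseteq> F"
    have "card (CL w {v}) <= 2 * card w + 1"
     using w F edge by (intro card_CL_le) (auto intro: finite_subset)
    also have "... <= 2 * N + 1" using card_mono[OF F(1) w] F(3) by simp
    finally show "real (card (CL w {v})) <= real (2 * N + 1)" by (rule of_nat_mono)
   qed
   then show ?thesis using F(1) by (simp add: bexp_const)
  qed
  then have bdd: "bdd_above A" by (auto simp: bdd_above_def)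
  have AB: "x <= B" if "x \<in> A" for x unfolding B_def by (rule cSup_upper[OF that bdd])
  have inA: "bexp F' p (%w. real (card (CL w {v}))) \<in> A" if "finite F'" "F' \<subseteq> E" "card F' <= N" "v \<in> V" for F' v
   unfolding A_def using that by blast
  have A0: "bexp F p (%w. real (card (CL w {v}))) \<in> A" using F v by (intro inA) (auto simp: N_def)
  have B0: "0 <= B" by (rule order_trans[OF bexp_nonneg AB[OF A0]]) (use p in auto)
  have "B <= a + \<phi> * B"
   unfolding B_def
  proof (rule cSup_least)
   show "A \<noteq> {}" using A0 by auto
   fix x assume "x \<in> A"
   then obtain F v where x: "x = bexp F p (%w. real (card (CL w {v})))" and F: "finite F" "F \<subseteq> E" "card F <= N" "v \<in> V"
    by (auto simp: A_def)
   obtain o' \<psi> where o': "o' \<in> R" "\<psi> \<in> Aut" "v = \<psi> o'" using R(3) F(4) by blast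
   have oV: "o' \<in> V" using o' R(2) by auto
   let ?\<psi> = "inv_into V \<psi>"
   let ?F = "(`) ?\<psi> ` F"
   have \<psi>: "?\<psi> \<in> Aut" by (rule aut_inv(1)[OF o'(2)])
   have \<psi>v: "?\<psi> v = o'" unfolding o'(3) by (rule aut_inv(3)[OF o'(2) oV])
   have F': "finite ?F" "?F \<subseteq> E" "card ?F <= N"
    using F aut_image_edges[OF \<psi> F(2)] card_image_le[OF F(1), of "(`) ?\<psi>"] by auto
   have "x = bexp ?F p (%w. real (card (CL w {o'})))"
    using card_CL_aut[OF \<psi> F(2) F(4), of p] unfolding x \<psi>v by simp
   also have "... <= card (S o') + dct p (S o') o' * B"
   proof (rule dct_decomposition[OF F'(1,2) p S(1-3)[OF o'(1)] _ B0])
    fix F'' u assume "F'' \<subseteq> ?F" "u \<in> V"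
    then show "bexp F'' p (%w. real (card (CL w {u}))) <= B"
     using F' card_mono[OF F'(1), of F''] by (intro AB inA) (auto intro: finite_subset)
   qed
   also have "... <= a + \<phi> * B" using a[OF o'(1)] \<phi>[OF o'(1)] B0 by (intro add_mono mult_right_mono)
   finally show "x <= a + \<phi> * Sup A" unfolding B_def .
  qed
  then have "B * (1 - \<phi>) <= a" by (simp add: algebra_simps)
  then have "B <= a / (1 - \<phi>)" using \<phi>1 by (simp add: pos_le_divide_eq)
  then show ?thesis using AB[OF A0] by simp
 qed
 then show ?thesis by (intro exI[of _ "a / (1 - \<phi>)"]) blast
qed simp

end

text \<open>If \<open>v\<close> is not joined to \<open>D\<close>, then a boundary edge of the
  complement of the cluster of \<open>D\<close> whose inner end is joined to \<open>v\<close>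
  becomes a connection when opened, so it is pivotal.\<close>

lemma escape_pivotal:
 assumes F: "finite F" "F \<subseteq> E" "\<And>e. e \<in> E ==> e \<subseteq> V" and w: "w \<subseteq> F" and fin: "finite (bd F (V - CL w D))"
 shows "of_bool (v \<notin> CL w D) * (\<Sum>(z, z')\<in>bd F (V - CL w D). of_bool (z \<in> CL (nt w (CL w D)) {v}))
  <= (\<Sum>e\<in>F. of_bool (v \<in> CL (insert e w) D) - of_bool (v \<in> CL (w - {e}) D) :: real)"
proof -
 let ?W = "CL w D"
 let ?g = "%e. of_bool (v \<in> CL (insert e w) D) - of_bool (v \<in> CL (w - {e}) D) :: real"
 have g0: "0 <= ?g e" for e
  using CL_mono[of "w - {e}" "insert e w" D D] by auto
 show ?thesis
 proof (cases "v \<in> ?W")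
  case True
  then show ?thesis using sum_nonneg[of F ?g] g0 by simp
 next
  case False
  define I where "I = {i \<in> bd F (V - ?W). fst i \<in> CL (nt w ?W) {v}}"
  have I: "finite I" unfolding I_def using fin by simp
  let ?e = "%i. {fst i, snd i}"
  have inj: "inj_on ?e I" by (rule inj_onI) (auto simp: I_def bd_def doubleton_eq_iff)
  have g1: "?g (?e i) = 1" if i: "i \<in> I" for i
  proof -
   have e: "?e i \<in> F" "fst i \<in> V - ?W" "snd i \<in> ?W" "fst i \<in> CL (nt w ?W) {v}"
    using i F(2,3) by (auto simp: I_def bd_def)
   have "snd i \<in> CL (insert (?e i) w) D" using e(3) CL_mono[of w "insert (?e i) w" D D] by auto
   then have f: "fst i \<in> CL (insert (?e i) w) D" by (rule CL_closed) (simp add: insert_commute)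
   have "fst i \<in> CL (insert (?e i) w) {v}"
    using e(4) CL_mono[of "nt w ?W" "insert (?e i) w" "{v}" "{v}"] nt_subset[of w ?W] by auto
   then have "v \<in> CL (insert (?e i) w) {fst i}" using CL_sym[of v "insert (?e i) w" "fst i"] by simp
   also have "... \<subseteq> CL (insert (?e i) w) D" using f by (intro CL_trans) simp
   finally have 1: "v \<in> CL (insert (?e i) w) D" .
   have "v \<notin> CL (w - {?e i}) D" using False CL_mono[of "w - {?e i}" w D D] by auto
   then show ?thesis using 1 by simp
  qed
  have "of_bool (v \<notin> ?W) * (\<Sum>(z, z')\<in>bd F (V - ?W). of_bool (z \<in> CL (nt w ?W) {v}))
   = (\<Sum>i\<in>bd F (V - ?W). of_bool (fst i \<in> CL (nt w ?W) {v}) :: real)"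
   using False by (simp add: case_prod_beta)
  also have "... = (\<Sum>i\<in>I. 1)"
   unfolding I_def using fin by (intro sum.mono_neutral_cong_right) auto
  also have "... = (\<Sum>i\<in>I. ?g (?e i))" using g1 by (intro sum.cong) auto
  also have "... = (\<Sum>e\<in>?e ` I. ?g e)" by (simp add: sum.reindex[OF inj])
  also have "... <= (\<Sum>e\<in>F. ?g e)" using F(1) g0 by (intro sum_mono2) (auto simp: I_def bd_def)
  finally show ?thesis .
 qed
qed

context quasi_transitive_graph
begin

lemma dct_mono:
 assumes "0 <= p" "p <= q" "q <= 1" "finite S" shows "dct p S v <= dct q S v"
 unfolding dct_def
proof (rule sum_mono, clarify)
 fix z z'
 show "p * bprob (inside S) p (%w. z \<in> CL w {v}) <= q * bprob (inside S) q (%w. z \<in> CL w {v})"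
  using assms bexp_mono_p[OF finite_inside[OF assms(4)] assms(1-3) incr_CL] by (intro mult_mono bprob_nonneg) auto
qed

text \<open>Explore the cluster of \<open>D\<close> from outside. If it misses \<open>v\<close>, its
  complement \<open>?S\<close> is a finite set containing \<open>v\<close> whose inner edges are
  fresh, and the mean number of pivotal edges is at least \<open>dct q ?S v >= 1\<close>. With
  \<open>f\<close> the escape probability, this is \<open>f' >= 1 - f\<close>.\<close>

lemma escape_derivative:
 assumes \<Lambda>: "finite \<Lambda>" "\<Lambda> \<subseteq> V" "v \<in> \<Lambda>" and q: "0 <= q" "q <= 1"
  and big: "\<And>S. finite S ==> S \<subseteq> V ==> v \<in> S ==> 1 <= dct q S v"
 shows "\<exists>D. ((%q. bprob (tch E \<Lambda>) q (%w. v \<in> CL w (V - \<Lambda>))) has_real_derivative D) (at q) \<and>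
  1 - bprob (tch E \<Lambda>) q (%w. v \<in> CL w (V - \<Lambda>)) <= D"
proof -
 define F where "F = tch E \<Lambda>"
 define D where "D = V - \<Lambda>"
 have F: "finite F" "F \<subseteq> E" unfolding F_def using finite_tch_E[OF \<Lambda>(1)] tch_subset by auto
 have fe: "\<And>e. e \<in> F ==> finite e" using subsetD[OF F(2)] edge_finite by auto
 have fbd: "finite (bd F S)" for S by (rule finite_bd[OF F(1) fe])
 define f where "f q = bprob F q (%w. v \<in> CL w D)" for q
 define d where "d = (\<Sum>e\<in>F. bexp F q (%w. of_bool (v \<in> CL (insert e w) D) - of_bool (v \<in> CL (w - {e}) D)))"
 have deriv: "(f has_real_derivative d) (at q)" unfolding f_def d_def by (rule russo[OF F(1)])
 define h where "h = (%a b. of_bool (v \<notin> CL a D) * (\<Sum>(z, z')\<in>bd F (V - CL a D). of_bool (z \<in> CL b {v}) :: real))"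
 have "1 - f q = bexp F q (%w. of_bool (v \<notin> CL w D))"
  unfolding f_def using bprob_not[OF F(1), of q "%w. v \<in> CL w D"] by simp
 also have "... <= bexp F q (%w. bexp (nt F (CL w D)) q (h (tch w (CL w D))))"
 proof (rule bexp_mono[OF q])
  fix w assume w: "w \<subseteq> F"
  let ?W = "CL w D"
  let ?S = "V - ?W"
  have "bexp (nt F ?W) q (h (tch w ?W))
   = of_bool (v \<notin> ?W) * (\<Sum>(z, z')\<in>bd F ?S. bprob (nt F ?W) q (%w. z \<in> CL w {v}))"
   unfolding h_def CL_tch bexp_cmult case_prod_beta bexp_sum ..
  moreover have "1 <= (\<Sum>(z, z')\<in>bd F ?S. bprob (nt F ?W) q (%w. z \<in> CL w {v}))" if "v \<notin> ?W"
  proof -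
   have DW: "D \<subseteq> ?W" by (rule CL_self)
   have S: "?S \<subseteq> \<Lambda>" "finite ?S" "v \<in> ?S"
    using DW that \<Lambda> by (auto simp: D_def intro: finite_subset[of _ \<Lambda>])
   have 1: "nt F ?W = inside ?S"
   proof (intro equalityI subsetI)
    fix e assume "e \<in> nt F ?W"
    then show "e \<in> inside ?S" using F(2) edge[of e] by (auto simp: nt_def inside_def)
   next
    fix e assume e: "e \<in> inside ?S"
    then obtain x y where "e = {x, y}" using edge_pair[of e] by (auto simp: inside_def)
    then show "e \<in> nt F ?W" using e S(1) by (auto simp: nt_def inside_def F_def tch_def)
   qed
   have 2: "bd F ?S = bd E ?S" using S(1) by (auto simp: bd_def F_def tch_def)
   have "1 <= dct q ?S v" by (rule big) (use S in auto)
   also have "... <= (\<Sum>(z, z')\<in>bd E ?S. bprob (inside ?S) q (%w. z \<in> CL w {v}))"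
    unfolding dct_def by (rule sum_mono) (use q bprob_nonneg[OF q] in \<open>auto intro!: mult_left_le_one_le\<close>)
   finally show ?thesis unfolding 1 2 .
  qed
  ultimately show "of_bool (v \<notin> ?W) <= bexp (nt F ?W) q (h (tch w ?W))" by (cases "v \<in> ?W") simp_all
 qed
 also have "... = bexp F q (%w. h (tch w (CL w D)) (nt w (CL w D)))" by (rule bexp_explore[OF F(1), symmetric])
 also have "... <= bexp F q (%w. \<Sum>e\<in>F. of_bool (v \<in> CL (insert e w) D) - of_bool (v \<in> CL (w - {e}) D))"
 proof (rule bexp_mono[OF q])
  fix w assume w: "w \<subseteq> F"
  show "h (tch w (CL w D)) (nt w (CL w D))
   <= (\<Sum>e\<in>F. of_bool (v \<in> CL (insert e w) D) - of_bool (v \<in> CL (w - {e}) D))"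
   unfolding h_def CL_tch by (rule escape_pivotal[OF F _ w fbd]) (use edge in auto)
 qed
 also have "... = d" unfolding d_def by (rule bexp_sum)
 finally have "1 - f q <= d" .
 then show ?thesis using deriv unfolding f_def F_def D_def by (intro exI[of _ d] conjI)
qed

text \<open>If the probability is at most \<open>1 / 2\<close> at \<open>p\<close>, it is so on the
  whole interval, and the derivative is at least \<open>1 / 2\<close> there.\<close>

lemma escape_lower:
 assumes \<Lambda>: "finite \<Lambda>" "\<Lambda> \<subseteq> V" "v \<in> \<Lambda>" and p: "0 <= p0" "p0 <= p" "p <= 1"
  and big: "\<And>S. finite S ==> S \<subseteq> V ==> v \<in> S ==> 1 <= dct p0 S v"
 shows "(p - p0) / 2 <= bprob (tch E \<Lambda>) p (%w. v \<in> CL w (V - \<Lambda>))"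
proof -
 define f where "f q = bprob (tch E \<Lambda>) q (%w. v \<in> CL w (V - \<Lambda>))" for q
 have F: "finite (tch E \<Lambda>)" by (rule finite_tch_E[OF \<Lambda>(1)])
 show ?thesis
 proof (cases "1 / 2 <= f p")
  case True
  then show ?thesis using p unfolding f_def by simp
 next
  case False
  have "f p0 - p0 / 2 <= f p - p / 2"
  proof (rule DERIV_nonneg_imp_nondecreasing[OF p(2)])
   fix q assume q: "p0 <= q" "q <= p"
   have q01: "0 <= q" "q <= 1" using p q by auto
   have "1 <= dct q S v" if "finite S" "S \<subseteq> V" "v \<in> S" for S
    using big[OF that] dct_mono[OF p(1) q(1) q01(2) that(1), of v] by linarith
   then obtain D where D: "(f has_real_derivative D) (at q)" "1 - f q <= D"
    using escape_derivative[OF \<Lambda> q01] unfolding f_def by blast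
   have "f q <= f p" unfolding f_def by (rule bexp_mono_p[OF F q01(1) q(2) p(3) incr_CL])
   then have "0 <= D - 1 / 2" using D(2) False by simp
   moreover have "((%q. f q - q / 2) has_real_derivative D - 1 / 2) (at q)"
    by (auto intro!: derivative_eq_intros D(1))
   ultimately show "\<exists>y. ((%q. f q - q / 2) has_real_derivative y) (at q) \<and> 0 <= y" by blast
  qed
  moreover have "0 <= f p0" unfolding f_def using p by (intro bprob_nonneg) auto
  ultimately show ?thesis unfolding f_def by (simp add: field_simps)
 qed
qed

text \<open>Failure of \<open>subcritical\<close> concerns a single vertex \<open>v0\<close>. An
  automorphism brings \<open>v0\<close> close to any given \<open>v\<close>, and a forced path of at
  most \<open>D0\<close> edges joins the two.\<close>

lemma escape_lower_all:
 "\<exists>D0. \<forall>p0 p \<Lambda> v. 0 <= p0 --> p0 <= p --> p <= 1 --> \<not> subcritical p0 --> finite \<Lambda> --> \<Lambda> \<subseteq> V --> v \<in> \<Lambda> -->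
  p ^ D0 * ((p - p0) / 2) <= bprob (tch E \<Lambda>) p (%w. v \<in> CL w (V - \<Lambda>))"
proof -
 obtain D0 where D0: "\<forall>u\<in>V. \<forall>v\<in>V. \<exists>\<phi>\<in>Aut. \<exists>n\<le>D0. v \<in> reach E {\<phi> u} n" using near by blast
 have "p ^ D0 * ((p - p0) / 2) <= bprob (tch E \<Lambda>) p (%w. v \<in> CL w (V - \<Lambda>))"
  if p: "0 <= p0" "p0 <= p" "p <= 1" and ns: "\<not> subcritical p0" and \<Lambda>: "finite \<Lambda>" "\<Lambda> \<subseteq> V" "v \<in> \<Lambda>"
  for p0 p \<Lambda> v
 proof -
  have p01: "0 <= p" using p by simp
  obtain v0 where v0: "v0 \<in> V" "\<And>S. finite S ==> S \<subseteq> V ==> v0 \<in> S ==> 1 <= dct p0 S v0"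
   using ns unfolding subcritical_def by (force simp: not_less)
  have vV: "v \<in> V" using \<Lambda> by auto
  obtain \<phi> n where \<phi>: "\<phi> \<in> Aut" "n <= D0" "v \<in> reach E {\<phi> v0} n" using D0 v0(1) vV by blast
  define y where "y = \<phi> v0"
  have wV: "y \<in> V" unfolding y_def by (rule aut_V[OF \<phi>(1) v0(1)])
  obtain \<gamma> where \<gamma>: "\<gamma> \<subseteq> E" "finite \<gamma>" "card \<gamma> <= n" "v \<in> CL \<gamma> {y}"
   using path_edges[OF \<phi>(3)] unfolding y_def by blast
  define F where "F = tch E \<Lambda>"
  define D where "D = V - \<Lambda>"
  define \<gamma>' where "\<gamma>' = \<gamma> \<inter> F"
  have F: "finite F" unfolding F_def by (rule finite_tch_E[OF \<Lambda>(1)])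
  have y: "(p - p0) / 2 <= bprob F p (%w. y \<in> CL w D)"
  proof (cases "y \<in> \<Lambda>")
   case True
   let ?\<psi> = "inv_into V \<phi>"
   have \<psi>: "?\<psi> \<in> Aut" by (rule aut_inv(1)[OF \<phi>(1)])
   have \<psi>y: "?\<psi> y = v0" unfolding y_def by (rule aut_inv(3)[OF \<phi>(1) v0(1)])
   have "?\<psi> y \<in> ?\<psi> ` \<Lambda>" using True by (rule imageI)
   then have \<Lambda>': "finite (?\<psi> ` \<Lambda>)" "?\<psi> ` \<Lambda> \<subseteq> V" "v0 \<in> ?\<psi> ` \<Lambda>"
    using \<Lambda> aut_V[OF \<psi>] unfolding \<psi>y by auto
   have "(p - p0) / 2 <= bprob (tch E (?\<psi> ` \<Lambda>)) p (%w. v0 \<in> CL w (V - ?\<psi> ` \<Lambda>))"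
    by (rule escape_lower[OF \<Lambda>' p v0(2)])
   also have "... = bprob F p (%w. y \<in> CL w D)"
    unfolding F_def D_def using escape_aut[OF \<psi> \<Lambda>(2) wV, of p] unfolding \<psi>y .
   finally show ?thesis .
  next
   case False
   then have "y \<in> CL w D" for w using CL_self[of D w] wV by (auto simp: D_def)
   then have "bprob F p (%w. y \<in> CL w D) = 1" using F by (simp add: bexp_const)
   then show ?thesis using p by simp
  qed
  have vT: "v \<in> CL (\<gamma>' \<union> w) D" if "y \<in> CL w D" for w
  proof -
   let ?T = "CL (\<gamma>' \<union> w) D"
   have "CL \<gamma> {y} \<subseteq> ?T"
   proof (rule CL_least)
    show "{y} \<subseteq> ?T" using that CL_mono[of w "\<gamma>' \<union> w" D D] by auto
    fix a b assume a: "a \<in> ?T" and ab: "{a, b} \<in> \<gamma>"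
    show "b \<in> ?T"
    proof (cases "{a, b} \<in> F")
     case True
     then show ?thesis using ab by (intro CL_closed[OF a]) (simp add: \<gamma>'_def)
    next
     case False
     \<comment> \<open>An edge of \<open>\<gamma>\<close> outside \<open>F\<close> does not touch
       \<open>\<Lambda>\<close>, so both its ends already lie in \<open>D\<close>.\<close>
     then have "b \<in> D" using ab \<gamma>(1) edge_V[of a b] by (auto simp: F_def tch_def D_def)
     then show ?thesis using CL_self[of D "\<gamma>' \<union> w"] by auto
    qed
   qed
   then show ?thesis using \<gamma>(4) by auto
  qed
  have "card \<gamma>' <= D0" using card_mono[OF \<gamma>(2), of \<gamma>'] \<gamma>(3) \<phi>(2) by (simp add: \<gamma>'_def)
  then have "p ^ D0 * ((p - p0) / 2) <= p ^ card \<gamma>' * bprob F p (%w. y \<in> CL w D)"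
   using y p p01 by (intro mult_mono power_decreasing) auto
  also have "... <= p ^ card \<gamma>' * bprob F p (%w. v \<in> CL (\<gamma>' \<union> w) D)"
   using p p01 vT by (intro mult_left_mono bprob_mono) auto
  also have "... <= bprob F p (%w. v \<in> CL w D)"
   by (rule bexp_force_open[OF F _ p01 p(3)]) (auto simp: \<gamma>'_def)
  finally show ?thesis unfolding F_def D_def .
 qed
 then show ?thesis by (intro exI[of _ D0]) blast
qed

lemma subcritical_small: "\<exists>p>0. p <= 1 \<and> subcritical p"
proof -
 obtain d where d: "\<forall>v. card {e \<in> E. v \<in> e} <= d" using degree_bound by blast
 define p where "p = 1 / (real d + 1)"
 have p: "0 < p" "p <= 1" by (auto simp: p_def)
 have "dct p {v} v < 1" for v
 proof -
  have "card (bd E {v}) <= card {e \<in> E. v \<in> e}"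
  proof (rule card_inj_on_le[OF _ _ finite_incident])
   show "inj_on (%i. {fst i, snd i}) (bd E {v})" by (rule inj_onI) (auto simp: bd_def doubleton_eq_iff)
   show "(%i. {fst i, snd i}) ` bd E {v} \<subseteq> {e \<in> E. v \<in> e}" by (auto simp: bd_def)
  qed
  then have c: "card (bd E {v}) <= d" using d by (meson le_trans)
  have "dct p {v} v <= (\<Sum>i\<in>bd E {v}. p)"
   unfolding dct_def
  proof (rule sum_mono, clarify)
   fix z z'
   have "bprob (inside {v}) p (%w. z \<in> CL w {v}) <= 1"
    using p by (intro bprob_le_1 finite_inside) auto
   then show "p * bprob (inside {v}) p (%w. z \<in> CL w {v}) <= p" using p by (simp add: mult_left_le)
  qed
  also have "... <= d * p" using c p by simp
  also have "... < 1" by (simp add: p_def)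
  finally show ?thesis .
 qed
 then have "subcritical p" unfolding subcritical_def by (intro ballI exI[of _ "{_}"]) auto
 then show ?thesis using p by blast
qed

end

lemma bexp_0: "finite F ==> bexp F 0 f = f {}"
proof -
 assume F: "finite F"
 have "bexp F 0 f = (\<Sum>w\<in>{{}}. 0 ^ card w * (1 - 0) ^ card (F - w) * f w)"
  unfolding bexp_def using F finite_subset[OF _ F] by (intro sum.mono_neutral_right) auto
 then show ?thesis by simp
qed

text \<open>At \<open>p = 0\<close> the two-point matrix is the identity, so \<open>0\<close>
  belongs to the set whose supremum is \<open>p_2to2\<close>, and that set is nonempty.\<close>

lemma two_point_0:
 fixes E :: "'v set set"
 assumes "countable E" shows "two_point E 0 x y = of_bool (x = y)"
proof -
 interpret prob_space "percolation E 0" by (rule prob_space_percolation)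
 obtain Y :: "nat => 'v set set" where Y: "\<And>n. finite (Y n)" "incseq Y" "(\<Union>n. Y n) = E" using exhaustion[OF assms] by blast
 show ?thesis
 proof (cases "x = y")
  case True
  have "{w \<in> space (percolation E 0). y \<in> cluster E w x} = space (percolation E 0)"
   using True by (auto simp: cluster_def)
  then show ?thesis using True prob_space by (simp add: two_point_def)
 next
  case False
  let ?A = "%n. {w \<in> space (percolation E 0). y \<in> CL (open_edges E w \<inter> Y n) {x}}"
  have YE: "Y n \<subseteq> E" for n using Y(3) by auto
  have A: "?A n \<in> sets (percolation E 0)" "measure (percolation E 0) (?A n) = 0" for n
   using local_CL_event[OF _ _ Y(1) YE, where p = 0 and R = "%X. y \<in> X" and A = "{x}"] False bexp_0[OF Y(1)] by auto
  have sub: "{w \<in> space (percolation E 0). y \<in> cluster E w x} \<subseteq> (\<Union>n. ?A n)"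
  proof
   fix w assume w: "w \<in> {w \<in> space (percolation E 0). y \<in> cluster E w x}"
   have "\<exists>n. y \<in> CL (open_edges E w \<inter> Y n) {x}"
    using w Y(3) open_edges_subset[of E w] by (intro CL_finite_witness[OF Y(2)]) (auto simp: cluster_CL)
   then show "w \<in> (\<Union>n. ?A n)" using w by auto
  qed
  have "two_point E 0 x y <= measure (percolation E 0) (\<Union>n. ?A n)"
   unfolding two_point_def using A(1) by (intro finite_measure_mono[OF sub] sets.countable_UN) auto
  also have "... <= 0"
  proof (rule measure_incseq_le[OF prob_space_axioms A(1)])
   show "incseq ?A"
   proof (rule incseq_SucI)
    fix n
    have "CL (open_edges E w \<inter> Y n) {x} \<subseteq> CL (open_edges E w \<inter> Y (Suc n)) {x}" for w
     using Y(2) by (intro CL_mono) (auto simp: incseq_Suc_iff)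
    then show "?A n \<subseteq> ?A (Suc n)" by auto
   qed
  qed (simp add: A(2))
  finally have "two_point E 0 x y <= 0" .
  moreover have "0 <= two_point E 0 x y" unfolding two_point_def by (rule measure_nonneg)
  ultimately show ?thesis using False by simp
 qed
qed

lemma L2_op_norm_identity:
 fixes V :: "'v set"
 shows "L2_op_norm V (%u v. of_bool (u = v)) < \<infinity>"
proof -
 have app: "mat_apply V (%u v. of_bool (u = v)) f u = f u" "(%v. of_bool (u = v) * f v) summable_on V" if u: "u \<in> V" for f :: "'v => real" and u
 proof -
  have "mat_apply V (%u v. of_bool (u = v)) f u = (\<Sum>\<^sub>\<infinity>v\<in>{u}. of_bool (u = v) * f v)"
   unfolding mat_apply_def using u by (intro infsum_cong_neutral) auto
  then show "mat_apply V (%u v. of_bool (u = v)) f u = f u" by simp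
  have "finite {v \<in> V. of_bool (u = v) * f v \<noteq> 0}" by (rule finite_subset[of _ "{u}"]) auto
  then show "(%v. of_bool (u = v) * f v) summable_on V" by (rule finite_nonzero_values_imp_summable_on)
 qed
 have "L2_op_norm V (%u v. of_bool (u = v)) <= 1"
  unfolding L2_op_norm_def
 proof (rule SUP_least, clarify)
  fix f :: "'v => real" assume f: "in_L2 V f"
  let ?T = "mat_apply V (%u v. of_bool (u = v)) f"
  have "in_L2 V ?T" using f unfolding in_L2_def by (subst summable_on_cong[where g = "%v. (f v)\<^sup>2"]) (simp_all add: app(1))
  moreover have "L2_norm_on V ?T = L2_norm_on V f" unfolding L2_norm_on_def by (subst infsum_cong[where g = "%v. (f v)\<^sup>2"]) (simp_all add: app(1))
  ultimately show "(if (\<forall>u\<in>V. (%v. of_bool (u = v) * f v) summable_on V) \<and> in_L2 V ?T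
    then ennreal (L2_norm_on V ?T / L2_norm_on V f) else \<infinity>) <= 1"
   using app(2) by (auto simp: ennreal_le_1 divide_le_eq_1)
 qed
 then show ?thesis by (rule le_less_trans) simp
qed

text \<open>Test the norm on \<open>g\<close> cut off outside \<open>X\<close>, which makes all
  infinite sums finite. The supremum runs over nonzero functions, so \<open>g\<close> vanishing on
  \<open>X\<close> is a separate, trivial case.\<close>

lemma L2_op_norm_form:
 fixes M :: "'v => 'v => real"
 assumes fin: "L2_op_norm V M < \<infinity>"
 shows "\<exists>C\<ge>1. \<forall>X f g. finite X --> X \<subseteq> V --> (\<forall>x. 0 <= f x) --> (\<forall>x. 0 <= g x) -->
  (\<Sum>x\<in>X. \<Sum>y\<in>X. f x * M x y * g y) <= C * L2_set f X * L2_set g X"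
proof -
 define N where "N = enn2real (L2_op_norm V M)"
 have N: "L2_op_norm V M = ennreal N" "0 <= N" using fin by (simp_all add: N_def)
 have main: "(\<Sum>x\<in>X. \<Sum>y\<in>X. f x * M x y * g y) <= max 1 N * L2_set f X * L2_set g X"
  if X: "finite X" "X \<subseteq> V" and f: "\<forall>x. 0 <= f x" and g: "\<forall>x. 0 <= g x" for X and f g :: "'v => real"
 proof (cases "\<exists>v\<in>X. g v \<noteq> 0")
  case False
  then have "(\<Sum>x\<in>X. \<Sum>y\<in>X. f x * M x y * g y) = 0" by simp
  then show ?thesis by (simp add: L2_set_nonneg)
 next
  case True
  define h where "h v = (if v \<in> X then g v else 0)" for v
  have h2: "(\<Sum>\<^sub>\<infinity>v\<in>V. (h v)\<^sup>2) = (\<Sum>v\<in>X. (g v)\<^sup>2)"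
  proof -
   have "(\<Sum>\<^sub>\<infinity>v\<in>V. (h v)\<^sup>2) = (\<Sum>\<^sub>\<infinity>v\<in>X. (g v)\<^sup>2)" using X(2) by (intro infsum_cong_neutral) (auto simp: h_def)
   then show ?thesis using X(1) by simp
  qed
  have nh: "L2_norm_on V h = L2_set g X" unfolding L2_norm_on_def h2 L2_set_def ..
  obtain v0 where v0: "v0 \<in> X" "g v0 \<noteq> 0" using True by blast
  have pos: "0 < L2_set g X"
  proof -
   have "0 < (g v0)\<^sup>2" using v0 by simp
   also have "... <= (\<Sum>v\<in>X. (g v)\<^sup>2)" by (rule member_le_sum[OF v0(1) _ X(1)]) simp
   finally show ?thesis by (simp add: L2_set_def)
  qed
  have "finite {v \<in> V. (h v)\<^sup>2 \<noteq> 0}" by (rule finite_subset[OF _ X(1)]) (auto simp: h_def)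
  then have hL2: "in_L2 V h" unfolding in_L2_def by (rule finite_nonzero_values_imp_summable_on)
  let ?T = "mat_apply V M h"
  let ?val = "if (\<forall>u\<in>V. (%v. M u v * h v) summable_on V) \<and> in_L2 V ?T
    then ennreal (L2_norm_on V ?T / L2_norm_on V h) else \<infinity>"
  have "h v0 \<noteq> 0" "v0 \<in> V" using v0 X(2) by (auto simp: h_def)
  then have "?val <= L2_op_norm V M" unfolding L2_op_norm_def using hL2 by (intro SUP_upper) blast
  then have v: "?val <= ennreal N" unfolding N(1) .
  have TL2: "in_L2 V ?T" and "ennreal (L2_norm_on V ?T / L2_norm_on V h) <= ennreal N"
   using v by (auto split: if_splits simp: top_unique)
  then have "L2_norm_on V ?T / L2_set g X <= N" unfolding nh using N(2) by (simp add: ennreal_le_iff)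
  then have T: "L2_norm_on V ?T <= N * L2_set g X" using pos by (simp add: field_simps)
  have Tu: "?T u = (\<Sum>y\<in>X. M u y * g y)" for u
  proof -
   have "?T u = (\<Sum>\<^sub>\<infinity>y\<in>X. M u y * g y)"
    unfolding mat_apply_def using X(2) by (intro infsum_cong_neutral) (auto simp: h_def)
   then show ?thesis using X(1) by simp
  qed
  have TX: "L2_set ?T X <= L2_norm_on V ?T"
   unfolding L2_set_def L2_norm_on_def
   using TL2 X unfolding in_L2_def by (intro real_sqrt_le_mono finite_sum_le_infsum) auto
  have "(\<Sum>x\<in>X. \<Sum>y\<in>X. f x * M x y * g y) = (\<Sum>x\<in>X. f x * ?T x)"
   unfolding Tu sum_distrib_left by (simp add: mult.assoc)
  also have "... <= (\<Sum>x\<in>X. \<bar>f x\<bar> * \<bar>?T x\<bar>)" by (intro sum_mono) (simp add: abs_mult[symmetric])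
  also have "... <= L2_set f X * L2_set ?T X" by (rule L2_set_mult_ineq)
  also have "... <= L2_set f X * (N * L2_set g X)" using TX T by (intro mult_left_mono L2_set_nonneg) linarith
  also have "... <= L2_set f X * (max 1 N * L2_set g X)"
   by (intro mult_left_mono mult_right_mono L2_set_nonneg) simp
  finally show ?thesis by (simp add: mult_ac)
 qed
 show ?thesis using main by (intro exI[of _ "max 1 N"]) auto
qed

context quasi_transitive_graph
begin

text \<open>The ball of radius \<open>n - 1\<close>: leaving it means reaching extrinsic distance at
  least \<open>n\<close>.\<close>

definition dball :: "'v => nat => 'v set" where
 "dball v n = (\<Union>m<n. reach E {v} m)"

lemma finite_dball: "finite (dball v n)" and dball_V: "v \<in> V ==> dball v n \<subseteq> V"
 unfolding dball_def using finite_ball ball_V by (blast, blast)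

lemma dball_mono: "m <= n ==> dball v m \<subseteq> dball v n"
 unfolding dball_def by (intro UN_mono) auto

lemma dball_self: "1 <= n ==> v \<in> dball v n"
 unfolding dball_def by (intro UN_I[of 0]) auto

lemma dball_UN: "v \<in> V ==> V \<subseteq> (\<Union>n. dball v n)"
 using conn unfolding dball_def by fastforce

lemma finite_dball_bound:
 assumes v: "v \<in> V" and K: "finite K" "K \<subseteq> V" shows "\<exists>n\<ge>1. K \<subseteq> dball v n"
 using K
proof (induction K)
 case (insert x K)
 then obtain n where n: "1 <= n" "K \<subseteq> dball v n" by auto
 obtain m where m: "x \<in> dball v m" using dball_UN[OF v] insert.prems by auto
 have "insert x K \<subseteq> dball v (max n m)" using n m dball_mono[of n "max n m" v] dball_mono[of m "max n m" v] by auto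
 then show ?case using n(1) by (intro exI[of _ "max n m"]) auto
qed auto

definition all_finite :: "real => bool" where
 "all_finite p \<longleftrightarrow> (AE w in percolation E p. \<forall>v\<in>V. finite (cluster E w v))"

text \<open>Markov's inequality in finite volumes: an infinite cluster contains, for every
  \<open>n\<close>, at least \<open>n\<close> vertices that are already connected within a finite
  volume, an event of probability at most \<open>X / n\<close>.\<close>

lemma bounded_all_finite:
 assumes p: "0 <= p" "p <= 1"
  and X: "\<And>F v. finite F ==> F \<subseteq> E ==> v \<in> V ==> bexp F p (%w. real (card (CL w {v}))) <= X"
 shows "all_finite p"
 unfolding all_finite_def AE_ball_countable[OF countable_V]
proof
 fix v assume v: "v \<in> V"
 interpret prob_space "percolation E p" by (rule prob_space_percolation)
 obtain Y :: "nat => 'v set set" where Y: "\<And>n. finite (Y n)" "incseq Y" "(\<Union>n. Y n) = E" using exhaustion[OF countable_E] by blast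
 have YE: "Y m \<subseteq> E" for m using Y(3) by auto
 define A where "A n m = {w \<in> space (percolation E p). n <= card (CL (open_edges E w \<inter> Y m) {v})}" for n m :: nat
 have A: "A n m \<in> events" "measure (percolation E p) (A n m) = bprob (Y m) p (%w. n <= card (CL w {v}))" for n m
  unfolding A_def using local_CL_event[OF p Y(1) YE, where R = "%X. n <= card X"] by auto
 have fin: "finite (CL (w \<inter> Y m) {v})" for w m
  using Y(1) subsetD[OF YE] edge_finite by (intro finite_CL) auto
 have mono: "CL (w \<inter> Y m) {v} \<subseteq> CL (w \<inter> Y m') {v}" if "m <= m'" for w m m'
  using that Y(2) by (intro CL_mono) (auto simp: incseq_def)
 have incA: "incseq (A n)" for n
  unfolding A_def incseq_def using card_mono[OF fin mono] by (auto intro: order_trans)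
 define N where "N = (\<Inter>n. \<Union>m. A (Suc n) m)"
 have Nev: "N \<in> events" unfolding N_def using A(1) by auto
 have le: "measure (percolation E p) (\<Union>m. A (Suc n) m) <= X / Suc n" for n
 proof (rule measure_incseq_le[OF prob_space_axioms A(1) incA])
  fix m
  have "real (Suc n) * bprob (Y m) p (%w. Suc n <= card (CL w {v})) <= bexp (Y m) p (%w. real (card (CL w {v})))"
   by (rule markov_card[OF p])
  also have "... <= X" by (rule X[OF Y(1) YE v])
  finally show "measure (percolation E p) (A (Suc n) m) <= X / Suc n" unfolding A(2) by (simp add: field_simps)
 qed
 have "measure (percolation E p) N <= X / Suc n" for n
  by (rule order_trans[OF finite_measure_mono le]) (use A(1) in \<open>auto simp: N_def\<close>)
 moreover have "(%n. X / real (Suc n)) \<longlonglongrightarrow> 0"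
  using LIMSEQ_inverse_real_of_nat tendsto_mult_right_zero[of _ _ X] by (simp add: divide_inverse)
 ultimately have "measure (percolation E p) N <= 0" by (intro LIMSEQ_le_const) auto
 then have "measure (percolation E p) N = 0" using measure_nonneg[of "percolation E p" N] by linarith
 then have null: "N \<in> null_sets (percolation E p)" using Nev by (simp add: null_sets_def emeasure_eq_measure)
 show "AE w in percolation E p. finite (cluster E w v)"
 proof (rule AE_I'[OF null], clarify)
  fix w assume w: "w \<in> space (percolation E p)" "infinite (cluster E w v)"
  let ?w = "open_edges E w"
  have "\<exists>m. Suc n <= card (CL (?w \<inter> Y m) {v})" for n
  proof -
   obtain T where T: "T \<subseteq> CL ?w {v}" "finite T" "card T = Suc n"
    using infinite_arbitrarily_large[OF w(2), of "Suc n"] by (auto simp: cluster_CL)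
   have "\<exists>m. T \<subseteq> CL (?w \<inter> Y m) {v}"
    using T(2,1)
   proof (induction T)
    case (insert y T)
    then obtain m where m: "T \<subseteq> CL (?w \<inter> Y m) {v}" by auto
    obtain m' where m': "y \<in> CL (?w \<inter> Y m') {v}"
     using CL_finite_witness[OF Y(2), of ?w y "{v}"] insert.prems open_edges_subset[of E w] Y(3) by auto
    have "insert y T \<subseteq> CL (?w \<inter> Y (max m m')) {v}"
     using m m' mono[of m "max m m'" ?w] mono[of m' "max m m'" ?w] by auto
    then show ?case by blast
   qed auto
   then obtain m where m: "T \<subseteq> CL (?w \<inter> Y m) {v}" by blast
   then show ?thesis using card_mono[OF fin m] T(3) by auto
  qed
  then show "w \<in> N" using w(1) by (auto simp: N_def A_def)
 qed
qed

text \<open>The escape probability has a positive lower bound uniform over balls, so the cluster of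
  \<open>v\<close> lies in some ball with probability less than \<open>1\<close>.\<close>

lemma infinite_clusters:
 assumes ns: "\<not> subcritical p0" and p: "0 <= p0" "p0 < p" "p <= 1" shows "\<not> all_finite p"
proof
 assume af: "all_finite p"
 interpret prob_space "percolation E p" by (rule prob_space_percolation)
 obtain v where v: "v \<in> V" using ns by (auto simp: subcritical_def)
 obtain D0 where D0: "\<forall>p0 p \<Lambda> v. 0 <= p0 --> p0 <= p --> p <= 1 --> \<not> subcritical p0 --> finite \<Lambda> --> \<Lambda> \<subseteq> V --> v \<in> \<Lambda> -->
  p ^ D0 * ((p - p0) / 2) <= bprob (tch E \<Lambda>) p (%w. v \<in> CL w (V - \<Lambda>))" using escape_lower_all by blast
 define c where "c = p ^ D0 * ((p - p0) / 2)"
 have c: "0 < c" using p by (simp add: c_def)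
 define A where "A m = {w \<in> space (percolation E p). CL (open_edges E w) {v} \<subseteq> dball v (Suc m)}" for m
 have F: "finite (tch E (dball v m))" "tch E (dball v m) \<subseteq> E" for m
  by (rule finite_tch_E[OF finite_dball]) (rule tch_subset)
 have A: "A m \<in> events" "measure (percolation E p) (A m) <= 1 - c" for m
 proof -
  let ?B = "dball v (Suc m)"
  have l: "(CL w {v} \<subseteq> ?B) = (CL (w \<inter> tch E ?B) {v} \<subseteq> ?B)" if "w \<subseteq> E" for w
   by (rule CL_local_iff[OF that order_refl])
  have p01: "0 <= p" using p by simp
  note ev = local_event[OF p01 p(3) F, of "%w. CL w {v} \<subseteq> ?B", OF l]
  show "A m \<in> events" unfolding A_def by (rule ev(1))
  have "measure (percolation E p) (A m) = bprob (tch E ?B) p (%w. CL w {v} \<subseteq> ?B)" unfolding A_def by (rule ev(2))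
  also have "... <= bprob (tch E ?B) p (%w. v \<notin> CL w (V - ?B))"
  proof (rule bprob_mono[OF p01 p(3)])
   fix w assume *: "CL w {v} \<subseteq> ?B"
   show "v \<notin> CL w (V - ?B)"
   proof
    assume "v \<in> CL w (V - ?B)"
    then obtain b where "b \<in> V - ?B" "v \<in> CL w {b}" unfolding CL_iff[of v w "V - ?B"] by auto
    then show False using * CL_sym[of b w v] by auto
   qed
  qed
  also have "... = 1 - bprob (tch E ?B) p (%w. v \<in> CL w (V - ?B))" by (rule bprob_not[OF F(1)])
  also have "... <= 1 - c"
  proof -
   have "p ^ D0 * ((p - p0) / 2) <= bprob (tch E ?B) p (%w. v \<in> CL w (V - ?B))"
    using D0 p ns finite_dball dball_V[OF v] dball_self[of "Suc m" v] by simp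
   then show ?thesis by (simp add: c_def)
  qed
  finally show "measure (percolation E p) (A m) <= 1 - c" .
 qed
 have "measure (percolation E p) (\<Union>m. A m) <= 1 - c"
 proof (rule measure_incseq_le[OF prob_space_axioms A(1) _ A(2)])
  show "incseq A"
  proof (rule incseq_SucI)
   fix m show "A m \<subseteq> A (Suc m)" unfolding A_def using dball_mono[of "Suc m" "Suc (Suc m)" v] by auto
  qed
 qed
 moreover have "measure (percolation E p) (\<Union>m. A m) = 1"
 proof (subst prob_eq_1)
  show "(\<Union>m. A m) \<in> events" using A(1) by auto
  show "AE w in percolation E p. w \<in> (\<Union>m. A m)"
   using af[unfolded all_finite_def] AE_space
  proof eventually_elim
   case (elim w)
   have "finite (CL (open_edges E w) {v})" using elim(1) v by (simp add: cluster_CL)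
   moreover have "CL (open_edges E w) {v} \<subseteq> V" using v by (intro CL_in_V open_edges_subset) simp
   ultimately obtain n where n: "1 <= n" "CL (open_edges E w) {v} \<subseteq> dball v n" using finite_dball_bound[OF v] by blast
   then obtain m where "n = Suc m" by (cases n) auto
   then show ?case using n elim(2) by (auto simp: A_def)
  qed
 qed
 ultimately show False using c by simp
qed

lemma p_crit_eq: "p_crit V E = Sup {p \<in> {0..1}. all_finite p}"
 by (simp add: p_crit_def all_finite_def)

lemma le_p_crit: "0 <= p ==> p <= 1 ==> all_finite p ==> p <= p_crit V E"
 unfolding p_crit_eq by (rule cSup_upper) (auto simp: bdd_above_def intro: exI[of _ 1])

lemma subcritical_all_finite:
 assumes "0 <= p" "p <= 1" "subcritical p" shows "all_finite p"
proof -
 obtain X where "\<forall>F v. finite F --> F \<subseteq> E --> v \<in> V --> bexp F p (%w. real (card (CL w {v}))) <= X"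
  using subcritical_bounded[OF assms] by blast
 then show ?thesis by (intro bounded_all_finite[OF assms(1,2), of X]) auto
qed

lemma p_crit_pos: "0 < p_crit V E"
proof -
 obtain p where "0 < p" "p <= 1" "subcritical p" using subcritical_small by blast
 then show ?thesis using le_p_crit[of p] subcritical_all_finite[of p] by simp
qed

lemma below_p_crit:
 assumes "0 <= p" "p < p_crit V E" shows "subcritical p"
proof (rule ccontr)
 assume ns: "\<not> subcritical p"
 obtain r where r: "0 < r" "r <= 1" "subcritical r" using subcritical_small by blast
 then have "r \<in> {p \<in> {0..1}. all_finite p}" using subcritical_all_finite by simp
 then have "\<exists>q\<in>{p \<in> {0..1}. all_finite p}. p < q"
  using assms(2) unfolding p_crit_eq by (subst less_cSup_iff[symmetric]) (auto simp: bdd_above_def intro: exI[of _ 1])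
 then obtain q where "q <= 1" "all_finite q" "p < q" by auto
 then show False using infinite_clusters[OF ns assms(1)] by simp
qed

lemma above_p_crit: "p_crit V E < p ==> p <= 1 ==> \<not> subcritical p"
 using le_p_crit[of p] subcritical_all_finite[of p] p_crit_pos by force

end

section \<open>Radii as events of the product measure and the final bounds\<close>

lemma le_graph_dist: "enat n <= graph_dist H v y \<longleftrightarrow> (\<forall>k<n. y \<notin> reach H {v} k)"
 unfolding graph_dist_def le_INF_iff reach_def by (auto simp: not_le[symmetric])

lemma le_SUP_enat:
 fixes f :: "'a => enat"
 assumes "1 <= n" shows "enat n <= (SUP x\<in>K. f x) \<longleftrightarrow> (\<exists>x\<in>K. enat n <= f x)"
proof -
 obtain m where m: "n = Suc m" using assms by (cases n) auto
 show ?thesis unfolding m Suc_ile_eq less_SUP_iff ..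
qed

lemma ereal_le_enat: "ereal r <= ereal_of_enat x \<longleftrightarrow> enat (nat \<lceil>r\<rceil>) <= x"
 by (cases x) (auto simp: nat_ceiling_le_eq)

lemma enat_finite_iff: "x < \<infinity> \<longleftrightarrow> (\<exists>n\<ge>1. \<not> enat n <= x)"
proof (cases x)
 case (enat k)
 then show ?thesis by (auto intro: exI[of _ "Suc k"])
qed simp

lemma lv_nonempty_iff: "lv w {v} n \<noteq> {} \<longleftrightarrow> (\<exists>u\<in>CL w {v}. \<forall>k<n. u \<notin> reach w {v} k)"
proof
 assume "lv w {v} n \<noteq> {}"
 then obtain u where u: "u \<in> lv w {v} n" by auto
 then show "\<exists>u\<in>CL w {v}. \<forall>k<n. u \<notin> reach w {v} k"
  using subsetD[OF lv_subset_CL u] by (auto simp: lv_def)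
next
 assume "\<exists>u\<in>CL w {v}. \<forall>k<n. u \<notin> reach w {v} k"
 then obtain u where u: "u \<in> CL w {v}" "\<forall>k<n. u \<notin> reach w {v} k" by auto
 obtain m where m: "u \<in> lv w {v} m" using u(1) by (rule CL_lvE)
 then have "n <= m" using u(2) subsetD[OF lv_subset_reach m] by (cases "m < n") auto
 then show "lv w {v} n \<noteq> {}" using m lv_arm_mono[of w "{v}" m n] by auto
qed

context quasi_transitive_graph
begin

lemma Rad_int_ge: "1 <= n ==> enat n <= Rad_int E w v \<longleftrightarrow> lv (open_edges E w) {v} n \<noteq> {}"
 unfolding Rad_int_def le_SUP_enat le_graph_dist cluster_CL lv_nonempty_iff ..

lemma Rad_ext_ge: "1 <= n ==> enat n <= Rad_ext E w v \<longleftrightarrow> (\<exists>u\<in>CL (open_edges E w) {v}. u \<notin> dball v n)"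
 unfolding Rad_ext_def le_SUP_enat le_graph_dist cluster_CL dball_def by auto

lemma far_lv:
 assumes "w \<subseteq> E" "u \<in> CL w {v}" "u \<notin> dball v n" shows "lv w {v} n \<noteq> {}"
 unfolding lv_nonempty_iff using assms reach_mono[OF assms(1) order_refl, of "{v}"]
 by (intro bexI[OF _ assms(2)]) (auto simp: dball_def)

lemma Rad_finite:
 assumes v: "v \<in> V"
 shows "Rad_int E w v < \<infinity> \<longleftrightarrow> finite (CL (open_edges E w) {v})"
  "Rad_ext E w v < \<infinity> \<longleftrightarrow> finite (CL (open_edges E w) {v})"
proof -
 let ?K = "CL (open_edges E w) {v}"
 have KV: "?K \<subseteq> V" using v by (intro CL_in_V open_edges_subset) simp
 have 1: "\<exists>n\<ge>1. ?K \<subseteq> dball v n" if "finite ?K" by (rule finite_dball_bound[OF v that KV])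
 have 2: "finite ?K" if "?K \<subseteq> dball v n" for n by (rule finite_subset[OF that finite_dball])
 show "Rad_ext E w v < \<infinity> \<longleftrightarrow> finite ?K"
  unfolding enat_finite_iff
 proof
  assume "\<exists>n\<ge>1. \<not> enat n <= Rad_ext E w v"
  then obtain n where n: "1 <= n" "\<not> enat n <= Rad_ext E w v" by blast
  then have "?K \<subseteq> dball v n" using Rad_ext_ge[OF n(1)] by blast
  then show "finite ?K" by (rule 2)
 next
  assume "finite ?K"
  then obtain n where n: "1 <= n" "?K \<subseteq> dball v n" using 1 by blast
  then have "\<not> enat n <= Rad_ext E w v" using Rad_ext_ge[OF n(1)] by blast
  then show "\<exists>n\<ge>1. \<not> enat n <= Rad_ext E w v" using n(1) by blast
 qed
 have 3: "?K \<subseteq> dball v n" if "lv (open_edges E w) {v} n = {}" for n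
  using that far_lv[OF open_edges_subset, of _ w v n] by blast
 have 4: "\<exists>n\<ge>1. lv (open_edges E w) {v} n = {}" if fin: "finite ?K"
 proof -
  define l where "l u = (SOME n. u \<in> lv (open_edges E w) {v} n)" for u
  have l: "u \<in> lv (open_edges E w) {v} (l u)" if "u \<in> ?K" for u
   unfolding l_def by (rule someI_ex) (use that[unfolded CL_lv] in auto)
  define N where "N = Suc (\<Sum>u\<in>?K. l u)"
  have "lv (open_edges E w) {v} N = {}"
  proof (rule ccontr)
   assume "lv (open_edges E w) {v} N \<noteq> {}"
   then obtain u where u: "u \<in> lv (open_edges E w) {v} N" by auto
   have uK: "u \<in> ?K" by (rule subsetD[OF lv_subset_CL u])
   have "l u <= (\<Sum>u\<in>?K. l u)" using fin uK by (intro member_le_sum) auto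
   moreover have "N = l u" by (rule lv_unique[OF u l[OF uK]])
   ultimately show False by (simp add: N_def)
  qed
  then show ?thesis by (intro exI[of _ N]) (simp add: N_def)
 qed
 show "Rad_int E w v < \<infinity> \<longleftrightarrow> finite ?K"
  unfolding enat_finite_iff
 proof
  assume "\<exists>n\<ge>1. \<not> enat n <= Rad_int E w v"
  then obtain n where n: "1 <= n" "\<not> enat n <= Rad_int E w v" by blast
  then have "lv (open_edges E w) {v} n = {}" using Rad_int_ge[OF n(1)] by simp
  then show "finite ?K" using 2 3 by blast
 next
  assume "finite ?K"
  then obtain n where "1 <= n" "lv (open_edges E w) {v} n = {}" using 4 by blast
  then show "\<exists>n\<ge>1. \<not> enat n <= Rad_int E w v" using Rad_int_ge[of n w v] by auto
 qed
qed

definition int_event where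
 "int_event p v n = {w \<in> space (percolation E p). lv (open_edges E w) {v} n \<noteq> {} \<and> finite (CL (open_edges E w) {v})}"

definition ext_event where
 "ext_event p v n = {w \<in> space (percolation E p). (\<exists>u\<in>CL (open_edges E w) {v}. u \<notin> dball v n) \<and> finite (CL (open_edges E w) {v})}"

lemma finite_cluster_iff:
 assumes "v \<in> V" shows "finite (CL (open_edges E w) {v}) \<longleftrightarrow> (\<exists>m. CL (open_edges E w) {v} \<subseteq> dball v m)"
proof -
 have KV: "CL (open_edges E w) {v} \<subseteq> V" using assms by (intro CL_in_V open_edges_subset) simp
 show ?thesis using finite_dball_bound[OF assms _ KV] finite_subset[OF _ finite_dball] by blast
qed

lemma tch_dball: "finite (tch E (dball v m))" "tch E (dball v m) \<subseteq> E"
 by (rule finite_tch_E[OF finite_dball], rule tch_subset)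

lemma int_event_upper:
 assumes p: "0 <= p" "p <= 1" and v: "v \<in> V"
  and U: "\<And>B. finite B ==> B \<subseteq> V ==> \<exists>F. finite F \<and> F \<subseteq> E \<and> tch E B \<subseteq> F \<and>
   bprob F p (%w. lv w {v} n \<noteq> {} \<and> CL w {v} \<subseteq> B) <= U"
 shows "int_event p v n \<in> sets (percolation E p)" "measure (percolation E p) (int_event p v n) <= U"
proof -
 define A where "A m = {w \<in> space (percolation E p). lv (open_edges E w) {v} n \<noteq> {} \<and> CL (open_edges E w) {v} \<subseteq> dball v m}" for m
 have I: "int_event p v n = (\<Union>m. A m)"
  unfolding int_event_def A_def finite_cluster_iff[OF v] by auto
 have A: "A m \<in> sets (percolation E p)" "measure (percolation E p) (A m) <= U" for m
 proof -
  obtain F where F: "finite F" "F \<subseteq> E" "tch E (dball v m) \<subseteq> F"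
   "bprob F p (%w. lv w {v} n \<noteq> {} \<and> CL w {v} \<subseteq> dball v m) <= U" using U[OF finite_dball dball_V[OF v]] by blast
  show "A m \<in> sets (percolation E p)" "measure (percolation E p) (A m) <= U"
   unfolding A_def using event_int[OF p F(1-3)] F(4) by auto
 qed
 have inc: "incseq A"
 proof (rule incseq_SucI)
  fix m show "A m \<subseteq> A (Suc m)" unfolding A_def using dball_mono[of m "Suc m" v] by auto
 qed
 show "int_event p v n \<in> sets (percolation E p)" unfolding I using A(1) by auto
 show "measure (percolation E p) (int_event p v n) <= U"
  unfolding I by (rule measure_incseq_le[OF prob_space_percolation A(1) inc A(2)])
qed

lemma ext_event_sets:
 assumes p: "0 <= p" "p <= 1" and v: "v \<in> V" shows "ext_event p v n \<in> sets (percolation E p)"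
proof -
 have I: "ext_event p v n = (\<Union>m. {w \<in> space (percolation E p). (\<exists>u\<in>CL (open_edges E w) {v}. u \<notin> dball v n) \<and>
   CL (open_edges E w) {v} \<subseteq> dball v m})"
  unfolding ext_event_def finite_cluster_iff[OF v] by auto
 show ?thesis unfolding I by (intro sets.countable_UN image_subsetI event_ext(1)[OF p tch_dball order_refl])
qed

lemma ext_event_lower:
 assumes p: "0 <= p" "p <= 1" and v: "v \<in> V" and B: "finite B" "B \<subseteq> V"
 shows "bprob (tch E B) p (%w. (\<exists>u\<in>CL w {v}. u \<notin> dball v n) \<and> CL w {v} \<subseteq> B) <= measure (percolation E p) (ext_event p v n)"
proof -
 interpret prob_space "percolation E p" by (rule prob_space_percolation)
 have "bprob (tch E B) p (%w. (\<exists>u\<in>CL w {v}. u \<notin> dball v n) \<and> CL w {v} \<subseteq> B)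
  = measure (percolation E p) {w \<in> space (percolation E p). (\<exists>u\<in>CL (open_edges E w) {v}. u \<notin> dball v n) \<and> CL (open_edges E w) {v} \<subseteq> B}"
  by (rule event_ext(2)[OF p finite_tch_E[OF B(1)] tch_subset order_refl, symmetric])
 also have "... <= measure (percolation E p) (ext_event p v n)"
  using B(1) by (intro finite_measure_mono ext_event_sets[OF p v]) (auto simp: ext_event_def intro: finite_subset)
 finally show ?thesis .
qed

lemma ext_subset_int: "ext_event p v n \<subseteq> int_event p v n"
 unfolding ext_event_def int_event_def using far_lv[OF open_edges_subset] by blast

lemma radius_events:
 assumes v: "v \<in> V" and r: "1 <= r" and n: "n = nat \<lceil>r\<rceil>"
 shows "{w \<in> space (percolation E p). ereal r <= ereal_of_enat (Rad_int E w v) \<and> Rad_int E w v < \<infinity>} = int_event p v n"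
  "{w \<in> space (percolation E p). ereal r <= ereal_of_enat (Rad_ext E w v) \<and> Rad_ext E w v < \<infinity>} = ext_event p v n"
proof -
 have n1: "1 <= n" using r unfolding n by linarith
 show "{w \<in> space (percolation E p). ereal r <= ereal_of_enat (Rad_int E w v) \<and> Rad_int E w v < \<infinity>} = int_event p v n"
  "{w \<in> space (percolation E p). ereal r <= ereal_of_enat (Rad_ext E w v) \<and> Rad_ext E w v < \<infinity>} = ext_event p v n"
  unfolding ereal_le_enat n[symmetric] Rad_int_ge[OF n1] Rad_ext_ge[OF n1] Rad_finite[OF v] int_event_def ext_event_def by simp_all
qed

lemma L2_percolation:
 assumes gap: "p_crit V E < p_2to2 V E" and V: "V \<noteq> {}"
 shows "\<exists>d \<tau> C p1 \<kappa> \<theta>. l2_percolation V E d \<tau> C (p_crit V E) p1 \<kappa> \<theta>"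
proof -
 let ?pc = "p_crit V E"
 have pc0: "0 < ?pc" by (rule p_crit_pos)
 let ?S = "{p \<in> {0..1}. L2_op_norm V (two_point E p) < \<infinity>}"
 have "two_point E 0 = (%u v. of_bool (u = v))" using two_point_0[OF countable_E] by (intro ext)
 then have "0 \<in> ?S" using L2_op_norm_identity[of V] by simp
 then have ne: "?S \<noteq> {}" by blast
 have bdd: "bdd_above ?S" by (rule bdd_aboveI[of _ 1]) simp
 have "\<exists>q\<in>?S. ?pc < q" using gap unfolding p_2to2_def less_cSup_iff[OF ne bdd] .
 then obtain q where q: "0 <= q" "q <= 1" "L2_op_norm V (two_point E q) < \<infinity>" "?pc < q" by auto
 \<comment> \<open>Strictly between \<open>p_crit\<close> and \<open>q\<close>; the two-point matrix
   at \<open>q\<close> then dominates all finite-volume ones up to \<open>p1\<close>, and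
   \<open>p1 < 1\<close>.\<close>
 define p1 where "p1 = (?pc + q) / 2"
 have p1: "?pc < p1" "p1 < q" "p1 < 1" using q by (auto simp: p1_def)
 obtain C where C: "1 <= C" "\<forall>X f g. finite X --> X \<subseteq> V --> (\<forall>x. 0 <= f x) --> (\<forall>x. 0 <= g x) -->
  (\<Sum>x\<in>X. \<Sum>y\<in>X. f x * two_point E q x y * g y) <= C * L2_set f X * L2_set g X"
  using L2_op_norm_form[OF q(3)] by blast
 obtain d where d: "\<forall>v. card {e \<in> E. v \<in> e} <= d" using degree_bound by blast
 obtain D0 where D0: "\<forall>p F u v. 0 <= p --> p <= 1 --> finite F --> F \<subseteq> E --> u \<in> V --> v \<in> V -->
  (\<exists>F'. finite F' \<and> F' \<subseteq> E \<and> p ^ D0 * bexp F p (%w. real (card (CL w {u}))) <= bexp F' p (%w. real (card (CL w {v}))))"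
  using comparable_clusters by blast
 obtain D1 where D1: "\<forall>p0 p \<Lambda> v. 0 <= p0 --> p0 <= p --> p <= 1 --> \<not> subcritical p0 --> finite \<Lambda> --> \<Lambda> \<subseteq> V --> v \<in> \<Lambda> -->
  p ^ D1 * ((p - p0) / 2) <= bprob (tch E \<Lambda>) p (%w. v \<in> CL w (V - \<Lambda>))" using escape_lower_all by blast
 \<comment> \<open>Worst cases of the forced paths: density at least \<open>p_crit / 2\<close> for
   the comparison, at least \<open>p_crit\<close> for the escape. The \<open>4\<close> arises
   because the escape bound is used from the midpoint \<open>p0\<close> of \<open>p_crit\<close> and
   \<open>p\<close>, where \<open>subcritical\<close> is known to fail.\<close>
 define \<kappa>' where "\<kappa>' = (?pc / 2) ^ D0"
 define \<theta> where "\<theta> = ?pc ^ D1 / 4"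
 have "l2_percolation V E d (two_point E q) C ?pc p1 \<kappa>' \<theta>"
 proof
  show "\<And>e. e \<in> E ==> e \<subseteq> V \<and> card e = 2" by (rule edge)
  show "\<And>v. finite {e \<in> E. v \<in> e}" by (rule finite_incident)
  show "\<And>v. card {e \<in> E. v \<in> e} <= d" using d by blast
  show "V \<noteq> {}" "0 < ?pc" "?pc < p1" "p1 < 1" "1 <= C" by fact+
  show "(\<Sum>x\<in>X. \<Sum>y\<in>X. f x * two_point E q x y * g y) <= C * L2_set f X * L2_set g X"
   if "finite X" "X \<subseteq> V" "\<And>x. 0 <= f x" "\<And>x. 0 <= g x" for X f g
   using C(2) that by blast
  show "bprob F p (%w. y \<in> CL w {x}) <= two_point E q x y"
   if "finite F" "F \<subseteq> E" "0 <= p" "p <= p1" for F p x y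
  proof -
   have "bprob F p (%w. y \<in> CL w {x}) <= bprob F q (%w. y \<in> CL w {x})"
    using that p1 q by (intro bexp_mono_p incr_CL) auto
   also have "... <= two_point E q x y" by (rule two_point_ge[OF q(1,2) countable_E that(1,2)])
   finally show ?thesis .
  qed
  show "\<exists>X. \<forall>F v. finite F --> F \<subseteq> E --> v \<in> V --> bexp F p (%w. real (card (CL w {v}))) <= X"
   if "0 <= p" "p < ?pc" for p
   using that p1 by (intro subcritical_bounded below_p_crit) auto
  show "0 < \<kappa>'" "0 < \<theta>" using pc0 by (auto simp: \<kappa>'_def \<theta>_def)
  show "\<exists>F'. finite F' \<and> F' \<subseteq> E \<and> \<kappa>' * bexp F p (%w. real (card (CL w {u}))) <= bexp F' p (%w. real (card (CL w {v})))"
   if p: "?pc / 2 <= p" "p <= p1" and F: "finite F" "F \<subseteq> E" and uv: "u \<in> V" "v \<in> V" for p F u v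
  proof -
   have p01: "0 <= p" "p <= 1" using p pc0 p1 by auto
   obtain F' where F': "finite F'" "F' \<subseteq> E"
    "p ^ D0 * bexp F p (%w. real (card (CL w {u}))) <= bexp F' p (%w. real (card (CL w {v})))"
    using D0[rule_format, OF p01 F uv] by (elim exE conjE) (rule that, assumption+)
   have "\<kappa>' * bexp F p (%w. real (card (CL w {u}))) <= p ^ D0 * bexp F p (%w. real (card (CL w {u})))"
    unfolding \<kappa>'_def using p pc0 by (intro mult_right_mono power_mono bexp_nonneg p01) auto
   then show ?thesis using F' by (intro exI[of _ F']) auto
  qed
  show "\<theta> * (p - ?pc) <= bprob (tch E \<Lambda>) p (%w. v \<in> CL w (V - \<Lambda>))"
   if p: "?pc < p" "p <= p1" and \<Lambda>: "finite \<Lambda>" "\<Lambda> \<subseteq> V" "v \<in> \<Lambda>" for p \<Lambda> v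
  proof -
   define p0 where "p0 = (p + ?pc) / 2"
   have p0: "?pc < p0" "p0 <= p" "p0 <= 1" "0 <= p0" "p <= 1" using p pc0 p1 by (auto simp: p0_def)
   have "\<theta> * (p - ?pc) = ?pc ^ D1 * ((p - p0) / 2)" by (simp add: \<theta>_def p0_def field_simps)
   also have "... <= p ^ D1 * ((p - p0) / 2)" using p p0 pc0 by (intro mult_right_mono power_mono) auto
   also have "... <= bprob (tch E \<Lambda>) p (%w. v \<in> CL w (V - \<Lambda>))"
    using D1 p0 above_p_crit[OF p0(1,3)] \<Lambda> by simp
   finally show ?thesis .
  qed
 qed
 then show ?thesis by blast
qed

text \<open>Graph distance is at most intrinsic distance, so the extrinsic event is contained in the
  intrinsic one: a lower bound for the former and an upper bound for the latter give all four
  inequalities.\<close>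

lemma radius_bounds:
 assumes gap: "p_crit V E < p_2to2 V E" and V: "V \<noteq> {}"
 shows "\<exists>\<delta> c K c2 C1. 0 < \<delta> \<and> 0 < c \<and> 0 < K \<and> 0 < c2 \<and> 0 < C1 \<and>
  (\<forall>p v n. \<bar>p - p_crit V E\<bar> < \<delta> --> v \<in> V --> 1 <= n -->
   c / real n * exp (- C1 * \<bar>p - p_crit V E\<bar> * real n) <= measure (percolation E p) (ext_event p v n) \<and>
   measure (percolation E p) (ext_event p v n) <= measure (percolation E p) (int_event p v n) \<and>
   measure (percolation E p) (int_event p v n) <= K / real n * exp (- c2 * \<bar>p - p_crit V E\<bar> * real n))"
proof -
 let ?pc = "p_crit V E"
 obtain d \<tau> C p1 \<kappa>' \<theta> where "l2_percolation V E d \<tau> C ?pc p1 \<kappa>' \<theta>" using L2_percolation[OF assms] by blast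
 then interpret L: l2_percolation V E d \<tau> C ?pc p1 \<kappa>' \<theta> .
 obtain \<delta>1 c C1 where lo: "0 < \<delta>1" "0 < c" "0 < C1" and lower: "\<forall>p v k. \<bar>p - ?pc\<bar> < \<delta>1 --> v \<in> V --> 1 <= k -->
  (\<exists>B. finite B \<and> B \<subseteq> V \<and> c / real k * exp (- C1 * \<bar>p - ?pc\<bar> * real k) <=
   bprob (tch E B) p (%w. (\<exists>u\<in>CL w {v}. u \<notin> (\<Union>m<k. reach E {v} m)) \<and> CL w {v} \<subseteq> B))"
  using L.lower_bound by (elim exE conjE) (rule that, assumption+)
 obtain K1 c1 where sub: "0 < K1" "0 < c1" and subd: "\<forall>n\<ge>1. \<forall>p. ?pc / 2 <= p --> p <= ?pc --> L.arm_le p n (K1 / n * exp (- c1 * (?pc - p) * n))"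
  using L.subcritical_decay by (elim exE conjE) (rule that, assumption+)
 obtain \<delta>2 K2 c2 where sup: "0 < \<delta>2" "0 < K2" "0 < c2" and supd: "\<forall>p v n B. ?pc < p --> p < ?pc + \<delta>2 --> v \<in> V --> 1 <= n --> finite B --> B \<subseteq> V -->
  (\<exists>F. finite F \<and> F \<subseteq> E \<and> tch E B \<subseteq> F \<and>
   bprob F p (%w. lv w {v} n \<noteq> {} \<and> CL w {v} \<subseteq> B) <= K2 / real n * exp (- c2 * (p - ?pc) * real n))"
  using L.supercritical_decay by (elim exE conjE) (rule that, assumption+)
 define \<delta> where "\<delta> = min (min \<delta>1 \<delta>2) (min (?pc / 2) (p1 - ?pc))"
 define K where "K = max K1 K2"
 define c3 where "c3 = min c1 c2"
 have pos: "0 < \<delta>" "0 < K" "0 < c3" using lo sub sup L.pc by (auto simp: \<delta>_def K_def c3_def)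
 have bnd: "K' / real n * exp (- c' * x * real n) <= K / real n * exp (- c3 * x * real n)"
  if "K' <= K" "c3 <= c'" "0 <= x" "0 < K'" for K' c' x and n :: nat
 proof (rule mult_mono)
  show "K' / real n <= K / real n" using that by (intro divide_right_mono) auto
  have "c3 * (x * real n) <= c' * (x * real n)" using that by (intro mult_right_mono) auto
  then show "exp (- c' * x * real n) <= exp (- c3 * x * real n)" by (simp add: mult.assoc)
 qed (use pos that in auto)
 have main: "c / real n * exp (- C1 * \<bar>p - ?pc\<bar> * real n) <= measure (percolation E p) (ext_event p v n) \<and>
   measure (percolation E p) (ext_event p v n) <= measure (percolation E p) (int_event p v n) \<and>
   measure (percolation E p) (int_event p v n) <= K / real n * exp (- c3 * \<bar>p - ?pc\<bar> * real n)"
  if p: "\<bar>p - ?pc\<bar> < \<delta>" and v: "v \<in> V" and n: "1 <= n" for p v n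
 proof -
  interpret P: prob_space "percolation E p" by (rule prob_space_percolation)
  have p': "\<bar>p - ?pc\<bar> < \<delta>1" "\<bar>p - ?pc\<bar> < \<delta>2" "\<bar>p - ?pc\<bar> < ?pc / 2" "\<bar>p - ?pc\<bar> < p1 - ?pc" using p by (auto simp: \<delta>_def)
  have p01: "0 <= p" "p <= 1" "?pc / 2 <= p" using p'(3,4) L.pc by linarith+
  obtain B where B: "finite B" "B \<subseteq> V" "c / real n * exp (- C1 * \<bar>p - ?pc\<bar> * real n) <=
   bprob (tch E B) p (%w. (\<exists>u\<in>CL w {v}. u \<notin> dball v n) \<and> CL w {v} \<subseteq> B)"
   using lower[rule_format, OF p'(1) v n, folded dball_def] by (elim exE conjE) (rule that, assumption+)
  have 1: "c / real n * exp (- C1 * \<bar>p - ?pc\<bar> * real n) <= measure (percolation E p) (ext_event p v n)"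
   by (rule order_trans[OF B(3) ext_event_lower[OF p01(1,2) v B(1,2)]])
  have U: "\<exists>F. finite F \<and> F \<subseteq> E \<and> tch E B \<subseteq> F \<and>
   bprob F p (%w. lv w {v} n \<noteq> {} \<and> CL w {v} \<subseteq> B) <= K / real n * exp (- c3 * \<bar>p - ?pc\<bar> * real n)"
   if B: "finite B" "B \<subseteq> V" for B
  proof (cases "?pc < p")
   case True
   have "p < ?pc + \<delta>2" using p'(2) by linarith
   from supd[rule_format, OF True this v n B] obtain F where F: "finite F" "F \<subseteq> E" "tch E B \<subseteq> F"
    "bprob F p (%w. lv w {v} n \<noteq> {} \<and> CL w {v} \<subseteq> B) <= K2 / real n * exp (- c2 * (p - ?pc) * real n)"
    by (elim exE conjE) (rule that, assumption+)
   have "K2 / real n * exp (- c2 * (p - ?pc) * real n) <= K / real n * exp (- c3 * (p - ?pc) * real n)"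
    using True sup by (intro bnd) (auto simp: K_def c3_def)
   then show ?thesis using F True by (intro exI[of _ F]) auto
  next
   case False
   have F: "finite (tch E B)" "tch E B \<subseteq> E" by (rule finite_tch_E[OF B(1)], rule tch_subset)
   have arm: "L.arm_le p n (K1 / n * exp (- c1 * (?pc - p) * n))" using subd n p01 False by simp
   have "bprob (tch E B) p (%w. lv w {v} n \<noteq> {} \<and> CL w {v} \<subseteq> B) <= bprob (tch E B) p (%w. lv w {v} n \<noteq> {})"
    using p01 by (intro bprob_mono) auto
   also have "... <= K1 / n * exp (- c1 * (?pc - p) * n)" by (rule L.arm_leD[OF arm F v])
   also have "... <= K / real n * exp (- c3 * (?pc - p) * real n)" using False sub by (intro bnd) (auto simp: K_def c3_def)
   finally show ?thesis using F False by (intro exI[of _ "tch E B"]) simp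
  qed
  note I = int_event_upper[OF p01(1,2) v U]
  have 2: "measure (percolation E p) (ext_event p v n) <= measure (percolation E p) (int_event p v n)"
   by (rule P.finite_measure_mono[OF ext_subset_int I(1)])
  show ?thesis using 1 2 I(2) by simp
 qed
 show ?thesis
  by (rule exI[of _ \<delta>], rule exI[of _ c], rule exI[of _ K], rule exI[of _ c3], rule exI[of _ C1],
   intro conjI[OF pos(1)] conjI[OF lo(2)] conjI[OF pos(2)] conjI[OF pos(3)] conjI[OF lo(3)] allI impI, rule main)
qed

end

theorem theorem1p2:
  fixes V :: "'v set" and E :: "'v set set"
  assumes "simple_graph V E"
    and "connected_graph V E"
    and "locally_finite_graph V E"
    and "quasi_transitive V E"
    and "p_crit V E < p_2to2 V E"
  shows "\<exists>\<delta> c1 c2 C1 C2 :: real.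
    \<delta> > 0 \<and> c1 > 0 \<and> c2 > 0 \<and> C1 > 0 \<and> C2 > 0 \<and>
    (\<forall>r::real. \<forall>v\<in>V. \<forall>p\<in>{p_crit V E - \<delta> <..< p_crit V E + \<delta>}. r \<ge> 1 \<longrightarrow>
      (let P = percolation E p;
           prob_int = measure P {\<omega> \<in> space P.
             ereal r \<le> ereal_of_enat (Rad_int E \<omega> v) \<and> Rad_int E \<omega> v < \<infinity>};
           prob_ext = measure P {\<omega> \<in> space P.
             ereal r \<le> ereal_of_enat (Rad_ext E \<omega> v) \<and> Rad_ext E \<omega> v < \<infinity>};
           lower = c1 / r * exp (- C1 * \<bar>p - p_crit V E\<bar> * r);
           upper = C2 / r * exp (- c2 * \<bar>p - p_crit V E\<bar> * r)
       in lower \<le> prob_int \<and> prob_int \<le> upper \<and>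
          lower \<le> prob_ext \<and> prob_ext \<le> upper))"
proof (cases "V = {}")
  case True
  then show ?thesis by (intro exI[of _ 1]) simp
next
  case False
  interpret quasi_transitive_graph V E using assms by unfold_locales
  let ?pc = "p_crit V E"
  obtain \<delta> c K c2 C1 where pos: "0 < \<delta>" "0 < c" "0 < K" "0 < c2" "0 < C1"
    and bounds: "\<forall>p v n. \<bar>p - ?pc\<bar> < \<delta> \<longrightarrow> v \<in> V \<longrightarrow> 1 \<le> n \<longrightarrow>
      c / real n * exp (- C1 * \<bar>p - ?pc\<bar> * real n) \<le> measure (percolation E p) (ext_event p v n) \<and>
      measure (percolation E p) (ext_event p v n) \<le> measure (percolation E p) (int_event p v n) \<and>
      measure (percolation E p) (int_event p v n) \<le> K / real n * exp (- c2 * \<bar>p - ?pc\<bar> * real n)"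
    using radius_bounds[OF assms(5) False] by blast
  show ?thesis
  proof (rule exI[of _ \<delta>], rule exI[of _ "c / 2"], rule exI[of _ c2], rule exI[of _ "2 * C1"], rule exI[of _ K], intro conjI ballI allI impI)
    show "\<delta> > 0" "c / 2 > 0" "c2 > 0" "2 * C1 > 0" "K > 0" using pos by auto
    fix r :: real and v p
    assume v: "v \<in> V" and p: "p \<in> {?pc - \<delta> <..< ?pc + \<delta>}" and r: "r \<ge> 1"
    \<comment> \<open>Both radii are integers, so \<open>r\<close> is rounded up;
      \<open>r <= n <= 2 * r\<close> because \<open>r >= 1\<close>, which explains the constants
      \<open>c / 2\<close> and \<open>2 * C1\<close>.\<close>
    define n where "n = nat \<lceil>r\<rceil>"
    define \<epsilon> where "\<epsilon> = \<bar>p - ?pc\<bar>"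
    have n: "1 \<le> n" "r \<le> real n" "real n \<le> 2 * r" using r unfolding n_def by linarith+
    have "\<bar>p - ?pc\<bar> < \<delta>" using p by auto
    then have b: "c / real n * exp (- C1 * \<epsilon> * real n) \<le> measure (percolation E p) (ext_event p v n)"
      "measure (percolation E p) (ext_event p v n) \<le> measure (percolation E p) (int_event p v n)"
      "measure (percolation E p) (int_event p v n) \<le> K / real n * exp (- c2 * \<epsilon> * real n)"
      using bounds v n(1) unfolding \<epsilon>_def by blast+
    have \<epsilon>: "0 \<le> \<epsilon>" by (simp add: \<epsilon>_def)
    have lo: "c / 2 / r * exp (- (2 * C1) * \<epsilon> * r) \<le> c / real n * exp (- C1 * \<epsilon> * real n)"
    proof (rule mult_mono)
      show "c / 2 / r \<le> c / real n" using n r pos by (simp add: divide_divide_eq_left) (intro divide_left_mono, auto)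
      have "C1 * \<epsilon> * real n \<le> C1 * \<epsilon> * (2 * r)" using n pos \<epsilon> by (intro mult_left_mono) auto
      then show "exp (- (2 * C1) * \<epsilon> * r) \<le> exp (- C1 * \<epsilon> * real n)" by simp
    qed (use pos in auto)
    have up: "K / real n * exp (- c2 * \<epsilon> * real n) \<le> K / r * exp (- c2 * \<epsilon> * r)"
    proof (rule mult_mono)
      show "K / real n \<le> K / r" using n r pos by (intro divide_left_mono) auto
      have "c2 * \<epsilon> * r \<le> c2 * \<epsilon> * real n" using n pos \<epsilon> by (intro mult_left_mono) auto
      then show "exp (- c2 * \<epsilon> * real n) \<le> exp (- c2 * \<epsilon> * r)" by simp
    qed (use pos r in auto)
    show "let P = percolation E p;
           prob_int = measure P {\<omega> \<in> space P.
             ereal r \<le> ereal_of_enat (Rad_int E \<omega> v) \<and> Rad_int E \<omega> v < \<infinity>};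
           prob_ext = measure P {\<omega> \<in> space P.
             ereal r \<le> ereal_of_enat (Rad_ext E \<omega> v) \<and> Rad_ext E \<omega> v < \<infinity>};
           lower = c / 2 / r * exp (- (2 * C1) * \<bar>p - ?pc\<bar> * r);
           upper = K / r * exp (- c2 * \<bar>p - ?pc\<bar> * r)
       in lower \<le> prob_int \<and> prob_int \<le> upper \<and> lower \<le> prob_ext \<and> prob_ext \<le> upper"
      unfolding Let_def radius_events[OF v r n_def] \<epsilon>_def[symmetric] using b lo up by linarith
  qed
qed

end
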